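(* Let $k$ be a field of characteristic $p>0$ and let $R$ be a regular $F$-finite ring, essentially of finite type over $k$. Let $\mathfrak{a}$ be an ideal in $R$. Then: (1) The set of $F$-jumping exponents of $\mathfrak{a}$ is discrete, in the sense that every finite interval contains only finitely many $F$-jumping exponents of $\mathfrak{a}$. (2) Every $F$-jumping exponent of $\mathfrak{a}$ is a rational number.
   Context: All rings are commutative and Noetherian. A ring $R$ of prime characteristic $p$ is $F$-finite if the Frobenius morphism $F\colon R\to R$, $x\mapsto x^p$, is finite. Let $R$ be a regular $F$-finite ring of characteristic $p$ (not necessarily local). For an ideal $J$ of $R$ and $q=p^e$, $J^{[q]}$ is the ideal generated by $\{u^q \mid u\in J\}$. For an ideal $\mathfrak{b}$ of $R$ and $q=p^e$ with $e\geq 1$, $\mathfrak{b}^{[1/q]}$ denotes the unique smallest ideal $J$ of $R$ (with respect to inclusion) such that $\mathfrak{b}\subseteq J^{[q]}$ (it exists for such $R$). Generalized test ideals: for an ideal $\mathfrak{a}$ of $R$ and a real number $c>0$, $\tau(\mathfrak{a}^c)=\bigcup_{e>0}\left(\mathfrak{a}^{\lceil cp^e\rceil}\right)^{[1/p^e]}$; this is an increasing union of ideals, so $\tau(\mathfrak{a}^c)=(\mathfrak{a}^{\lceil cp^e\rceil})^{[1/p^e]}$ for all $e\gg 0$. Convention for $c=0$: if $R$ is a domain, $\tau(\mathfrak{a}^0)=R$ if $\mathfrak{a}\neq(0)$ and $\tau(\mathfrak{a}^0)=(0)$ if $\mathfrak{a}=(0)$; in general write $R=R_1\times\cdots\times R_m$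 with $R_i$ regular domains, $\mathfrak{a}=\mathfrak{a}_1\times\cdots\times\mathfrak{a}_m$, and put $\tau(\mathfrak{a}^0)=\tau(\mathfrak{a}_1^0)\times\cdots\times\tau(\mathfrak{a}_m^0)$. A positive real number $c$ is an $F$-jumping exponent of $\mathfrak{a}$ if $\tau(\mathfrak{a}^c)\neq\tau(\mathfrak{a}^{c-\epsilon})$ for every $\epsilon$ with $0<\epsilon\leq c$. By convention $0$ is also an $F$-jumping exponent. *)

theory Defs
  imports Complex_Main "HOL-Algebra.Algebra" "HOL-Library.Extended_Nat"
begin

section \<open>Localization\<close>

text \<open>The fraction \<open>r/s\<close> in \<open>W\<^sup>-\<^sup>1R\<close> is the set of all pairs \<open>(r', s')\<close> equivalent to \<open>(r, s)\<close>.
  The operations on fractions are unions over representatives; for a multiplicative set \<open>W\<close>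
  in a commutative ring all members of such a union are the same class.\<close>

definition fraction :: "('a, 'm) ring_scheme \<Rightarrow> 'a set \<Rightarrow> 'a \<Rightarrow> 'a \<Rightarrow> ('a \<times> 'a) set" where
  "fraction R W r s = {(r', s'). r' \<in> carrier R \<and> s' \<in> W \<and>
     (\<exists>t\<in>W. t \<otimes>\<^bsub>R\<^esub> (s' \<otimes>\<^bsub>R\<^esub> r \<ominus>\<^bsub>R\<^esub> s \<otimes>\<^bsub>R\<^esub> r') = \<zero>\<^bsub>R\<^esub>)}"

definition localization :: "('a, 'm) ring_scheme \<Rightarrow> 'a set \<Rightarrow> ('a \<times> 'a) set ring" where
  "localization R W =
    \<lparr> carrier = {fraction R W r s | r s. r \<in> carrier R \<and> s \<in> W},
      monoid.mult = (\<lambda>x y. \<Union>(r, s)\<in>x. \<Union>(r', s')\<in>y. fraction R W (r \<otimes>\<^bsub>R\<^esub> r') (s \<otimes>\<^bsub>R\<^esub> s')),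
      one = fraction R W \<one>\<^bsub>R\<^esub> \<one>\<^bsub>R\<^esub>,
      ring.zero = fraction R W \<zero>\<^bsub>R\<^esub> \<one>\<^bsub>R\<^esub>,
      add = (\<lambda>x y. \<Union>(r, s)\<in>x. \<Union>(r', s')\<in>y.
               fraction R W (s' \<otimes>\<^bsub>R\<^esub> r \<oplus>\<^bsub>R\<^esub> s \<otimes>\<^bsub>R\<^esub> r') (s \<otimes>\<^bsub>R\<^esub> s')) \<rparr>"


section \<open>Regular rings\<close>

definition krull_dim :: "('a, 'm) ring_scheme \<Rightarrow> enat" where
  "krull_dim R = (SUP n \<in> {n. \<exists>P :: nat \<Rightarrow> 'a set.
     (\<forall>i\<le>n. primeideal (P i) R) \<and> (\<forall>i<n. P i \<subset> P (Suc i))}. enat n)"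

text \<open>A Noetherian local ring is regular if its maximal ideal is generated by
  \<open>dim R\<close> elements.\<close>

definition regular_local_ring :: "('a, 'm) ring_scheme \<Rightarrow> bool" where
  "regular_local_ring R \<longleftrightarrow> cring R \<and> noetherian_ring R \<and> (\<exists>!M. maximalideal M R) \<and>
     (\<exists>G \<subseteq> carrier R. finite G \<and> maximalideal (genideal R G) R \<and> enat (card G) = krull_dim R)"

definition regular_ring :: "('a, 'm) ring_scheme \<Rightarrow> bool" where
  "regular_ring R \<longleftrightarrow> cring R \<and> noetherian_ring R \<and>
     (\<forall>P. primeideal P R \<longrightarrow> regular_local_ring (localization R (carrier R - P)))"


section \<open>Characteristic and F-finiteness\<close>

definition has_characteristic :: "('a, 'm) ring_scheme \<Rightarrow> nat \<Rightarrow> bool" where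
  "has_characteristic R p \<longleftrightarrow> (\<forall>n::nat. [n] \<cdot>\<^bsub>R\<^esub> \<one>\<^bsub>R\<^esub> = \<zero>\<^bsub>R\<^esub> \<longleftrightarrow> p dvd n)"

text \<open>Finiteness of the Frobenius morphism: \<open>R\<close> is a finitely generated module over itself
  with scalar action \<open>(c, g) \<mapsto> c\<^sup>p g\<close>.\<close>

definition F_finite :: "nat \<Rightarrow> ('a, 'm) ring_scheme \<Rightarrow> bool" where
  "F_finite p R \<longleftrightarrow> Factorial_Ring.prime p \<and> cring R \<and> has_characteristic R p \<and>
     (\<exists>G \<subseteq> carrier R. finite G \<and>
       (\<forall>x\<in>carrier R. \<exists>c \<in> G \<rightarrow> carrier R.
          x = (\<Oplus>\<^bsub>R\<^esub>g\<in>G. (c g [^]\<^bsub>R\<^esub> p) \<otimes>\<^bsub>R\<^esub> g)))"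


section \<open>Algebras (essentially) of finite type\<close>

definition finite_type_algebra ::
  "('k, 'n) ring_scheme \<Rightarrow> ('a, 'm) ring_scheme \<Rightarrow> ('k \<Rightarrow> 'a) \<Rightarrow> bool" where
  "finite_type_algebra K A \<phi> \<longleftrightarrow> cring A \<and> \<phi> \<in> ring_hom K A \<and>
     (\<exists>G \<subseteq> carrier A. finite G \<and> generate_ring A (\<phi> ` carrier K \<union> G) = carrier A)"

text \<open>The \<open>K\<close>-algebra \<open>\<phi> : K \<rightarrow> R\<close> is isomorphic, as a \<open>K\<close>-algebra, to a localization
  \<open>W\<^sup>-\<^sup>1A\<close> of a \<open>K\<close>-algebra \<open>\<psi> : K \<rightarrow> A\<close> of finite type. HOL cannot quantify
  existentially over types, so the type \<open>'b\<close> in which \<open>A\<close> lives is a parameter; used as a hypothesis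
  with a free \<open>'b\<close>, this covers presentations by algebras on an arbitrary type.\<close>

definition ess_finite_type_algebra ::
  "'b itself \<Rightarrow> ('k, 'n) ring_scheme \<Rightarrow> ('a, 'm) ring_scheme \<Rightarrow> ('k \<Rightarrow> 'a) \<Rightarrow> bool" where
  "ess_finite_type_algebra TYPE('b) K R \<phi> \<longleftrightarrow> \<phi> \<in> ring_hom K R \<and>
     (\<exists>(A :: 'b ring) \<psi> W h. finite_type_algebra K A \<psi> \<and> submonoid W A \<and>
        h \<in> ring_iso (localization A W) R \<and>
        (\<forall>x\<in>carrier K. h (fraction A W (\<psi> x) \<one>\<^bsub>A\<^esub>) = \<phi> x))"


section \<open>Generalized test ideals\<close>

definition frob_power :: "('a, 'm) ring_scheme \<Rightarrow> nat \<Rightarrow> 'a set \<Rightarrow> 'a set" where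
  "frob_power R q J = genideal R {u [^]\<^bsub>R\<^esub> q | u. u \<in> J}"

text \<open>The smallest ideal \<open>J\<close> with \<open>b \<subseteq> J\<^sup>[\<^sup>q\<^sup>]\<close>; the order on sets is inclusion.\<close>

definition frob_root :: "('a, 'm) ring_scheme \<Rightarrow> nat \<Rightarrow> 'a set \<Rightarrow> 'a set" where
  "frob_root R q b = (LEAST J. ideal J R \<and> b \<subseteq> frob_power R q J)"

definition ideal_power :: "('a, 'm) ring_scheme \<Rightarrow> 'a set \<Rightarrow> nat \<Rightarrow> 'a set" where
  "ideal_power R I n = I [^]\<^bsub>ideals_set R\<^esub> n"

definition test_ideal_zero_domain :: "('a, 'm) ring_scheme \<Rightarrow> 'a set \<Rightarrow> 'a set" where
  "test_ideal_zero_domain R I = (if I = {\<zero>\<^bsub>R\<^esub>} then {\<zero>\<^bsub>R\<^esub>} else carrier R)"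

text \<open>The exponent \<open>0\<close>: \<open>h\<close> is a decomposition of \<open>R\<close> as a product of regular domains
  \<open>R\<^sub>1 \<times> \<dots> \<times> R\<^sub>m\<close>, and the ideal is pulled back along \<open>h\<close> from the product of
  the ideals of the factors. Each \<open>R\<^sub>i\<close> is isomorphic to the ideal of \<open>R\<close> generated by an
  idempotent, so taking the factors on the type of \<open>R\<close> loses no decomposition; the decomposition
  is unique up to isomorphism and order, so the result does not depend on it.\<close>

definition test_ideal_zero :: "('a, 'm) ring_scheme \<Rightarrow> 'a set \<Rightarrow> 'a set" where
  "test_ideal_zero R I = (THE T. \<exists>(Rs :: 'a ring list) h.
     (\<forall>S\<in>set Rs. domain S \<and> regular_ring S) \<and> h \<in> ring_iso R (RDirProd_list Rs) \<and>
     T = {x \<in> carrier R. \<forall>i<length Rs.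
            h x ! i \<in> test_ideal_zero_domain (Rs ! i) ((\<lambda>y. h y ! i) ` I)})"

text \<open>Used only for \<open>c \<ge> 0\<close>; for negative \<open>c\<close> the value has no meaning.\<close>

definition test_ideal :: "nat \<Rightarrow> ('a, 'm) ring_scheme \<Rightarrow> 'a set \<Rightarrow> real \<Rightarrow> 'a set" where
  "test_ideal p R I c =
     (if c = 0 then test_ideal_zero R I
      else (\<Union>e\<in>{e::nat. e > 0}. frob_root R (p ^ e) (ideal_power R I (nat \<lceil>c * real p ^ e\<rceil>))))"

definition F_jumping_exponents :: "nat \<Rightarrow> ('a, 'm) ring_scheme \<Rightarrow> 'a set \<Rightarrow> real set" where
  "F_jumping_exponents p R I = insert 0
     {c. c > 0 \<and> (\<forall>\<epsilon>. 0 < \<epsilon> \<and> \<epsilon> \<le> c \<longrightarrow> test_ideal p R I c \<noteq> test_ideal p R I (c - \<epsilon>))}"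

end

theory Submission
  imports Defs
begin

text \<open>
  Everything rests on a dual basis of the Frobenius pushforward: finitely many
  \<open>p\<^sup>-\<^sup>1\<close>-linear maps \<open>f\<close> and elements \<open>g\<close> with \<open>x = \<Sum> f(x)\<^sup>p g\<close>. It makes
  \<open>b \<mapsto> b\<^bsup>[1/p]\<^esup>\<close> the operation ``ideal generated by all \<open>f(b)\<close>'', adjoint to
  \<open>J \<mapsto> J\<^bsup>[p]\<^esup>\<close>.

  To find a dual basis at a prime \<open>P\<close>, let \<open>x\<^sub>1,\<dots>,x\<^sub>d\<close> generate \<open>P\<close> locally, \<open>d\<close> the local dimension,
  and let \<open>y\<^sub>1,\<dots>,y\<^sub>m\<close> be a \<open>p\<close>-basis of the residue field. By Nakayama's lemma the \<open>m p\<^sup>d\<close> products of the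
  \<open>y\<^sub>j\<close> with monomials in the \<open>x\<^sub>i\<close> of exponents below \<open>p\<close> generate. The degree \<open>[\<kappa>(Q) : \<kappa>(Q)\<^sup>p]\<close>
  grows by a factor of at least \<open>p\<close> with every strict step down a chain of primes, so at the bottom
  \<open>Q\<^sub>0\<close> of a chain of length \<open>d\<close> these generators are independent. Hence \<open>Q\<^sub>0\<close> lies locally in
  \<open>Q\<^sub>0\<^bsup>[p]\<^esup>\<close>, so \<open>Q\<^sub>0 = 0\<close> locally and the generators form a basis. No dimension theory enters, because
  the rank inequality follows from counting elements of bounded degree.

  Writing \<open>R\<close> as a localization of an algebra generated by finitely many elements over a field that is
  itself \<open>F\<close>-finite, the maps \<open>f\<close> divide degrees by \<open>p\<close> up to a constant. So all \<open>\<tau>(a\<^sup>c)\<close>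
  with bounded \<open>c\<close> are generated inside one finite-dimensional space, and only finitely many of them
  can occur. Rationality follows since the jumping exponents are stable under
  multiplication by \<open>p\<close> and, by Skoda's theorem, under subtraction of \<open>1\<close> above the number of
  generators.
\<close>

section \<open>The Frobenius map of a ring of prime characteristic\<close>

text \<open>That the ground field is \<open>F\<close>-finite has to be derived: finiteness of the
  rank of \<open>R\<close> at a maximal ideal descends to the subalgebra generated by
  \<open>xs\<close> and then, one generator at a time, to the field, which meets the maximal ideal
  only in zero. A finite-dimensional space over an infinite field has infinitely many subspaces, so
  bounded degree alone does not bound the number of test ideals. They decrease in the exponent,
  hence form a chain, and every strict step of it costs one dimension. Rationality is a pigeonhole
  argument: for every \<open>e\<close> a natural number can be subtracted from
  \<open>p ^ e * c\<close> so that the result lies in one finite set. Two results agree for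
  different \<open>e\<close>, which is a linear equation for \<open>c\<close> with integer
  coefficients. Residue fields and pushforwards never appear as structures of their own. Linear
  algebra takes place in \<open>R\<close>, with coefficients acting by \<open>q\<close>-th powers,
  modulo an ideal, and up to denominators outside a prime. Hence the frequent merging of finitely
  many denominators into one, and the units in the degree estimates.\<close>

lemma (in cring) finsum_uminus:
  "finite A \<Longrightarrow> f \<in> A \<rightarrow> carrier R \<Longrightarrow> \<ominus> (\<Oplus>i\<in>A. f i) = (\<Oplus>i\<in>A. \<ominus> f i)"
  by (induction A rule: finite_induct) (auto simp: minus_add Pi_def)

lemma (in cring) binomial_expansion:
  assumes "x \<in> carrier R" "y \<in> carrier R"
  shows "(x \<oplus> y) [^] (n::nat) = (\<Oplus>k\<in>{..n}. [(n choose k)] \<cdot> (x [^] k \<otimes> y [^] (n - k)))"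
proof (induction n)
  case 0
  then show ?case using assms by (simp add: add.nat_pow_0)
next
  case (Suc n)
  define f where "f = (\<lambda>n k. [(n choose k)] \<cdot> (x [^] k \<otimes> y [^] (n - k)))"
  have f[simp]: "f n k \<in> carrier R" for n k using assms by (simp add: f_def)
  have eq1: "(\<Oplus>k\<in>{..n}. f n k \<otimes> x) = (\<Oplus>k\<in>{..n}. [(n choose k)] \<cdot> (x [^] Suc k \<otimes> y [^] (n - k)))"
  proof (rule finsum_cong')
    fix k assume "k \<in> {..n}"
    have "f n k \<otimes> x = [(n choose k)] \<cdot> ((x [^] k \<otimes> y [^] (n - k)) \<otimes> x)"
      unfolding f_def using assms by (subst add_pow_ldistr) auto
    also have "(x [^] k \<otimes> y [^] (n - k)) \<otimes> x = x [^] Suc k \<otimes> y [^] (n - k)"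
      using assms by (simp add: m_ac)
    finally show "f n k \<otimes> x = [(n choose k)] \<cdot> (x [^] Suc k \<otimes> y [^] (n - k))" .
  qed (use assms in auto)
  have eq2: "(\<Oplus>k\<in>{..n}. f n k \<otimes> y) = (\<Oplus>k\<in>{..n}. [(n choose k)] \<cdot> (x [^] k \<otimes> y [^] (Suc n - k)))"
  proof (rule finsum_cong')
    fix k assume k: "k \<in> {..n}"
    have "f n k \<otimes> y = [(n choose k)] \<cdot> ((x [^] k \<otimes> y [^] (n - k)) \<otimes> y)"
      unfolding f_def using assms by (subst add_pow_ldistr) auto
    also have "(x [^] k \<otimes> y [^] (n - k)) \<otimes> y = x [^] k \<otimes> y [^] (Suc n - k)"
      using assms k by (simp add: m_ac Suc_diff_le)
    finally show "f n k \<otimes> y = [(n choose k)] \<cdot> (x [^] k \<otimes> y [^] (Suc n - k))" .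
  qed (use assms in auto)
  define g where "g = (\<lambda>k. [(n choose k)] \<cdot> (x [^] Suc k \<otimes> y [^] (n - k)))"
  define h where "h = (\<lambda>k. [(n choose k)] \<cdot> (x [^] k \<otimes> y [^] (Suc n - k)))"
  have g[simp]: "g k \<in> carrier R" for k using assms by (simp add: g_def)
  have h[simp]: "h k \<in> carrier R" for k using assms by (simp add: h_def)
  have hS: "h (Suc n) = \<zero>" using assms by (simp add: h_def add.nat_pow_0 binomial_eq_0)
  have fg: "f (Suc n) (Suc k) = g k \<oplus> h (Suc k)" for k
    using assms by (simp add: f_def g_def h_def add.nat_pow_mult)
  have f0: "f (Suc n) 0 = h 0" using assms by (simp add: f_def h_def)
  have "(x \<oplus> y) [^] Suc n = (\<Oplus>k\<in>{..n}. f n k) \<otimes> (x \<oplus> y)"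
    using Suc by (simp add: f_def)
  also have "\<dots> = (\<Oplus>k\<in>{..n}. f n k) \<otimes> x \<oplus> (\<Oplus>k\<in>{..n}. f n k) \<otimes> y"
    using assms by (simp add: r_distr)
  also have "\<dots> = (\<Oplus>k\<in>{..n}. g k) \<oplus> (\<Oplus>k\<in>{..n}. h k)"
    using assms by (simp add: finsum_ldistr eq1 eq2 g_def h_def)
  also have "(\<Oplus>k\<in>{..n}. h k) = (\<Oplus>k\<in>{..Suc n}. h k)"
    by (subst finsum_Suc) (auto simp: hS)
  also have "\<dots> = (\<Oplus>k\<in>{..n}. h (Suc k)) \<oplus> h 0"
    by (subst finsum_Suc2) auto
  also have "(\<Oplus>k\<in>{..n}. g k) \<oplus> ((\<Oplus>k\<in>{..n}. h (Suc k)) \<oplus> h 0)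
      = (\<Oplus>k\<in>{..n}. g k \<oplus> h (Suc k)) \<oplus> h 0"
    by (subst finsum_addf) (auto simp: a_assoc)
  also have "\<dots> = (\<Oplus>k\<in>{..n}. f (Suc n) (Suc k)) \<oplus> f (Suc n) 0"
    by (simp add: fg f0)
  also have "\<dots> = (\<Oplus>k\<in>{..Suc n}. f (Suc n) k)"
    by (rule finsum_Suc2[symmetric]) auto
  finally show ?case by (simp add: f_def)
qed

locale char_p_ring = cring R for R (structure) + fixes p :: nat
  assumes prime_p: "Factorial_Ring.prime p" and char_p: "[p] \<cdot> \<one> = \<zero>"
begin

lemma p_ge2: "p \<ge> 2" and p_pos: "p > 0"
  using prime_p prime_ge_2_nat prime_gt_0_nat by auto

lemma add_pow_dvd_p: "p dvd n \<Longrightarrow> x \<in> carrier R \<Longrightarrow> [n] \<cdot> x = \<zero>"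
proof -
  assume "p dvd n" and x: "x \<in> carrier R"
  then obtain m where n: "n = p * m" by auto
  have "[p] \<cdot> ([m] \<cdot> x) = ([p] \<cdot> \<one>) \<otimes> ([m] \<cdot> x)"
    using x by (simp add: add_pow_ldistr)
  also have "\<dots> = \<zero>" using x by (simp add: char_p)
  finally show ?thesis using x by (simp add: n add.nat_pow_pow mult.commute)
qed

lemma frob_add_p:
  assumes "x \<in> carrier R" "y \<in> carrier R"
  shows "(x \<oplus> y) [^] p = x [^] p \<oplus> y [^] p"
proof -
  \<comment> \<open>Two is split off so that the exponents strictly between \<open>0\<close> and
    \<open>p\<close> are exactly the \<open>Suc k\<close> with \<open>k \<le> n\<close>.\<close>
  obtain n where p: "p = Suc (Suc n)" using p_ge2 by (intro that[of "p - 2"]) simp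
  define f where "f = (\<lambda>k. [(p choose k)] \<cdot> (x [^] k \<otimes> y [^] (p - k)))"
  have f[simp]: "f k \<in> carrier R" for k using assms by (simp add: f_def)
  have z: "f (Suc k) = \<zero>" if "k \<le> n" for k
  proof -
    have "p dvd (p choose Suc k)" using that p prime_p by (intro dvd_choose_prime) auto
    then show ?thesis unfolding f_def using assms by (intro add_pow_dvd_p) auto
  qed
  have "(x \<oplus> y) [^] p = (\<Oplus>k\<in>{..p}. f k)"
    using binomial_expansion[OF assms] by (simp add: f_def)
  also have "\<dots> = f p \<oplus> (\<Oplus>k\<in>{..Suc n}. f k)"
    unfolding p by (subst finsum_Suc) auto
  also have "(\<Oplus>k\<in>{..Suc n}. f k) = (\<Oplus>k\<in>{..n}. f (Suc k)) \<oplus> f 0"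
    by (subst finsum_Suc2) auto
  also have "(\<Oplus>k\<in>{..n}. f (Suc k)) = \<zero>"
    using z by (intro add.finprod_one_eqI) auto
  finally show ?thesis using assms by (simp add: f_def)
qed

lemma frob_add:
  assumes "x \<in> carrier R" "y \<in> carrier R"
  shows "(x \<oplus> y) [^] (p ^ e) = x [^] (p ^ e) \<oplus> y [^] (p ^ e)"
proof (induction e)
  case (Suc e)
  have "(x \<oplus> y) [^] (p ^ Suc e) = ((x \<oplus> y) [^] (p ^ e)) [^] p"
    using assms by (simp add: nat_pow_pow mult.commute)
  also have "\<dots> = x [^] (p ^ Suc e) \<oplus> y [^] (p ^ Suc e)"
    using assms by (simp add: Suc frob_add_p nat_pow_pow mult.commute)
  finally show ?case .
qed (use assms in simp)

lemma frob_zero [simp]: "\<zero> [^] (p ^ e) = \<zero>"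
  using p_pos by (intro nat_pow_zero) auto

lemma frob_neg:
  assumes "x \<in> carrier R"
  shows "(\<ominus> x) [^] (p ^ e) = \<ominus> (x [^] (p ^ e))"
proof -
  have "x [^] (p ^ e) \<oplus> (\<ominus> x) [^] (p ^ e) = \<zero>"
    using assms by (simp add: frob_add[symmetric] r_neg)
  then show ?thesis using assms
    by (metis a_inv_closed add.inv_equality add.m_comm nat_pow_closed)
qed

lemma frob_finsum:
  assumes "finite A" "f \<in> A \<rightarrow> carrier R"
  shows "(\<Oplus>i\<in>A. f i) [^] (p ^ e) = (\<Oplus>i\<in>A. f i [^] (p ^ e))"
  using assms by (induction A rule: finite_induct) (auto simp: frob_add Pi_def)

lemmas frob_add1 = frob_add[of _ _ 1, simplified] and frob_neg1 = frob_neg[of _ 1, simplified]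
  and frob_finsum1 = frob_finsum[of _ _ 1, simplified]
  and frob_zero1 = frob_zero[of 1, simplified]

end

section \<open>Twisted linear algebra over a subring modulo an ideal\<close>

text \<open>A coefficient \<open>c \<in> S\<close> acts as multiplication by \<open>c\<^sup>q\<close>, and everything is taken modulo \<open>Q\<close>;
  \<open>S = R\<close> and \<open>q = p\<close> give the Frobenius pushforward of \<open>R\<close>.\<close>

inductive_set tspan :: "('a, 'm) ring_scheme \<Rightarrow> 'a set \<Rightarrow> nat \<Rightarrow> 'a set \<Rightarrow> 'a set \<Rightarrow> 'a set"
  for R S q Q U where
  base: "w \<in> Q \<Longrightarrow> w \<in> tspan R S q Q U"
| step: "x \<in> tspan R S q Q U \<Longrightarrow> c \<in> S \<Longrightarrow> u \<in> U \<Longrightarrow>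
    x \<oplus>\<^bsub>R\<^esub> (c [^]\<^bsub>R\<^esub> q) \<otimes>\<^bsub>R\<^esub> u \<in> tspan R S q Q U"

definition tindep :: "('a, 'm) ring_scheme \<Rightarrow> 'a set \<Rightarrow> nat \<Rightarrow> 'a set \<Rightarrow> 'i set \<Rightarrow> ('i \<Rightarrow> 'a) \<Rightarrow> bool" where
  "tindep R S q Q I v \<longleftrightarrow> (\<forall>c \<in> I \<rightarrow> S. (\<Oplus>\<^bsub>R\<^esub>i\<in>I. (c i [^]\<^bsub>R\<^esub> q) \<otimes>\<^bsub>R\<^esub> v i) \<in> Q \<longrightarrow> (\<forall>i\<in>I. c i \<in> Q))"

text \<open>Here \<open>S\<close> is a mere set, because coefficients are later taken from a degree
  part \<open>V d\<close> or from a prime ideal \<open>P\<close>, neither of which is a subring.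
  Closure of \<open>S\<close> is irrelevant for sums: the terms are listed one after another, and a
  generator may be repeated.\<close>

lemma (in cring) tspan_add_any:
  assumes "x \<in> tspan R S q Q U" "y \<in> tspan R S q Q U" "S \<subseteq> carrier R" "U \<subseteq> carrier R" "ideal Q R"
  shows "x \<oplus> y \<in> tspan R S q Q U"
proof -
  interpret ideal Q R by fact
  have carr: "z \<in> carrier R" if "z \<in> tspan R S q Q U" for z
    using that by induction (use assms(3,4) Icarr in auto)
  show ?thesis using assms(2)
  proof induction
    case (base w)
    show ?case using assms(1)
    proof induction
      case (base v)
      then show ?case using \<open>w \<in> Q\<close> by (intro tspan.base) auto
    next
      case (step z c u)
      have "z \<in> carrier R" "c \<in> carrier R" "u \<in> carrier R" "w \<in> carrier R"
        using step base assms carr[OF step(1)] Icarr by auto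
      then have "z \<oplus> c [^] q \<otimes> u \<oplus> w = (z \<oplus> w) \<oplus> c [^] q \<otimes> u" by (simp add: a_ac)
      then show ?case using step by (auto intro: tspan.step)
    qed
  next
    case (step z c u)
    have "z \<in> carrier R" "c \<in> carrier R" "u \<in> carrier R" "x \<in> carrier R"
      using step assms carr[OF step(1)] carr[OF assms(1)] by auto
    then have "x \<oplus> (z \<oplus> c [^] q \<otimes> u) = (x \<oplus> z) \<oplus> c [^] q \<otimes> u" by (simp add: a_assoc)
    then show ?case using step by (auto intro: tspan.step)
  qed
qed

lemma tspan_mono: "Q \<subseteq> Q' \<Longrightarrow> S \<subseteq> S' \<Longrightarrow> U \<subseteq> U' \<Longrightarrow> tspan R S q Q U \<subseteq> tspan R S' q Q' U'"
proof
  fix x assume a: "Q \<subseteq> Q'" "S \<subseteq> S'" "U \<subseteq> U'" and "x \<in> tspan R S q Q U"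
  from this(4) show "x \<in> tspan R S' q Q' U'"
    by induction (use a in \<open>auto intro: tspan.intros\<close>)
qed

locale twisted = char_p_ring R p for R (structure) and p +
  fixes S Q :: "'a set"
  assumes ideal_Q: "ideal Q R" and subring_S: "subring S R"
begin

lemma S_carr: "c \<in> S \<Longrightarrow> c \<in> carrier R"
  using subringE(1)[OF subring_S] by auto
lemma S_zero: "\<zero> \<in> S" and S_one: "\<one> \<in> S"
  and S_neg: "c \<in> S \<Longrightarrow> \<ominus> c \<in> S"
  and S_add: "c \<in> S \<Longrightarrow> d \<in> S \<Longrightarrow> c \<oplus> d \<in> S" and S_mult: "c \<in> S \<Longrightarrow> d \<in> S \<Longrightarrow> c \<otimes> d \<in> S"
  using subringE[OF subring_S] by auto
lemma S_pow: "c \<in> S \<Longrightarrow> c [^] (n::nat) \<in> S"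
  by (induction n) (auto simp: S_one S_mult)
lemma S_finsum: "finite A \<Longrightarrow> f \<in> A \<rightarrow> S \<Longrightarrow> (\<Oplus>i\<in>A. f i) \<in> S"
proof (induction A rule: finite_induct)
  case (insert x F)
  then have "f \<in> F \<rightarrow> carrier R" "f x \<in> carrier R" using S_carr by auto
  then show ?case using insert by (auto simp: S_add)
qed (simp add: S_zero)
lemma Q_carr: "c \<in> Q \<Longrightarrow> c \<in> carrier R"
  using ideal.Icarr[OF ideal_Q] .
lemma Q_zero: "\<zero> \<in> Q" and Q_add: "c \<in> Q \<Longrightarrow> d \<in> Q \<Longrightarrow> c \<oplus> d \<in> Q" and Q_neg: "c \<in> Q \<Longrightarrow> \<ominus> c \<in> Q"
  using ideal.axioms(1)[OF ideal_Q]
  by (auto simp: additive_subgroup.zero_closed additive_subgroup.a_closed additive_subgroup.a_inv_closed)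
lemma Q_lmult: "c \<in> Q \<Longrightarrow> d \<in> carrier R \<Longrightarrow> d \<otimes> c \<in> Q"
  and Q_rmult: "c \<in> Q \<Longrightarrow> d \<in> carrier R \<Longrightarrow> c \<otimes> d \<in> Q"
  using ideal.I_l_closed[OF ideal_Q] ideal.I_r_closed[OF ideal_Q] by auto
lemma Q_pow: "c \<in> Q \<Longrightarrow> c [^] (p ^ e) \<in> Q"
proof -
  assume "c \<in> Q"
  obtain n where "p ^ e = Suc n" using p_pos by (metis gr0_implies_Suc zero_less_power)
  then show ?thesis using \<open>c \<in> Q\<close> Q_carr by (auto intro: Q_lmult)
qed
lemma Q_cancel: "x \<oplus> w \<in> Q \<Longrightarrow> w \<in> Q \<Longrightarrow> x \<in> carrier R \<Longrightarrow> x \<in> Q"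
proof -
  assume a: "x \<oplus> w \<in> Q" "w \<in> Q" "x \<in> carrier R"
  then have "(x \<oplus> w) \<oplus> \<ominus> w \<in> Q" by (auto intro: Q_add Q_neg)
  then show "x \<in> Q" using a Q_carr by (simp add: a_assoc r_neg)
qed
lemma Q_finsum: "finite A \<Longrightarrow> f \<in> A \<rightarrow> Q \<Longrightarrow> (\<Oplus>i\<in>A. f i) \<in> Q"
proof (induction A rule: finite_induct)
  case (insert x F)
  then have "f \<in> F \<rightarrow> carrier R" "f x \<in> carrier R" using Q_carr by auto
  then show ?case using insert by (auto simp: Q_add)
qed (simp add: Q_zero)

lemma tspan_carrier:
  assumes "x \<in> tspan R S q Q U" "U \<subseteq> carrier R" shows "x \<in> carrier R"
  using assms by induction (auto simp: S_carr Q_carr)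

lemma tspan_add:
  assumes "x \<in> tspan R S q Q U" "y \<in> tspan R S q Q U" "U \<subseteq> carrier R"
  shows "x \<oplus> y \<in> tspan R S q Q U"
  using assms subringE(1)[OF subring_S] ideal_Q by (intro tspan_add_any)

lemma tspan_zero: "\<zero> \<in> tspan R S q Q U"
  by (simp add: tspan.base Q_zero)

lemma tspan_term: "c \<in> S \<Longrightarrow> u \<in> U \<Longrightarrow> U \<subseteq> carrier R \<Longrightarrow> c [^] q \<otimes> u \<in> tspan R S q Q U"
  using tspan.step[OF tspan_zero[of q U], of c u] S_carr[of c] by (auto simp: subset_iff)

lemma tspan_incl: "u \<in> U \<Longrightarrow> U \<subseteq> carrier R \<Longrightarrow> u \<in> tspan R S q Q U"
  using tspan_term[OF S_one, of u U q] by auto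

lemma tspan_scale:
  assumes "x \<in> tspan R S q Q U" "c \<in> S" "U \<subseteq> carrier R"
  shows "c [^] q \<otimes> x \<in> tspan R S q Q U"
  using assms(1)
proof induction
  case (base w)
  then show ?case using assms(2) S_carr by (auto intro!: tspan.base Q_lmult)
next
  case (step x d u)
  have "c [^] q \<otimes> (x \<oplus> d [^] q \<otimes> u) = c [^] q \<otimes> x \<oplus> (c \<otimes> d) [^] q \<otimes> u"
    using step tspan_carrier[OF step(1)] assms(2,3) S_carr
    by (simp add: subset_iff r_distr nat_pow_distrib m_assoc)
  then show ?case using step assms by (auto intro: tspan.step S_mult)
qed

text \<open>The coefficient minus one acts as \<open>(\<ominus> \<one>) [^] (p ^ e)\<close>, which
  is minus one again in characteristic \<open>p\<close>.\<close>

lemma tspan_neg: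
  assumes "x \<in> tspan R S (p ^ e) Q U" "U \<subseteq> carrier R"
  shows "\<ominus> x \<in> tspan R S (p ^ e) Q U"
  using tspan_scale[OF assms(1) S_neg[OF S_one] assms(2)] tspan_carrier[OF assms]
  by (simp add: frob_neg l_minus)

lemma tspan_minus:
  assumes "x \<in> tspan R S (p ^ e) Q U" "y \<in> tspan R S (p ^ e) Q U" "U \<subseteq> carrier R"
  shows "x \<ominus> y \<in> tspan R S (p ^ e) Q U"
  using assms by (simp add: minus_eq tspan_add tspan_neg)

lemma tspan_finsum:
  assumes "finite A" "\<And>i. i \<in> A \<Longrightarrow> f i \<in> tspan R S q Q U" "U \<subseteq> carrier R"
  shows "(\<Oplus>i\<in>A. f i) \<in> tspan R S q Q U"
  using assms(1,2)
proof (induction A rule: finite_induct)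
  case (insert x F)
  then have "f \<in> F \<rightarrow> carrier R" "f x \<in> carrier R" using tspan_carrier[OF _ assms(3)] by auto
  then show ?case using insert assms(3) by (auto intro: tspan_add)
qed (simp add: tspan_zero)

lemma tspan_empty: "x \<in> tspan R S q Q {} \<Longrightarrow> x \<in> Q"
  by (induction rule: tspan.induct) auto

text \<open>Repeated occurrences of \<open>u\<close> merge into a single coefficient because
  \<open>q\<close>-th powers are additive when \<open>q\<close> is a power of \<open>p\<close>; this
  is why the twist is \<open>p ^ e\<close> here.\<close>

lemma tspan_insert:
  assumes "x \<in> tspan R S (p ^ e) Q (insert u U)" "insert u U \<subseteq> carrier R"
  obtains c y where "c \<in> S" "y \<in> tspan R S (p ^ e) Q U" "x = y \<oplus> c [^] (p ^ e) \<otimes> u"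
proof -
  have "\<exists>c y. c \<in> S \<and> y \<in> tspan R S (p ^ e) Q U \<and> x = y \<oplus> c [^] (p ^ e) \<otimes> u"
    using assms(1)
  proof induction
    case (base w)
    have "w = w \<oplus> \<zero> [^] (p ^ e) \<otimes> u" using base Q_carr assms(2) by simp
    then show ?case using base S_zero by (blast intro: tspan.base)
  next
    case (step x d v)
    then obtain c y where cy: "c \<in> S" "y \<in> tspan R S (p ^ e) Q U" "x = y \<oplus> c [^] (p ^ e) \<otimes> u" by auto
    have y: "y \<in> carrier R" using cy(2) tspan_carrier assms(2) by auto
    have carr: "c \<in> carrier R" "d \<in> carrier R" "v \<in> carrier R" "u \<in> carrier R"
      using cy step assms(2) S_carr by auto
    show ?case
    proof (cases "v = u")
      case True
      have "x \<oplus> d [^] (p ^ e) \<otimes> v = y \<oplus> (c \<oplus> d) [^] (p ^ e) \<otimes> u"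
        using carr y by (simp add: cy(3) True frob_add l_distr a_assoc)
      then show ?thesis using cy step by (blast intro: S_add)
    next
      case False
      then have "v \<in> U" using step by auto
      have "x \<oplus> d [^] (p ^ e) \<otimes> v = (y \<oplus> d [^] (p ^ e) \<otimes> v) \<oplus> c [^] (p ^ e) \<otimes> u"
        using carr y by (simp add: cy(3) a_ac)
      then show ?thesis using cy step \<open>v \<in> U\<close> by (blast intro: tspan.step)
    qed
  qed
  then show thesis using that by auto
qed

lemma tspan_trans:
  assumes "x \<in> tspan R S q Q U" "U \<subseteq> tspan R S q Q V" "V \<subseteq> carrier R"
  shows "x \<in> tspan R S q Q V"
  using assms(1)
proof induction
  case (step x c u)
  then show ?case using assms(2,3) by (intro tspan_add tspan_scale) auto
qed (rule tspan.base)

lemma tspan_image_mult: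
  assumes "x \<in> tspan R S q Q U" "z \<in> carrier R" "U \<subseteq> carrier R"
  shows "z \<otimes> x \<in> tspan R S q Q ((\<lambda>u. z \<otimes> u) ` U)"
  using assms(1)
proof induction
  case (base w)
  then show ?case using assms by (auto intro!: tspan.base Q_lmult)
next
  case (step x c u)
  have "z \<otimes> (x \<oplus> c [^] q \<otimes> u) = z \<otimes> x \<oplus> c [^] q \<otimes> (z \<otimes> u)"
    using step tspan_carrier[OF step(1)] assms(2,3) S_carr by (simp add: subset_iff r_distr m_ac)
  then show ?case using step by (auto intro: tspan.step)
qed

text \<open>Frobenius is additive, so it acts on a whole expansion term by term and multiplies the
  twist by \<open>p\<close>. Spanning statements climb from \<open>p ^ e\<close> to
  \<open>p ^ Suc e\<close> in this way.\<close>

lemma tspan_frob: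
  assumes "x \<in> tspan R S q Q U" "U \<subseteq> carrier R"
  shows "x [^] p \<in> tspan R S (q * p) Q ((\<lambda>u. u [^] p) ` U)"
  using assms(1)
proof induction
  case (base w)
  then show ?case using Q_pow[of w 1] by (auto intro!: tspan.base)
next
  case (step x c u)
  have "(x \<oplus> c [^] q \<otimes> u) [^] p = x [^] p \<oplus> c [^] (q * p) \<otimes> u [^] p"
    using step tspan_carrier[OF step(1)] assms S_carr
    by (simp add: subset_iff frob_add1 nat_pow_distrib nat_pow_pow)
  then show ?case using step by (auto intro: tspan.step)
qed

lemma tspan_finite:
  assumes "x \<in> tspan R S (p ^ e) Q U" "finite U" "U \<subseteq> carrier R"
  obtains c w where "c \<in> U \<rightarrow> S" "w \<in> Q" "x = w \<oplus> (\<Oplus>u\<in>U. c u [^] (p ^ e) \<otimes> u)"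
proof -
  have "\<exists>c w. c \<in> U \<rightarrow> S \<and> w \<in> Q \<and> x = w \<oplus> (\<Oplus>u\<in>U. c u [^] (p ^ e) \<otimes> u)"
    using assms(2,3,1)
  proof (induction U arbitrary: x rule: finite_induct)
    case empty
    then show ?case using tspan_empty[OF empty(2)] Q_carr by auto
  next
    case (insert u U)
    obtain c y where cy: "c \<in> S" "y \<in> tspan R S (p ^ e) Q U" "x = y \<oplus> c [^] (p ^ e) \<otimes> u"
      using tspan_insert[OF insert(5,4)] by blast
    have UC: "U \<subseteq> carrier R" using insert by auto
    obtain d w where dw: "d \<in> U \<rightarrow> S" "w \<in> Q" "y = w \<oplus> (\<Oplus>u\<in>U. d u [^] (p ^ e) \<otimes> u)"
      using insert.IH[OF UC cy(2)] by blast
    define d' where "d' = d(u := c)"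
    have d': "d' \<in> insert u U \<rightarrow> S" using dw(1) cy(1) by (auto simp: d'_def)
    have U: "u \<in> carrier R" "U \<subseteq> carrier R" using insert by auto
    have "(\<Oplus>v\<in>insert u U. d' v [^] (p ^ e) \<otimes> v) = d' u [^] (p ^ e) \<otimes> u \<oplus> (\<Oplus>v\<in>U. d' v [^] (p ^ e) \<otimes> v)"
      using d' U insert S_carr by (subst finsum_insert) (auto simp: Pi_def subset_iff)
    also have "(\<Oplus>v\<in>U. d' v [^] (p ^ e) \<otimes> v) = (\<Oplus>v\<in>U. d v [^] (p ^ e) \<otimes> v)"
      using dw(1) U insert S_carr by (intro finsum_cong') (auto simp: d'_def Pi_def subset_iff)
    finally have eq: "(\<Oplus>v\<in>insert u U. d' v [^] (p ^ e) \<otimes> v) = c [^] (p ^ e) \<otimes> u \<oplus> (\<Oplus>v\<in>U. d v [^] (p ^ e) \<otimes> v)"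
      by (simp add: d'_def)
    have "(\<Oplus>v\<in>U. d v [^] (p ^ e) \<otimes> v) \<in> carrier R"
      using dw(1) U S_carr by (intro finsum_closed) (auto simp: Pi_def subset_iff)
    then have "x = w \<oplus> (\<Oplus>v\<in>insert u U. d' v [^] (p ^ e) \<otimes> v)"
      unfolding eq cy(3) dw(3) using Q_carr dw(2) cy(1) S_carr U by (simp add: a_ac)
    then show ?case using d' dw(2) by blast
  qed
  then show thesis using that by blast
qed

text \<open>\<open>M\<close> is a multiplicative set and \<open>P s a\<close> means that
  \<open>s\<close> is a valid denominator for \<open>a\<close>. Validity passes to multiples, so a
  product of individual denominators serves a whole finite set.\<close>

lemma common_multiple:
  assumes "finite A" "M \<subseteq> carrier R" "\<one> \<in> M" "\<And>s t. s \<in> M \<Longrightarrow> t \<in> M \<Longrightarrow> s \<otimes> t \<in> M"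
    "\<And>a. a \<in> A \<Longrightarrow> \<exists>s\<in>M. P s a"
    "\<And>a s t. a \<in> A \<Longrightarrow> s \<in> M \<Longrightarrow> t \<in> M \<Longrightarrow> P s a \<Longrightarrow> P (t \<otimes> s) a"
  shows "\<exists>s\<in>M. \<forall>a\<in>A. P s a"
  using assms(1,5,6)
proof (induction A rule: finite_induct)
  case empty then show ?case using assms(3) by auto
next
  case (insert x F)
  then have "\<exists>s\<in>M. \<forall>a\<in>F. P s a" by (intro insert.IH) auto
  then obtain s where s: "s \<in> M" "\<forall>a\<in>F. P s a" by auto
  obtain t where t: "t \<in> M" "P t x" using insert.prems(1)[of x] by auto
  have "P (t \<otimes> s) a" if "a \<in> F" for a using that s t insert by auto
  moreover have "t \<otimes> s = s \<otimes> t" using s t assms(2) by (intro m_comm) auto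
  then have "P (t \<otimes> s) x" using s t insert.prems(2)[of x t s] by auto
  ultimately show ?case using assms(4) s t by auto
qed

lemma tspan_denominator:
  assumes "x \<in> tspan R S q Q U" "U \<subseteq> carrier R" "V \<subseteq> carrier R"
    and M: "M \<subseteq> carrier R" "\<one> \<in> M" "M \<subseteq> S" "\<And>s t. s \<in> M \<Longrightarrow> t \<in> M \<Longrightarrow> s \<otimes> t \<in> M"
    and "\<And>u. u \<in> U \<Longrightarrow> \<exists>s\<in>M. s [^] q \<otimes> u \<in> tspan R S q Q V"
  shows "\<exists>s\<in>M. s [^] q \<otimes> x \<in> tspan R S q Q V"
  using assms(1)
proof induction
  case (base w)
  then show ?case using M by (auto intro!: bexI[of _ \<one>] tspan.base Q_lmult)
next
  case (step x c u)
  obtain s where s: "s \<in> M" "s [^] q \<otimes> x \<in> tspan R S q Q V" using step by auto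
  obtain t where t: "t \<in> M" "t [^] q \<otimes> u \<in> tspan R S q Q V" using assms(8) step by auto
  have carr: "s \<in> carrier R" "t \<in> carrier R" "x \<in> carrier R" "u \<in> carrier R" "c \<in> carrier R"
    using s t M step tspan_carrier[OF step(1)] assms(2) S_carr by auto
  have "(s \<otimes> t) [^] q \<otimes> (x \<oplus> c [^] q \<otimes> u) = t [^] q \<otimes> (s [^] q \<otimes> x) \<oplus> (c \<otimes> s) [^] q \<otimes> (t [^] q \<otimes> u)"
  proof -
    have *: "(a \<otimes> b) \<otimes> (x \<oplus> d \<otimes> u) = b \<otimes> (a \<otimes> x) \<oplus> (d \<otimes> a) \<otimes> (b \<otimes> u)"
      if "a \<in> carrier R" "b \<in> carrier R" "d \<in> carrier R" for a b d
      using that carr(3,4) by algebra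
    show ?thesis unfolding nat_pow_distrib[OF carr(1,2)] nat_pow_distrib[OF carr(5,1)]
      using carr by (intro *) auto
  qed
  moreover have "\<dots> \<in> tspan R S q Q V"
  proof -
    have "t \<in> S" "c \<otimes> s \<in> S" using s t M(3) step by (auto intro: S_mult)
    then show ?thesis
      using tspan_add[OF tspan_scale[OF s(2) _ assms(3)] tspan_scale[OF t(2) _ assms(3)] assms(3)] by blast
  qed
  ultimately show ?case using M(4)[OF s(1) t(1)] by (intro bexI[of _ "s \<otimes> t"]) simp_all
qed

end

text \<open>The elimination step of the exchange argument: cross-multiplication removes
  \<open>u\<close> without a division.\<close>

lemma (in cring) cross_cancel:
  assumes "a \<in> carrier R" "b \<in> carrier R" "x \<in> carrier R" "y \<in> carrier R" "u \<in> carrier R"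
  shows "a \<otimes> (x \<oplus> b \<otimes> u) \<ominus> b \<otimes> (y \<oplus> a \<otimes> u) = a \<otimes> x \<ominus> b \<otimes> y"
  using assms by algebra

text \<open>The exchange lemma is proved by elimination without denominators, which avoids the fraction
  field of \<open>S / Q\<close>.\<close>

locale twisted_prime = twisted +
  assumes one_notin: "\<one> \<notin> Q" and dom: "\<And>a b. a \<in> S \<Longrightarrow> b \<in> S \<Longrightarrow> a \<otimes> b \<in> Q \<Longrightarrow> a \<in> Q \<or> b \<in> Q"
begin

lemma pow_notin: "a \<in> S \<Longrightarrow> a \<notin> Q \<Longrightarrow> a [^] (n::nat) \<notin> Q"
proof (induction n)
  case (Suc n)
  then show ?case using dom S_pow by auto
qed (simp add: one_notin)

theorem tspan_exchange:
  assumes "finite U" "U \<subseteq> carrier R" "finite I" "v \<in> I \<rightarrow> carrier R"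
    "\<And>i. i \<in> I \<Longrightarrow> \<exists>s\<in>S - Q. s [^] (p ^ e) \<otimes> v i \<in> tspan R S (p ^ e) Q U" "card U < card I"
  shows "\<not> tindep R S (p ^ e) Q I v"
  using assms
proof (induction U arbitrary: I v rule: finite_induct)
  case empty
  obtain i where i: "i \<in> I" using empty by fastforce
  then obtain s where s: "s \<in> S - Q" "s [^] (p ^ e) \<otimes> v i \<in> Q" using empty tspan_empty by blast
  define c where "c = (\<lambda>j. if j = i then s else \<zero>)"
  have c: "c \<in> I \<rightarrow> S" using s S_zero by (auto simp: c_def)
  have vc: "v j \<in> carrier R" if "j \<in> I" for j using empty that by auto
  have "(\<Oplus>j\<in>I. c j [^] (p ^ e) \<otimes> v j) = (\<Oplus>j\<in>I. if i = j then s [^] (p ^ e) \<otimes> v j else \<zero>)"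
    using s S_carr vc by (intro finsum_cong') (auto simp: c_def)
  also have "\<dots> = s [^] (p ^ e) \<otimes> v i"
    using s S_carr vc i empty by (subst add.finprod_singleton) auto
  finally have "(\<Oplus>j\<in>I. c j [^] (p ^ e) \<otimes> v j) \<in> Q" using s by simp
  moreover have "c i \<notin> Q" using s by (simp add: c_def)
  ultimately show ?case using c i unfolding tindep_def by blast
next
  case (insert u U)
  let ?q = "p ^ e"
  have "\<exists>s c y. s \<in> S - Q \<and> c \<in> S \<and> y \<in> tspan R S ?q Q U \<and> s [^] ?q \<otimes> v i = y \<oplus> c [^] ?q \<otimes> u"
    if i: "i \<in> I" for i
  proof -
    obtain s where s: "s \<in> S - Q" "s [^] ?q \<otimes> v i \<in> tspan R S ?q Q (insert u U)"
      using insert.prems(4)[OF i] by blast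
    obtain c y where "c \<in> S" "y \<in> tspan R S ?q Q U" "s [^] ?q \<otimes> v i = y \<oplus> c [^] ?q \<otimes> u"
      by (rule tspan_insert[OF s(2) insert(4)])
    with s show ?thesis by blast
  qed
  then obtain s c y where scy: "\<And>i. i \<in> I \<Longrightarrow> s i \<in> S - Q \<and> c i \<in> S \<and> y i \<in> tspan R S ?q Q U
      \<and> s i [^] ?q \<otimes> v i = y i \<oplus> c i [^] ?q \<otimes> u" by metis
  have U: "u \<in> carrier R" "U \<subseteq> carrier R" using insert by auto
  have carr: "s i \<in> carrier R" "c i \<in> carrier R" "y i \<in> carrier R" "v i \<in> carrier R" if "i \<in> I" for i
    using scy[OF that] S_carr tspan_carrier U insert that by auto
  show ?case
  proof (cases "\<forall>i\<in>I. c i \<in> Q")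
    \<comment> \<open>All \<open>u\<close>-terms vanish modulo \<open>Q\<close>, so \<open>u\<close>
      is dropped and the family \<open>v\<close> is kept.\<close>
    case True
    have "\<exists>s\<in>S - Q. s [^] ?q \<otimes> v i \<in> tspan R S ?q Q U" if "i \<in> I" for i
    proof -
      have "c i [^] ?q \<otimes> u \<in> Q" using True that U by (auto intro: Q_rmult Q_pow)
      then have "s i [^] ?q \<otimes> v i \<in> tspan R S ?q Q U"
        using scy[OF that] U by (auto intro: tspan_add tspan.base)
      then show ?thesis using scy[OF that] by (intro bexI[of _ "s i"]) auto
    qed
    moreover have "card U < card I" using insert by auto
    ultimately show ?thesis using insert by auto
  next
    case False
    \<comment> \<open>The pivot: \<open>c j\<close>, being outside \<open>Q\<close>, eliminates
      \<open>u\<close> from every other vector. One vector and one generator are lost together, so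
      the inequality of cardinalities survives.\<close>
    then obtain j where j: "j \<in> I" "c j \<notin> Q" by auto
    define I' where "I' = I - {j}"
    have I: "I = insert j I'" "j \<notin> I'" "finite I'" using j insert by (auto simp: I'_def)
    define v' where "v' = (\<lambda>i. c j [^] ?q \<otimes> (s i [^] ?q \<otimes> v i) \<ominus> c i [^] ?q \<otimes> (s j [^] ?q \<otimes> v j))"
    have v': "v' \<in> I' \<rightarrow> carrier R" using carr I by (auto simp: v'_def)
    have "v' i \<in> tspan R S ?q Q U" if "i \<in> I'" for i
    proof -
      have i: "i \<in> I" using that I by auto
      have "v' i = c j [^] ?q \<otimes> (y i \<oplus> c i [^] ?q \<otimes> u) \<ominus> c i [^] ?q \<otimes> (y j \<oplus> c j [^] ?q \<otimes> u)"
        using scy[OF i] scy[OF j(1)] by (simp add: v'_def)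
      also have "\<dots> = c j [^] ?q \<otimes> y i \<ominus> c i [^] ?q \<otimes> y j"
        using carr[OF i] carr[OF j(1)] U by (intro cross_cancel) auto
      finally show ?thesis using scy[OF i] scy[OF j(1)] U by (auto intro: tspan_minus tspan_scale)
    qed
    then have "\<one> [^] ?q \<otimes> v' i \<in> tspan R S ?q Q U" if "i \<in> I'" for i
      using that v' by (auto simp: Pi_def)
    then have "\<exists>s\<in>S - Q. s [^] ?q \<otimes> v' i \<in> tspan R S ?q Q U" if "i \<in> I'" for i
      using that S_one one_notin by blast
    moreover have "card U < card I'" using insert I by auto
    ultimately have "\<not> tindep R S ?q Q I' v'" using insert(3)[OF U(2) I(3) v'] by auto
    then obtain a k where a: "a \<in> I' \<rightarrow> S" "(\<Oplus>i\<in>I'. a i [^] ?q \<otimes> v' i) \<in> Q" "k \<in> I'" "a k \<notin> Q"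
      unfolding tindep_def by blast
    \<comment> \<open>A relation \<open>a\<close> among the \<open>v'\<close> becomes one among the
      \<open>v\<close>. The coefficient of \<open>v j\<close> is minus a sum of \<open>q\<close>-th
      powers and must itself be a \<open>q\<close>-th power, which additivity of Frobenius
      provides.\<close>
    define b where "b = (\<lambda>i. if i = j then \<ominus> (\<Oplus>i\<in>I'. a i \<otimes> (c i \<otimes> s j)) else a i \<otimes> (c j \<otimes> s i))"
    have ac: "a i \<in> carrier R" "a i \<in> S" if "i \<in> I'" for i using a that S_carr by auto
    have ij: "i \<in> I" if "i \<in> I'" for i using that I by auto
    have b: "b \<in> I \<rightarrow> S"
      unfolding b_def using ac scy ij I by (auto intro!: S_neg S_finsum S_mult)
    have bc: "b i \<in> carrier R" if "i \<in> I" for i using b that S_carr by auto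
    have bj: "b j [^] ?q \<otimes> v j = (\<Oplus>i\<in>I'. \<ominus> (a i [^] ?q \<otimes> (c i [^] ?q \<otimes> (s j [^] ?q \<otimes> v j))))"
    proof -
      have "b j = (\<Oplus>i\<in>I'. \<ominus> (a i \<otimes> (c i \<otimes> s j)))"
        using I ac carr j(1) ij unfolding b_def by (simp add: finsum_uminus)
      also have "\<dots> [^] ?q = (\<Oplus>i\<in>I'. (\<ominus> (a i \<otimes> (c i \<otimes> s j))) [^] ?q)"
        using I ac carr j(1) ij by (intro frob_finsum) auto
      finally have "b j [^] ?q \<otimes> v j = (\<Oplus>i\<in>I'. (\<ominus> (a i \<otimes> (c i \<otimes> s j))) [^] ?q \<otimes> v j)"
        using I ac carr j(1) ij by (simp add: finsum_ldistr)
      also have "\<dots> = (\<Oplus>i\<in>I'. \<ominus> (a i [^] ?q \<otimes> (c i [^] ?q \<otimes> (s j [^] ?q \<otimes> v j))))"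
        using ac carr j(1) ij by (intro finsum_cong') (auto simp: frob_neg nat_pow_distrib l_minus m_assoc)
      finally show ?thesis .
    qed
    have "(\<Oplus>i\<in>I. b i [^] ?q \<otimes> v i) = b j [^] ?q \<otimes> v j \<oplus> (\<Oplus>i\<in>I'. b i [^] ?q \<otimes> v i)"
      using bc carr I ij unfolding I(1) by (subst finsum_insert) auto
    also have "(\<Oplus>i\<in>I'. b i [^] ?q \<otimes> v i) = (\<Oplus>i\<in>I'. a i [^] ?q \<otimes> (c j [^] ?q \<otimes> (s i [^] ?q \<otimes> v i)))"
      using I(2) ac carr j(1) ij
      by (intro finsum_cong') (auto simp: b_def nat_pow_distrib m_assoc)
    also have "b j [^] ?q \<otimes> v j \<oplus> (\<Oplus>i\<in>I'. a i [^] ?q \<otimes> (c j [^] ?q \<otimes> (s i [^] ?q \<otimes> v i)))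
        = (\<Oplus>i\<in>I'. \<ominus> (a i [^] ?q \<otimes> (c i [^] ?q \<otimes> (s j [^] ?q \<otimes> v j)))
             \<oplus> a i [^] ?q \<otimes> (c j [^] ?q \<otimes> (s i [^] ?q \<otimes> v i)))"
      unfolding bj using ac carr j(1) ij by (intro finsum_addf[symmetric]) auto
    also have "\<dots> = (\<Oplus>i\<in>I'. a i [^] ?q \<otimes> v' i)"
    proof (intro finsum_cong')
      fix i assume "i \<in> I'"
      then show "\<ominus> (a i [^] ?q \<otimes> (c i [^] ?q \<otimes> (s j [^] ?q \<otimes> v j)))
             \<oplus> a i [^] ?q \<otimes> (c j [^] ?q \<otimes> (s i [^] ?q \<otimes> v i)) = a i [^] ?q \<otimes> v' i"
        using ac carr carr[OF j(1)] ij unfolding v'_def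
        by (simp add: minus_eq r_distr r_minus a_comm)
    qed (use ac v' in auto)
    finally have "(\<Oplus>i\<in>I. b i [^] ?q \<otimes> v i) \<in> Q" using a by simp
    \<comment> \<open>\<open>b k\<close> is the product of \<open>a k\<close>, \<open>c j\<close>
      and \<open>s k\<close>, all in \<open>S\<close> and outside \<open>Q\<close>.\<close>
    moreover have "b k \<notin> Q"
    proof
      assume "b k \<in> Q"
      then have "a k \<otimes> (c j \<otimes> s k) \<in> Q" using a I by (auto simp: b_def split: if_splits)
      then show False using dom a ac scy ij j S_mult
        by (metis Diff_iff)
    qed
    ultimately show ?thesis using b a ij unfolding tindep_def by blast
  qed
qed

end

section \<open>Finite sums over initial segments of the natural numbers\<close>

context cring
begin

lemma finsum_lessThan_Suc:
  "f \<in> {..<Suc n} \<rightarrow> carrier R \<Longrightarrow> (\<Oplus>i\<in>{..<Suc n}. f i) = f n \<oplus> (\<Oplus>i\<in>{..<n}. f i)"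
  unfolding lessThan_Suc by (subst finsum_insert) auto

lemma finsum_lessThan_Suc_shift:
  "f \<in> {..<Suc n} \<rightarrow> carrier R \<Longrightarrow> (\<Oplus>i\<in>{..<Suc n}. f i) = f 0 \<oplus> (\<Oplus>i\<in>{..<n}. f (Suc i))"
proof (induction n)
  case 0
  then show ?case by (subst finsum_lessThan_Suc) auto
next
  case (Suc n)
  have c: "f i \<in> carrier R" if "i < Suc (Suc n)" for i using Suc.prems that by auto
  have "(\<Oplus>i\<in>{..<Suc (Suc n)}. f i) = f (Suc n) \<oplus> (f 0 \<oplus> (\<Oplus>i\<in>{..<n}. f (Suc i)))"
    using Suc c by (subst finsum_lessThan_Suc) auto
  also have "\<dots> = f 0 \<oplus> (f (Suc n) \<oplus> (\<Oplus>i\<in>{..<n}. f (Suc i)))"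
    using c by (intro a_lcomm finsum_closed) auto
  also have "f (Suc n) \<oplus> (\<Oplus>i\<in>{..<n}. f (Suc i)) = (\<Oplus>i\<in>{..<Suc n}. f (Suc i))"
    using c by (subst finsum_lessThan_Suc) auto
  finally show ?case .
qed

text \<open>Families indexed by pairs are coded by one number, with \<open>div\<close> and
  \<open>mod\<close> as coordinates; their sums are unfolded into double sums here.\<close>

lemma finsum_group:
  fixes a b :: nat
  assumes "f \<in> {..<b * a} \<rightarrow> carrier R"
  shows "(\<Oplus>i\<in>{..<b * a}. f i) = (\<Oplus>l\<in>{..<b}. \<Oplus>j\<in>{..<a}. f (l * a + j))"
  using assms
proof (induct b)
  case (Suc b)
  have c: "f i \<in> carrier R" if "i < Suc b * a" for i using Suc.prems that by auto
  have lt: "l * a + j < Suc b * a" if "l < Suc b" "j < a" for l j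
  proof -
    have "l * a + j < Suc l * a" using that by simp
    also have "\<dots> \<le> Suc b * a" using that by (intro mult_le_mono1) auto
    finally show ?thesis .
  qed
  have split: "{..<Suc b * a} = {..<b * a} \<union> (\<lambda>j. b * a + j) ` {..<a}"
  proof (intro equalityI subsetI)
    fix i assume i: "i \<in> {..<Suc b * a}"
    show "i \<in> {..<b * a} \<union> (\<lambda>j. b * a + j) ` {..<a}"
    proof (cases "i < b * a")
      case False
      then have "i = b * a + (i - b * a)" "i - b * a < a" using i by auto
      then show ?thesis by blast
    qed simp
  qed auto
  have "(\<Oplus>i\<in>{..<Suc b * a}. f i) = (\<Oplus>i\<in>{..<b * a}. f i) \<oplus> (\<Oplus>i\<in>(\<lambda>j. b * a + j) ` {..<a}. f i)"
    unfolding split using c by (intro finsum_Un_disjoint) auto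
  also have "(\<Oplus>i\<in>(\<lambda>j. b * a + j) ` {..<a}. f i) = (\<Oplus>j\<in>{..<a}. f (b * a + j))"
    using c by (intro finsum_reindex) (auto simp: inj_on_def)
  also have "(\<Oplus>i\<in>{..<b * a}. f i) = (\<Oplus>l\<in>{..<b}. \<Oplus>j\<in>{..<a}. f (l * a + j))"
    using c by (intro Suc.hyps) auto
  also have "\<dots> \<oplus> (\<Oplus>j\<in>{..<a}. f (b * a + j)) = (\<Oplus>j\<in>{..<a}. f (b * a + j)) \<oplus> \<dots>"
    using c lt by (intro a_comm finsum_closed) auto
  also have "\<dots> = (\<Oplus>l\<in>{..<Suc b}. \<Oplus>j\<in>{..<a}. f (l * a + j))"
    using c lt by (subst finsum_lessThan_Suc) (auto intro!: finsum_closed)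
  finally show ?case .
qed simp

end

context char_p_ring
begin

lemma twistedI: "ideal Q R \<Longrightarrow> subring S R \<Longrightarrow> twisted R p S Q"
  by (intro twisted.intro char_p_ring_axioms twisted_axioms.intro)

lemma twisted_primeI:
  assumes "primeideal Q R" "subring S R"
  shows "twisted_prime R p S Q"
proof -
  have Q: "ideal Q R" using assms(1) by (simp add: primeideal_def)
  have "\<one> \<notin> Q"
    using ideal.one_imp_carrier[OF Q] primeideal.I_notcarr[OF assms(1)] by metis
  moreover have "a \<in> Q \<or> b \<in> Q" if "a \<in> S" "b \<in> S" "a \<otimes> b \<in> Q" for a b
    using primeideal.I_prime[OF assms(1)] that subringE(1)[OF assms(2)] by blast
  ultimately show ?thesis
    by (intro twisted_prime.intro twistedI Q assms(2) twisted_prime_axioms.intro) blast+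
qed

end

section \<open>The \<open>p\<close>-rank\<close>

definition pind :: "('a, 'm) ring_scheme \<Rightarrow> nat \<Rightarrow> 'a set \<Rightarrow> 'a set \<Rightarrow> nat \<Rightarrow> bool" where
  "pind R p S Q n \<longleftrightarrow> (\<exists>v \<in> {..<n} \<rightarrow> S. tindep R S p Q {..<n} v)"

definition pbounded :: "('a, 'm) ring_scheme \<Rightarrow> nat \<Rightarrow> 'a set \<Rightarrow> 'a set \<Rightarrow> bool" where
  "pbounded R p S Q \<longleftrightarrow> (\<exists>N. \<forall>n. pind R p S Q n \<longrightarrow> n \<le> N)"

text \<open>Denominators outside \<open>Q\<close> are allowed: the fraction field k of
  \<open>S\<close> modulo \<open>Q\<close> lies in the k^p-span of \<open>U\<close>.\<close>

definition pspans :: "('a, 'm) ring_scheme \<Rightarrow> nat \<Rightarrow> 'a set \<Rightarrow> 'a set \<Rightarrow> 'a set \<Rightarrow> bool" where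
  "pspans R p S Q U \<longleftrightarrow> (\<forall>z\<in>S. \<exists>s\<in>S - Q. s [^]\<^bsub>R\<^esub> p \<otimes>\<^bsub>R\<^esub> z \<in> tspan R S p Q U)"

lemma (in twisted) Q_cancel2: "w \<oplus> x \<in> Q \<Longrightarrow> w \<in> Q \<Longrightarrow> x \<in> carrier R \<Longrightarrow> x \<in> Q"
  using Q_cancel[of x w] Q_carr[of w] by (simp add: a_comm)

context twisted_prime
begin

lemma pspans_card:
  assumes "pspans R p S Q U" "finite U" "U \<subseteq> carrier R" "pind R p S Q n"
  shows "n \<le> card U"
proof (rule ccontr)
  assume "\<not> n \<le> card U"
  obtain v where v: "v \<in> {..<n} \<rightarrow> S" "tindep R S p Q {..<n} v"
    using assms(4) unfolding pind_def by blast
  have vc: "v \<in> {..<n} \<rightarrow> carrier R" using v S_carr by auto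
  have "\<exists>s\<in>S - Q. s [^] p \<otimes> v i \<in> tspan R S p Q U" if "i \<in> {..<n}" for i
    using assms(1) v that unfolding pspans_def by blast
  then have "\<not> tindep R S p Q {..<n} v"
    using tspan_exchange[of U "{..<n}" v 1] assms vc \<open>\<not> n \<le> card U\<close> by simp
  then show False using v by simp
qed

text \<open>A relation among \<open>v\<close> and \<open>z\<close> must have a coefficient outside
  \<open>Q\<close> at \<open>z\<close>, as \<open>v\<close> alone is independent; this coefficient
  is the denominator with which \<open>z\<close> is expanded.\<close>

lemma tindep_maximal_spans:
  assumes "v \<in> {..<n} \<rightarrow> S" "tindep R S p Q {..<n} v" "\<not> pind R p S Q (Suc n)"
  shows "pspans R p S Q (v ` {..<n})"
  unfolding pspans_def
proof
  fix z assume z: "z \<in> S"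
  define w where "w = v(n := z)"
  have w: "w \<in> {..<Suc n} \<rightarrow> S" using assms(1) z by (auto simp: w_def Pi_def less_Suc_eq)
  have "\<not> tindep R S p Q {..<Suc n} w" using assms(3) w unfolding pind_def by blast
  then obtain c where c: "c \<in> {..<Suc n} \<rightarrow> S" "(\<Oplus>i\<in>{..<Suc n}. c i [^] p \<otimes> w i) \<in> Q"
      "\<exists>i\<in>{..<Suc n}. c i \<notin> Q"
    unfolding tindep_def by blast
  have vS: "v i \<in> carrier R" "v i \<in> S" "c i \<in> S" "c i \<in> carrier R" if "i < n" for i
    using that assms(1) c(1) S_carr[of "c i"] S_carr[of "v i"] by (auto simp: Pi_def)
  have cn: "c n \<in> S" "c n \<in> carrier R" using c(1) S_carr by auto
  have "(\<Oplus>i\<in>{..<Suc n}. c i [^] p \<otimes> w i) = c n [^] p \<otimes> w n \<oplus> (\<Oplus>i\<in>{..<n}. c i [^] p \<otimes> w i)"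
    using c w S_carr by (subst finsum_lessThan_Suc) (auto simp: Pi_def)
  also have "(\<Oplus>i\<in>{..<n}. c i [^] p \<otimes> w i) = (\<Oplus>i\<in>{..<n}. c i [^] p \<otimes> v i)"
    using vS by (intro finsum_cong') (auto simp: w_def)
  finally have eq: "c n [^] p \<otimes> z \<oplus> (\<Oplus>i\<in>{..<n}. c i [^] p \<otimes> v i) \<in> Q"
    using c(2) by (simp add: w_def)
  have sumS: "(\<Oplus>i\<in>{..<n}. c i [^] p \<otimes> v i) \<in> carrier R"
    using vS by (intro finsum_closed) auto
  have zc: "z \<in> carrier R" using z S_carr by auto
  have "c n \<notin> Q"
  proof
    assume "c n \<in> Q"
    then have cz: "c n [^] p \<otimes> z \<in> Q" using zc Q_pow[of "c n" 1] by (auto intro: Q_rmult)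
    have "(\<Oplus>i\<in>{..<n}. c i [^] p \<otimes> v i) \<in> Q"
      by (rule Q_cancel2[OF eq cz sumS])
    moreover have "c \<in> {..<n} \<rightarrow> S" using c(1) by (auto simp: Pi_def)
    ultimately have "\<forall>i\<in>{..<n}. c i \<in> Q" using assms(2) unfolding tindep_def by blast
    then show False using c(3) \<open>c n \<in> Q\<close> by (auto simp: less_Suc_eq)
  qed
  have sub: "v ` {..<n} \<subseteq> carrier R" using vS by auto
  have "(\<Oplus>i\<in>{..<n}. c i [^] p \<otimes> v i) \<in> tspan R S p Q (v ` {..<n})"
    using vS sub by (intro tspan_finsum tspan_term) auto
  then have "\<ominus> (\<Oplus>i\<in>{..<n}. c i [^] p \<otimes> v i) \<in> tspan R S p Q (v ` {..<n})"
    using tspan_neg[of _ 1] sub by simp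
  then have "(c n [^] p \<otimes> z \<oplus> (\<Oplus>i\<in>{..<n}. c i [^] p \<otimes> v i)) \<oplus> \<ominus> (\<Oplus>i\<in>{..<n}. c i [^] p \<otimes> v i)
      \<in> tspan R S p Q (v ` {..<n})"
    by (rule tspan_add[OF tspan.base[OF eq] _ sub])
  then have "c n [^] p \<otimes> z \<in> tspan R S p Q (v ` {..<n})"
    using sumS zc cn by (simp add: a_assoc r_neg)
  then show "\<exists>s\<in>S - Q. s [^] p \<otimes> z \<in> tspan R S p Q (v ` {..<n})"
    using \<open>c n \<notin> Q\<close> cn by blast
qed

lemma pbounded_basis:
  assumes "pbounded R p S Q"
  obtains n v where "v \<in> {..<n} \<rightarrow> S" "tindep R S p Q {..<n} v" "pspans R p S Q (v ` {..<n})"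
    "\<And>m. pind R p S Q m \<Longrightarrow> m \<le> n"
proof -
  obtain N where N: "\<forall>n. pind R p S Q n \<longrightarrow> n \<le> N" using assms unfolding pbounded_def by blast
  have p0: "pind R p S Q 0" by (auto simp: pind_def tindep_def)
  define n where "n = (GREATEST n. pind R p S Q n)"
  have n: "pind R p S Q n" unfolding n_def using p0 N GreatestI_nat[of "pind R p S Q" 0 N] by blast
  have le: "m \<le> n" if "pind R p S Q m" for m
    unfolding n_def using that N Greatest_le_nat[of "pind R p S Q" m N] by blast
  obtain v where v: "v \<in> {..<n} \<rightarrow> S" "tindep R S p Q {..<n} v"
    using n unfolding pind_def by blast
  have "\<not> pind R p S Q (Suc n)" using le[of "Suc n"] by auto
  then show thesis using that v le tindep_maximal_spans[OF v] by blast
qed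

end

lemma (in char_p_ring) pbounded_carrier:
  assumes "primeideal Q R" "finite H" "H \<subseteq> carrier R"
    "\<And>x. x \<in> carrier R \<Longrightarrow> x \<in> tspan R (carrier R) p {\<zero>} H"
  shows "pbounded R p (carrier R) Q"
proof -
  interpret T: twisted_prime R p "carrier R" Q by (rule twisted_primeI[OF assms(1) carrier_is_subring])
  have "tspan R (carrier R) p {\<zero>} H \<subseteq> tspan R (carrier R) p Q H"
    using T.Q_zero by (intro tspan_mono) auto
  then have "\<one> [^] p \<otimes> z \<in> tspan R (carrier R) p Q H" if "z \<in> carrier R" for z
    using that assms(4) by auto
  then have "pspans R p (carrier R) Q H"
    unfolding pspans_def using T.one_notin by blast
  then show ?thesis unfolding pbounded_def using T.pspans_card[OF _ assms(2,3)] by blast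
qed

subsection \<open>Descending boundedness along a ring generator\<close>

text \<open>Values at \<open>y\<close> of polynomials over \<open>S\<close> of degree less than
  \<open>d\<close>, in Horner form. This form exposes the constant coefficient, which the
  transcendental case strips off.\<close>

primrec adjoin_deg :: "('a, 'm) ring_scheme \<Rightarrow> 'a set \<Rightarrow> 'a \<Rightarrow> nat \<Rightarrow> 'a set" where
  "adjoin_deg R S y 0 = {\<zero>\<^bsub>R\<^esub>}"
| "adjoin_deg R S y (Suc d) = {a \<oplus>\<^bsub>R\<^esub> y \<otimes>\<^bsub>R\<^esub> b | a b. a \<in> S \<and> b \<in> adjoin_deg R S y d}"

definition adjoin :: "('a, 'm) ring_scheme \<Rightarrow> 'a set \<Rightarrow> 'a \<Rightarrow> 'a set" where
  "adjoin R S y = (\<Union>d. adjoin_deg R S y d)"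

section \<open>The subring generated by a subring and one more element\<close>

locale adjunction = cring R for R (structure) +
  fixes S y assumes subS: "subring S R" and y_carr [simp]: "y \<in> carrier R"
begin

lemma Sc: "a \<in> S \<Longrightarrow> a \<in> carrier R" using subringE(1)[OF subS] by auto

lemma adjoin_deg_SucI: "a \<in> S \<Longrightarrow> b \<in> adjoin_deg R S y d \<Longrightarrow> a \<oplus> y \<otimes> b \<in> adjoin_deg R S y (Suc d)"
  by auto

lemma adjoin_deg_carr: "b \<in> adjoin_deg R S y d \<Longrightarrow> b \<in> carrier R"
  by (induction d arbitrary: b) (auto simp: Sc)

lemma adjoin_deg_zero: "\<zero> \<in> adjoin_deg R S y d"
proof (induction d)
  case (Suc d)
  show ?case using adjoin_deg_SucI[of \<zero> \<zero> d] Suc subringE(2)[OF subS] by simp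
qed simp

lemma adjoin_deg_Suc: "b \<in> adjoin_deg R S y d \<Longrightarrow> b \<in> adjoin_deg R S y (Suc d)"
proof (induction d arbitrary: b)
  case 0
  then show ?case using adjoin_deg_zero[of 1] by simp
next
  case (Suc d)
  obtain a b' where "a \<in> S" "b' \<in> adjoin_deg R S y d" "b = a \<oplus> y \<otimes> b'" using Suc.prems by auto
  then show ?case using Suc.IH[of b'] by (subst adjoin_deg.simps(2)) blast
qed

lemma adjoin_deg_mono: "d \<le> e \<Longrightarrow> adjoin_deg R S y d \<subseteq> adjoin_deg R S y e"
  by (induction e rule: dec_induct) (use adjoin_deg_Suc in blast)+

lemma adjoin_deg_add:
  "b \<in> adjoin_deg R S y d \<Longrightarrow> c \<in> adjoin_deg R S y d \<Longrightarrow> b \<oplus> c \<in> adjoin_deg R S y d"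
proof (induction d arbitrary: b c)
  case (Suc d)
  obtain a b' where b: "a \<in> S" "b' \<in> adjoin_deg R S y d" "b = a \<oplus> y \<otimes> b'" using Suc.prems(1) by auto
  obtain a' c' where c: "a' \<in> S" "c' \<in> adjoin_deg R S y d" "c = a' \<oplus> y \<otimes> c'" using Suc.prems(2) by auto
  have "b \<oplus> c = (a \<oplus> a') \<oplus> y \<otimes> (b' \<oplus> c')"
    using b c Sc adjoin_deg_carr by (simp add: r_distr a_ac)
  then show ?case using Suc.IH[OF b(2) c(2)] b c subringE(7)[OF subS] by auto
qed simp

lemma adjoin_deg_y: "b \<in> adjoin_deg R S y d \<Longrightarrow> y \<otimes> b \<in> adjoin_deg R S y (Suc d)"
  using adjoin_deg_SucI[of \<zero> b d] adjoin_deg_carr[of b d] subringE(2)[OF subS] by simp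

lemma adjoin_deg_S: "a \<in> S \<Longrightarrow> a \<in> adjoin_deg R S y (Suc d)"
  using adjoin_deg_SucI[of a \<zero> d] adjoin_deg_zero[of d] Sc by simp

lemma adjoin_deg_scale: "a \<in> S \<Longrightarrow> b \<in> adjoin_deg R S y d \<Longrightarrow> a \<otimes> b \<in> adjoin_deg R S y d"
proof (induction d arbitrary: b)
  case 0
  then show ?case using Sc by simp
next
  case (Suc d)
  obtain a' b' where b: "a' \<in> S" "b' \<in> adjoin_deg R S y d" "b = a' \<oplus> y \<otimes> b'" using Suc.prems by auto
  have "a \<otimes> b = a \<otimes> a' \<oplus> y \<otimes> (a \<otimes> b')"
    using b Suc.prems(1) Sc adjoin_deg_carr by (simp add: r_distr m_ac)
  then show ?case using Suc.IH[OF Suc.prems(1) b(2)] b Suc.prems(1) subringE(6)[OF subS] by auto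
qed

lemma adjoin_deg_mult:
  "b \<in> adjoin_deg R S y d \<Longrightarrow> c \<in> adjoin_deg R S y e \<Longrightarrow> b \<otimes> c \<in> adjoin_deg R S y (d + e)"
proof (induction d arbitrary: b)
  case 0
  then show ?case using adjoin_deg_carr[of c] adjoin_deg_zero by simp
next
  case (Suc d)
  obtain a b' where b: "a \<in> S" "b' \<in> adjoin_deg R S y d" "b = a \<oplus> y \<otimes> b'" using Suc.prems(1) by auto
  have carr: "a \<in> carrier R" "b' \<in> carrier R" "c \<in> carrier R"
    using b Sc adjoin_deg_carr Suc.prems(2) by auto
  have "b \<otimes> c = a \<otimes> c \<oplus> y \<otimes> (b' \<otimes> c)"
    using carr by (simp add: b(3) l_distr m_assoc)
  moreover have "a \<otimes> c \<in> adjoin_deg R S y (Suc d + e)"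
    using adjoin_deg_scale[OF b(1) Suc.prems(2)] adjoin_deg_mono[of e "Suc d + e"] by auto
  moreover have "y \<otimes> (b' \<otimes> c) \<in> adjoin_deg R S y (Suc d + e)"
    using adjoin_deg_y[OF Suc.IH[OF b(2) Suc.prems(2)]] by simp
  ultimately show ?case using adjoin_deg_add[of _ "Suc d + e"] by metis
qed

text \<open>The recursion gives access to the constant term only; the algebraic case has to strip
  off the term of highest degree.\<close>

lemma adjoin_deg_top:
  assumes "b \<in> adjoin_deg R S y (Suc d)"
  shows "\<exists>b'\<in>adjoin_deg R S y d. \<exists>t\<in>S. b = b' \<oplus> t \<otimes> y [^] d"
  using assms
proof (induction d arbitrary: b)
  case 0
  then show ?case using Sc by auto
next
  case (Suc d)
  obtain a b1 where b: "a \<in> S" "b1 \<in> adjoin_deg R S y (Suc d)" "b = a \<oplus> y \<otimes> b1"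
    using Suc.prems by auto
  obtain b' t where bt: "b' \<in> adjoin_deg R S y d" "t \<in> S" "b1 = b' \<oplus> t \<otimes> y [^] d"
    using Suc.IH[OF b(2)] by blast
  have carr: "a \<in> carrier R" "b' \<in> carrier R" "t \<in> carrier R" "y [^] d \<in> carrier R"
    using b bt Sc adjoin_deg_carr by auto
  have "b = (a \<oplus> y \<otimes> b') \<oplus> t \<otimes> y [^] Suc d"
    using carr by (simp add: b(3) bt(3) r_distr a_assoc m_ac)
  then show ?case using b bt by auto
qed

lemma subring_adjoin: "subring (adjoin R S y) R"
proof (rule subringI)
  show "adjoin R S y \<subseteq> carrier R" using adjoin_deg_carr by (auto simp: adjoin_def)
  show "\<one> \<in> adjoin R S y" using adjoin_deg_S[of \<one>] subringE(3)[OF subS] unfolding adjoin_def by blast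
next
  fix b c assume "b \<in> adjoin R S y" "c \<in> adjoin R S y"
  then obtain d e where de: "b \<in> adjoin_deg R S y d" "c \<in> adjoin_deg R S y e" by (auto simp: adjoin_def)
  then show "b \<otimes> c \<in> adjoin R S y" using adjoin_deg_mult[OF de] unfolding adjoin_def by blast
  have "b \<in> adjoin_deg R S y (max d e)" "c \<in> adjoin_deg R S y (max d e)"
    using de adjoin_deg_mono[of d "max d e"] adjoin_deg_mono[of e "max d e"] by auto
  then have "b \<oplus> c \<in> adjoin_deg R S y (max d e)" by (rule adjoin_deg_add)
  then show "b \<oplus> c \<in> adjoin R S y" by (auto simp: adjoin_def)
next
  fix b assume "b \<in> adjoin R S y"
  then obtain d where d: "b \<in> adjoin_deg R S y d" by (auto simp: adjoin_def)
  have "\<ominus> \<one> \<in> S" using subringE(3,5)[OF subS] by blast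
  from adjoin_deg_scale[OF this d] have "\<ominus> b \<in> adjoin_deg R S y d"
    using adjoin_deg_carr[OF d] by (simp add: l_minus)
  then show "\<ominus> b \<in> adjoin R S y" by (auto simp: adjoin_def)
qed

lemma adjoin_incl: "S \<subseteq> adjoin R S y" "y \<in> adjoin R S y"
proof -
  show "S \<subseteq> adjoin R S y" using adjoin_deg_S unfolding adjoin_def by blast
  have "y \<otimes> \<one> \<in> adjoin_deg R S y 2"
    using adjoin_deg_y[OF adjoin_deg_S[of \<one> 0]] subringE(3)[OF subS] by (simp add: numeral_2_eq_2)
  then show "y \<in> adjoin R S y" by (auto simp: adjoin_def)
qed

end

locale twisted_adjunction = twisted_prime R p S Q + adjunction R S y
  for R (structure) and p S Q y +
  assumes prime_Q: "primeideal Q R"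
begin

lemma Q_prime: "a \<in> carrier R \<Longrightarrow> b \<in> carrier R \<Longrightarrow> a \<otimes> b \<in> Q \<Longrightarrow> a \<in> Q \<or> b \<in> Q"
  using primeideal.I_prime[OF prime_Q] by blast

text \<open>In this case \<open>y\<close> behaves like a variable: the constant coefficient of a relation lies in \<open>Q\<close>.\<close>

lemma pind_adjoin_transcendental:
  assumes T: "\<And>a b. a \<in> S \<Longrightarrow> b \<in> adjoin R S y \<Longrightarrow> a \<oplus> y \<otimes> b \<in> Q \<Longrightarrow> a \<in> Q"
    and "pind R p S Q n"
  shows "pind R p (adjoin R S y) Q n"
proof -
  interpret B: twisted R p "adjoin R S y" Q
    by (rule twistedI[OF ideal_Q subring_adjoin])
  obtain v where v: "v \<in> {..<n} \<rightarrow> S" "tindep R S p Q {..<n} v"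
    using assms(2) unfolding pind_def by blast
  have vc: "v j \<in> carrier R" "v j \<in> adjoin R S y" if "j < n" for j
    using v that S_carr adjoin_incl by auto
  \<comment> \<open>Induction on the degree in \<open>y\<close> of the coefficients
    \<open>c j\<close>: their constant terms \<open>a j\<close> and the remainders
    \<open>b j\<close> give separate relations.\<close>
  have main: "\<forall>j\<in>{..<n}. c j \<in> Q" if "c \<in> {..<n} \<rightarrow> adjoin_deg R S y d"
      "(\<Oplus>j\<in>{..<n}. c j [^] p \<otimes> v j) \<in> Q" for d c
    using that
  proof (induction d arbitrary: c)
    case 0
    then show ?case using Q_zero by (auto simp: Pi_def)
  next
    case (Suc d)
    have "\<forall>j\<in>{..<n}. \<exists>a. a \<in> S \<and> (\<exists>b. b \<in> adjoin_deg R S y d \<and> c j = a \<oplus> y \<otimes> b)"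
      using Suc.prems(1) by fastforce
    then obtain a where a: "\<forall>j\<in>{..<n}. a j \<in> S \<and> (\<exists>b. b \<in> adjoin_deg R S y d \<and> c j = a j \<oplus> y \<otimes> b)"
      by (rule bchoice[THEN exE])
    then have "\<forall>j\<in>{..<n}. \<exists>b. b \<in> adjoin_deg R S y d \<and> c j = a j \<oplus> y \<otimes> b" by blast
    then obtain b where b: "\<forall>j\<in>{..<n}. b j \<in> adjoin_deg R S y d \<and> c j = a j \<oplus> y \<otimes> b j"
      by (rule bchoice[THEN exE])
    have carr: "a j \<in> carrier R" "b j \<in> carrier R" "a j \<in> S" "b j \<in> adjoin R S y" if "j < n" for j
      using a b that S_carr adjoin_deg_carr[of "b j" d] by (auto simp: adjoin_def)
    define A where "A = (\<Oplus>j\<in>{..<n}. a j [^] p \<otimes> v j)"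
    define C where "C = (\<Oplus>j\<in>{..<n}. b j [^] p \<otimes> v j)"
    have AC: "A \<in> carrier R" "C \<in> carrier R"
      unfolding A_def C_def using carr vc by (auto intro!: finsum_closed)
    have AS: "A \<in> S" unfolding A_def using carr v by (intro S_finsum) (auto intro!: S_mult S_pow)
    have CB: "C \<in> adjoin R S y" unfolding C_def using carr vc
      by (intro B.S_finsum) (auto intro!: B.S_mult B.S_pow)
    have "(\<Oplus>j\<in>{..<n}. c j [^] p \<otimes> v j) = (\<Oplus>j\<in>{..<n}. a j [^] p \<otimes> v j \<oplus> y [^] p \<otimes> (b j [^] p \<otimes> v j))"
      using carr vc b by (intro finsum_cong') (auto simp: frob_add1 nat_pow_distrib l_distr m_assoc)
    also have "\<dots> = A \<oplus> y [^] p \<otimes> C"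
      unfolding A_def C_def using carr vc
      by (subst finsum_addf) (auto simp: finsum_rdistr)
    finally have eq: "A \<oplus> y [^] p \<otimes> C \<in> Q" using Suc.prems(2) by simp
    \<comment> \<open>One factor \<open>y\<close> is pulled out of \<open>y [^] p\<close>, so that
      the hypothesis on constant coefficients applies to \<open>A\<close>.\<close>
    obtain r where r: "p = Suc r" using p_pos gr0_implies_Suc by blast
    have "y [^] p \<otimes> C = y \<otimes> (y [^] r \<otimes> C)" using AC by (simp add: r m_ac)
    then have "A \<in> Q"
      using T[OF AS, of "y [^] r \<otimes> C"] eq adjoin_incl(2) CB B.S_mult B.S_pow by simp
    then have aQ: "\<forall>j\<in>{..<n}. a j \<in> Q"
      using v(2) carr unfolding tindep_def A_def by auto
    have "y [^] p \<otimes> C \<in> Q"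
      using eq AC \<open>A \<in> Q\<close> by (intro Q_cancel2[OF eq]) auto
    \<comment> \<open>If \<open>y\<close> lies in \<open>Q\<close> it cannot be cancelled, but then
      the products \<open>y \<otimes> b j\<close> lie in \<open>Q\<close> at once, and only these
      are required.\<close>
    have yb: "\<forall>j\<in>{..<n}. y \<otimes> b j \<in> Q"
    proof (cases "y \<in> Q")
      case True
      then show ?thesis using carr by (auto intro: Q_rmult)
    next
      case False
      have "C \<in> Q"
      proof -
        have "y [^] k \<notin> Q" for k :: nat
        proof (induction k)
          case (Suc k)
          then show ?case using False Q_prime[of "y [^] k" y] by auto
        qed (use one_notin in simp)
        then show ?thesis using Q_prime[OF _ AC(2) \<open>y [^] p \<otimes> C \<in> Q\<close>] by auto
      qed
      then have "\<forall>j\<in>{..<n}. b j \<in> Q" using b by (intro Suc.IH) (auto simp: C_def)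
      then show ?thesis by (auto intro: Q_lmult)
    qed
    show ?case using aQ yb b by (auto intro: Q_add)
  qed
  have "tindep R (adjoin R S y) p Q {..<n} v"
    unfolding tindep_def
  proof (intro ballI impI)
    fix c i assume c: "c \<in> {..<n} \<rightarrow> adjoin R S y" "(\<Oplus>j\<in>{..<n}. c j [^] p \<otimes> v j) \<in> Q" and i: "i \<in> {..<n}"
    have "\<forall>j\<in>{..<n}. \<exists>d. c j \<in> adjoin_deg R S y d" using c(1) by (auto simp: adjoin_def)
    then obtain d where d: "\<forall>j\<in>{..<n}. c j \<in> adjoin_deg R S y (d j)" by (rule bchoice[THEN exE])
    define D where "D = Max (insert 0 (d ` {..<n}))"
    have "c j \<in> adjoin_deg R S y D" if "j < n" for j
    proof -
      have "d j \<le> D" unfolding D_def using that by (intro Max_ge) auto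
      then show ?thesis using d that adjoin_deg_mono by blast
    qed
    then show "c i \<in> Q" using main[of c D] c(2) i by auto
  qed
  then show ?thesis using v(1) vc unfolding pind_def by auto
qed

text \<open>Among the relations with constant coefficient outside \<open>Q\<close>, one of least
  degree has its top coefficient \<open>t\<close> outside \<open>Q\<close>, since otherwise the top
  term could be omitted. Up to the factor \<open>t\<close>, the power \<open>y [^] d\<close> is then
  a combination of lower powers, and every further degree costs one more factor
  \<open>t\<close>.\<close>

lemma adjoin_algebraic:
  assumes "a0 \<in> S" "b0 \<in> adjoin R S y" "a0 \<oplus> y \<otimes> b0 \<in> Q" "a0 \<notin> Q"
  obtains d where "\<And>b. b \<in> adjoin R S y \<Longrightarrow>
    \<exists>s\<in>S - Q. s \<otimes> b \<in> tspan R S 1 Q ((\<lambda>i. y [^] i) ` {..<d::nat})"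
proof -
  define rel where "rel = (\<lambda>d. \<exists>a\<in>S - Q. \<exists>b\<in>adjoin_deg R S y d. a \<oplus> y \<otimes> b \<in> Q)"
  have "\<exists>d. rel d" using assms unfolding rel_def adjoin_def by blast
  define d where "d = (LEAST d. rel d)"
  have reld: "rel d" unfolding d_def using \<open>\<exists>d. rel d\<close> by (rule LeastI_ex)
  have least: "\<not> rel e" if "e < d" for e using that not_less_Least unfolding d_def by blast
  obtain a b where ab: "a \<in> S" "a \<notin> Q" "b \<in> adjoin_deg R S y d" "a \<oplus> y \<otimes> b \<in> Q"
    using reld unfolding rel_def by blast
  have ac: "a \<in> carrier R" using ab S_carr by auto
  have "d \<noteq> 0"
  proof
    assume "d = 0" then have "b = \<zero>" using ab by simp
    then show False using ab ac by simp
  qed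
  then obtain d' where d': "d = Suc d'" using not0_implies_Suc by blast
  obtain b' t where bt: "b' \<in> adjoin_deg R S y d'" "t \<in> S" "b = b' \<oplus> t \<otimes> y [^] d'"
    using adjoin_deg_top[of b d'] ab(3) d' by blast
  have carr: "b' \<in> carrier R" "t \<in> carrier R" using bt S_carr adjoin_deg_carr by auto
  have eq: "(a \<oplus> y \<otimes> b') \<oplus> t \<otimes> y [^] d \<in> Q"
    using ab(4) carr ac by (simp add: bt(3) d' r_distr a_assoc m_ac)
  have "t \<notin> Q"
  proof
    assume "t \<in> Q"
    then have "t \<otimes> y [^] d \<in> Q" by (auto intro: Q_rmult)
    then have "a \<oplus> y \<otimes> b' \<in> Q" using eq carr ac by (intro Q_cancel[OF eq]) auto
    then have "rel d'" unfolding rel_def using ab bt by blast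
    then show False using least[of d'] d' by simp
  qed
  define M where "M = tspan R S 1 Q ((\<lambda>i. y [^] i) ` {..<d})"
  have sub: "(\<lambda>i. y [^] i) ` {..<d} \<subseteq> carrier R" by auto
  have Mpow: "y [^] i \<in> M" if "i < d" for i unfolding M_def using that sub by (intro tspan_incl) auto
  have Mscale: "c \<otimes> x \<in> M" if "c \<in> S" "x \<in> M" for c x
    using tspan_scale[of x 1 _ c] that sub S_carr unfolding M_def by simp
  have Madd: "x \<oplus> z \<in> M" if "x \<in> M" "z \<in> M" for x z using that tspan_add sub unfolding M_def by blast
  have Mcarr: "x \<in> carrier R" if "x \<in> M" for x using that tspan_carrier sub unfolding M_def by blast
  have Mdeg: "x \<in> M" if "x \<in> adjoin_deg R S y e" "e \<le> d" for e x
    using that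
  proof (induction e arbitrary: x)
    case 0
    then show ?case using tspan_zero by (simp add: M_def)
  next
    case (Suc e)
    obtain x' s where "x' \<in> adjoin_deg R S y e" "s \<in> S" "x = x' \<oplus> s \<otimes> y [^] e"
      using adjoin_deg_top[OF Suc.prems(1)] by blast
    then show ?case using Suc.IH[of x'] Suc.prems Mpow[of e] by (auto intro!: Madd Mscale)
  qed
  have "a \<oplus> y \<otimes> b' \<in> M" by (rule Mdeg[of _ d]) (use ab bt d' in auto)
  then have "\<ominus> (a \<oplus> y \<otimes> b') \<in> M" unfolding M_def using tspan_neg[of _ 0] sub by simp
  moreover have "(a \<oplus> y \<otimes> b') \<oplus> t \<otimes> y [^] d \<in> M" unfolding M_def using eq by (rule tspan.base)
  ultimately have "\<ominus> (a \<oplus> y \<otimes> b') \<oplus> ((a \<oplus> y \<otimes> b') \<oplus> t \<otimes> y [^] d) \<in> M" by (rule Madd)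
  then have td: "t \<otimes> y [^] d \<in> M" using ac carr by (simp add: r_neg1)
  \<comment> \<open>Multiplication by \<open>t \<otimes> y\<close> raises the exponents by one; the
    only power that leaves the range is \<open>y [^] d\<close>, and \<open>td\<close> brings it
    back.\<close>
  have My: "(t \<otimes> y) \<otimes> x \<in> M" if "x \<in> M" for x
  proof -
    have "(t \<otimes> y) \<otimes> x \<in> tspan R S 1 Q ((\<lambda>u. (t \<otimes> y) \<otimes> u) ` ((\<lambda>i. y [^] i) ` {..<d}))"
      using that carr sub unfolding M_def by (intro tspan_image_mult) auto
    moreover have "(\<lambda>u. (t \<otimes> y) \<otimes> u) ` ((\<lambda>i. y [^] i) ` {..<d}) \<subseteq> M"
    proof clarsimp
      fix i assume i: "i < d"
      have e: "(t \<otimes> y) \<otimes> y [^] i = t \<otimes> y [^] Suc i" using carr by (simp add: m_ac)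
      show "(t \<otimes> y) \<otimes> y [^] i \<in> M"
      proof (cases "Suc i < d")
        case True show ?thesis unfolding e using Mscale[OF bt(2) Mpow[OF True]] .
      next
        case False then have "Suc i = d" using i by simp
        then show ?thesis unfolding e using td by simp
      qed
    qed
    ultimately show ?thesis using tspan_trans[OF _ _ sub] unfolding M_def by blast
  qed
  have "\<exists>s\<in>S - Q. s \<otimes> x \<in> M" if "x \<in> adjoin_deg R S y e" for e x
    using that
  proof (induction e arbitrary: x)
    case 0
    then show ?case using tspan_zero S_one one_notin by (auto simp: M_def intro!: bexI[of _ \<one>])
  next
    case (Suc e)
    obtain c x' where x: "c \<in> S" "x' \<in> adjoin_deg R S y e" "x = c \<oplus> y \<otimes> x'" using Suc.prems by auto
    obtain s where s: "s \<in> S" "s \<notin> Q" "s \<otimes> x' \<in> M" using Suc.IH[OF x(2)] by blast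
    have cc: "c \<in> carrier R" "x' \<in> carrier R" "s \<in> carrier R" using x s S_carr adjoin_deg_carr by auto
    have "(t \<otimes> s) \<otimes> x = (t \<otimes> s \<otimes> c) \<otimes> y [^] (0::nat) \<oplus> (t \<otimes> y) \<otimes> (s \<otimes> x')"
      using cc carr by (simp add: x(3) r_distr m_ac)
    also have "\<dots> \<in> M"
      by (rule Madd[OF Mscale[OF S_mult[OF S_mult[OF bt(2) s(1)] x(1)] Mpow] My[OF s(3)]])
        (use \<open>d \<noteq> 0\<close> in simp)
    finally have "(t \<otimes> s) \<otimes> x \<in> M" .
    moreover have "t \<otimes> s \<in> S - Q" using s bt \<open>t \<notin> Q\<close> dom S_mult by blast
    ultimately show ?case by blast
  qed
  then show thesis using that[of d] unfolding adjoin_def M_def by blast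
qed

text \<open>Two finite extensions are composed, up to denominators: \<open>Z\<close> spans
  \<open>S[y]\<close> over its \<open>p\<close>-th powers, and the \<open>p\<close>-th powers of
  \<open>y [^] i\<close> with \<open>i < d\<close> span these over the \<open>p\<close>-th powers of
  \<open>S\<close>. The set \<open>U\<close> of products then bounds every independent family in
  \<open>S\<close>; the bound is crude, but only finiteness matters.\<close>

lemma pind_adjoin_algebraic:
  assumes "a0 \<in> S" "b0 \<in> adjoin R S y" "a0 \<oplus> y \<otimes> b0 \<in> Q" "a0 \<notin> Q"
    and "pbounded R p (adjoin R S y) Q"
  shows "pbounded R p S Q"
proof -
  let ?B = "adjoin R S y"
  interpret B: twisted_prime R p ?B Q
    by (rule twisted_primeI[OF prime_Q subring_adjoin])
  obtain d where d: "\<And>b. b \<in> ?B \<Longrightarrow> \<exists>s\<in>S - Q. s \<otimes> b \<in> tspan R S 1 Q ((\<lambda>i. y [^] i) ` {..<d::nat})"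
    by (rule adjoin_algebraic[OF assms(1-4)]) blast
  obtain n z where z: "z \<in> {..<n} \<rightarrow> ?B" "pspans R p ?B Q (z ` {..<n::nat})"
    by (rule B.pbounded_basis[OF assms(5)]) blast
  let ?Z = "z ` {..<n}"
  have Zc: "?Z \<subseteq> carrier R" using z B.S_carr by auto
  define U where "U = (\<lambda>(w, i). w \<otimes> (y [^] i) [^] p) ` (?Z \<times> {..<d})"
  have U: "finite U" "U \<subseteq> carrier R" using Zc by (auto simp: U_def)
  have notin: "s [^] (k::nat) \<in> S - Q" if "s \<in> S - Q" for s k using that pow_notin S_pow by auto
  have *: "\<exists>s\<in>S - Q. s [^] p \<otimes> x \<in> tspan R S p Q U" if "x \<in> tspan R ?B p Q ?Z" for x
    using that
  proof induction
    case (base w)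
    then show ?case using S_one one_notin Q_carr by (auto intro!: bexI[of _ \<one>] tspan.base)
  next
    case (step x c u)
    obtain s where s: "s \<in> S" "s \<notin> Q" "s [^] p \<otimes> x \<in> tspan R S p Q U" using step by blast
    obtain t where t: "t \<in> S" "t \<notin> Q" "t \<otimes> c \<in> tspan R S 1 Q ((\<lambda>i. y [^] i) ` {..<d})"
      using d[OF step(2)] by blast
    have carr: "s \<in> carrier R" "t \<in> carrier R" "c \<in> carrier R" "u \<in> carrier R" "x \<in> carrier R"
      using s t S_carr step B.S_carr Zc B.tspan_carrier[OF step(1) Zc] by auto
    have "(t \<otimes> c) [^] p \<in> tspan R S p Q ((\<lambda>w. w [^] p) ` ((\<lambda>i. y [^] i) ` {..<d}))"
      using tspan_frob[OF t(3)] by (simp add: image_subset_iff)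
    then have "u \<otimes> (t \<otimes> c) [^] p \<in> tspan R S p Q ((\<lambda>w. u \<otimes> w) ` ((\<lambda>w. w [^] p) ` ((\<lambda>i. y [^] i) ` {..<d})))"
      using carr by (intro tspan_image_mult) auto
    also have "\<dots> \<subseteq> tspan R S p Q U"
      by (rule tspan_mono) (use step(3) in \<open>auto simp: U_def\<close>)
    finally have 1: "u \<otimes> (t \<otimes> c) [^] p \<in> tspan R S p Q U" .
    have "(s \<otimes> t) [^] p \<otimes> (x \<oplus> c [^] p \<otimes> u)
        = t [^] p \<otimes> (s [^] p \<otimes> x) \<oplus> s [^] p \<otimes> (u \<otimes> (t \<otimes> c) [^] p)"
    proof -
      have "(a \<otimes> b) \<otimes> (x \<oplus> e \<otimes> u) = b \<otimes> (a \<otimes> x) \<oplus> a \<otimes> (u \<otimes> (b \<otimes> e))"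
        if "a \<in> carrier R" "b \<in> carrier R" "e \<in> carrier R" for a b e
        using that carr by algebra
      then show ?thesis using carr by (simp add: nat_pow_distrib)
    qed
    also have "\<dots> \<in> tspan R S p Q U"
      using tspan_add[OF tspan_scale[OF s(3) t(1) U(2)] tspan_scale[OF 1 s(1) U(2)] U(2)] .
    finally have "(s \<otimes> t) [^] p \<otimes> (x \<oplus> c [^] p \<otimes> u) \<in> tspan R S p Q U" .
    moreover have "s \<otimes> t \<in> S - Q" using s t dom S_mult by blast
    ultimately show ?case by blast
  qed
  have "m \<le> card U" if m: "pind R p S Q m" for m
  proof (rule ccontr)
    assume gt: "\<not> m \<le> card U"
    obtain v where v: "v \<in> {..<m} \<rightarrow> S" "tindep R S p Q {..<m} v" using m unfolding pind_def by blast
    have vB: "v j \<in> ?B" "v j \<in> carrier R" if "j < m" for j using v that adjoin_incl S_carr by auto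
    have "\<exists>t\<in>?B - Q. \<forall>j\<in>{..<m}. t [^] p \<otimes> v j \<in> tspan R ?B p Q ?Z"
    proof (rule common_multiple)
      show "?B - Q \<subseteq> carrier R" using B.S_carr by auto
      show "\<one> \<in> ?B - Q" using B.S_one one_notin by auto
      show "s \<otimes> t \<in> ?B - Q" if "s \<in> ?B - Q" "t \<in> ?B - Q" for s t using that B.dom B.S_mult by blast
      show "\<exists>t\<in>?B - Q. t [^] p \<otimes> v j \<in> tspan R ?B p Q ?Z" if "j \<in> {..<m}" for j
        using z(2) vB that unfolding pspans_def by blast
      show "(t \<otimes> s) [^] p \<otimes> v j \<in> tspan R ?B p Q ?Z"
        if "j \<in> {..<m}" "s \<in> ?B - Q" "t \<in> ?B - Q" "s [^] p \<otimes> v j \<in> tspan R ?B p Q ?Z" for j s t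
      proof -
        have "(t \<otimes> s) [^] p \<otimes> v j = t [^] p \<otimes> (s [^] p \<otimes> v j)"
          using that B.S_carr vB by (simp add: nat_pow_distrib m_assoc)
        then show ?thesis using B.tspan_scale[OF that(4) _ Zc] that by simp
      qed
    qed simp
    then obtain t where t: "t \<in> ?B" "t \<notin> Q" "\<forall>j\<in>{..<m}. t [^] p \<otimes> v j \<in> tspan R ?B p Q ?Z" by blast
    have tc: "t \<in> carrier R" using t B.S_carr by auto
    \<comment> \<open>The denominator \<open>t\<close> lies in \<open>S[y]\<close> and cannot be
      absorbed into coefficients from \<open>S\<close>. The whole family is multiplied by
      \<open>t [^] p\<close> instead, and primality of \<open>Q\<close> cancels this factor from the
      resulting relation.\<close>
    have "\<not> tindep R S (p ^ 1) Q {..<m} (\<lambda>j. t [^] p \<otimes> v j)"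
      using U gt tc vB t(3) * by (intro tspan_exchange[of U]) auto
    then obtain c k where c: "c \<in> {..<m} \<rightarrow> S" "(\<Oplus>j\<in>{..<m}. c j [^] p \<otimes> (t [^] p \<otimes> v j)) \<in> Q"
       "k \<in> {..<m}" "c k \<notin> Q"
      unfolding tindep_def by auto
    have cc: "c j \<in> carrier R" if "j < m" for j using c(1) that S_carr by auto
    have "(\<Oplus>j\<in>{..<m}. c j [^] p \<otimes> (t [^] p \<otimes> v j)) = (\<Oplus>j\<in>{..<m}. t [^] p \<otimes> (c j [^] p \<otimes> v j))"
      using cc tc vB by (intro finsum_cong') (auto simp: m_ac)
    also have "\<dots> = t [^] p \<otimes> (\<Oplus>j\<in>{..<m}. c j [^] p \<otimes> v j)"
      using cc tc vB by (subst finsum_rdistr) auto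
    finally have "t [^] p \<otimes> (\<Oplus>j\<in>{..<m}. c j [^] p \<otimes> v j) \<in> Q" using c by simp
    moreover have "t [^] p \<notin> Q" using B.pow_notin[OF t(1,2)] .
    moreover have "(\<Oplus>j\<in>{..<m}. c j [^] p \<otimes> v j) \<in> carrier R" using cc vB by (intro finsum_closed) auto
    ultimately have "(\<Oplus>j\<in>{..<m}. c j [^] p \<otimes> v j) \<in> Q" using Q_prime tc by blast
    then show False using v(2) c unfolding tindep_def by blast
  qed
  then show ?thesis unfolding pbounded_def by blast
qed

lemma pbounded_adjoin:
  assumes "pbounded R p (adjoin R S y) Q"
  shows "pbounded R p S Q"
proof (cases "\<forall>a\<in>S. \<forall>b\<in>adjoin R S y. a \<oplus> y \<otimes> b \<in> Q \<longrightarrow> a \<in> Q")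
  case True
  then show ?thesis using assms pind_adjoin_transcendental unfolding pbounded_def by blast
next
  case False
  then show ?thesis using assms pind_adjoin_algebraic by blast
qed

end

section \<open>A degree filtration\<close>

text \<open>\<open>monomials R K d xs\<close> are the monomials in \<open>xs\<close> with coefficient in \<open>K\<close> whose exponents
  are all at most \<open>d\<close>; bounding every exponent, rather than the total degree, lets
  \<open>p\<close>-th powers split off one variable at a time.\<close>

primrec monomials :: "('a, 'm) ring_scheme \<Rightarrow> 'a set \<Rightarrow> nat \<Rightarrow> 'a list \<Rightarrow> 'a set" where
  "monomials R K d [] = K"
| "monomials R K d (x # xs) = {m \<otimes>\<^bsub>R\<^esub> x [^]\<^bsub>R\<^esub> j | m j. m \<in> monomials R K d xs \<and> j \<le> d}"

inductive_set add_closure :: "('a, 'm) ring_scheme \<Rightarrow> 'a set \<Rightarrow> 'a set" for R M where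
  zero: "\<zero>\<^bsub>R\<^esub> \<in> add_closure R M"
| add: "x \<in> add_closure R M \<Longrightarrow> m \<in> M \<Longrightarrow> x \<oplus>\<^bsub>R\<^esub> m \<in> add_closure R M"

text \<open>An element may be represented by several polynomials in \<open>xs\<close>, so this is an
  increasing filtration of the subalgebra and not a grading.\<close>

definition degree_part :: "('a, 'm) ring_scheme \<Rightarrow> 'a set \<Rightarrow> 'a list \<Rightarrow> nat \<Rightarrow> 'a set" where
  "degree_part R K xs d = add_closure R (monomials R K d xs)"

lemma add_closure_mono: "M \<subseteq> N \<Longrightarrow> add_closure R M \<subseteq> add_closure R N"
proof
  fix x assume "M \<subseteq> N" and "x \<in> add_closure R M"
  from this(2) show "x \<in> add_closure R N"
    by induction (use \<open>M \<subseteq> N\<close> in \<open>auto intro: add_closure.intros\<close>)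
qed

context cring
begin

lemma add_closure_carr: "x \<in> add_closure R M \<Longrightarrow> M \<subseteq> carrier R \<Longrightarrow> x \<in> carrier R"
  by (induction rule: add_closure.induct) auto

lemma add_closure_incl: "m \<in> M \<Longrightarrow> M \<subseteq> carrier R \<Longrightarrow> m \<in> add_closure R M"
  using add_closure.add[OF add_closure.zero, of m M R] by auto

lemma add_closure_add:
  assumes "x \<in> add_closure R M" "y \<in> add_closure R M" "M \<subseteq> carrier R"
  shows "x \<oplus> y \<in> add_closure R M"
  using assms(2)
proof induction
  case zero
  then show ?case using assms add_closure_carr by simp
next
  case (add y m)
  have "x \<in> carrier R" "y \<in> carrier R" "m \<in> carrier R"
    using assms add add_closure_carr[OF add(1)] add_closure_carr[OF assms(1)] by auto
  then have "x \<oplus> (y \<oplus> m) = (x \<oplus> y) \<oplus> m" by (simp add: a_assoc)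
  then show ?case using add by (auto intro: add_closure.add)
qed

lemma add_closure_image:
  assumes "x \<in> add_closure R M" "M \<subseteq> carrier R" "N \<subseteq> carrier R"
    "f \<zero> = \<zero>" "\<And>x y. x \<in> carrier R \<Longrightarrow> y \<in> carrier R \<Longrightarrow> f (x \<oplus> y) = f x \<oplus> f y"
    "\<And>m. m \<in> M \<Longrightarrow> f m \<in> add_closure R N"
  shows "f x \<in> add_closure R N"
  using assms(1)
proof induction
  case zero
  then show ?case using assms by (auto intro: add_closure.zero)
next
  case (add x m)
  have "f (x \<oplus> m) = f x \<oplus> f m" using add assms add_closure_carr[OF add(1)] by auto
  then show ?case using add assms add_closure_add by auto
qed

end

locale filtered = char_p_ring R p for R (structure) and p +
  fixes K :: "'a set" and xs :: "'a list"
  assumes sub_K: "subring K R" and xs_carr: "set xs \<subseteq> carrier R"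
begin

abbreviation "V \<equiv> degree_part R K xs"

lemma K_carr: "c \<in> K \<Longrightarrow> c \<in> carrier R" using subringE(1)[OF sub_K] by auto

lemma monomials_carr: "set ys \<subseteq> carrier R \<Longrightarrow> m \<in> monomials R K d ys \<Longrightarrow> m \<in> carrier R"
  by (induction ys arbitrary: m) (auto simp: K_carr)

lemma monomials_ConsI:
  "m \<in> monomials R K d ys \<Longrightarrow> j \<le> d \<Longrightarrow> m \<otimes> y [^] j \<in> monomials R K d (y # ys)"
  by auto

lemma monomials_mono: "d \<le> e \<Longrightarrow> monomials R K d ys \<subseteq> monomials R K e ys"
proof (induction ys)
  case (Cons y ys)
  then show ?case by (auto intro: order_trans)
qed simp

lemma monomials_mult:
  "set ys \<subseteq> carrier R \<Longrightarrow> m \<in> monomials R K d ys \<Longrightarrow> n \<in> monomials R K e ys \<Longrightarrow> m \<otimes> n \<in> monomials R K (d + e) ys"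
proof (induction ys arbitrary: m n)
  case Nil
  then show ?case using subringE(6)[OF sub_K] by simp
next
  case (Cons y ys)
  obtain m' i where m: "m' \<in> monomials R K d ys" "i \<le> d" "m = m' \<otimes> y [^] i" using Cons.prems by auto
  obtain n' j where n: "n' \<in> monomials R K e ys" "j \<le> e" "n = n' \<otimes> y [^] j" using Cons.prems by auto
  have "m' \<in> carrier R" "n' \<in> carrier R" "y \<in> carrier R" using m n Cons.prems monomials_carr by auto
  then have "m \<otimes> n = (m' \<otimes> n') \<otimes> y [^] (i + j)"
    by (simp add: m(3) n(3) nat_pow_mult[symmetric] m_ac)
  then show ?case using Cons.IH[of m' n'] m n Cons.prems
    by (auto intro!: exI[of _ "m' \<otimes> n'"] exI[of _ "i + j"])
qed

lemma monomials_K: "set ys \<subseteq> carrier R \<Longrightarrow> c \<in> K \<Longrightarrow> c \<in> monomials R K d ys"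
proof (induction ys)
  case (Cons y ys)
  have "c = c \<otimes> y [^] (0::nat)" using K_carr Cons.prems by simp
  then show ?case using Cons monomials_ConsI[of c d ys 0 y] by (simp del: monomials.simps)
qed simp

lemma monomials_var: "set ys \<subseteq> carrier R \<Longrightarrow> y \<in> set ys \<Longrightarrow> d \<ge> 1 \<Longrightarrow> y \<in> monomials R K d ys"
proof (induction ys)
  case (Cons x ys)
  show ?case
  proof (cases "y = x")
    case True
    have "y = \<one> \<otimes> y [^] (1::nat)" using Cons.prems True by simp
    then show ?thesis
      using True Cons.prems monomials_K[of ys \<one> d] subringE(3)[OF sub_K] monomials_ConsI[of \<one> d ys 1 y]
      by (simp del: monomials.simps)
  next
    case False
    have "y = y \<otimes> x [^] (0::nat)" using Cons.prems by auto
    then show ?thesis using False Cons monomials_ConsI[of y d ys 0 x] by (simp del: monomials.simps)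
  qed
qed simp

lemma monomials_sub: "monomials R K d xs \<subseteq> carrier R"
  using monomials_carr xs_carr by blast

lemma V_carr: "v \<in> V d \<Longrightarrow> v \<in> carrier R"
  unfolding degree_part_def using add_closure_carr monomials_sub by blast

lemma V_mono: "d \<le> e \<Longrightarrow> V d \<subseteq> V e"
  unfolding degree_part_def by (intro add_closure_mono monomials_mono)

lemma V_zero: "\<zero> \<in> V d" unfolding degree_part_def by (rule add_closure.zero)

lemma V_add: "v \<in> V d \<Longrightarrow> w \<in> V d \<Longrightarrow> v \<oplus> w \<in> V d"
  unfolding degree_part_def using add_closure_add monomials_sub by blast

lemma V_K: "c \<in> K \<Longrightarrow> c \<in> V d"
  unfolding degree_part_def using add_closure_incl[OF _ monomials_sub] monomials_K xs_carr by blast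

lemma V_one: "\<one> \<in> V d" using V_K subringE(3)[OF sub_K] by blast

lemma V_mult:
  assumes "v \<in> V d" "w \<in> V e"
  shows "v \<otimes> w \<in> V (d + e)"
proof -
  have 1: "m \<otimes> w \<in> V (d + e)" if "m \<in> monomials R K d xs" for m
    unfolding degree_part_def
  proof (rule add_closure_image[where f = "\<lambda>x. m \<otimes> x" and M = "monomials R K e xs"])
    show "w \<in> add_closure R (monomials R K e xs)" using assms(2) by (simp add: degree_part_def)
    fix n assume "n \<in> monomials R K e xs"
    then show "m \<otimes> n \<in> add_closure R (monomials R K (d + e) xs)"
      using that xs_carr monomials_mult monomials_sub by (intro add_closure_incl) auto
  qed (use monomials_sub[of d] monomials_sub[of e] monomials_sub[of "d + e"] that r_distr[of _ _ m] in \<open>auto simp: subset_iff\<close>)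
  show ?thesis unfolding degree_part_def
  proof (rule add_closure_image[where f = "\<lambda>x. x \<otimes> w" and M = "monomials R K d xs"])
    show "v \<in> add_closure R (monomials R K d xs)" using assms(1) by (simp add: degree_part_def)
  qed (use monomials_sub 1 V_carr[OF assms(2)] l_distr in \<open>auto simp: degree_part_def\<close>)
qed

lemma V_pow: "v \<in> V d \<Longrightarrow> v [^] n \<in> V (n * d)"
proof (induction n)
  case (Suc n)
  then have "v [^] n \<otimes> v \<in> V (n * d + d)" by (intro V_mult) auto
  then show ?case by (simp add: add.commute)
qed (simp add: V_one)

lemma V_scale: "c \<in> K \<Longrightarrow> v \<in> V d \<Longrightarrow> c \<otimes> v \<in> V d"
  using V_mult[OF V_K[of c 0], of v d] by simp

lemma V_neg: "v \<in> V d \<Longrightarrow> \<ominus> v \<in> V d"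
  using V_scale[of "\<ominus> \<one>" v d] subringE(3,5)[OF sub_K] V_carr[of v d] by (simp add: l_minus)

lemma generated_in_V:
  assumes "x \<in> generate_ring R (K \<union> set xs)"
  shows "\<exists>d. x \<in> V d"
  using assms
proof induction
  case one then show ?case using V_one by blast
next
  case (incl h)
  then show ?case
  proof
    assume "h \<in> set xs"
    then have "h \<in> V 1" unfolding degree_part_def
      by (intro add_closure_incl monomials_sub monomials_var xs_carr) auto
    then show ?thesis by blast
  qed (use V_K in blast)
next
  case (a_inv h) then show ?case using V_neg by blast
next
  case (eng_add a b)
  then obtain d e where "a \<in> V d" "b \<in> V e" by blast
  then have "a \<in> V (max d e)" "b \<in> V (max d e)" using V_mono[of d "max d e"] V_mono[of e "max d e"] by auto
  then show ?case using V_add by blast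
next
  case (eng_mult a b) then show ?case using V_mult by blast
qed

lemma monomials_span:
  "set ys \<subseteq> carrier R \<Longrightarrow> \<exists>T. finite T \<and> T \<subseteq> carrier R \<and> (\<forall>m\<in>monomials R K d ys. \<exists>c\<in>K. \<exists>t\<in>T. m = c \<otimes> t)"
proof (induction ys)
  case Nil
  show ?case by (rule exI[of _ "{\<one>}"]) (auto simp: K_carr)
next
  case (Cons y ys)
  then obtain T where T: "finite T" "T \<subseteq> carrier R" "\<forall>m\<in>monomials R K d ys. \<exists>c\<in>K. \<exists>t\<in>T. m = c \<otimes> t"
    by auto
  have y: "y \<in> carrier R" using Cons.prems by auto
  define T' where "T' = (\<lambda>(t, j). t \<otimes> y [^] (j::nat)) ` (T \<times> {..d})"
  have "\<exists>c\<in>K. \<exists>t\<in>T'. m = c \<otimes> t" if "m \<in> monomials R K d (y # ys)" for m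
  proof -
    obtain n j where n: "n \<in> monomials R K d ys" "j \<le> d" "m = n \<otimes> y [^] j" using \<open>m \<in> _\<close> by auto
    obtain c t where ct: "c \<in> K" "t \<in> T" "n = c \<otimes> t" using T n by blast
    have "m = c \<otimes> (t \<otimes> y [^] j)" using ct T K_carr y by (auto simp: n(3) m_assoc)
    moreover have "t \<otimes> y [^] j \<in> T'" using ct n by (auto simp: T'_def)
    ultimately show ?thesis using ct by blast
  qed
  moreover have "finite T'" "T' \<subseteq> carrier R" using T y by (auto simp: T'_def)
  ultimately show ?case by blast
qed

text \<open>Twist one means ordinary linear combinations: there are finitely many monomials with
  bounded exponents, so \<open>V d\<close> is contained in a finitely generated module over
  \<open>K\<close>.\<close>

lemma V_span:
  assumes "ideal Q R"
  obtains T where "finite T" "T \<subseteq> carrier R" "V d \<subseteq> tspan R K 1 Q T"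
proof -
  interpret twisted R p K Q by (rule twistedI[OF assms sub_K])
  obtain T where T: "finite T" "T \<subseteq> carrier R" "\<forall>m\<in>monomials R K d xs. \<exists>c\<in>K. \<exists>t\<in>T. m = c \<otimes> t"
    using monomials_span[OF xs_carr, of d] by blast
  have "v \<in> tspan R K 1 Q T" if "v \<in> add_closure R (monomials R K d xs)" for v
    using that
  proof induction
    case zero then show ?case by (rule tspan_zero)
  next
    case (add x m)
    obtain c t where "c \<in> K" "t \<in> T" "m = c \<otimes> t" using T add by blast
    then show ?case using tspan.step[OF add(3), of c t] K_carr by auto
  qed
  then show thesis using that T unfolding degree_part_def by blast
qed

end

locale F_finite_filtered = filtered +
  fixes E :: "'a set"
  assumes E: "finite E" "E \<subseteq> carrier R" "\<And>c. c \<in> K \<Longrightarrow> c \<in> tspan R K p {\<zero>} E"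
begin

text \<open>Every exponent is divided by \<open>p\<close> with remainder. The quotients go into
  \<open>f\<close>; the remainders, together with the generators \<open>E\<close> for the
  coefficients, go into a finite set \<open>B\<close> that does not depend on \<open>d\<close>. The
  expansion of a coefficient has several terms, whence the additive closure.\<close>

lemma monomials_frob_decomp:
  "set ys \<subseteq> carrier R \<Longrightarrow> \<exists>B. finite B \<and> B \<subseteq> carrier R \<and> (\<forall>d. \<forall>m\<in>monomials R K d ys.
     m \<in> add_closure R {f [^] p \<otimes> b | f b. f \<in> monomials R K (d div p) ys \<and> b \<in> B})"
proof (induction ys)
  case Nil
  have "c \<in> add_closure R {f [^] p \<otimes> b | f b. f \<in> K \<and> b \<in> E}" if "c \<in> tspan R K p {\<zero>} E" for c
    using that by induction (auto intro!: add_closure.intros)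
  then show ?case using E by (intro exI[of _ E]) auto
next
  case (Cons y ys)
  obtain B where B: "finite B" "B \<subseteq> carrier R" "\<forall>d. \<forall>m\<in>monomials R K d ys.
     m \<in> add_closure R {f [^] p \<otimes> b | f b. f \<in> monomials R K (d div p) ys \<and> b \<in> B}"
    using Cons by auto
  have y: "y \<in> carrier R" and ys: "set ys \<subseteq> carrier R" using Cons.prems by auto
  define B' where "B' = (\<lambda>(b, r). b \<otimes> y [^] (r::nat)) ` (B \<times> {..<p})"
  have B': "finite B'" "B' \<subseteq> carrier R" using B y by (auto simp: B'_def)
  have "m \<in> add_closure R {f [^] p \<otimes> b | f b. f \<in> monomials R K (d div p) (y # ys) \<and> b \<in> B'}"
    if m: "m \<in> monomials R K d (y # ys)" for d m
  proof -
    obtain n j where n: "n \<in> monomials R K d ys" "j \<le> d" "m = n \<otimes> y [^] j" using m by auto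
    show ?thesis unfolding n(3)
    proof (rule add_closure_image[where f = "\<lambda>x. x \<otimes> y [^] j"])
      show "n \<in> add_closure R {f [^] p \<otimes> b | f b. f \<in> monomials R K (d div p) ys \<and> b \<in> B}"
        using B n by blast
      show "{f [^] p \<otimes> b | f b. f \<in> monomials R K (d div p) ys \<and> b \<in> B} \<subseteq> carrier R"
        using B monomials_carr[OF ys] by auto
      show sub: "{f [^] p \<otimes> b | f b. f \<in> monomials R K (d div p) (y # ys) \<and> b \<in> B'} \<subseteq> carrier R"
        using B' monomials_carr[OF Cons.prems] by (auto simp del: monomials.simps)
      fix x assume "x \<in> {f [^] p \<otimes> b | f b. f \<in> monomials R K (d div p) ys \<and> b \<in> B}"
      then obtain f b where fb: "f \<in> monomials R K (d div p) ys" "b \<in> B" "x = f [^] p \<otimes> b" by blast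
      have c: "f \<in> carrier R" "b \<in> carrier R" using fb B monomials_carr[OF ys] by auto
      have "j = (j div p) * p + j mod p" by simp
      then have "y [^] j = (y [^] (j div p)) [^] p \<otimes> y [^] (j mod p)"
        using y by (metis nat_pow_mult nat_pow_pow)
      then have "x \<otimes> y [^] j = (f \<otimes> y [^] (j div p)) [^] p \<otimes> (b \<otimes> y [^] (j mod p))"
        using c y by (simp add: fb(3) nat_pow_distrib m_ac)
      moreover have "f \<otimes> y [^] (j div p) \<in> monomials R K (d div p) (y # ys)"
        using fb n(2) div_le_mono[of j d p] by auto
      moreover have "b \<otimes> y [^] (j mod p) \<in> B'" using fb p_pos by (auto simp: B'_def)
      ultimately have "x \<otimes> y [^] j \<in> {f [^] p \<otimes> b | f b. f \<in> monomials R K (d div p) (y # ys) \<and> b \<in> B'}"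
        unfolding mem_Collect_eq by metis
      then show "x \<otimes> y [^] j \<in> add_closure R {f [^] p \<otimes> b | f b. f \<in> monomials R K (d div p) (y # ys) \<and> b \<in> B'}"
        by (rule add_closure_incl[OF _ sub])
    qed (use y l_distr in auto)
  qed
  then show ?case using B' by blast
qed

lemma V_frob_decomp:
  obtains B where "finite B" "B \<subseteq> carrier R"
    "\<And>d v. v \<in> V d \<Longrightarrow> v \<in> add_closure R {f [^] p \<otimes> b | f b. f \<in> V (d div p) \<and> b \<in> B}"
proof -
  obtain B where B: "finite B" "B \<subseteq> carrier R" "\<forall>d. \<forall>m\<in>monomials R K d xs.
     m \<in> add_closure R {f [^] p \<otimes> b | f b. f \<in> monomials R K (d div p) xs \<and> b \<in> B}"
    using monomials_frob_decomp[OF xs_carr] by auto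
  have *: "v \<in> add_closure R {f [^] p \<otimes> b | f b. f \<in> V (d div p) \<and> b \<in> B}" if "v \<in> V d" for d v
  proof (rule add_closure_image[where f = "\<lambda>x. x" and M = "monomials R K d xs"])
    show "v \<in> add_closure R (monomials R K d xs)" using that by (simp add: degree_part_def)
    show "{f [^] p \<otimes> b | f b. f \<in> V (d div p) \<and> b \<in> B} \<subseteq> carrier R" using B V_carr by auto
    fix m assume "m \<in> monomials R K d xs"
    then have "m \<in> add_closure R {f [^] p \<otimes> b | f b. f \<in> monomials R K (d div p) xs \<and> b \<in> B}" using B by blast
    also have "\<dots> \<subseteq> add_closure R {f [^] p \<otimes> b | f b. f \<in> V (d div p) \<and> b \<in> B}"
      unfolding degree_part_def using add_closure_incl[OF _ monomials_sub] by (intro add_closure_mono) blast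
    finally show "m \<in> add_closure R {f [^] p \<otimes> b | f b. f \<in> V (d div p) \<and> b \<in> B}" .
  qed (use monomials_sub in auto)
  show thesis by (rule that[OF B(1,2) *])
qed

end

section \<open>The \<open>p\<close>-rank drops by a factor of at least \<open>p\<close> along a strict inclusion of primes\<close>

text \<open>Let \<open>Q \<subset> Q'\<close> with ranks \<open>n\<close> and \<open>m\<close>, and let \<open>x \<in> Q' - Q\<close>. The \<open>(p m)\<^sup>e\<close> products of powers \<open>x\<^sup>i\<close>
  with twisted products of \<open>p\<close>-independent elements at \<open>Q'\<close> are independent over the \<open>p\<^sup>e\<close>-th powers of \<open>K\<close>
  modulo \<open>Q\<close>, and their degrees are \<open>O(p\<^sup>e)\<close>. Up to one factor outside \<open>Q\<close>, all elements of such degrees are spanned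
  by \<open>C n\<^sup>e\<close> elements. Hence \<open>(p m)\<^sup>e \<le> C n\<^sup>e\<close> for all \<open>e\<close>, so \<open>p m \<le> n\<close>.\<close>

locale ess_finite_alg = F_finite_filtered R p K xs E for R (structure) and p K xs E +
  fixes H :: "'a set"
  assumes K_inv: "\<And>c. c \<in> K \<Longrightarrow> c \<noteq> \<zero> \<Longrightarrow> \<exists>d\<in>K. c \<otimes> d = \<one>"
    and unit_multiple: "\<And>A. finite A \<Longrightarrow> A \<subseteq> carrier R \<Longrightarrow>
      \<exists>u\<in>Units R. \<exists>d. u \<in> V d \<and> (\<forall>a\<in>A. u \<otimes> a \<in> V d)"
    and H: "finite H" "H \<subseteq> carrier R" "\<And>x. x \<in> carrier R \<Longrightarrow> x \<in> tspan R (carrier R) p {\<zero>} H"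
begin

lemma K_meets_prime:
  assumes "primeideal Q R" "c \<in> K" "c \<in> Q"
  shows "c = \<zero>"
proof (rule ccontr)
  interpret primeideal Q R by fact
  assume "c \<noteq> \<zero>"
  then obtain d where "d \<in> K" "c \<otimes> d = \<one>" using K_inv assms by blast
  then have "\<one> \<in> Q" using assms(3) I_r_closed[of c d] K_carr by auto
  then show False using one_imp_carrier I_notcarr by metis
qed

lemma unit_notin_prime:
  assumes "primeideal Q R" "u \<in> Units R"
  shows "u \<notin> Q"
proof
  interpret primeideal Q R by fact
  assume "u \<in> Q"
  then have "\<one> \<in> Q" using assms(2) I_l_closed[of u "inv u"] by simp
  then show False using one_imp_carrier I_notcarr by metis
qed

text \<open>Elements of \<open>V d\<close> are sums of \<open>f [^] p \<otimes> b\<close> with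
  \<open>b\<close> in a fixed finite set \<open>B\<close>. One \<open>s\<close> clears the
  denominators in the expansions of all \<open>b\<close> by \<open>Z\<close>, and one unit
  \<open>u\<close> moves the finitely many coefficients that occur into a degree \<open>D\<close>.
  Both are chosen before \<open>d\<close>, so \<open>t = u \<otimes> s\<close> and \<open>D\<close>
  are uniform.\<close>

lemma degree_part_span_step:
  assumes "primeideal Q R" "pspans R p (carrier R) Q Z" "finite Z" "Z \<subseteq> carrier R"
  obtains t D where "t \<in> carrier R" "t \<notin> Q" "\<And>d v. v \<in> V d \<Longrightarrow> t [^] p \<otimes> v \<in> tspan R (V (d div p + D)) p Q Z"
proof -
  interpret Q: primeideal Q R by fact
  interpret T: twisted_prime R p "carrier R" Q by (rule twisted_primeI[OF assms(1) carrier_is_subring])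
  obtain B where B: "finite B" "B \<subseteq> carrier R"
    "\<And>d v. v \<in> V d \<Longrightarrow> v \<in> add_closure R {f [^] p \<otimes> b | f b. f \<in> V (d div p) \<and> b \<in> B}"
    by (rule V_frob_decomp) blast
  have "\<exists>s\<in>carrier R - Q. \<forall>b\<in>B. s [^] p \<otimes> b \<in> tspan R (carrier R) p Q Z"
  proof (rule T.common_multiple[OF B(1)])
    show "carrier R - Q \<subseteq> carrier R" by auto
    show "\<one> \<in> carrier R - Q" using T.one_notin by auto
    show "s \<otimes> t \<in> carrier R - Q" if "s \<in> carrier R - Q" "t \<in> carrier R - Q" for s t
      using that T.dom by auto
    show "\<exists>s\<in>carrier R - Q. s [^] p \<otimes> b \<in> tspan R (carrier R) p Q Z" if "b \<in> B" for b
      using assms(2) B that unfolding pspans_def by blast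
    fix b s t assume *: "b \<in> B" "s \<in> carrier R - Q" "t \<in> carrier R - Q" "s [^] p \<otimes> b \<in> tspan R (carrier R) p Q Z"
    have "(t \<otimes> s) [^] p \<otimes> b = t [^] p \<otimes> (s [^] p \<otimes> b)"
      using * B by (auto simp: nat_pow_distrib m_assoc)
    then show "(t \<otimes> s) [^] p \<otimes> b \<in> tspan R (carrier R) p Q Z"
      using T.tspan_scale[OF *(4) _ assms(4)] * by auto
  qed
  then obtain s where s: "s \<in> carrier R" "s \<notin> Q" "\<forall>b\<in>B. s [^] p \<otimes> b \<in> tspan R (carrier R) p Q Z" by blast
  have "\<exists>c. c \<in> Z \<rightarrow> carrier R \<and> (\<exists>w\<in>Q. s [^] p \<otimes> b = w \<oplus> (\<Oplus>z\<in>Z. c z [^] p \<otimes> z))" if b: "b \<in> B" for b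
  proof -
    have "s [^] p \<otimes> b \<in> tspan R (carrier R) (p ^ 1) Q Z" using s b by simp
    then obtain c w where "c \<in> Z \<rightarrow> carrier R" "w \<in> Q" "s [^] p \<otimes> b = w \<oplus> (\<Oplus>u\<in>Z. c u [^] (p ^ 1) \<otimes> u)"
      by (rule T.tspan_finite[OF _ assms(3,4)])
    then show ?thesis by auto
  qed
  then have "\<forall>b\<in>B. \<exists>c. c \<in> Z \<rightarrow> carrier R \<and> (\<exists>w\<in>Q. s [^] p \<otimes> b = w \<oplus> (\<Oplus>z\<in>Z. c z [^] p \<otimes> z))" by blast
  then obtain c where c: "\<forall>b\<in>B. c b \<in> Z \<rightarrow> carrier R \<and> (\<exists>w\<in>Q. s [^] p \<otimes> b = w \<oplus> (\<Oplus>z\<in>Z. c b z [^] p \<otimes> z))"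
    by (rule bchoice[THEN exE])
  have cc: "c b z \<in> carrier R" if "b \<in> B" "z \<in> Z" for b z using c that by auto
  have "\<exists>u\<in>Units R. \<exists>D. u \<in> V D \<and> (\<forall>a\<in>(\<lambda>(b, z). c b z) ` (B \<times> Z). u \<otimes> a \<in> V D)"
    using B assms cc by (intro unit_multiple) auto
  then obtain u D where u: "u \<in> Units R" "\<forall>b\<in>B. \<forall>z\<in>Z. u \<otimes> c b z \<in> V D" by auto
  have uc: "u \<in> carrier R" using u by auto
  have base: "(u \<otimes> s) [^] p \<otimes> (f [^] p \<otimes> b) \<in> tspan R (V (a + D)) p Q Z"
    if bf: "b \<in> B" "f \<in> V a" for a f b
  proof -
    obtain w where w: "w \<in> Q" "s [^] p \<otimes> b = w \<oplus> (\<Oplus>z\<in>Z. c b z [^] p \<otimes> z)" using c bf(1) by blast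
    have fc: "f \<in> carrier R" "b \<in> carrier R" "w \<in> carrier R" using bf V_carr B w Q.Icarr by auto
    have sc: "(\<lambda>z. c b z [^] p \<otimes> z) \<in> Z \<rightarrow> carrier R" using cc[OF bf(1)] assms(4) by auto
    have "(u \<otimes> s) [^] p \<otimes> (f [^] p \<otimes> b) = (u \<otimes> f) [^] p \<otimes> (s [^] p \<otimes> b)"
      using uc s fc by (simp add: nat_pow_distrib m_ac)
    also have "\<dots> = (u \<otimes> f) [^] p \<otimes> w \<oplus> (\<Oplus>z\<in>Z. (u \<otimes> f) [^] p \<otimes> (c b z [^] p \<otimes> z))"
      unfolding w(2) using uc fc sc assms(3) by (simp add: r_distr finsum_rdistr)
    also have "(\<Oplus>z\<in>Z. (u \<otimes> f) [^] p \<otimes> (c b z [^] p \<otimes> z)) = (\<Oplus>z\<in>Z. (f \<otimes> (u \<otimes> c b z)) [^] p \<otimes> z)"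
      using uc fc cc[OF bf(1)] assms(4)
      by (intro finsum_cong') (auto simp: nat_pow_distrib m_ac subset_iff)
    finally have eq: "(u \<otimes> s) [^] p \<otimes> (f [^] p \<otimes> b)
      = (u \<otimes> f) [^] p \<otimes> w \<oplus> (\<Oplus>z\<in>Z. (f \<otimes> (u \<otimes> c b z)) [^] p \<otimes> z)" .
    have coef: "f \<otimes> (u \<otimes> c b z) \<in> V (a + D)" if "z \<in> Z" for z
      using V_mult[OF \<open>f \<in> V a\<close>] u \<open>b \<in> B\<close> that by blast
    have "w' \<oplus> (\<Oplus>z\<in>Z'. (f \<otimes> (u \<otimes> c b z)) [^] p \<otimes> z) \<in> tspan R (V (a + D)) p Q Z"
      if "finite Z'" "Z' \<subseteq> Z" "w' \<in> Q" for Z' w'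
      using that
    proof (induction Z' rule: finite_induct)
      case empty then show ?case using Q.Icarr by (auto intro: tspan.base)
    next
      case (insert z Z')
      have zc: "z \<in> carrier R" "Z' \<subseteq> carrier R" using insert assms(4) by auto
      have k: "f \<otimes> (u \<otimes> c b y) \<in> carrier R" if "y \<in> insert z Z'" for y
        using insert.prems(1) that V_carr[OF coef] by blast
      have "(\<Oplus>y\<in>Z'. (f \<otimes> (u \<otimes> c b y)) [^] p \<otimes> y) \<in> carrier R"
        using k zc by (intro finsum_closed) auto
      then have "w' \<oplus> (\<Oplus>y\<in>insert z Z'. (f \<otimes> (u \<otimes> c b y)) [^] p \<otimes> y)
        = (w' \<oplus> (\<Oplus>y\<in>Z'. (f \<otimes> (u \<otimes> c b y)) [^] p \<otimes> y)) \<oplus> (f \<otimes> (u \<otimes> c b z)) [^] p \<otimes> z"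
        using insert zc k Q.Icarr[OF insert.prems(2)] by (subst finsum_insert) (auto simp: a_ac)
      then show ?case using insert coef by (auto intro: tspan.step)
    qed
    then show ?thesis unfolding eq using assms(3) w(1) uc fc Q.I_l_closed by simp
  qed
  have "(u \<otimes> s) [^] p \<otimes> v \<in> tspan R (V (d div p + D)) p Q Z"
    if "v \<in> add_closure R {f [^] p \<otimes> b | f b. f \<in> V (d div p) \<and> b \<in> B}" for d v
    using that
  proof induction
    case zero
    then show ?case using uc s Q.zero_closed by (auto intro: tspan.base)
  next
    case (add x m)
    obtain f b where fb: "f \<in> V (d div p)" "b \<in> B" "m = f [^] p \<otimes> b" using add by blast
    have "{f [^] p \<otimes> b | f b. f \<in> V (d div p) \<and> b \<in> B} \<subseteq> carrier R" using B V_carr by auto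
    then have "x \<in> carrier R" "m \<in> carrier R" using add add_closure_carr by blast+
    then have "(u \<otimes> s) [^] p \<otimes> (x \<oplus> m) = (u \<otimes> s) [^] p \<otimes> x \<oplus> (u \<otimes> s) [^] p \<otimes> m"
      using uc s by (simp add: r_distr)
    moreover have "V (d div p + D) \<subseteq> carrier R" using V_carr by auto
    ultimately show ?case
      using tspan_add_any[OF add.IH _ _ assms(4) Q.is_ideal] base[OF fb(2,1)] fb(3) by simp
  qed
  moreover have "u \<otimes> s \<notin> Q"
    using T.dom[of u s] unit_notin_prime[OF assms(1) u(1)] s uc by auto
  ultimately show thesis using that[of "u \<otimes> s" D] B(3) uc s by blast
qed

text \<open>The degree bound \<open>a * p ^ e + 2 * D\<close> reproduces itself with
  \<open>e\<close> lowered by one, because \<open>2 * D div p + D\<close> is at most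
  \<open>2 * D\<close>. After \<open>e\<close> steps the degree is \<open>a + 2 * D\<close>,
  independent of \<open>e\<close>, and the constant \<open>C\<close> counts spanning elements of
  that degree part.\<close>

lemma degree_part_span:
  assumes "primeideal Q R" "pspans R p (carrier R) Q Z" "finite Z" "Z \<subseteq> carrier R"
  obtains C where "\<And>e. \<exists>t\<in>carrier R - Q. \<exists>U. finite U \<and> U \<subseteq> carrier R \<and> card U \<le> C * card Z ^ e
      \<and> (\<forall>v\<in>V (a * p ^ e). t \<otimes> v \<in> tspan R K (p ^ e) Q U)"
proof -
  interpret Q: primeideal Q R by fact
  interpret T: twisted_prime R p "carrier R" Q by (rule twisted_primeI[OF assms(1) carrier_is_subring])
  interpret TK: twisted R p K Q by (rule twistedI[OF Q.is_ideal sub_K])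
  obtain t D where t: "t \<in> carrier R" "t \<notin> Q"
    "\<And>d v. v \<in> V d \<Longrightarrow> t [^] p \<otimes> v \<in> tspan R (V (d div p + D)) p Q Z"
    by (rule degree_part_span_step[OF assms]) blast
  obtain T where T: "finite T" "T \<subseteq> carrier R" "V (a + 2 * D) \<subseteq> tspan R K 1 Q T"
    by (rule V_span[OF Q.is_ideal])
  have main: "\<exists>t\<in>carrier R - Q. \<exists>U. finite U \<and> U \<subseteq> carrier R \<and> card U \<le> card T * card Z ^ e
      \<and> (\<forall>v\<in>V (a * p ^ e + 2 * D). t \<otimes> v \<in> tspan R K (p ^ e) Q U)" for e
  proof (induction e)
    case 0
    have "\<one> \<otimes> v \<in> tspan R K 1 Q T" if "v \<in> V (a + 2 * D)" for v
      using that T V_carr[OF that] by auto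
    then show ?case using T T.one_notin by (intro bexI[of _ \<one>] exI[of _ T]) auto
  next
    case (Suc e)
    then obtain s U where s: "s \<in> carrier R" "s \<notin> Q" and U: "finite U" "U \<subseteq> carrier R"
      "card U \<le> card T * card Z ^ e"
      "\<And>v. v \<in> V (a * p ^ e + 2 * D) \<Longrightarrow> s \<otimes> v \<in> tspan R K (p ^ e) Q U" by blast
    \<comment> \<open>The coefficients of an expansion by \<open>Z\<close> are themselves expanded
      by \<open>U\<close>; Frobenius turns the latter into expansions by \<open>p\<close>-th powers,
      so the count gains a factor \<open>card Z\<close>.\<close>
    define U' where "U' = (\<lambda>(z, u). z \<otimes> u [^] p) ` (Z \<times> U)"
    have U': "finite U'" "U' \<subseteq> carrier R" using U assms by (auto simp: U'_def)
    have "card U' \<le> card Z * card U" unfolding U'_def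
      using card_image_le[of "Z \<times> U"] U assms by (simp add: card_cartesian_product)
    also have "\<dots> \<le> card Z * (card T * card Z ^ e)" using U by simp
    finally have cU': "card U' \<le> card T * card Z ^ Suc e" by (simp add: ac_simps)
    have le: "(a * p ^ Suc e + 2 * D) div p + D \<le> a * p ^ e + 2 * D"
    proof -
      have "a * p ^ Suc e + 2 * D = 2 * D + (a * p ^ e) * p" by simp
      then have "(a * p ^ Suc e + 2 * D) div p = a * p ^ e + 2 * D div p"
        using p_pos by (metis div_mult_self1 add.commute less_not_refl2)
      moreover have "2 * D div p \<le> 2 * D div 2" using p_ge2 by (intro div_le_mono2) auto
      ultimately show ?thesis by simp
    qed
    have *: "s [^] p \<otimes> x \<in> tspan R K (p ^ Suc e) Q U'"
      if "x \<in> tspan R (V ((a * p ^ Suc e + 2 * D) div p + D)) p Q Z" for x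
      using that
    proof induction
      case (base w)
      then show ?case using s Q.I_l_closed by (auto intro: tspan.base)
    next
      case (step x f z)
      have f: "f \<in> V (a * p ^ e + 2 * D)" using step(2) V_mono[OF le] by blast
      have c: "f \<in> carrier R" "z \<in> carrier R" using V_carr[OF f] step assms by auto
      have xc: "x \<in> carrier R" using step(1)
      proof induction
        case (base w)
        then show ?case by (rule Q.Icarr)
      next
        case (step x c u)
        then show ?case using V_carr[of c] assms by auto
      qed
      have "(s \<otimes> f) [^] p \<in> tspan R K (p ^ e * p) Q ((\<lambda>u. u [^] p) ` U)"
        by (rule TK.tspan_frob[OF U(4)[OF f] U(2)])
      then have "z \<otimes> (s \<otimes> f) [^] p \<in> tspan R K (p ^ e * p) Q ((\<lambda>u. z \<otimes> u) ` (\<lambda>u. u [^] p) ` U)"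
        using U c by (intro TK.tspan_image_mult) auto
      also have "\<dots> \<subseteq> tspan R K (p ^ e * p) Q U'"
        by (rule tspan_mono) (use step(3) in \<open>auto simp: U'_def\<close>)
      finally have 1: "z \<otimes> (s \<otimes> f) [^] p \<in> tspan R K (p ^ Suc e) Q U'" by (simp add: mult.commute)
      have "s [^] p \<otimes> (x \<oplus> f [^] p \<otimes> z) = s [^] p \<otimes> x \<oplus> z \<otimes> (s \<otimes> f) [^] p"
        using s c xc by (simp add: r_distr nat_pow_distrib m_ac)
      then show ?case using TK.tspan_add[OF step.IH 1 U'(2)] by simp
    qed
    have "(s [^] p \<otimes> t [^] p) \<otimes> v \<in> tspan R K (p ^ Suc e) Q U'" if "v \<in> V (a * p ^ Suc e + 2 * D)" for v
      using *[OF t(3)[OF that]] s t V_carr[OF that] by (simp add: m_assoc)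
    moreover have "s [^] p \<otimes> t [^] p \<in> carrier R - Q"
      using T.dom[of "s [^] p" "t [^] p"] T.pow_notin[OF s, of p] T.pow_notin[OF t(1,2), of p] s t by auto
    ultimately show ?case using U' cU' by blast
  qed
  show thesis
  proof (rule that)
    fix e
    obtain s U where s: "s \<in> carrier R - Q" "finite U" "U \<subseteq> carrier R" "card U \<le> card T * card Z ^ e"
      "\<forall>v\<in>V (a * p ^ e + 2 * D). s \<otimes> v \<in> tspan R K (p ^ e) Q U" using main[of e] by blast
    moreover have "V (a * p ^ e) \<subseteq> V (a * p ^ e + 2 * D)" by (rule V_mono) simp
    ultimately show "\<exists>t\<in>carrier R - Q. \<exists>U. finite U \<and> U \<subseteq> carrier R \<and> card U \<le> card T * card Z ^ e
      \<and> (\<forall>v\<in>V (a * p ^ e). t \<otimes> v \<in> tspan R K (p ^ e) Q U)" by blast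
  qed
qed

text \<open>Used to move an independent family into a degree part. The unit enters as a
  \<open>p\<close>-th power, since that is what the coefficients can absorb.\<close>

lemma tindep_unit_multiple:
  assumes "primeideal Q R" "tindep R (carrier R) p Q {..<n} y" "y \<in> {..<n} \<rightarrow> carrier R" "u \<in> Units R"
  shows "tindep R (carrier R) p Q {..<n} (\<lambda>i. u [^] p \<otimes> y i)"
  unfolding tindep_def
proof (intro ballI impI)
  interpret Q: primeideal Q R by fact
  fix c i assume c: "c \<in> {..<n} \<rightarrow> carrier R" "(\<Oplus>i\<in>{..<n}. c i [^] p \<otimes> (u [^] p \<otimes> y i)) \<in> Q" "i \<in> {..<n}"
  have uc: "u \<in> carrier R" using assms by auto
  have "(\<Oplus>i\<in>{..<n}. c i [^] p \<otimes> (u [^] p \<otimes> y i)) = (\<Oplus>i\<in>{..<n}. (c i \<otimes> u) [^] p \<otimes> y i)"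
    using c uc assms by (intro finsum_cong') (auto simp: nat_pow_distrib m_assoc Pi_def)
  then have "(\<Oplus>i\<in>{..<n}. (c i \<otimes> u) [^] p \<otimes> y i) \<in> Q" using c by simp
  moreover have "(\<lambda>i. c i \<otimes> u) \<in> {..<n} \<rightarrow> carrier R" using c uc by auto
  ultimately have "\<forall>i\<in>{..<n}. c i \<otimes> u \<in> Q"
    using assms(2)[unfolded tindep_def, rule_format, of "\<lambda>i. c i \<otimes> u"] by blast
  then have "c i \<otimes> u \<in> Q" using c(3) by blast
  then show "c i \<in> Q" using Q.I_prime[of "c i" u] unit_notin_prime[OF assms(1,4)] c uc by auto
qed

text \<open>Multiplicativity of degrees in the tower of fields k, k^p, k^(p^2) and so on: a family
  at level \<open>e\<close> is raised to the \<open>p\<close>-th power and multiplied by the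
  \<open>y j\<close>. The degrees D, pD, up to p^(e-1) D add up to at most
  \<open>D * (p ^ e - 1)\<close>, because \<open>p\<close> is at least two.\<close>

lemma tindep_tower:
  fixes m :: nat
  assumes "primeideal Q R" "tindep R (carrier R) p Q {..<m} y" "y \<in> {..<m} \<rightarrow> V D"
  shows "\<exists>Y\<in>{..<m ^ e} \<rightarrow> V (D * (p ^ e - 1)). tindep R (carrier R) (p ^ e) Q {..<m ^ e} Y"
proof (induction e)
  case 0
  have one: "{..<1::nat} = {0}" by auto
  have "c 0 \<in> Q" if "c \<in> {..<1} \<rightarrow> carrier R" "(\<Oplus>i\<in>{..<1::nat}. c i [^] (1::nat) \<otimes> \<one>) \<in> Q" for c
  proof -
    have "c 0 \<in> carrier R" using that by auto
    then show ?thesis using that(2) unfolding one by simp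
  qed
  then have "tindep R (carrier R) (p ^ 0) Q {..<m ^ 0} (\<lambda>_. \<one>)"
    unfolding tindep_def power_0 one by (simp only: ball_simps) blast
  then show ?case using V_one by auto
next
  case (Suc e)
  interpret Q: primeideal Q R by fact
  obtain Y where Y: "Y \<in> {..<m ^ e} \<rightarrow> V (D * (p ^ e - 1))" "tindep R (carrier R) (p ^ e) Q {..<m ^ e} Y"
    using Suc by blast
  define Y' where "Y' = (\<lambda>i. y (i div m ^ e) \<otimes> Y (i mod m ^ e) [^] p)"
  have ym: "y j \<in> V D" "y j \<in> carrier R" if "j < m" for j using assms(3) that V_carr[of "y j"] by auto
  have Ym: "Y l \<in> V (D * (p ^ e - 1))" "Y l \<in> carrier R" if "l < m ^ e" for l
    using Y(1) that V_carr[of "Y l"] by auto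
  have idx: "i div m ^ e < m" "i mod m ^ e < m ^ e" if "i < m * m ^ e" for i
  proof -
    have "m ^ e > 0" using that by (cases "m ^ e = 0") auto
    then show "i mod m ^ e < m ^ e" by simp
    show "i div m ^ e < m" using that by (simp add: less_mult_imp_div_less)
  qed
  have idx2: "j * m ^ e + l < m * m ^ e" if "j < m" "l < m ^ e" for j l
  proof -
    have "j * m ^ e + l < Suc j * m ^ e" using that by simp
    also have "\<dots> \<le> m * m ^ e" using that by (intro mult_le_mono1) auto
    finally show ?thesis .
  qed
  have deg: "D + p * (D * (p ^ e - 1)) \<le> D * (p ^ Suc e - 1)"
  proof -
    have "p * (p ^ e - 1) = p ^ Suc e - p" by (simp add: diff_mult_distrib2)
    moreover have "p \<le> p ^ Suc e" using p_pos power_increasing[of 1 "Suc e" p] by simp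
    ultimately have "1 + p * (p ^ e - 1) \<le> p ^ Suc e - 1" using p_ge2 by linarith
    then have "D * (1 + p * (p ^ e - 1)) \<le> D * (p ^ Suc e - 1)" by (rule mult_le_mono2)
    then show ?thesis by (simp add: algebra_simps)
  qed
  have Y'V: "Y' i \<in> V (D * (p ^ Suc e - 1))" if "i < m * m ^ e" for i
    using V_mult[OF ym(1)[OF idx(1)] V_pow[OF Ym(1)[OF idx(2)], of _ p]] that V_mono[OF deg]
    unfolding Y'_def by blast
  have "tindep R (carrier R) (p ^ Suc e) Q {..<m * m ^ e} Y'"
    unfolding tindep_def
  proof (intro ballI impI)
    fix c i assume c: "c \<in> {..<m * m ^ e} \<rightarrow> carrier R" "(\<Oplus>i\<in>{..<m * m ^ e}. c i [^] (p ^ Suc e) \<otimes> Y' i) \<in> Q"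
      and i: "i \<in> {..<m * m ^ e}"
    have cc: "c (j * m ^ e + l) \<in> carrier R" if "j < m" "l < m ^ e" for j l
      using c(1) idx2[OF that] by auto
    \<comment> \<open>Grouping by \<open>j\<close> makes the outer coefficients \<open>p\<close>-th
      powers of the \<open>w j\<close>. Independence of \<open>y\<close> puts these into
      \<open>Q\<close>, and then the induction hypothesis applies to each
      \<open>w j\<close>.\<close>
    define w where "w = (\<lambda>j. \<Oplus>l\<in>{..<m ^ e}. c (j * m ^ e + l) [^] (p ^ e) \<otimes> Y l)"
    have wc: "w j \<in> carrier R" if "j < m" for j
      unfolding w_def using cc that Ym by (intro finsum_closed) auto
    have inner: "(\<Oplus>l\<in>{..<m ^ e}. c (j * m ^ e + l) [^] (p ^ Suc e) \<otimes> Y' (j * m ^ e + l)) = w j [^] p \<otimes> y j"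
      if j: "j < m" for j
    proof -
      have "w j [^] p = (\<Oplus>l\<in>{..<m ^ e}. (c (j * m ^ e + l) [^] (p ^ e) \<otimes> Y l) [^] p)"
        unfolding w_def using cc[OF j] Ym by (intro frob_finsum1) auto
      then have "w j [^] p \<otimes> y j = (\<Oplus>l\<in>{..<m ^ e}. (c (j * m ^ e + l) [^] (p ^ e) \<otimes> Y l) [^] p \<otimes> y j)"
        using cc[OF j] Ym ym[OF j] by (simp add: finsum_ldistr)
      also have "\<dots> = (\<Oplus>l\<in>{..<m ^ e}. c (j * m ^ e + l) [^] (p ^ Suc e) \<otimes> Y' (j * m ^ e + l))"
      proof (rule finsum_cong')
        fix l assume "l \<in> {..<m ^ e}"
        then have l: "l < m ^ e" by simp
        have e: "(j * m ^ e + l) div m ^ e = j" "(j * m ^ e + l) mod m ^ e = l"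
          using l div_mult_self3[of "m ^ e" j l] by (cases "m ^ e = 0"; simp)+
        show "(c (j * m ^ e + l) [^] (p ^ e) \<otimes> Y l) [^] p \<otimes> y j
            = c (j * m ^ e + l) [^] (p ^ Suc e) \<otimes> Y' (j * m ^ e + l)"
          unfolding Y'_def e using cc[OF j l] Ym(2)[OF l] ym(2)[OF j]
          by (simp add: nat_pow_distrib nat_pow_pow m_assoc mult.commute[of p] m_comm)
      qed (use cc[OF j] V_carr[OF Y'V] idx2[OF j] in \<open>auto simp del: power_Suc\<close>)
      finally show ?thesis by simp
    qed
    have "(\<Oplus>i\<in>{..<m * m ^ e}. c i [^] (p ^ Suc e) \<otimes> Y' i)
      = (\<Oplus>j\<in>{..<m}. \<Oplus>l\<in>{..<m ^ e}. c (j * m ^ e + l) [^] (p ^ Suc e) \<otimes> Y' (j * m ^ e + l))"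
      using c(1) V_carr[OF Y'V] by (intro finsum_group) (auto simp del: power_Suc)
    also have "\<dots> = (\<Oplus>j\<in>{..<m}. w j [^] p \<otimes> y j)"
      using inner wc ym by (intro finsum_cong') auto
    finally have "(\<Oplus>j\<in>{..<m}. w j [^] p \<otimes> y j) \<in> Q" using c(2) by simp
    moreover have "w \<in> {..<m} \<rightarrow> carrier R" using wc by auto
    ultimately have wQ: "\<forall>j\<in>{..<m}. w j \<in> Q"
      using assms(2)[unfolded tindep_def, rule_format, of w] by blast
    define j l where "j = i div m ^ e" and "l = i mod m ^ e"
    have jl: "j < m" "l < m ^ e" using idx i by (auto simp: j_def l_def)
    have "(\<lambda>l. c (j * m ^ e + l)) \<in> {..<m ^ e} \<rightarrow> carrier R" using cc[OF jl(1)] by auto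
    moreover have "(\<Oplus>l\<in>{..<m ^ e}. c (j * m ^ e + l) [^] (p ^ e) \<otimes> Y l) \<in> Q"
      using wQ jl by (simp add: w_def)
    ultimately have "\<forall>l\<in>{..<m ^ e}. c (j * m ^ e + l) \<in> Q"
      using Y(2)[unfolded tindep_def, rule_format, of "\<lambda>l. c (j * m ^ e + l)"] by blast
    then have "c (j * m ^ e + l) \<in> Q" using jl by blast
    moreover have "j * m ^ e + l = i" unfolding j_def l_def by (rule div_mult_mod_eq)
    ultimately show "c i \<in> Q" by simp
  qed
  then show ?case using Y'V by (intro bexI[of _ Y']) auto
qed

text \<open>Modulo \<open>Q'\<close> all terms with a positive power of \<open>x\<close> disappear,
  which leaves \<open>w 0\<close> in \<open>Q'\<close>, so it is zero. As \<open>x\<close> is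
  outside \<open>Q\<close>, one factor \<open>x\<close> can be cancelled modulo \<open>Q\<close>,
  and the argument repeats.\<close>

lemma power_combination_vanishes:
  fixes N :: nat and w :: "nat \<Rightarrow> 'a"
  assumes "primeideal Q R" "primeideal Q' R" "Q \<subseteq> Q'" "x \<in> Q'" "x \<notin> Q"
    "\<And>l. l < N \<Longrightarrow> w l \<in> carrier R" "\<And>l. l < N \<Longrightarrow> w l \<in> Q' \<Longrightarrow> w l = \<zero>"
    "(\<Oplus>l\<in>{..<N}. x [^] l \<otimes> w l) \<in> Q"
  shows "\<forall>l<N. w l = \<zero>"
  using assms(6-8)
proof (induction N arbitrary: w)
  case (Suc N)
  interpret Q: primeideal Q R by fact
  interpret Q': primeideal Q' R by fact
  have xc: "x \<in> carrier R" using assms(4) by (rule Q'.Icarr)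
  have wc: "w l \<in> carrier R" if "l < Suc N" for l using Suc.prems(1) that by blast
  define S where "S = (\<Oplus>l\<in>{..<N}. x [^] l \<otimes> w (Suc l))"
  have Sc: "S \<in> carrier R" unfolding S_def using xc wc by (intro finsum_closed) auto
  have "(\<Oplus>l\<in>{..<Suc N}. x [^] l \<otimes> w l) = x [^] (0::nat) \<otimes> w 0 \<oplus> (\<Oplus>l\<in>{..<N}. x [^] Suc l \<otimes> w (Suc l))"
    using xc wc by (intro finsum_lessThan_Suc_shift) auto
  also have "(\<Oplus>l\<in>{..<N}. x [^] Suc l \<otimes> w (Suc l)) = (\<Oplus>l\<in>{..<N}. x \<otimes> (x [^] l \<otimes> w (Suc l)))"
    using xc wc by (intro finsum_cong') (auto simp: m_ac)
  also have "\<dots> = x \<otimes> S" unfolding S_def using xc wc by (intro finsum_rdistr[symmetric]) auto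
  finally have eq: "w 0 \<oplus> x \<otimes> S \<in> Q" using Suc.prems(3) wc[of 0] xc by simp
  have "x \<otimes> S \<in> Q'" using assms(4) Sc by (rule Q'.I_r_closed)
  moreover have "w 0 = (w 0 \<oplus> x \<otimes> S) \<ominus> x \<otimes> S"
    using wc[of 0] xc Sc by (simp add: minus_eq a_assoc r_neg)
  ultimately have "w 0 \<in> Q'" using eq assms(3)
    by (metis (no_types, lifting) Q'.a_closed Q'.a_inv_closed minus_eq subsetD)
  then have w0: "w 0 = \<zero>" using Suc.prems(2) by blast
  then have "x \<otimes> S \<in> Q" using eq Sc xc by simp
  then have "S \<in> Q" using Q.I_prime[OF xc Sc] assms(5) by blast
  then have "\<forall>l<N. w (Suc l) = \<zero>"
    using Suc.prems(2) wc by (intro Suc.IH) (auto simp: S_def)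
  then show ?case using w0 by (auto simp: less_Suc_eq_0_disj)
qed simp

lemma prank_step_aux:
  fixes m :: nat
  assumes "primeideal Q R" "primeideal Q' R" "Q \<subset> Q'"
    "tindep R (carrier R) p Q' {..<m} y" "y \<in> {..<m} \<rightarrow> carrier R"
    "pspans R p (carrier R) Q Z" "finite Z" "Z \<subseteq> carrier R"
  shows "p * m \<le> card Z"
proof -
  interpret Q: primeideal Q R by fact
  interpret Q': primeideal Q' R by fact
  interpret T: twisted_prime R p "carrier R" Q by (rule twisted_primeI[OF assms(1) carrier_is_subring])
  interpret TK: twisted_prime R p K Q by (rule twisted_primeI[OF assms(1) sub_K])
  interpret TK': twisted R p K Q' by (rule twistedI[OF Q'.is_ideal sub_K])
  obtain x0 where x0: "x0 \<in> Q'" "x0 \<notin> Q" using assms(3) by blast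
  have x0c: "x0 \<in> carrier R" using x0 Q'.Icarr by blast
  \<comment> \<open>An element of \<open>R\<close> need not lie in any degree part; it does after
    multiplication by a suitable unit.\<close>
  have "\<exists>u\<in>Units R. \<exists>d. u \<in> V d \<and> (\<forall>a\<in>insert x0 (y ` {..<m}). u \<otimes> a \<in> V d)"
    using x0c assms(5) by (intro unit_multiple) auto
  then obtain u d where u: "u \<in> Units R" "u \<in> V d" "u \<otimes> x0 \<in> V d" "\<And>i. i < m \<Longrightarrow> u \<otimes> y i \<in> V d"
    by auto
  have uc: "u \<in> carrier R" using u by auto
  define x where "x = u \<otimes> x0"
  have x: "x \<in> Q'" "x \<notin> Q" "x \<in> V d" "x \<in> carrier R"
    using x0 x0c uc u Q'.I_l_closed[OF x0(1) uc] Q.I_prime[OF uc x0c] unit_notin_prime[OF assms(1) u(1)]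
    by (auto simp: x_def)
  \<comment> \<open>\<open>u [^] p \<otimes> y i\<close> is \<open>p - 1\<close> further factors
    \<open>u\<close> times \<open>u \<otimes> y i\<close>, each of degree \<open>d\<close>.\<close>
  define D where "D = p * d"
  have dD: "d \<le> D" using p_pos by (simp add: D_def)
  define y' where "y' = (\<lambda>i. u [^] p \<otimes> y i)"
  have y': "y' \<in> {..<m} \<rightarrow> V D"
  proof
    fix i assume "i \<in> {..<m}"
    then have i: "i < m" "y i \<in> carrier R" using assms(5) by auto
    obtain r where r: "p = Suc r" using p_pos gr0_implies_Suc by blast
    have "u [^] r \<otimes> (u \<otimes> y i) \<in> V (r * d + d)" by (rule V_mult[OF V_pow[OF u(2)] u(4)[OF i(1)]])
    moreover have "u [^] r \<otimes> (u \<otimes> y i) = y' i" using uc i by (simp add: y'_def r m_assoc)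
    ultimately show "y' i \<in> V D" by (simp add: D_def r add.commute)
  qed
  have ind': "tindep R (carrier R) p Q' {..<m} y'"
    unfolding y'_def by (rule tindep_unit_multiple[OF assms(2,4,5) u(1)])
  \<comment> \<open>A power of \<open>x\<close> with exponent below \<open>p ^ e\<close> and an
    element of the tower each have degree at most \<open>D * p ^ e\<close>; hence the factor
    two.\<close>
  obtain C where C: "\<And>e. \<exists>t\<in>carrier R - Q. \<exists>U. finite U \<and> U \<subseteq> carrier R \<and> card U \<le> C * card Z ^ e
      \<and> (\<forall>v\<in>V (2 * D * p ^ e). t \<otimes> v \<in> tspan R K (p ^ e) Q U)"
    by (rule degree_part_span[OF assms(1,6,7,8), of "2 * D"]) blast
  have bound: "(p * m) ^ e \<le> C * card Z ^ e" for e
  proof (rule ccontr)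
    assume gt: "\<not> (p * m) ^ e \<le> C * card Z ^ e"
    obtain t U where tU: "t \<in> carrier R" "t \<notin> Q" "finite U" "U \<subseteq> carrier R" "card U \<le> C * card Z ^ e"
      "\<And>v. v \<in> V (2 * D * p ^ e) \<Longrightarrow> t \<otimes> v \<in> tspan R K (p ^ e) Q U" using C[of e] by blast
    obtain Y where Y: "Y \<in> {..<m ^ e} \<rightarrow> V (D * (p ^ e - 1))" "tindep R (carrier R) (p ^ e) Q' {..<m ^ e} Y"
      using tindep_tower[OF assms(2) ind' y', of e] by blast
    have Ym: "Y l \<in> V (D * p ^ e)" "Y l \<in> carrier R" if "l < m ^ e" for l
    proof -
      have "D * (p ^ e - 1) \<le> D * p ^ e" by (intro mult_le_mono2) simp
      then show "Y l \<in> V (D * p ^ e)" using Y(1) that V_mono by blast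
      then show "Y l \<in> carrier R" by (rule V_carr)
    qed
    let ?M = "m ^ e" and ?N = "p ^ e"
    define v where "v = (\<lambda>i. x [^] (i div ?M) \<otimes> Y (i mod ?M))"
    have idx: "i div ?M < ?N" "i mod ?M < ?M" if "i < ?N * ?M" for i
    proof -
      have "?M > 0" using that by (cases "?M = 0") auto
      then show "i mod ?M < ?M" by simp
      show "i div ?M < ?N" using that by (simp add: less_mult_imp_div_less)
    qed
    have idx2: "j * ?M + l < ?N * ?M" if "j < ?N" "l < ?M" for j l
    proof -
      have "j * ?M + l < Suc j * ?M" using that by simp
      also have "\<dots> \<le> ?N * ?M" using that by (intro mult_le_mono1) auto
      finally show ?thesis .
    qed
    have vV: "v i \<in> V (2 * D * p ^ e)" if i: "i < ?N * ?M" for i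
    proof -
      have "v i \<in> V ((i div ?M) * d + D * p ^ e)"
        unfolding v_def by (rule V_mult[OF V_pow[OF x(3)] Ym(1)[OF idx(2)[OF i]]])
      moreover have "(i div ?M) * d \<le> p ^ e * D" using idx(1)[OF i] dD by (intro mult_le_mono) auto
      then have "(i div ?M) * d + D * p ^ e \<le> 2 * D * p ^ e" by (simp add: mult.commute)
      ultimately show ?thesis using V_mono by blast
    qed
    have vc: "v i \<in> carrier R" if "i < ?N * ?M" for i using V_carr[OF vV[OF that]] .
    \<comment> \<open>The coefficients of this relation come from \<open>K\<close>, the ring over
      which \<open>U\<close> spans; the next steps depend on that.\<close>
    have "\<not> tindep R K (p ^ e) Q {..<?N * ?M} (\<lambda>i. t \<otimes> v i)"
    proof (rule TK.tspan_exchange[OF tU(3,4)])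
      show "(\<lambda>i. t \<otimes> v i) \<in> {..<?N * ?M} \<rightarrow> carrier R" using tU vc by auto
      show "card U < card {..<?N * ?M}" using tU gt by (simp add: power_mult_distrib)
      fix i assume "i \<in> {..<?N * ?M}"
      then have "\<one> [^] (p ^ e) \<otimes> (t \<otimes> v i) \<in> tspan R K (p ^ e) Q U"
        using tU(6)[OF vV] vc tU(1) by simp
      then show "\<exists>s\<in>K - Q. s [^] (p ^ e) \<otimes> (t \<otimes> v i) \<in> tspan R K (p ^ e) Q U"
        using TK.S_one TK.one_notin by blast
    qed simp
    then obtain c k where c: "c \<in> {..<?N * ?M} \<rightarrow> K" "(\<Oplus>i\<in>{..<?N * ?M}. c i [^] (p ^ e) \<otimes> (t \<otimes> v i)) \<in> Q"
      "k < ?N * ?M" "c k \<notin> Q" unfolding tindep_def by blast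
    have cK: "c i \<in> K" "c i \<in> carrier R" if "i < ?N * ?M" for i using c(1) that K_carr by auto
    have "(\<Oplus>i\<in>{..<?N * ?M}. c i [^] (p ^ e) \<otimes> (t \<otimes> v i)) = (\<Oplus>i\<in>{..<?N * ?M}. t \<otimes> (c i [^] (p ^ e) \<otimes> v i))"
      using cK vc tU(1) by (intro finsum_cong') (auto simp: m_ac)
    also have "\<dots> = t \<otimes> (\<Oplus>i\<in>{..<?N * ?M}. c i [^] (p ^ e) \<otimes> v i)"
      using cK vc tU(1) by (intro finsum_rdistr[symmetric]) auto
    finally have "t \<otimes> (\<Oplus>i\<in>{..<?N * ?M}. c i [^] (p ^ e) \<otimes> v i) \<in> Q" using c(2) by simp
    moreover have "(\<Oplus>i\<in>{..<?N * ?M}. c i [^] (p ^ e) \<otimes> v i) \<in> carrier R"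
      using cK vc by (intro finsum_closed) auto
    ultimately have rel: "(\<Oplus>i\<in>{..<?N * ?M}. c i [^] (p ^ e) \<otimes> v i) \<in> Q"
      using Q.I_prime[OF tU(1)] tU(2) by blast
    define w where "w = (\<lambda>j. \<Oplus>l\<in>{..<?M}. c (j * ?M + l) [^] (p ^ e) \<otimes> Y l)"
    have cjl: "c (j * ?M + l) \<in> K" "c (j * ?M + l) \<in> carrier R" if "j < ?N" "l < ?M" for j l
      using cK[OF idx2[OF that]] by auto
    have wc: "w j \<in> carrier R" if "j < ?N" for j
      unfolding w_def using cjl[OF that] Ym by (intro finsum_closed) auto
    \<comment> \<open>Independence modulo \<open>Q'\<close> only puts coefficients into
      \<open>Q'\<close>. Since \<open>K\<close> meets \<open>Q'\<close> in zero, they vanish, and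
      this is what allows passing between the two primes.\<close>
    have czero: "c (j * ?M + l) = \<zero>" if "j < ?N" "w j \<in> Q'" "l < ?M" for j l
    proof -
      have "(\<lambda>l. c (j * ?M + l)) \<in> {..<?M} \<rightarrow> carrier R" using cjl(2)[OF that(1)] by auto
      then have "\<forall>l\<in>{..<?M}. c (j * ?M + l) \<in> Q'"
        using Y(2)[unfolded tindep_def, rule_format, of "\<lambda>l. c (j * ?M + l)"] that(2) by (auto simp: w_def)
      then show ?thesis using K_meets_prime[OF assms(2) cjl(1)[OF that(1,3)]] that(3) by blast
    qed
    have wzero: "w j = \<zero>" if "j < ?N" "w j \<in> Q'" for j
      unfolding w_def using czero[OF that] Ym(2) by (intro add.finprod_one_eqI) auto
    have "(\<Oplus>i\<in>{..<?N * ?M}. c i [^] (p ^ e) \<otimes> v i)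
      = (\<Oplus>j\<in>{..<?N}. \<Oplus>l\<in>{..<?M}. c (j * ?M + l) [^] (p ^ e) \<otimes> v (j * ?M + l))"
      using cK vc by (intro finsum_group) auto
    also have "\<dots> = (\<Oplus>j\<in>{..<?N}. x [^] j \<otimes> w j)"
    proof (rule finsum_cong')
      fix j assume "j \<in> {..<?N}"
      then have j: "j < ?N" by simp
      have "x [^] j \<otimes> w j = (\<Oplus>l\<in>{..<?M}. x [^] j \<otimes> (c (j * ?M + l) [^] (p ^ e) \<otimes> Y l))"
        unfolding w_def using x cjl[OF j] Ym by (intro finsum_rdistr) auto
      also have "\<dots> = (\<Oplus>l\<in>{..<?M}. c (j * ?M + l) [^] (p ^ e) \<otimes> v (j * ?M + l))"
      proof (rule finsum_cong')
        fix l assume "l \<in> {..<?M}"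
        then have l: "l < ?M" by simp
        have e: "(j * ?M + l) div ?M = j" "(j * ?M + l) mod ?M = l"
          using l div_mult_self3[of ?M j l] by (cases "?M = 0"; simp)+
        show "x [^] j \<otimes> (c (j * ?M + l) [^] (p ^ e) \<otimes> Y l) = c (j * ?M + l) [^] (p ^ e) \<otimes> v (j * ?M + l)"
          unfolding v_def e using x cjl(2)[OF j l] Ym(2)[OF l] by (simp add: m_lcomm)
      qed (use cjl[OF j] vc idx2[OF j] in auto)
      finally show "(\<Oplus>l\<in>{..<?M}. c (j * ?M + l) [^] (p ^ e) \<otimes> v (j * ?M + l)) = x [^] j \<otimes> w j" by simp
    qed (use x wc in auto)
    finally have "(\<Oplus>j\<in>{..<?N}. x [^] j \<otimes> w j) \<in> Q" using rel by simp
    then have w0: "\<forall>j<?N. w j = \<zero>"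
      using assms(1,2,3) x wc wzero
      by (intro power_combination_vanishes[of Q Q' x ?N w]) auto
    have "w (k div ?M) \<in> Q'" using w0 idx[OF c(3)] by simp
    then have "c ((k div ?M) * ?M + k mod ?M) = \<zero>" using czero idx[OF c(3)] by blast
    moreover have "(k div ?M) * ?M + k mod ?M = k" by (rule div_mult_mod_eq)
    ultimately show False using c(4) TK.Q_zero by metis
  qed
  \<comment> \<open>An inequality between exponentials, up to a constant and valid for all
    \<open>e\<close>, forces the inequality between the bases.\<close>
  show ?thesis
  proof (rule ccontr)
    assume "\<not> p * m \<le> card Z"
    then have lt: "card Z < p * m" by simp
    show False
    proof (cases "card Z = 0")
      case True
      then show False using bound[of 1] lt by simp
    next
      case False
      define r where "r = real (p * m) / real (card Z)"
      have "real (card Z) < real (p * m)" using lt of_nat_less_iff by blast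
      then have "r > 1" using False by (simp add: r_def)
      then obtain e where e: "real C < r ^ e" using real_arch_pow by blast
      have "real ((p * m) ^ e) \<le> real (C * card Z ^ e)" using bound[of e] of_nat_le_iff by blast
      then have "r ^ e \<le> real C" using False by (simp add: r_def power_divide divide_simps)
      then show False using e by simp
    qed
  qed
qed

subsection \<open>The rank function\<close>

lemma pbounded_prime: "primeideal Q R \<Longrightarrow> pbounded R p (carrier R) Q"
  by (rule pbounded_carrier[OF _ H])

text \<open>The degree [kappa(Q) : kappa(Q)^p] of the residue field at \<open>Q\<close> over its
  \<open>p\<close>-th powers. The maximum exists at a prime by
  \<open>pbounded_prime\<close>.\<close>

definition prank :: "'a set \<Rightarrow> nat" where
  "prank Q = (GREATEST n. pind R p (carrier R) Q n)"

lemma prank_basis: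
  assumes "primeideal Q R"
  obtains v where "v \<in> {..<prank Q} \<rightarrow> carrier R" "tindep R (carrier R) p Q {..<prank Q} v"
    "pspans R p (carrier R) Q (v ` {..<prank Q})"
proof -
  interpret T: twisted_prime R p "carrier R" Q by (rule twisted_primeI[OF assms carrier_is_subring])
  obtain n v where nv: "v \<in> {..<n} \<rightarrow> carrier R" "tindep R (carrier R) p Q {..<n} v"
    "pspans R p (carrier R) Q (v ` {..<n})" "\<And>m. pind R p (carrier R) Q m \<Longrightarrow> m \<le> n"
    by (rule T.pbounded_basis[OF pbounded_prime[OF assms]]) blast
  have "pind R p (carrier R) Q n" unfolding pind_def using nv by blast
  then have "prank Q = n" unfolding prank_def using nv(4) by (intro Greatest_equality) auto
  then show thesis using that nv by blast
qed

lemma prank_le_card: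
  assumes "primeideal Q R" "pspans R p (carrier R) Q Z" "finite Z" "Z \<subseteq> carrier R"
  shows "prank Q \<le> card Z"
proof -
  interpret T: twisted_prime R p "carrier R" Q by (rule twisted_primeI[OF assms(1) carrier_is_subring])
  obtain v where "v \<in> {..<prank Q} \<rightarrow> carrier R" "tindep R (carrier R) p Q {..<prank Q} v"
    by (rule prank_basis[OF assms(1)])
  then show ?thesis using T.pspans_card[OF assms(2-4)] unfolding pind_def by blast
qed

theorem prank_strict:
  assumes "primeideal Q R" "primeideal Q' R" "Q \<subset> Q'"
  shows "p * prank Q' \<le> prank Q"
proof -
  obtain v where v: "v \<in> {..<prank Q'} \<rightarrow> carrier R" "tindep R (carrier R) p Q' {..<prank Q'} v"
    by (rule prank_basis[OF assms(2)])
  obtain z where z: "z \<in> {..<prank Q} \<rightarrow> carrier R" "pspans R p (carrier R) Q (z ` {..<prank Q})"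
    by (rule prank_basis[OF assms(1)])
  have "p * prank Q' \<le> card (z ` {..<prank Q})"
    using prank_step_aux[OF assms v(2,1) z(2)] z(1) by auto
  also have "\<dots> \<le> prank Q" using card_image_le[of "{..<prank Q}" z] by simp
  finally show ?thesis .
qed

lemma prank_chain:
  assumes "\<And>i. i \<le> d \<Longrightarrow> primeideal (Qs i) R" "\<And>i. i < d \<Longrightarrow> Qs i \<subset> Qs (Suc i)"
  shows "p ^ d * prank (Qs d) \<le> prank (Qs 0)"
  using assms
proof (induction d)
  case (Suc d)
  have "p * prank (Qs (Suc d)) \<le> prank (Qs d)"
    using Suc.prems(1)[of d] Suc.prems(1)[of "Suc d"] Suc.prems(2)[of d] by (intro prank_strict) auto
  then have "p ^ d * (p * prank (Qs (Suc d))) \<le> p ^ d * prank (Qs d)" by (rule mult_le_mono2)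
  also have "\<dots> \<le> prank (Qs 0)" using Suc by auto
  finally show ?case by (simp add: ac_simps)
qed simp

end

section \<open>Localization\<close>

text \<open>The operations of \<open>localization\<close> are unions over all representatives. Such
  a union collapses to one class when the choice of representatives does not matter and both classes
  are inhabited.\<close>

lemma union_representatives:
  assumes "\<And>a b a' b'. (a, b) \<in> x \<Longrightarrow> (a', b') \<in> y \<Longrightarrow> f a b a' b' = C" "(r, s) \<in> x" "(r', s') \<in> y"
  shows "(\<Union>(a, b)\<in>x. \<Union>(a', b')\<in>y. f a b a' b') = C"
proof (intro equalityI subsetI)
  fix c assume "c \<in> (\<Union>(a, b)\<in>x. \<Union>(a', b')\<in>y. f a b a' b')"
  then obtain a b a' b' where "(a, b) \<in> x" "(a', b') \<in> y" "c \<in> f a b a' b'" by blast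
  then show "c \<in> C" using assms(1)[of a b a' b'] by simp
next
  fix c assume "c \<in> C"
  then have "c \<in> f r s r' s'" using assms(1)[OF assms(2,3)] by simp
  then show "c \<in> (\<Union>(a, b)\<in>x. \<Union>(a', b')\<in>y. f a b a' b')" using assms(2,3) by blast
qed

locale localize = cring A for A (structure) +
  fixes W assumes sub: "submonoid W A"
begin

abbreviation (input) "fr \<equiv> fraction A W"

lemma W_carr: "w \<in> W \<Longrightarrow> w \<in> carrier A" and W_one: "\<one> \<in> W"
  and W_mult: "w \<in> W \<Longrightarrow> v \<in> W \<Longrightarrow> w \<otimes> v \<in> W"
  using submonoid.subset[OF sub] submonoid.one_closed[OF sub] submonoid.m_closed[OF sub] by auto

text \<open>The relation inside \<open>fraction\<close> with the subtraction moved to the other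
  side: visibly symmetric, and open to rewriting by \<open>m_ac\<close>.\<close>

definition feq :: "'a \<Rightarrow> 'a \<Rightarrow> 'a \<Rightarrow> 'a \<Rightarrow> bool" where
  "feq r s r' s' \<longleftrightarrow> (\<exists>t\<in>W. t \<otimes> (s' \<otimes> r) = t \<otimes> (s \<otimes> r'))"

lemma feqI: "t \<in> W \<Longrightarrow> t \<otimes> (s' \<otimes> r) = t \<otimes> (s \<otimes> r') \<Longrightarrow> feq r s r' s'"
  unfolding feq_def by blast

lemma mem_fraction:
  assumes "r \<in> carrier A" "s \<in> W"
  shows "(r', s') \<in> fr r s \<longleftrightarrow> r' \<in> carrier A \<and> s' \<in> W \<and> feq r s r' s'"
proof -
  have "t \<otimes> (s' \<otimes> r \<ominus> s \<otimes> r') = \<zero> \<longleftrightarrow> t \<otimes> (s' \<otimes> r) = t \<otimes> (s \<otimes> r')"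
    if "t \<in> W" "s' \<in> W" "r' \<in> carrier A" for t
  proof -
    have c: "t \<in> carrier A" "s' \<in> carrier A" "s \<in> carrier A" using that assms W_carr by auto
    have "t \<otimes> (s' \<otimes> r \<ominus> s \<otimes> r') = t \<otimes> (s' \<otimes> r) \<ominus> t \<otimes> (s \<otimes> r')"
      using c assms that by (simp add: minus_eq r_distr r_minus)
    also have "\<dots> = \<zero> \<longleftrightarrow> t \<otimes> (s' \<otimes> r) = t \<otimes> (s \<otimes> r')"
      using c assms that r_right_minus_eq by simp
    finally show ?thesis .
  qed
  then show ?thesis unfolding fraction_def feq_def by blast
qed

lemma feq_refl: "r \<in> carrier A \<Longrightarrow> s \<in> W \<Longrightarrow> feq r s r s"
  by (rule feqI[OF W_one]) simp

lemma feq_sym: "feq r s r' s' \<Longrightarrow> feq r' s' r s"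
  unfolding feq_def by metis

lemma feq_trans:
  assumes "feq r s r' s'" "feq r' s' r'' s''" "r \<in> carrier A" "s \<in> W" "r' \<in> carrier A" "s' \<in> W"
    "r'' \<in> carrier A" "s'' \<in> W"
  shows "feq r s r'' s''"
proof -
  obtain t u where t: "t \<in> W" "t \<otimes> (s' \<otimes> r) = t \<otimes> (s \<otimes> r')"
    and u: "u \<in> W" "u \<otimes> (s'' \<otimes> r') = u \<otimes> (s' \<otimes> r'')" using assms unfolding feq_def by blast
  have c: "t \<in> carrier A" "u \<in> carrier A" "s \<in> carrier A" "s' \<in> carrier A" "s'' \<in> carrier A"
    using t u assms W_carr by auto
  have "(t \<otimes> (u \<otimes> s')) \<otimes> (s'' \<otimes> r) = (u \<otimes> s'') \<otimes> (t \<otimes> (s' \<otimes> r))" using c assms by (simp add: m_ac)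
  also have "\<dots> = (t \<otimes> s) \<otimes> (u \<otimes> (s'' \<otimes> r'))" unfolding t(2) using c assms by (simp add: m_ac)
  also have "\<dots> = (t \<otimes> (u \<otimes> s')) \<otimes> (s \<otimes> r'')" unfolding u(2) using c assms by (simp add: m_ac)
  finally show ?thesis using t u assms by (intro feqI[of "t \<otimes> (u \<otimes> s')"]) (auto intro: W_mult)
qed

lemma fraction_eq_iff:
  assumes "r \<in> carrier A" "s \<in> W" "r' \<in> carrier A" "s' \<in> W"
  shows "fr r s = fr r' s' \<longleftrightarrow> feq r s r' s'"
proof
  assume "fr r s = fr r' s'"
  moreover have "(r', s') \<in> fr r' s'" using assms by (simp add: mem_fraction feq_refl)
  ultimately show "feq r s r' s'" using assms mem_fraction by metis
next
  assume e: "feq r s r' s'"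
  have "(a, b) \<in> fr r s \<longleftrightarrow> (a, b) \<in> fr r' s'" for a b
    using assms e feq_trans[OF feq_sym[OF e], of a b] feq_trans[OF e, of a b] by (auto simp: mem_fraction)
  then show "fr r s = fr r' s'" by auto
qed

lemma fraction_refl: "r \<in> carrier A \<Longrightarrow> s \<in> W \<Longrightarrow> (r, s) \<in> fr r s"
  by (simp add: mem_fraction feq_refl)

lemma mult_fraction:
  assumes "r \<in> carrier A" "s \<in> W" "r' \<in> carrier A" "s' \<in> W"
  shows "fr r s \<otimes>\<^bsub>localization A W\<^esub> fr r' s' = fr (r \<otimes> r') (s \<otimes> s')"
proof -
  have *: "fr (a \<otimes> a') (b \<otimes> b') = fr (r \<otimes> r') (s \<otimes> s')"
    if "(a, b) \<in> fr r s" "(a', b') \<in> fr r' s'" for a b a' b'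
  proof -
    have ab: "a \<in> carrier A" "b \<in> W" "feq r s a b" "a' \<in> carrier A" "b' \<in> W" "feq r' s' a' b'"
      using that assms by (auto simp: mem_fraction)
    obtain t u where t: "t \<in> W" "t \<otimes> (b \<otimes> r) = t \<otimes> (s \<otimes> a)"
      and u: "u \<in> W" "u \<otimes> (b' \<otimes> r') = u \<otimes> (s' \<otimes> a')" using ab unfolding feq_def by blast
    have c: "t \<in> carrier A" "u \<in> carrier A" "s \<in> carrier A" "s' \<in> carrier A" "b \<in> carrier A" "b' \<in> carrier A"
      using t u assms ab W_carr by auto
    have "(t \<otimes> u) \<otimes> ((b \<otimes> b') \<otimes> (r \<otimes> r')) = (t \<otimes> (b \<otimes> r)) \<otimes> (u \<otimes> (b' \<otimes> r'))"
      using c assms ab by (simp add: m_ac)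
    also have "\<dots> = (t \<otimes> u) \<otimes> ((s \<otimes> s') \<otimes> (a \<otimes> a'))"
      unfolding t(2) u(2) using c assms ab by (simp add: m_ac)
    finally have "feq (r \<otimes> r') (s \<otimes> s') (a \<otimes> a') (b \<otimes> b')"
      using t u by (intro feqI[of "t \<otimes> u"]) (auto intro: W_mult)
    then show ?thesis using assms ab by (subst fraction_eq_iff) (auto intro: W_mult feq_sym)
  qed
  have "(\<Union>(a, b)\<in>fr r s. \<Union>(a', b')\<in>fr r' s'. fr (a \<otimes> a') (b \<otimes> b')) = fr (r \<otimes> r') (s \<otimes> s')"
    by (rule union_representatives[OF * fraction_refl[OF assms(1,2)] fraction_refl[OF assms(3,4)]])
  then show ?thesis unfolding localization_def by simp
qed

lemma add_fraction:
  assumes "r \<in> carrier A" "s \<in> W" "r' \<in> carrier A" "s' \<in> W"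
  shows "fr r s \<oplus>\<^bsub>localization A W\<^esub> fr r' s' = fr (s' \<otimes> r \<oplus> s \<otimes> r') (s \<otimes> s')"
proof -
  have *: "fr (b' \<otimes> a \<oplus> b \<otimes> a') (b \<otimes> b') = fr (s' \<otimes> r \<oplus> s \<otimes> r') (s \<otimes> s')"
    if "(a, b) \<in> fr r s" "(a', b') \<in> fr r' s'" for a b a' b'
  proof -
    have ab: "a \<in> carrier A" "b \<in> W" "feq r s a b" "a' \<in> carrier A" "b' \<in> W" "feq r' s' a' b'"
      using that assms by (auto simp: mem_fraction)
    obtain t u where t: "t \<in> W" "t \<otimes> (b \<otimes> r) = t \<otimes> (s \<otimes> a)"
      and u: "u \<in> W" "u \<otimes> (b' \<otimes> r') = u \<otimes> (s' \<otimes> a')" using ab unfolding feq_def by blast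
    have c: "t \<in> carrier A" "u \<in> carrier A" "s \<in> carrier A" "s' \<in> carrier A" "b \<in> carrier A" "b' \<in> carrier A"
      using t u assms ab W_carr by auto
    have "(t \<otimes> u) \<otimes> ((b \<otimes> b') \<otimes> (s' \<otimes> r \<oplus> s \<otimes> r'))
        = (u \<otimes> (b' \<otimes> s')) \<otimes> (t \<otimes> (b \<otimes> r)) \<oplus> (t \<otimes> (b \<otimes> s)) \<otimes> (u \<otimes> (b' \<otimes> r'))"
      using c assms ab by (simp add: m_ac r_distr)
    also have "\<dots> = (t \<otimes> u) \<otimes> ((s \<otimes> s') \<otimes> (b' \<otimes> a \<oplus> b \<otimes> a'))"
      unfolding t(2) u(2) using c assms ab by (simp add: m_ac r_distr)
    finally have "feq (s' \<otimes> r \<oplus> s \<otimes> r') (s \<otimes> s') (b' \<otimes> a \<oplus> b \<otimes> a') (b \<otimes> b')"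
      using t u by (intro feqI[of "t \<otimes> u"]) (auto intro: W_mult)
    then show ?thesis using assms ab c by (subst fraction_eq_iff) (auto intro: W_mult feq_sym)
  qed
  have "(\<Union>(a, b)\<in>fr r s. \<Union>(a', b')\<in>fr r' s'. fr (b' \<otimes> a \<oplus> b \<otimes> a') (b \<otimes> b')) = fr (s' \<otimes> r \<oplus> s \<otimes> r') (s \<otimes> s')"
    by (rule union_representatives[OF * fraction_refl[OF assms(1,2)] fraction_refl[OF assms(3,4)]])
  then show ?thesis unfolding localization_def by simp
qed

lemma carrier_localization:
  "x \<in> carrier (localization A W) \<longleftrightarrow> (\<exists>r\<in>carrier A. \<exists>s\<in>W. x = fr r s)"
  unfolding localization_def by auto

lemma fraction_closed: "r \<in> carrier A \<Longrightarrow> s \<in> W \<Longrightarrow> fr r s \<in> carrier (localization A W)"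
  using carrier_localization by blast

lemma one_localization: "\<one>\<^bsub>localization A W\<^esub> = fr \<one> \<one>"
  and zero_localization: "\<zero>\<^bsub>localization A W\<^esub> = fr \<zero> \<one>"
  unfolding localization_def by auto

lemma fraction_hom: "(\<lambda>r. fr r \<one>) \<in> ring_hom A (localization A W)"
  by (rule ring_hom_memI)
     (auto simp: fraction_closed W_one mult_fraction add_fraction one_localization)

lemma fraction_split:
  assumes "r \<in> carrier A" "s \<in> W"
  shows "fr s \<one> \<otimes>\<^bsub>localization A W\<^esub> fr r s = fr r \<one>"
proof -
  have "fr s \<one> \<otimes>\<^bsub>localization A W\<^esub> fr r s = fr (s \<otimes> r) (\<one> \<otimes> s)"
    using assms W_carr W_one by (intro mult_fraction) auto
  also have "\<dots> = fr r \<one>"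
    using assms W_carr W_one by (subst fraction_eq_iff) (auto intro!: feqI[of \<one>])
  finally show ?thesis .
qed

end

text \<open>Regularity at \<open>P\<close>, contracted to \<open>R\<close> so that no fractions remain.\<close>

lemma regular_ring_at_prime:
  fixes R (structure)
  assumes "regular_ring R" "primeideal P R"
  obtains E and Qs :: "nat \<Rightarrow> 'a set" and d :: nat where "E \<subseteq> P" "finite E" "card E \<le> d"
    "\<And>z. z \<in> P \<Longrightarrow> \<exists>s\<in>carrier R - P. s \<otimes> z \<in> genideal R E"
    "\<And>i. i \<le> d \<Longrightarrow> primeideal (Qs i) R" "\<And>i. i < d \<Longrightarrow> Qs i \<subset> Qs (Suc i)" "Qs d \<subseteq> P"
proof -
  interpret cring R using assms(1) by (simp add: regular_ring_def)
  interpret P: primeideal P R by fact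
  let ?W = "carrier R - P"
  have "\<one> \<notin> P" using P.one_imp_carrier P.I_notcarr by metis
  then have subm: "submonoid ?W R"
    by (intro submonoid.intro) (auto dest: P.I_prime)
  interpret localize R ?W by (intro localize.intro localize_axioms.intro subm cring_axioms)
  let ?L = "localization R ?W"
  have reg: "regular_local_ring ?L" using assms by (simp add: regular_ring_def)
  then interpret L: cring ?L by (simp add: regular_local_ring_def)
  obtain G where G: "G \<subseteq> carrier ?L" "finite G" "maximalideal (genideal ?L G) ?L"
    "enat (card G) = krull_dim ?L"
    using reg by (auto simp: regular_local_ring_def)
  define M where "M = genideal ?L G"
  interpret M: maximalideal M ?L using G(3) by (simp add: M_def)
  have Mprime: "primeideal M ?L" using L.maximalideal_prime[OF G(3)] by (simp add: M_def)
  define \<iota> where "\<iota> = (\<lambda>r. fraction R ?W r \<one>)"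
  have hom: "\<iota> \<in> ring_hom R ?L" unfolding \<iota>_def by (rule fraction_hom)
  have \<iota>c: "\<iota> r \<in> carrier ?L" if "r \<in> carrier R" for r using ring_hom_closed[OF hom that] .
  define con where "con = (\<lambda>Q. {r \<in> carrier R. \<iota> r \<in> Q})"
  have \<iota>unit: "\<exists>v\<in>carrier ?L. v \<otimes>\<^bsub>?L\<^esub> \<iota> s = \<one>\<^bsub>?L\<^esub>" if "s \<in> ?W" for s
  proof -
    have "fraction R ?W \<one> s \<otimes>\<^bsub>?L\<^esub> \<iota> s = fraction R ?W (\<one> \<otimes> s) (s \<otimes> \<one>)"
      unfolding \<iota>_def using that W_one by (intro mult_fraction) auto
    also have "\<dots> = \<one>\<^bsub>?L\<^esub>"
      unfolding one_localization using that W_one by (subst fraction_eq_iff) (auto intro!: feqI[of \<one>])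
    finally show ?thesis using that by (intro bexI[of _ "fraction R ?W \<one> s"]) (auto intro!: fraction_closed)
  qed
  have con_prime: "primeideal (con Q) R" "con Q \<subseteq> P" if "primeideal Q ?L" for Q
  proof -
    interpret Q: primeideal Q ?L by fact
    have notone: "\<one>\<^bsub>?L\<^esub> \<notin> Q" using Q.one_imp_carrier Q.I_notcarr by metis
    show "con Q \<subseteq> P"
    proof
      fix r assume r: "r \<in> con Q"
      show "r \<in> P"
      proof (rule ccontr)
        assume "r \<notin> P"
        then obtain v where "v \<in> carrier ?L" "v \<otimes>\<^bsub>?L\<^esub> \<iota> r = \<one>\<^bsub>?L\<^esub>"
          using \<iota>unit[of r] r by (auto simp: con_def)
        then show False using notone Q.I_l_closed[of "\<iota> r" v] r by (simp add: con_def)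
      qed
    qed
    have idc: "ideal (con Q) R"
    proof (rule idealI[OF ring_axioms])
      show "subgroup (con Q) (add_monoid R)"
      proof (rule add.subgroupI)
        show "con Q \<subseteq> carrier R" by (auto simp: con_def)
        have "\<iota> \<zero> = \<zero>\<^bsub>?L\<^esub>" by (simp add: \<iota>_def zero_localization)
        then have "\<zero> \<in> con Q" using Q.zero_closed by (simp add: con_def)
        then show "con Q \<noteq> {}" by auto
        fix a b assume ab: "a \<in> con Q" "b \<in> con Q"
        show "a \<oplus> b \<in> con Q" using ab by (auto simp: con_def ring_hom_add[OF hom])
        have "\<ominus> a = \<ominus> \<one> \<otimes> a" using ab by (simp add: con_def l_minus)
        then show "\<ominus> a \<in> con Q"
          using ab \<iota>c[of "\<ominus> \<one>"] by (auto simp: con_def ring_hom_mult[OF hom] intro: Q.I_l_closed)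
      qed
    next
      fix a x assume "a \<in> con Q" "x \<in> carrier R"
      then show "x \<otimes> a \<in> con Q" "a \<otimes> x \<in> con Q"
        by (auto simp: con_def ring_hom_mult[OF hom] \<iota>c intro: Q.I_l_closed Q.I_r_closed)
    qed
    show "primeideal (con Q) R"
    proof (rule primeidealI[OF idc cring_axioms])
      have "\<one> \<notin> con Q" using notone by (simp add: con_def ring_hom_one[OF hom])
      then show "carrier R \<noteq> con Q" by auto
      fix a b assume "a \<in> carrier R" "b \<in> carrier R" "a \<otimes> b \<in> con Q"
      then show "a \<in> con Q \<or> b \<in> con Q"
        using Q.I_prime[of "\<iota> a" "\<iota> b"] by (auto simp: con_def ring_hom_mult[OF hom] \<iota>c)
    qed
  qed
  \<comment> \<open>Up to a unit, an element of \<open>Q' - Q\<close> equals its numerator, and the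
    numerator separates the contractions.\<close>
  have con_strict: "con Q \<subset> con Q'"
    if QQ: "primeideal Q ?L" "primeideal Q' ?L" "Q \<subset> Q'" for Q Q'
  proof -
    interpret Q: primeideal Q ?L by fact
    interpret Q': primeideal Q' ?L by fact
    obtain z where z: "z \<in> Q'" "z \<notin> Q" using QQ(3) by auto
    then obtain r s where rs: "r \<in> carrier R" "s \<in> ?W" "z = fraction R ?W r s"
      using Q'.Icarr carrier_localization by blast
    have e: "\<iota> s \<otimes>\<^bsub>?L\<^esub> z = \<iota> r" unfolding \<iota>_def rs(3) using fraction_split rs by blast
    have sc: "\<iota> s \<in> carrier ?L" using \<iota>c rs by auto
    have "\<iota> r \<in> Q'" using Q'.I_l_closed[OF z(1) sc] e by simp
    moreover have "\<iota> r \<notin> Q"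
    proof
      assume "\<iota> r \<in> Q"
      then have "\<iota> s \<in> Q \<or> z \<in> Q" using Q.I_prime[OF sc, of z] e z Q'.Icarr by auto
      then have "s \<in> con Q" using z rs by (auto simp: con_def)
      then show False using con_prime(2)[OF QQ(1)] rs by auto
    qed
    ultimately have "r \<in> con Q'" "r \<notin> con Q" using rs by (auto simp: con_def)
    moreover have "con Q \<subseteq> con Q'" using QQ(3) by (auto simp: con_def)
    ultimately show ?thesis by blast
  qed
  have "\<exists>x. \<exists>s\<in>?W. x \<in> carrier R \<and> g = fraction R ?W x s" if "g \<in> G" for g
  proof -
    have "g \<in> carrier ?L" using that G(1) by auto
    then show ?thesis unfolding carrier_localization by auto
  qed
  then obtain \<xi> where \<xi>: "\<And>g. g \<in> G \<Longrightarrow> \<exists>s\<in>?W. \<xi> g \<in> carrier R \<and> g = fraction R ?W (\<xi> g) s"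
    by metis
  define E where "E = \<xi> ` G"
  have GM: "G \<subseteq> M" unfolding M_def by (rule L.genideal_self[OF G(1)])
  have Ec: "E \<subseteq> carrier R" using \<xi> by (auto simp: E_def)
  have EM: "E \<subseteq> con M"
  proof
    fix x assume "x \<in> E"
    then obtain g where "g \<in> G" "x = \<xi> g" by (auto simp: E_def)
    with \<xi>[of g] obtain s where g: "g \<in> G" "s \<in> ?W" "x \<in> carrier R" "g = fraction R ?W x s" by blast
    have "\<iota> s \<otimes>\<^bsub>?L\<^esub> g = \<iota> x" unfolding \<iota>_def g(4) using fraction_split g by blast
    then have "\<iota> x \<in> M" using M.I_l_closed[of g "\<iota> s"] GM g \<iota>c[of s] by auto
    then show "x \<in> con M" using g by (simp add: con_def)
  qed
  \<comment> \<open>Otherwise \<open>M\<close> and \<open>\<iota> z\<close> generate the unit ideal.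
    Clearing the denominator \<open>s\<close> in an expression of one puts
    \<open>s \<ominus> r \<otimes> z\<close> into the contraction of \<open>M\<close>, hence into
    \<open>P\<close>, and then \<open>s\<close> as well, although \<open>s\<close> was chosen
    outside \<open>P\<close>.\<close>
  have PM: "\<iota> z \<in> M" if z: "z \<in> P" for z
  proof (rule ccontr)
    assume nz: "\<iota> z \<notin> M"
    have zc: "z \<in> carrier R" using z P.Icarr by auto
    define N where "N = M <+>\<^bsub>?L\<^esub> PIdl\<^bsub>?L\<^esub> (\<iota> z)"
    have N: "ideal N ?L" unfolding N_def
      by (intro L.add_ideals M.is_ideal L.cgenideal_ideal \<iota>c zc)
    have "M \<subseteq> N"
    proof
      fix m assume "m \<in> M"
      moreover have "\<zero>\<^bsub>?L\<^esub> \<in> PIdl\<^bsub>?L\<^esub> (\<iota> z)"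
        using additive_subgroup.zero_closed[OF ideal.axioms(1)[OF L.cgenideal_ideal[OF \<iota>c[OF zc]]]] .
      ultimately have "m \<oplus>\<^bsub>?L\<^esub> \<zero>\<^bsub>?L\<^esub> \<in> N" unfolding N_def set_add_def' by blast
      then show "m \<in> N" using M.Icarr[OF \<open>m \<in> M\<close>] by simp
    qed
    moreover have "\<zero>\<^bsub>?L\<^esub> \<oplus>\<^bsub>?L\<^esub> \<iota> z \<in> N"
      unfolding N_def set_add_def' using M.zero_closed L.cgenideal_self[OF \<iota>c[OF zc]] by blast
    then have "\<iota> z \<in> N" using \<iota>c[OF zc] by simp
    ultimately have "N = carrier ?L"
      using M.I_maximal[OF N] nz ideal.Icarr[OF N] by auto
    then have "\<one>\<^bsub>?L\<^esub> \<in> N" by simp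
    then obtain m a where ma: "m \<in> M" "a \<in> carrier ?L" "\<one>\<^bsub>?L\<^esub> = m \<oplus>\<^bsub>?L\<^esub> a \<otimes>\<^bsub>?L\<^esub> \<iota> z"
      unfolding N_def set_add_def' cgenideal_def by blast
    obtain r s where rs: "r \<in> carrier R" "s \<in> ?W" "a = fraction R ?W r s"
      using ma(2) carrier_localization by blast
    have e: "\<iota> s \<otimes>\<^bsub>?L\<^esub> a = \<iota> r" unfolding \<iota>_def rs(3) using fraction_split rs by blast
    have sc: "\<iota> s \<in> carrier ?L" "\<iota> r \<in> carrier ?L" "\<iota> z \<in> carrier ?L" "m \<in> carrier ?L"
      using \<iota>c rs zc ma M.Icarr by auto
    have "\<iota> s = \<iota> s \<otimes>\<^bsub>?L\<^esub> (m \<oplus>\<^bsub>?L\<^esub> a \<otimes>\<^bsub>?L\<^esub> \<iota> z)" using ma sc by (metis L.r_one)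
    also have "\<dots> = \<iota> s \<otimes>\<^bsub>?L\<^esub> m \<oplus>\<^bsub>?L\<^esub> \<iota> r \<otimes>\<^bsub>?L\<^esub> \<iota> z"
      using sc ma by (simp add: L.r_distr e[symmetric] L.m_assoc)
    finally have es: "\<iota> s = \<iota> s \<otimes>\<^bsub>?L\<^esub> m \<oplus>\<^bsub>?L\<^esub> \<iota> (r \<otimes> z)"
      using rs zc by (simp add: ring_hom_mult[OF hom])
    have rz: "r \<otimes> z \<in> carrier R" "s \<in> carrier R" using rs zc by auto
    have "\<iota> s = \<iota> (s \<ominus> r \<otimes> z) \<oplus>\<^bsub>?L\<^esub> \<iota> (r \<otimes> z)"
      using rz by (simp add: ring_hom_add[OF hom, symmetric] minus_eq a_assoc l_neg)
    then have "\<iota> (s \<ominus> r \<otimes> z) = \<iota> s \<otimes>\<^bsub>?L\<^esub> m"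
      using es \<iota>c[OF rz(1)] \<iota>c[of "s \<ominus> r \<otimes> z"] rz sc
      by (metis L.add.r_cancel L.m_closed minus_closed)
    then have "s \<ominus> r \<otimes> z \<in> con M"
      using M.I_l_closed[OF ma(1) sc(1)] rz by (simp add: con_def)
    then have "s \<ominus> r \<otimes> z \<in> P" using con_prime(2)[OF Mprime] by auto
    moreover have "r \<otimes> z \<in> P" using z rs by (simp add: P.I_l_closed)
    ultimately have "(s \<ominus> r \<otimes> z) \<oplus> r \<otimes> z \<in> P" by simp
    then have "s \<in> P" using rz by (simp add: minus_eq a_assoc l_neg)
    then show False using rs by auto
  qed
  have EP: "E \<subseteq> P" using EM con_prime(2)[OF Mprime] by auto
  have IE: "ideal (genideal R E) R" by (rule genideal_ideal[OF Ec])
  interpret IE: ideal "genideal R E" R by (rule IE)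
  \<comment> \<open>The extension to the local ring of the ideal generated by \<open>E\<close>,
    described by numerators. It is an ideal containing \<open>G\<close>, so it contains
    \<open>M\<close>; \<open>Jmem\<close> makes the description independent of the
    representative.\<close>
  define J where "J = {y. \<exists>r\<in>carrier R. \<exists>s\<in>?W. y = fraction R ?W r s \<and> (\<exists>t\<in>?W. t \<otimes> r \<in> genideal R E)}"
  have Jmem: "(\<exists>t\<in>?W. t \<otimes> r \<in> genideal R E)"
    if rsJ: "fraction R ?W r s \<in> J" "r \<in> carrier R" "s \<in> ?W" for r s
  proof -
    obtain r' s' t where *: "r' \<in> carrier R" "s' \<in> ?W" "fraction R ?W r s = fraction R ?W r' s'"
      "t \<in> ?W" "t \<otimes> r' \<in> genideal R E" using rsJ(1) unfolding J_def by blast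
    then have "feq r s r' s'" using fraction_eq_iff[of r s r' s'] rsJ by blast
    then obtain w where w: "w \<in> ?W" "w \<otimes> (s' \<otimes> r) = w \<otimes> (s \<otimes> r')"
      unfolding feq_def by blast
    have c: "t \<in> carrier R" "w \<in> carrier R" "s \<in> carrier R" "s' \<in> carrier R" using * w rsJ by auto
    have "(t \<otimes> (w \<otimes> s')) \<otimes> r = t \<otimes> (w \<otimes> (s' \<otimes> r))" using c rsJ by (simp add: m_assoc)
    also have "\<dots> = (w \<otimes> s) \<otimes> (t \<otimes> r')" unfolding w(2) using c * by (simp add: m_ac)
    also have "\<dots> \<in> genideal R E" using IE.I_l_closed[OF *(5)] c by simp
    finally show ?thesis using W_mult[OF *(4) W_mult[OF w(1) *(2)]] by blast
  qed
  have "ideal J ?L"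
  proof (rule idealI[OF L.ring_axioms])
    have Jmult: "x \<otimes>\<^bsub>?L\<^esub> a \<in> J" if a: "a \<in> J" and x: "x \<in> carrier ?L" for a x
    proof -
      obtain r s t where *: "r \<in> carrier R" "s \<in> ?W" "a = fraction R ?W r s"
        "t \<in> ?W" "t \<otimes> r \<in> genideal R E" using a unfolding J_def by blast
      obtain r' s' where **: "r' \<in> carrier R" "s' \<in> ?W" "x = fraction R ?W r' s'"
        using x carrier_localization by blast
      have "t \<otimes> (r' \<otimes> r) = r' \<otimes> (t \<otimes> r)" using * ** by (simp add: m_ac)
      then have "t \<otimes> (r' \<otimes> r) \<in> genideal R E" using IE.I_l_closed[OF *(5) **(1)] by simp
      then show ?thesis
        using * ** W_mult[OF **(2) *(2)] mult_fraction[OF **(1,2) *(1,2)] unfolding J_def by blast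
    qed
    show "subgroup J (add_monoid ?L)"
    proof (rule L.add.subgroupI)
      show "J \<subseteq> carrier ?L" unfolding J_def using carrier_localization by blast
      have "t \<otimes> \<zero> \<in> genideal R E" if "t \<in> ?W" for t using that IE.zero_closed by simp
      then have "fraction R ?W \<zero> \<one> \<in> J" unfolding J_def using W_one by blast
      then show "J \<noteq> {}" by auto
      fix a b assume ab: "a \<in> J" "b \<in> J"
      have ac: "a \<in> carrier ?L" using ab unfolding J_def using carrier_localization by blast
      have "\<ominus>\<^bsub>?L\<^esub> \<one>\<^bsub>?L\<^esub> \<otimes>\<^bsub>?L\<^esub> a = \<ominus>\<^bsub>?L\<^esub> a" using ac by (simp add: L.l_minus)
      then show "\<ominus>\<^bsub>?L\<^esub> a \<in> J" using Jmult[OF ab(1), of "\<ominus>\<^bsub>?L\<^esub> \<one>\<^bsub>?L\<^esub>"] by simp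
      obtain r s t where *: "r \<in> carrier R" "s \<in> ?W" "a = fraction R ?W r s"
        "t \<in> ?W" "t \<otimes> r \<in> genideal R E" using ab(1) unfolding J_def by blast
      obtain r' s' t' where **: "r' \<in> carrier R" "s' \<in> ?W" "b = fraction R ?W r' s'"
        "t' \<in> ?W" "t' \<otimes> r' \<in> genideal R E" using ab(2) unfolding J_def by blast
      have c: "s \<in> carrier R" "s' \<in> carrier R" "t \<in> carrier R" "t' \<in> carrier R" using * ** by auto
      have "(t \<otimes> t') \<otimes> (s' \<otimes> r \<oplus> s \<otimes> r') = (t' \<otimes> s') \<otimes> (t \<otimes> r) \<oplus> (t \<otimes> s) \<otimes> (t' \<otimes> r')"
        using *(1) **(1) c by (simp add: m_ac r_distr)
      also have "\<dots> \<in> genideal R E" using IE.a_closed[OF IE.I_l_closed[OF *(5)] IE.I_l_closed[OF **(5)]] c by simp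
      finally have "(t \<otimes> t') \<otimes> (s' \<otimes> r \<oplus> s \<otimes> r') \<in> genideal R E" .
      moreover have "s' \<otimes> r \<oplus> s \<otimes> r' \<in> carrier R" using c * ** by auto
      moreover have "a \<oplus>\<^bsub>?L\<^esub> b = fraction R ?W (s' \<otimes> r \<oplus> s \<otimes> r') (s \<otimes> s')"
        unfolding *(3) **(3) using * ** by (intro add_fraction) auto
      ultimately show "a \<oplus>\<^bsub>?L\<^esub> b \<in> J"
        unfolding J_def using W_mult[OF *(2) **(2)] W_mult[OF *(4) **(4)] by blast
    qed
    fix a x assume "a \<in> J" "x \<in> carrier ?L"
    then show "x \<otimes>\<^bsub>?L\<^esub> a \<in> J" by (rule Jmult)
    have "a \<in> carrier ?L" using \<open>a \<in> J\<close> unfolding J_def using carrier_localization by blast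
    then show "a \<otimes>\<^bsub>?L\<^esub> x \<in> J" using Jmult[OF \<open>a \<in> J\<close> \<open>x \<in> carrier ?L\<close>] \<open>x \<in> carrier ?L\<close> by (simp add: L.m_comm)
  qed
  moreover have "G \<subseteq> J"
  proof
    fix g assume g: "g \<in> G"
    then obtain s where s: "s \<in> ?W" "\<xi> g \<in> carrier R" "g = fraction R ?W (\<xi> g) s" using \<xi> by blast
    have "\<one> \<otimes> \<xi> g \<in> genideal R E" using genideal_self[OF Ec] g s by (auto simp: E_def)
    then show "g \<in> J" unfolding J_def using s W_one by blast
  qed
  ultimately have MJ: "M \<subseteq> J" unfolding M_def by (rule L.genideal_minimal)
  have gen: "\<exists>s\<in>?W. s \<otimes> z \<in> genideal R E" if "z \<in> P" for z
    using Jmem[of z \<one>] PM[OF that] MJ that P.Icarr W_one unfolding \<iota>_def by blast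
  define D where "D = {n. \<exists>Q :: nat \<Rightarrow> ('a \<times> 'a) set set. (\<forall>i\<le>n. primeideal (Q i) ?L) \<and> (\<forall>i<n. Q i \<subset> Q (Suc i))}"
  have dim: "enat (card G) = Sup (enat ` D)"
    using G(4) unfolding krull_dim_def D_def .
  have "0 \<in> D" unfolding D_def using Mprime by (auto intro!: exI[of _ "\<lambda>_. M"])
  then have ne: "enat ` D \<noteq> {}" by auto
  \<comment> \<open>The supremum of the lengths is \<open>enat (card G)\<close>, hence not infinite,
    so the set of lengths is finite and the supremum is attained: there is a chain whose length is
    exactly \<open>card G\<close>.\<close>
  have fin: "finite (enat ` D)"
  proof (rule ccontr)
    assume "infinite (enat ` D)"
    then have "Sup (enat ` D) = \<infinity>" using ne by (simp add: Sup_enat_def)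
    then show False using dim by simp
  qed
  then have "Sup (enat ` D) = Max (enat ` D)" using ne by (simp add: Sup_enat_def)
  then have "enat (card G) \<in> enat ` D" using dim Max_in[OF fin ne] by simp
  then have "card G \<in> D" by auto
  then obtain Q :: "nat \<Rightarrow> ('a \<times> 'a) set set" where
    Q: "\<forall>i\<le>card G. primeideal (Q i) ?L" "\<forall>i<card G. Q i \<subset> Q (Suc i)" unfolding D_def by blast
  show thesis
  proof (rule that[of E "card G" "\<lambda>i. con (Q i)"])
    show "E \<subseteq> P" by (rule EP)
    show "finite E" "card E \<le> card G" using G(2) by (auto simp: E_def card_image_le)
    show "\<exists>s\<in>carrier R - P. s \<otimes> z \<in> genideal R E" if "z \<in> P" for z using gen[OF that] .
    show "primeideal (con (Q i)) R" if "i \<le> card G" for i using con_prime Q that by auto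
    show "con (Q i) \<subset> con (Q (Suc i))" if "i < card G" for i
      using con_strict[of "Q i" "Q (Suc i)"] Q that by auto
    show "con (Q (card G)) \<subseteq> P" using con_prime Q by auto
  qed
qed

section \<open>Nakayama's lemma for the Frobenius action\<close>

text \<open>Submodules of a Frobenius pushforward: \<open>c\<close> acts as multiplication by
  \<open>c [^] q\<close>. For \<open>q = 1\<close> these are the ideals.\<close>

definition qsub :: "('a, 'm) ring_scheme \<Rightarrow> nat \<Rightarrow> 'a set \<Rightarrow> bool" where
  "qsub R q U \<longleftrightarrow> U \<subseteq> carrier R \<and> \<zero>\<^bsub>R\<^esub> \<in> U \<and> (\<forall>u\<in>U. \<forall>v\<in>U. u \<oplus>\<^bsub>R\<^esub> v \<in> U) \<and>
     (\<forall>c\<in>carrier R. \<forall>u\<in>U. (c [^]\<^bsub>R\<^esub> q) \<otimes>\<^bsub>R\<^esub> u \<in> U)"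

lemma qsubI:
  "U \<subseteq> carrier R \<Longrightarrow> \<zero>\<^bsub>R\<^esub> \<in> U \<Longrightarrow> (\<And>u v. u \<in> U \<Longrightarrow> v \<in> U \<Longrightarrow> u \<oplus>\<^bsub>R\<^esub> v \<in> U) \<Longrightarrow>
    (\<And>c u. c \<in> carrier R \<Longrightarrow> u \<in> U \<Longrightarrow> (c [^]\<^bsub>R\<^esub> q) \<otimes>\<^bsub>R\<^esub> u \<in> U) \<Longrightarrow> qsub R q U"
  unfolding qsub_def by simp

lemma qsubD:
  assumes "qsub R q U"
  shows "U \<subseteq> carrier R" "\<zero>\<^bsub>R\<^esub> \<in> U" "u \<in> U \<Longrightarrow> v \<in> U \<Longrightarrow> u \<oplus>\<^bsub>R\<^esub> v \<in> U"
    "c \<in> carrier R \<Longrightarrow> u \<in> U \<Longrightarrow> (c [^]\<^bsub>R\<^esub> q) \<otimes>\<^bsub>R\<^esub> u \<in> U"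
  using assms unfolding qsub_def by simp_all

text \<open>The elements that fall into \<open>U\<close> after localization at \<open>P\<close>.
  Submodules with \<open>qsat R q P U = U\<close> stand in for submodules over the local
  ring.\<close>

definition qsat :: "('a, 'm) ring_scheme \<Rightarrow> nat \<Rightarrow> 'a set \<Rightarrow> 'a set \<Rightarrow> 'a set" where
  "qsat R q P U = {z \<in> carrier R. \<exists>s\<in>carrier R - P. (s [^]\<^bsub>R\<^esub> q) \<otimes>\<^bsub>R\<^esub> z \<in> U}"

locale prime_of = char_p_ring R p for R (structure) and p +
  fixes P :: "'a set" assumes prime_P: "primeideal P R"
begin

sublocale P: primeideal P R by (rule prime_P)

lemma one_notin_P: "\<one> \<notin> P" using P.one_imp_carrier P.I_notcarr by metis

lemma mult_notin_P: "s \<in> carrier R - P \<Longrightarrow> t \<in> carrier R - P \<Longrightarrow> s \<otimes> t \<in> carrier R - P"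
  using P.I_prime by auto

lemma pow_notin_P: "s \<in> carrier R - P \<Longrightarrow> s [^] (n::nat) \<in> carrier R - P"
  by (induction n) (use one_notin_P mult_notin_P in auto)

lemma qsatI: "z \<in> carrier R \<Longrightarrow> s \<in> carrier R - P \<Longrightarrow> s [^] q \<otimes> z \<in> U \<Longrightarrow> z \<in> qsat R q P U"
  unfolding qsat_def by blast

lemma qsat_incl: "U \<subseteq> carrier R \<Longrightarrow> U \<subseteq> qsat R q P U"
  using one_notin_P by (auto intro!: qsatI[of _ \<one>])

lemma qsub_qsat:
  assumes "qsub R q U"
  shows "qsub R q (qsat R q P U)"
proof -
  have U: "U \<subseteq> carrier R" "\<zero> \<in> U" "\<And>u v. u \<in> U \<Longrightarrow> v \<in> U \<Longrightarrow> u \<oplus> v \<in> U"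
    "\<And>c u. c \<in> carrier R \<Longrightarrow> u \<in> U \<Longrightarrow> c [^] q \<otimes> u \<in> U"
    using assms unfolding qsub_def by auto
  have add: "u \<oplus> v \<in> qsat R q P U" if uv: "u \<in> qsat R q P U" "v \<in> qsat R q P U" for u v
  proof -
    obtain s where s: "u \<in> carrier R" "s \<in> carrier R - P" "s [^] q \<otimes> u \<in> U" using uv(1) unfolding qsat_def by blast
    obtain t where t: "v \<in> carrier R" "t \<in> carrier R - P" "t [^] q \<otimes> v \<in> U" using uv(2) unfolding qsat_def by blast
    have c: "s \<in> carrier R" "t \<in> carrier R" using s t by auto
    have "(s \<otimes> t) [^] q \<otimes> (u \<oplus> v) = t [^] q \<otimes> (s [^] q \<otimes> u) \<oplus> s [^] q \<otimes> (t [^] q \<otimes> v)"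
      using c s(1) t(1) by (simp add: nat_pow_distrib r_distr m_ac)
    then have "(s \<otimes> t) [^] q \<otimes> (u \<oplus> v) \<in> U" using U(3)[OF U(4)[OF c(2) s(3)] U(4)[OF c(1) t(3)]] by simp
    then show ?thesis using mult_notin_P[OF s(2) t(2)] s t by (intro qsatI) auto
  qed
  have scale: "c [^] q \<otimes> u \<in> qsat R q P U" if cu: "c \<in> carrier R" "u \<in> qsat R q P U" for c u
  proof -
    obtain s where s: "u \<in> carrier R" "s \<in> carrier R - P" "s [^] q \<otimes> u \<in> U" using cu(2) unfolding qsat_def by blast
    have "s [^] q \<otimes> (c [^] q \<otimes> u) = c [^] q \<otimes> (s [^] q \<otimes> u)" using s cu by (simp add: m_lcomm)
    then have "s [^] q \<otimes> (c [^] q \<otimes> u) \<in> U" using U(4)[OF cu(1) s(3)] by simp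
    then show ?thesis using s cu by (intro qsatI) auto
  qed
  have "\<zero> \<in> qsat R q P U" using U(1,2) qsat_incl by blast
  moreover have "qsat R q P U \<subseteq> carrier R" unfolding qsat_def by auto
  ultimately show ?thesis using add scale by (intro qsubI)
qed

lemma qsat_qsat:
  assumes "U \<subseteq> carrier R"
  shows "qsat R q P (qsat R q P U) = qsat R q P U"
proof
  show "qsat R q P (qsat R q P U) \<subseteq> qsat R q P U"
  proof
    fix z assume "z \<in> qsat R q P (qsat R q P U)"
    then obtain s t where st: "z \<in> carrier R" "s \<in> carrier R - P" "t \<in> carrier R - P"
      "t [^] q \<otimes> (s [^] q \<otimes> z) \<in> U" unfolding qsat_def by blast
    have "(t \<otimes> s) [^] q \<otimes> z = t [^] q \<otimes> (s [^] q \<otimes> z)" using st by (simp add: nat_pow_distrib m_assoc)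
    then show "z \<in> qsat R q P U" using st mult_notin_P[OF st(3,2)] by (intro qsatI[of _ "t \<otimes> s"]) auto
  qed
  show "qsat R q P U \<subseteq> qsat R q P (qsat R q P U)" by (rule qsat_incl) (auto simp: qsat_def)
qed

lemma qsat_mono: "U \<subseteq> U' \<Longrightarrow> qsat R q P U \<subseteq> qsat R q P U'"
  unfolding qsat_def by blast

text \<open>Applied with \<open>J\<close> the whole ring and with \<open>J = P\<close>, this gives
  the two submodules U + Rh and U + Ph of Nakayama's argument.\<close>

lemma qsub_adjoin:
  assumes "qsub R (p ^ e) U" "h \<in> carrier R" "additive_subgroup J R"
    "\<And>c b. c \<in> carrier R \<Longrightarrow> b \<in> J \<Longrightarrow> c \<otimes> b \<in> J"
  shows "qsub R (p ^ e) {w \<oplus> c [^] (p ^ e) \<otimes> h | w c. w \<in> U \<and> c \<in> J}" (is "qsub R _ ?S")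
    "U \<subseteq> {w \<oplus> c [^] (p ^ e) \<otimes> h | w c. w \<in> U \<and> c \<in> J}"
proof -
  interpret J: additive_subgroup J R by fact
  have U: "U \<subseteq> carrier R" "\<zero> \<in> U" "\<And>u v. u \<in> U \<Longrightarrow> v \<in> U \<Longrightarrow> u \<oplus> v \<in> U"
    "\<And>c u. c \<in> carrier R \<Longrightarrow> u \<in> U \<Longrightarrow> c [^] (p ^ e) \<otimes> u \<in> U"
    using assms unfolding qsub_def by auto
  show sub: "U \<subseteq> ?S"
  proof
    fix w assume w: "w \<in> U"
    then have "w = w \<oplus> \<zero> [^] (p ^ e) \<otimes> h" using U assms by auto
    then show "w \<in> ?S" using w J.zero_closed by blast
  qed
  have "?S \<subseteq> carrier R" using U assms J.a_Hcarr by auto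
  moreover have "\<zero> \<in> ?S" using sub U by blast
  moreover have "u \<oplus> v \<in> ?S" if uv: "u \<in> ?S" "v \<in> ?S" for u v
  proof -
    obtain w c where 1: "w \<in> U" "c \<in> J" "u = w \<oplus> c [^] (p ^ e) \<otimes> h" using uv(1) by blast
    obtain w' c' where 2: "w' \<in> U" "c' \<in> J" "v = w' \<oplus> c' [^] (p ^ e) \<otimes> h" using uv(2) by blast
    have cc: "w \<in> carrier R" "w' \<in> carrier R" "c \<in> carrier R" "c' \<in> carrier R"
      using 1 2 U J.a_Hcarr by auto
    have "u \<oplus> v = (w \<oplus> w') \<oplus> (c \<oplus> c') [^] (p ^ e) \<otimes> h"
      using cc assms by (simp add: 1 2 frob_add l_distr a_ac)
    then show ?thesis using U(3)[OF 1(1) 2(1)] J.a_closed[OF 1(2) 2(2)] by blast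
  qed
  moreover have "a [^] (p ^ e) \<otimes> u \<in> ?S" if au: "a \<in> carrier R" "u \<in> ?S" for a u
  proof -
    obtain w c where 1: "w \<in> U" "c \<in> J" "u = w \<oplus> c [^] (p ^ e) \<otimes> h" using au(2) by blast
    have cc: "w \<in> carrier R" "c \<in> carrier R" using 1 U J.a_Hcarr by auto
    have "a [^] (p ^ e) \<otimes> u = a [^] (p ^ e) \<otimes> w \<oplus> (a \<otimes> c) [^] (p ^ e) \<otimes> h"
      using cc assms au by (simp add: 1 nat_pow_distrib r_distr m_assoc)
    then show ?thesis using U(4)[OF au(1) 1(1)] assms(4)[OF au(1) 1(2)] by blast
  qed
  ultimately show "qsub R (p ^ e) ?S" by (rule qsubI)
qed

text \<open>The last two hypotheses say that \<open>T\<close> is contained in \<open>U\<close> plus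
  \<open>P\<close> times \<open>T\<close>, and that \<open>F\<close> generates \<open>T\<close>
  modulo \<open>U\<close>, both locally at \<open>P\<close>. Quantifying over saturated
  \<open>Y\<close> avoids sums and quotients of modules and survives the enlargement of
  \<open>U\<close> in the induction.\<close>

lemma nakayama:
  fixes e :: nat
  assumes "finite F" "F \<subseteq> T" "T \<subseteq> carrier R" "qsub R (p ^ e) U" "qsat R (p ^ e) P U = U"
    "\<And>Y. qsub R (p ^ e) Y \<Longrightarrow> qsat R (p ^ e) P Y = Y \<Longrightarrow> U \<subseteq> Y \<Longrightarrow>
       (\<And>b z. b \<in> P \<Longrightarrow> z \<in> T \<Longrightarrow> b [^] (p ^ e) \<otimes> z \<in> Y) \<Longrightarrow> T \<subseteq> Y"
    "\<And>Y. qsub R (p ^ e) Y \<Longrightarrow> qsat R (p ^ e) P Y = Y \<Longrightarrow> U \<subseteq> Y \<Longrightarrow> F \<subseteq> Y \<Longrightarrow> T \<subseteq> Y"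
  shows "T \<subseteq> U"
  using assms(1,2,4-7)
proof (induction F arbitrary: U rule: finite_induct)
  case empty
  show ?case by (rule empty.prems(5)[OF empty.prems(2,3)]) auto
next
  case (insert h F)
  let ?q = "p ^ e"
  have hT: "h \<in> T" "h \<in> carrier R" using insert.prems(1) assms(3) by auto
  have Uc: "U \<subseteq> carrier R" using qsubD(1)[OF insert.prems(2)] .
  define S where "S = {w \<oplus> c [^] ?q \<otimes> h | w c. w \<in> U \<and> c \<in> carrier R}"
  define S0 where "S0 = {w \<oplus> c [^] ?q \<otimes> h | w c. w \<in> U \<and> c \<in> P}"
  have S: "qsub R ?q S" "U \<subseteq> S"
    unfolding S_def using qsub_adjoin[OF insert.prems(2) hT(2) ideal.axioms(1)[OF oneideal]] by auto
  have S0: "qsub R ?q S0" "U \<subseteq> S0"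
    unfolding S0_def using qsub_adjoin[OF insert.prems(2) hT(2) P.additive_subgroup_axioms P.I_l_closed] by auto
  have Sc: "S \<subseteq> carrier R" "S0 \<subseteq> carrier R" using qsubD(1)[OF S(1)] qsubD(1)[OF S0(1)] by auto
  define U' where "U' = qsat R ?q P S"
  define Y0 where "Y0 = qsat R ?q P S0"
  have U': "qsub R ?q U'" "qsat R ?q P U' = U'" "U \<subseteq> U'"
    unfolding U'_def using qsub_qsat[OF S(1)] qsat_qsat[OF Sc(1)] subset_trans[OF S(2) qsat_incl[OF Sc(1)]] by auto
  have Y0: "qsub R ?q Y0" "qsat R ?q P Y0 = Y0" "U \<subseteq> Y0"
    unfolding Y0_def using qsub_qsat[OF S0(1)] qsat_qsat[OF Sc(2)] subset_trans[OF S0(2) qsat_incl[OF Sc(2)]] by auto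
  have "\<zero> \<in> U" using qsubD(2)[OF insert.prems(2)] .
  have "\<zero> \<oplus> \<one> [^] ?q \<otimes> h \<in> S" unfolding S_def using \<open>\<zero> \<in> U\<close> by blast
  then have hU': "h \<in> U'" unfolding U'_def using hT qsat_incl[OF Sc(1)] by auto
  \<comment> \<open>With \<open>h\<close> moved from the finite set into the submodule, the
    induction hypothesis bounds \<open>T\<close> by \<open>U\<close> and the multiples of
    \<open>h\<close>.\<close>
  have TU': "T \<subseteq> U'"
  proof (rule insert.IH)
    show "F \<subseteq> T" using insert.prems(1) by auto
    show "qsub R ?q U'" "qsat R ?q P U' = U'" using U' by auto
    show "T \<subseteq> Y" if "qsub R ?q Y" "qsat R ?q P Y = Y" "U' \<subseteq> Y"
      "\<And>b z. b \<in> P \<Longrightarrow> z \<in> T \<Longrightarrow> b [^] ?q \<otimes> z \<in> Y" for Y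
      using that(3) U'(3) by (intro insert.prems(4)[OF that(1,2) _ that(4)]) blast
    show "T \<subseteq> Y" if "qsub R ?q Y" "qsat R ?q P Y = Y" "U' \<subseteq> Y" "F \<subseteq> Y" for Y
      using that(3,4) U'(3) hU' by (intro insert.prems(5)[OF that(1,2)]) blast+
  qed
  \<comment> \<open>Elements of \<open>T\<close> are locally of the form \<open>w\<close> plus a
    multiple of \<open>h\<close>; multiplying by \<open>b\<close> from \<open>P\<close> moves the
    coefficient of \<open>h\<close> into \<open>P\<close>.\<close>
  have "T \<subseteq> Y0"
  proof (rule insert.prems(4)[OF Y0])
    fix b z assume b: "b \<in> P" and z: "z \<in> T"
    then obtain t where t: "t \<in> carrier R - P" "t [^] ?q \<otimes> z \<in> S" "z \<in> carrier R"
      using TU' unfolding U'_def qsat_def by blast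
    then obtain w c where wc: "w \<in> U" "c \<in> carrier R" "t [^] ?q \<otimes> z = w \<oplus> c [^] ?q \<otimes> h"
      unfolding S_def by blast
    have carr: "b \<in> carrier R" "w \<in> carrier R" "t \<in> carrier R" using b wc Uc t P.Icarr by auto
    have "t [^] ?q \<otimes> (b [^] ?q \<otimes> z) = b [^] ?q \<otimes> (t [^] ?q \<otimes> z)" using carr t by (simp add: m_lcomm)
    also have "\<dots> = b [^] ?q \<otimes> w \<oplus> (c \<otimes> b) [^] ?q \<otimes> h"
      unfolding wc(3) using carr wc hT by (simp add: r_distr nat_pow_distrib m_ac)
    also have "\<dots> \<in> S0"
    proof -
      have "b [^] ?q \<otimes> w \<in> U" using qsubD(4)[OF insert.prems(2) carr(1) wc(1)] .
      moreover have "c \<otimes> b \<in> P" using b wc by (intro P.I_l_closed)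
      ultimately show ?thesis unfolding S0_def by blast
    qed
    finally show "b [^] ?q \<otimes> z \<in> Y0" unfolding Y0_def using t carr by (intro qsatI) auto
  qed
  then obtain s where s: "s \<in> carrier R - P" "s [^] ?q \<otimes> h \<in> S0"
    using hT unfolding Y0_def qsat_def by blast
  then obtain w c where wc: "w \<in> U" "c \<in> P" "s [^] ?q \<otimes> h = w \<oplus> c [^] ?q \<otimes> h" unfolding S0_def by blast
  have carr: "s \<in> carrier R" "c \<in> carrier R" "w \<in> carrier R" using s wc Uc P.Icarr by auto
  \<comment> \<open>The determinant trick for a single generator: \<open>h\<close> is killed modulo
    \<open>U\<close> by the twisted action of \<open>s \<ominus> c\<close>, which is outside
    \<open>P\<close> because \<open>s\<close> is outside and \<open>c\<close> inside.\<close>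
  have "(s \<ominus> c) [^] ?q \<otimes> h = s [^] ?q \<otimes> h \<ominus> c [^] ?q \<otimes> h"
    using carr hT by (simp add: minus_eq frob_add frob_neg l_distr l_minus)
  also have "\<dots> = w" unfolding wc(3) using carr hT by (simp add: minus_eq a_assoc r_neg)
  finally have "(s \<ominus> c) [^] ?q \<otimes> h \<in> U" using wc by simp
  moreover have "s \<ominus> c \<in> carrier R - P"
  proof -
    have "s = (s \<ominus> c) \<oplus> c" using carr by (simp add: minus_eq a_assoc l_neg)
    then show ?thesis using s carr P.a_closed[OF _ wc(2), of "s \<ominus> c"] by auto
  qed
  ultimately have hU: "h \<in> U" using insert.prems(3) qsatI[OF hT(2), of "s \<ominus> c" ?q U] by simp
  have "S \<subseteq> U"
  proof
    fix x assume "x \<in> S"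
    then obtain w c where "w \<in> U" "c \<in> carrier R" "x = w \<oplus> c [^] ?q \<otimes> h" unfolding S_def by blast
    then show "x \<in> U" using qsubD(3,4)[OF insert.prems(2)] hU by simp
  qed
  then have "U' \<subseteq> U" unfolding U'_def using qsat_mono insert.prems(3) by blast
  then show ?case using TU' by blast
qed

lemma tspan_transfer:
  assumes "x \<in> tspan R (carrier R) p Q G" "G \<subseteq> G2" "G2 \<subseteq> carrier R" "ideal Q R" "ideal Q2 R"
    "\<And>w. w \<in> Q \<Longrightarrow> \<exists>t\<in>carrier R - P. t [^] p \<otimes> w \<in> tspan R (carrier R) p Q2 G2"
  shows "\<exists>t\<in>carrier R - P. t [^] p \<otimes> x \<in> tspan R (carrier R) p Q2 G2"
proof -
  interpret T: twisted R p "carrier R" Q by (rule twistedI[OF assms(4) carrier_is_subring])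
  interpret T2: twisted R p "carrier R" Q2 by (rule twistedI[OF assms(5) carrier_is_subring])
  have Gc: "G \<subseteq> carrier R" using assms by blast
  show ?thesis using assms(1)
  proof induction
    case (base w)
    then show ?case by (rule assms(6))
  next
    case (step x c u)
    obtain t where t: "t \<in> carrier R - P" "t [^] p \<otimes> x \<in> tspan R (carrier R) p Q2 G2" using step by blast
    have carr: "t \<in> carrier R" "x \<in> carrier R" "c \<in> carrier R" "u \<in> carrier R"
      using t step T.tspan_carrier[OF step(1) Gc] Gc by auto
    have "t [^] p \<otimes> (x \<oplus> c [^] p \<otimes> u) = t [^] p \<otimes> x \<oplus> (t \<otimes> c) [^] p \<otimes> u"
      using carr by (simp add: r_distr nat_pow_distrib m_assoc)
    also have "\<dots> \<in> tspan R (carrier R) p Q2 G2"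
      using t carr step assms(2) by (intro tspan.step) auto
    finally show ?case using t by blast
  qed
qed

end

section \<open>Ideals with one more generator, and existence of maximal ideals\<close>

context cring
begin

lemma Idl_insert:
  assumes "w \<in> genideal R (insert a B)" "a \<in> carrier R" "B \<subseteq> carrier R"
  obtains y b where "y \<in> carrier R" "b \<in> genideal R B" "w = a \<otimes> y \<oplus> b"
proof -
  interpret B: ideal "genideal R B" R by (rule genideal_ideal[OF assms(3)])
  let ?I = "PIdl a <+>\<^bsub>R\<^esub> genideal R B"
  have I: "ideal ?I R" by (intro add_ideals cgenideal_ideal assms(2) B.is_ideal)
  have "a \<oplus> \<zero> \<in> ?I"
    unfolding set_add_def' using cgenideal_self[OF assms(2)] B.zero_closed by blast
  then have "a \<in> ?I" using assms by simp
  moreover have "B \<subseteq> ?I"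
  proof
    fix b assume b: "b \<in> B"
    have "\<zero> \<in> PIdl a" using additive_subgroup.zero_closed[OF ideal.axioms(1)[OF cgenideal_ideal[OF assms(2)]]] .
    moreover have "b \<in> genideal R B" using b genideal_self[OF assms(3)] by blast
    ultimately have "\<zero> \<oplus> b \<in> ?I" unfolding set_add_def' by blast
    then show "b \<in> ?I" using b assms by auto
  qed
  ultimately have "genideal R (insert a B) \<subseteq> ?I" using genideal_minimal[OF I] by blast
  then have "w \<in> ?I" using assms by blast
  then obtain y b where "y \<in> carrier R" "b \<in> genideal R B" "w = (y \<otimes> a) \<oplus> b"
    unfolding set_add_def' cgenideal_def by blast
  then show thesis using that[of y b] assms by (simp add: m_comm)
qed

lemma maximal_above:
  assumes "ideal I R" "I \<noteq> carrier R"
  obtains M where "maximalideal M R" "I \<subseteq> M"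
proof -
  define A where "A = {J. ideal J R \<and> I \<subseteq> J \<and> \<one> \<notin> J}"
  have oneI: "\<one> \<notin> J" if "ideal J R" "J \<noteq> carrier R" for J using ideal.one_imp_carrier[OF that(1)] that by metis
  have IA: "I \<in> A" unfolding A_def using assms oneI by blast
  have "\<exists>M\<in>A. \<forall>J\<in>A. M \<subseteq> J \<longrightarrow> J = M"
  proof (rule subset_Zorn_nonempty)
    show "A \<noteq> {}" using IA by blast
    fix C assume C: "C \<noteq> {}" "subset.chain A C"
    have "subset.chain {J. ideal J R} C" using C(2) unfolding subset.chain_def A_def by blast
    then have "ideal (\<Union>C) R" using chain_Union_is_ideal[of C] C(1) by simp
    moreover have "I \<subseteq> \<Union>C" "\<one> \<notin> \<Union>C" using C unfolding subset.chain_def A_def by blast+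
    ultimately show "\<Union>C \<in> A" unfolding A_def by blast
  qed
  then obtain M where M: "M \<in> A" "\<And>J. J \<in> A \<Longrightarrow> M \<subseteq> J \<Longrightarrow> J = M" by blast
  have "maximalideal M R"
  proof (rule maximalidealI)
    show "ideal M R" "carrier R \<noteq> M" using M(1) unfolding A_def by auto
    fix J assume J: "ideal J R" "M \<subseteq> J" "J \<subseteq> carrier R"
    show "J = M \<or> J = carrier R"
    proof (cases "\<one> \<in> J")
      case True then show ?thesis using ideal.one_imp_carrier[OF J(1)] by blast
    next
      case False
      then have "J \<in> A" using J M(1) unfolding A_def by blast
      then show ?thesis using M(2) J by blast
    qed
  qed
  then show thesis using that M(1) unfolding A_def by blast
qed

end

section \<open>Local freeness of the Frobenius pushforward\<close>

context prime_of
begin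

text \<open>\<open>G\<close> generates, locally at \<open>P\<close>, the pushforward modulo
  \<open>I\<close>. Unlike in \<open>pspans\<close>, the denominators avoid the fixed prime
  \<open>P\<close> while the ideal \<open>I\<close> shrinks from \<open>P\<close> towards
  zero.\<close>

definition lspan :: "'a set \<Rightarrow> 'a set \<Rightarrow> bool" where
  "lspan I G \<longleftrightarrow> (\<forall>z\<in>carrier R. \<exists>s\<in>carrier R - P. s [^] p \<otimes> z \<in> tspan R (carrier R) p I G)"

lemma lspan_transfer:
  assumes "lspan Q G" "G \<subseteq> G2" "G2 \<subseteq> carrier R" "ideal Q R" "ideal Q2 R"
    "\<And>w. w \<in> Q \<Longrightarrow> \<exists>t\<in>carrier R - P. t [^] p \<otimes> w \<in> tspan R (carrier R) p Q2 G2"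
  shows "lspan Q2 G2"
  unfolding lspan_def
proof
  fix z assume z: "z \<in> carrier R"
  then obtain s where s: "s \<in> carrier R - P" "s [^] p \<otimes> z \<in> tspan R (carrier R) p Q G"
    using assms(1) unfolding lspan_def by blast
  obtain t where t: "t \<in> carrier R - P" "t [^] p \<otimes> (s [^] p \<otimes> z) \<in> tspan R (carrier R) p Q2 G2"
    using tspan_transfer[OF s(2) assms(2-6)] by blast
  have "(t \<otimes> s) [^] p \<otimes> z = t [^] p \<otimes> (s [^] p \<otimes> z)" using s t z by (simp add: nat_pow_distrib m_assoc)
  then have "(t \<otimes> s) [^] p \<otimes> z \<in> tspan R (carrier R) p Q2 G2" using t(2) by simp
  then show "\<exists>s\<in>carrier R - P. s [^] p \<otimes> z \<in> tspan R (carrier R) p Q2 G2"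
    using mult_notin_P[OF t(1) s(1)] by blast
qed

text \<open>Filter by powers of \<open>x\<close>: what is left of an expansion modulo
  \<open>x [^] r\<close> is a multiple \<open>x [^] r \<otimes> y\<close>, and expanding
  \<open>y\<close> modulo \<open>x\<close> contributes the new generators
  \<open>x [^] r \<otimes> g\<close>. At \<open>r = 0\<close> the ideal is the whole ring.\<close>

lemma lspan_power_step:
  assumes "lspan (genideal R (insert x B)) G" "x \<in> carrier R" "B \<subseteq> carrier R" "G \<subseteq> carrier R"
  shows "lspan (genideal R (insert (x [^] r) B)) ((\<lambda>(i, g). x [^] i \<otimes> g) ` ({..<r::nat} \<times> G))"
proof (induction r)
  case 0
  have one: "\<one> \<in> genideal R (insert \<one> B)" using genideal_self[of "insert \<one> B"] assms by auto
  have "ideal (genideal R (insert \<one> B)) R" using assms by (intro genideal_ideal) auto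
  then have "genideal R (insert \<one> B) = carrier R" using ideal.one_imp_carrier one by blast
  then show ?case unfolding lspan_def using one_notin_P by (auto intro!: bexI[of _ \<one>] tspan.base)
next
  case (Suc r)
  let ?I = "\<lambda>r. genideal R (insert (x [^] (r::nat)) B)"
  let ?G = "\<lambda>r. (\<lambda>(i, g). x [^] i \<otimes> g) ` ({..<r::nat} \<times> G)"
  have idl: "ideal (?I r) R" for r using assms by (intro genideal_ideal) auto
  have idx: "ideal (genideal R (insert x B)) R" using assms by (intro genideal_ideal) auto
  have Gc: "?G r \<subseteq> carrier R" for r using assms by auto
  interpret I: ideal "?I (Suc r)" R by (rule idl)
  interpret T: twisted R p "carrier R" "?I (Suc r)" by (rule twistedI[OF idl carrier_is_subring])
  interpret T1: twisted R p "carrier R" "genideal R (insert x B)" by (rule twistedI[OF idx carrier_is_subring])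
  have inB: "b \<in> ?I (Suc r)" if "b \<in> genideal R B" for b
  proof -
    have "genideal R B \<subseteq> ?I (Suc r)"
      using genideal_self[of "insert (x [^] Suc r) B"] assms by (intro genideal_minimal idl) auto
    then show ?thesis using that by blast
  qed
  have inx: "x [^] Suc r \<in> ?I (Suc r)" using genideal_self[of "insert (x [^] Suc r) B"] assms by auto
  have mult: "x [^] r \<otimes> a \<in> tspan R (carrier R) p (?I (Suc r)) (?G (Suc r))"
    if "a \<in> tspan R (carrier R) p (genideal R (insert x B)) G" for a
    using that
  proof induction
    case (base w)
    obtain y b where yb: "y \<in> carrier R" "b \<in> genideal R B" "w = x \<otimes> y \<oplus> b"
      by (rule Idl_insert[OF base assms(2,3)])
    have bc: "b \<in> carrier R" using I.Icarr[OF inB[OF yb(2)]] .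
    have "x [^] r \<otimes> w = x [^] Suc r \<otimes> y \<oplus> x [^] r \<otimes> b"
      using yb bc assms by (simp add: r_distr m_assoc)
    also have "\<dots> \<in> ?I (Suc r)"
      using I.a_closed[OF I.I_r_closed[OF inx yb(1)] I.I_l_closed[OF inB[OF yb(2)], of "x [^] r"]] assms by simp
    finally show ?case by (rule tspan.base)
  next
    case (step a c u)
    have carr: "a \<in> carrier R" "c \<in> carrier R" "u \<in> carrier R"
      using T1.tspan_carrier[OF step(1) assms(4)] step assms by auto
    have "x [^] r \<otimes> (a \<oplus> c [^] p \<otimes> u) = x [^] r \<otimes> a \<oplus> c [^] p \<otimes> (x [^] r \<otimes> u)"
      using carr assms by (simp add: r_distr m_lcomm)
    moreover have "x [^] r \<otimes> u \<in> ?G (Suc r)" using step by (intro image_eqI[of _ _ "(r, u)"]) auto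
    ultimately show ?case using tspan.step[OF step.IH step(2)] by simp
  qed
  show ?case
  proof (rule lspan_transfer[OF Suc _ Gc idl idl])
    show "?G r \<subseteq> ?G (Suc r)" by auto
    fix w assume "w \<in> ?I r"
    then obtain y b where yb: "y \<in> carrier R" "b \<in> genideal R B" "w = x [^] r \<otimes> y \<oplus> b"
      by (rule Idl_insert) (use assms in auto)
    obtain t where t: "t \<in> carrier R - P" "t [^] p \<otimes> y \<in> tspan R (carrier R) p (genideal R (insert x B)) G"
      using assms(1) yb unfolding lspan_def by blast
    have bc: "b \<in> carrier R" using I.Icarr[OF inB[OF yb(2)]] .
    have "t [^] p \<otimes> w = x [^] r \<otimes> (t [^] p \<otimes> y) \<oplus> t [^] p \<otimes> b"
      using yb bc t assms by (simp add: r_distr m_lcomm)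
    moreover have "t [^] p \<otimes> b \<in> tspan R (carrier R) p (?I (Suc r)) (?G (Suc r))"
      using t I.I_l_closed[OF inB[OF yb(2)]] by (intro tspan.base) auto
    ultimately have "t [^] p \<otimes> w \<in> tspan R (carrier R) p (?I (Suc r)) (?G (Suc r))"
      using T.tspan_add[OF mult[OF t(2)] _ Gc] by simp
    then show "\<exists>t\<in>carrier R - P. t [^] p \<otimes> w \<in> tspan R (carrier R) p (?I (Suc r)) (?G (Suc r))"
      using t by blast
  qed
qed

text \<open>\<open>A\<close> collects the generators that have already been replaced by their
  \<open>p\<close>-th powers; each replacement multiplies the number of generators by at most
  \<open>p\<close>.\<close>

lemma lspan_powers:
  assumes "finite B" "B \<subseteq> carrier R" "A \<subseteq> carrier R" "finite G" "G \<subseteq> carrier R"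
    "lspan (genideal R (A \<union> B)) G"
  shows "\<exists>G'. finite G' \<and> G' \<subseteq> carrier R \<and> card G' \<le> card G * p ^ card B
    \<and> lspan (genideal R (A \<union> (\<lambda>x. x [^] p) ` B)) G'"
  using assms
proof (induction B arbitrary: A G rule: finite_induct)
  case empty
  then show ?case by (intro exI[of _ G]) auto
next
  case (insert x B)
  let ?G = "(\<lambda>(i, g). x [^] i \<otimes> g) ` ({..<p} \<times> G)"
  have "card ?G \<le> card ({..<p} \<times> G)" using insert by (intro card_image_le) auto
  then have cG: "card ?G \<le> p * card G" by (simp add: card_cartesian_product)
  have G: "finite ?G" "?G \<subseteq> carrier R" using insert by auto
  have "lspan (genideal R (insert (x [^] p) (A \<union> B))) ?G"
    using insert by (intro lspan_power_step) auto
  then have "lspan (genideal R (insert (x [^] p) A \<union> B)) ?G" by simp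
  then obtain G' where G': "finite G'" "G' \<subseteq> carrier R" "card G' \<le> card ?G * p ^ card B"
    "lspan (genideal R (insert (x [^] p) A \<union> (\<lambda>x. x [^] p) ` B)) G'"
    using insert.IH[of "insert (x [^] p) A" ?G] G insert.prems by auto
  have "card G' \<le> (p * card G) * p ^ card B" using G'(3) cG by (meson le_trans mult_le_mono1)
  then have "card G' \<le> card G * p ^ card (insert x B)" using insert by (simp add: ac_simps)
  then show ?case using G' by auto
qed

end

text \<open>Under the twisted action, an ideal generated by \<open>p\<close>-th powers of elements
  of \<open>P\<close> lies in \<open>P\<close> times the pushforward. This is the form in which
  Nakayama's lemma can discard it.\<close>

lemma (in char_p_ring) frob_ideal_in_tspan:
  assumes "ideal P R" "B \<subseteq> P" "w \<in> genideal R ((\<lambda>x. x [^] p) ` B)"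
  shows "w \<in> tspan R P p {\<zero>} (carrier R)"
proof -
  interpret P: ideal P R by fact
  let ?N = "tspan R P p {\<zero>} (carrier R)"
  have Pc: "P \<subseteq> carrier R" using P.Icarr by auto
  have Nc: "x \<in> carrier R" if "x \<in> ?N" for x
    using that by induction (use P.Icarr in auto)
  have mult: "a \<otimes> x \<in> ?N" if "a \<in> carrier R" "x \<in> ?N" for a x
    using that(2)
  proof induction
    case (base w)
    then show ?case using that(1) by (auto intro: tspan.base)
  next
    case (step x c u)
    have "a \<otimes> (x \<oplus> c [^] p \<otimes> u) = a \<otimes> x \<oplus> c [^] p \<otimes> (a \<otimes> u)"
      using Nc[OF step(1)] step that(1) P.Icarr by (simp add: r_distr m_lcomm)
    then show ?case using tspan.step[OF step.IH step(2), of "a \<otimes> u"] step(3) that(1) by simp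
  qed
  have "ideal ?N R"
  proof (rule idealI[OF ring_axioms])
    show "subgroup ?N (add_monoid R)"
    proof (rule add.subgroupI)
      show "?N \<subseteq> carrier R" using Nc by auto
      have "\<zero> \<in> ?N" by (intro tspan.base) simp
      then show "?N \<noteq> {}" by blast
      fix a b assume ab: "a \<in> ?N" "b \<in> ?N"
      show "a \<oplus> b \<in> ?N" by (rule tspan_add_any[OF ab Pc subset_refl zeroideal])
      show "\<ominus> a \<in> ?N" using mult[OF _ ab(1), of "\<ominus> \<one>"] Nc[OF ab(1)] by (simp add: l_minus)
    qed
    fix a x assume "a \<in> ?N" "x \<in> carrier R"
    then show "x \<otimes> a \<in> ?N" "a \<otimes> x \<in> ?N" using mult[of x a] Nc[of a] by (auto simp: m_comm)
  qed
  moreover have "(\<lambda>x. x [^] p) ` B \<subseteq> ?N"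
  proof clarify
    fix x assume "x \<in> B"
    then have x: "x \<in> P" "x \<in> carrier R" using assms(2) P.Icarr by auto
    have "\<zero> \<oplus> x [^] p \<otimes> \<one> \<in> ?N" using x by (intro tspan.step tspan.base) auto
    then show "x [^] p \<in> ?N" using x by simp
  qed
  ultimately show ?thesis using genideal_minimal assms(3) by blast
qed

lemma (in twisted) tspan_qsub:
  assumes "S = carrier R" "U \<subseteq> carrier R"
  shows "qsub R q (tspan R S q Q U)"
  using assms tspan_carrier[OF _ assms(2)] tspan_add[OF _ _ assms(2)] tspan_scale[OF _ _ assms(2)]
  by (intro qsubI tspan_zero) auto

lemma (in char_p_ring) tspan_in_qsub:
  assumes "x \<in> tspan R S q Q U" "qsub R q Y" "Q \<subseteq> Y" "U \<subseteq> Y" "S \<subseteq> carrier R"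
  shows "x \<in> Y"
  using assms(1) by induction (use assms qsubD[OF assms(2)] in blast)+

locale reg_ess_alg = ess_finite_alg R p K xs E H for R (structure) and p K xs E H +
  assumes reg: "regular_ring R"
begin

lemma noeth: "noetherian_ring R" using reg by (simp add: regular_ring_def)

lemma ideal_finite: "ideal I R \<Longrightarrow> \<exists>A\<subseteq>carrier R. finite A \<and> I = genideal R A"
  using noetherian_ring.finetely_gen[OF noeth] .

lemma carrier_from_H:
  assumes "qsub R p Y" "H \<subseteq> Y"
  shows "carrier R \<subseteq> Y"
  using tspan_in_qsub[OF H(3) assms(1) _ assms(2) subset_refl] qsubD(2)[OF assms(1)] by auto

text \<open>After inverting \<open>s\<close> and \<open>t\<close>, the set \<open>G\<close> is a
  basis of the pushforward: \<open>s\<close> is a common denominator for all expansions, and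
  \<open>t\<close> kills the coefficients of every relation. Uniformity comes from finite
  generation, of the pushforward by \<open>H\<close> for \<open>s\<close> and of a prime ideal for
  \<open>t\<close>.\<close>

lemma local_basis:
  assumes "primeideal P R"
  obtains G s t where "finite G" "G \<subseteq> carrier R" "s \<in> carrier R - P" "t \<in> carrier R - P"
    "\<And>z. z \<in> carrier R \<Longrightarrow> s [^] p \<otimes> z \<in> tspan R (carrier R) p {\<zero>} G"
    "\<And>c g. c \<in> G \<rightarrow> carrier R \<Longrightarrow> (\<Oplus>g\<in>G. c g [^] p \<otimes> g) = \<zero> \<Longrightarrow> g \<in> G \<Longrightarrow> t \<otimes> c g = \<zero>"
proof -
  interpret prime_of R p P by (intro prime_of.intro char_p_ring_axioms prime_of_axioms.intro assms)
  interpret Z: twisted R p "carrier R" "{\<zero>}" by (rule twistedI[OF zeroideal carrier_is_subring])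
  obtain B and Qs :: "nat \<Rightarrow> 'a set" and d where B: "B \<subseteq> P" "finite B" "card B \<le> d"
    "\<And>z. z \<in> P \<Longrightarrow> \<exists>s\<in>carrier R - P. s \<otimes> z \<in> genideal R B"
    and Qs: "\<And>i. i \<le> d \<Longrightarrow> primeideal (Qs i) R" "\<And>i. i < d \<Longrightarrow> Qs i \<subset> Qs (Suc i)" "Qs d \<subseteq> P"
    by (rule regular_ring_at_prime[OF reg assms]) blast
  have Bc: "B \<subseteq> carrier R" using B(1) P.Icarr by auto
  obtain y where y: "y \<in> {..<prank P} \<rightarrow> carrier R" "pspans R p (carrier R) P (y ` {..<prank P})"
    by (rule prank_basis[OF assms])
  let ?Y = "y ` {..<prank P}"
  have Y: "finite ?Y" "?Y \<subseteq> carrier R" "card ?Y \<le> prank P" using y card_image_le[of "{..<prank P}" y] by auto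
  have IB: "ideal (genideal R B) R" by (rule genideal_ideal[OF Bc])
  have "lspan P ?Y" using y(2) unfolding pspans_def lspan_def .
  \<comment> \<open>\<open>s [^] p\<close> is a multiple of \<open>s\<close>, so an ordinary
    denominator also serves for the twisted action.\<close>
  then have "lspan (genideal R B) ?Y"
  proof (rule lspan_transfer[OF _ subset_refl Y(2) P.is_ideal IB])
    fix w assume w: "w \<in> P"
    then obtain s where s: "s \<in> carrier R - P" "s \<otimes> w \<in> genideal R B" using B(4) by blast
    obtain r where r: "p = Suc r" using p_pos gr0_implies_Suc by blast
    have "s [^] p \<otimes> w = s [^] r \<otimes> (s \<otimes> w)" using s w P.Icarr by (simp add: r m_assoc)
    then have "s [^] p \<otimes> w \<in> genideal R B" using ideal.I_l_closed[OF IB s(2), of "s [^] r"] s(1) by auto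
    then show "\<exists>t\<in>carrier R - P. t [^] p \<otimes> w \<in> tspan R (carrier R) p (genideal R B) ?Y"
      using s(1) by (blast intro: tspan.base)
  qed
  then have "\<exists>G'. finite G' \<and> G' \<subseteq> carrier R \<and> card G' \<le> card ?Y * p ^ card B
    \<and> lspan (genideal R ({} \<union> (\<lambda>x. x [^] p) ` B)) G'"
    using B(2) Bc Y by (intro lspan_powers) auto
  then obtain G where G: "finite G" "G \<subseteq> carrier R" "card G \<le> card ?Y * p ^ card B"
    "lspan (genideal R ((\<lambda>x. x [^] p) ` B)) G" by auto
  have GU: "qsub R p (tspan R (carrier R) p {\<zero>} G)" by (rule Z.tspan_qsub[OF refl G(2)])
  define U where "U = qsat R p P (tspan R (carrier R) p {\<zero>} G)"
  have GUc: "tspan R (carrier R) p {\<zero>} G \<subseteq> carrier R" using qsubD(1)[OF GU] .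
  have U: "qsub R p U" "qsat R p P U = U" "tspan R (carrier R) p {\<zero>} G \<subseteq> U"
    unfolding U_def using qsub_qsat[OF GU] qsat_qsat[OF GUc] qsat_incl[OF GUc] by auto
  \<comment> \<open>\<open>G\<close> generates only modulo the \<open>p\<close>-th powers of
    \<open>B\<close>. These lie in \<open>P\<close> times the pushforward, which is finitely
    generated by \<open>H\<close>, so Nakayama's lemma removes them.\<close>
  have "carrier R \<subseteq> U"
  proof (rule nakayama[of H "carrier R" 1 U, simplified])
    show "finite H" "H \<subseteq> carrier R" "qsub R p U" "qsat R p P U = U" using H U by auto
    show "carrier R \<subseteq> W" if W: "qsub R p W" "H \<subseteq> W" for W by (rule carrier_from_H[OF W])
    fix W assume W: "qsub R p W" "qsat R p P W = W" "U \<subseteq> W" "\<And>b z. b \<in> P \<Longrightarrow> z \<in> carrier R \<Longrightarrow> b [^] p \<otimes> z \<in> W"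
    have PW: "x \<in> W" if "x \<in> tspan R P p {\<zero>} (carrier R)" for x
      using that by induction (use qsubD(2,3)[OF W(1)] W(4) in auto)
    show "carrier R \<subseteq> W"
    proof
      fix z assume z: "z \<in> carrier R"
      then obtain s where s: "s \<in> carrier R - P" "s [^] p \<otimes> z \<in> tspan R (carrier R) p (genideal R ((\<lambda>x. x [^] p) ` B)) G"
        using G(4) unfolding lspan_def by blast
      have "G \<subseteq> W" using Z.tspan_incl[OF _ G(2)] U(3) W(3) by blast
      moreover have "genideal R ((\<lambda>x. x [^] p) ` B) \<subseteq> W"
        using PW frob_ideal_in_tspan[OF P.is_ideal B(1)] by blast
      ultimately have "s [^] p \<otimes> z \<in> W" using tspan_in_qsub[OF s(2) W(1)] by blast
      then show "z \<in> W" using qsatI[OF z s(1)] W(2) by blast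
    qed
  qed
  then have span: "\<exists>s\<in>carrier R - P. s [^] p \<otimes> z \<in> tspan R (carrier R) p {\<zero>} G" if "z \<in> carrier R" for z
    using that unfolding U_def qsat_def by blast
  text \<open>By the rank inequality along the chain, these generators are independent modulo \<open>Qs 0\<close>;
    hence \<open>Qs 0\<close> lies in its own Frobenius power and vanishes at \<open>P\<close>.\<close>
  let ?Q = "Qs 0"
  have Q: "primeideal ?Q R" using Qs(1) by simp
  interpret Q: primeideal ?Q R by (rule Q)
  interpret TQ: twisted_prime R p "carrier R" ?Q by (rule twisted_primeI[OF Q carrier_is_subring])
  have QP: "?Q \<subseteq> P"
  proof -
    have "Qs 0 \<subseteq> Qs i" if "i \<le> d" for i
      using that by (induction i) (use Qs(2) in \<open>auto dest!: Suc_le_lessD\<close>)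
    then show ?thesis using Qs(3) by blast
  qed
  have "prank P \<le> prank (Qs d)"
  proof (cases "Qs d = P")
    case False
    then have "p * prank P \<le> prank (Qs d)" using Qs(1)[of d] Qs(3) assms by (intro prank_strict) auto
    moreover have "prank P \<le> p * prank P" using p_pos by simp
    ultimately show ?thesis by linarith
  qed simp
  then have "p ^ d * prank P \<le> p ^ d * prank (Qs d)" by (rule mult_le_mono2)
  also have "\<dots> \<le> prank ?Q" using Qs by (intro prank_chain) auto
  finally have le: "p ^ d * prank P \<le> prank ?Q" .
  have "p ^ card B \<le> p ^ d" using B(3) p_pos by (intro power_increasing) auto
  then have "card ?Y * p ^ card B \<le> prank P * p ^ d" using Y(3) by (intro mult_le_mono)
  then have cG: "card G \<le> prank ?Q" using G(3) le by (simp add: mult.commute)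
  have spanQ: "\<exists>s\<in>carrier R - ?Q. s [^] p \<otimes> z \<in> tspan R (carrier R) p ?Q G" if "z \<in> carrier R" for z
  proof -
    have "tspan R (carrier R) p {\<zero>} G \<subseteq> tspan R (carrier R) p ?Q G" using TQ.Q_zero by (intro tspan_mono) auto
    then show ?thesis using span[OF that] QP by blast
  qed
  \<comment> \<open>A coefficient outside \<open>?Q\<close> would make \<open>h\<close> redundant at
    \<open>?Q\<close>, and fewer than \<open>prank ?Q\<close> elements would span there.\<close>
  have indep: "c h \<in> ?Q" if ch: "c \<in> G \<rightarrow> carrier R" "(\<Oplus>g\<in>G. c g [^] p \<otimes> g) \<in> ?Q" "h \<in> G" for c h
  proof (rule ccontr)
    assume nh: "c h \<notin> ?Q"
    let ?G = "G - {h}"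
    have Gh: "G = insert h ?G" "finite ?G" "?G \<subseteq> carrier R" "h \<notin> ?G" "h \<in> carrier R" using ch G by auto
    have cc: "c g \<in> carrier R" if "g \<in> G" for g using ch(1) that by auto
    have sumc: "(\<Oplus>g\<in>?G. c g [^] p \<otimes> g) \<in> carrier R" using Gh cc by (intro finsum_closed) auto
    have "(\<Oplus>g\<in>insert h ?G. c g [^] p \<otimes> g) = c h [^] p \<otimes> h \<oplus> (\<Oplus>g\<in>?G. c g [^] p \<otimes> g)"
      using Gh cc ch(3) by (intro finsum_insert) auto
    then have eq: "c h [^] p \<otimes> h \<oplus> (\<Oplus>g\<in>?G. c g [^] p \<otimes> g) \<in> ?Q" using ch(2) Gh(1) by simp
    have "(\<Oplus>g\<in>?G. c g [^] p \<otimes> g) \<in> tspan R (carrier R) p ?Q ?G"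
      using Gh cc by (intro TQ.tspan_finsum TQ.tspan_term) auto
    then have "\<ominus> (\<Oplus>g\<in>?G. c g [^] p \<otimes> g) \<in> tspan R (carrier R) p ?Q ?G"
      using TQ.tspan_neg[of _ 1] Gh(3) by simp
    from TQ.tspan_add[OF tspan.base[OF eq] this Gh(3)]
    have hspan: "c h [^] p \<otimes> h \<in> tspan R (carrier R) p ?Q ?G"
      using sumc cc[OF ch(3)] Gh(5) by (simp add: a_assoc r_neg)
    have "pspans R p (carrier R) ?Q ?G"
      unfolding pspans_def
    proof
      fix z assume z: "z \<in> carrier R"
      obtain s where s: "s \<in> carrier R - ?Q" "s [^] p \<otimes> z \<in> tspan R (carrier R) p ?Q G" using spanQ[OF z] by blast
      have "\<exists>t\<in>carrier R - ?Q. t [^] p \<otimes> (s [^] p \<otimes> z) \<in> tspan R (carrier R) p ?Q ?G"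
      proof (rule TQ.tspan_denominator[OF s(2) G(2) Gh(3)])
        show "carrier R - ?Q \<subseteq> carrier R" "carrier R - ?Q \<subseteq> carrier R" by auto
        show "\<one> \<in> carrier R - ?Q" using TQ.one_notin by simp
        show "a \<otimes> b \<in> carrier R - ?Q" if "a \<in> carrier R - ?Q" "b \<in> carrier R - ?Q" for a b
          using that TQ.dom by auto
        fix u assume u: "u \<in> G"
        show "\<exists>s\<in>carrier R - ?Q. s [^] p \<otimes> u \<in> tspan R (carrier R) p ?Q ?G"
        proof (cases "u = h")
          case True
          then show ?thesis using hspan nh cc[OF ch(3)] by blast
        next
          case False
          then have "\<one> [^] p \<otimes> u \<in> tspan R (carrier R) p ?Q ?G"
            using u TQ.tspan_incl[OF _ Gh(3)] G(2) by auto
          then show ?thesis using TQ.one_notin by blast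
        qed
      qed
      then obtain t where t: "t \<in> carrier R - ?Q" "t [^] p \<otimes> (s [^] p \<otimes> z) \<in> tspan R (carrier R) p ?Q ?G" by blast
      have "(t \<otimes> s) [^] p \<otimes> z = t [^] p \<otimes> (s [^] p \<otimes> z)" using s t z by (simp add: nat_pow_distrib m_assoc)
      then have "(t \<otimes> s) [^] p \<otimes> z \<in> tspan R (carrier R) p ?Q ?G" using t(2) by simp
      moreover have "t \<otimes> s \<in> carrier R - ?Q" using TQ.dom s t by auto
      ultimately show "\<exists>s\<in>carrier R - ?Q. s [^] p \<otimes> z \<in> tspan R (carrier R) p ?Q ?G" by blast
    qed
    then have "prank ?Q \<le> card ?G" using prank_le_card[OF Q _ Gh(2,3)] by blast
    moreover have "card ?G < card G" using G(1) ch(3) by (intro psubset_card_mono) auto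
    ultimately show False using cG by simp
  qed
  obtain A where A: "A \<subseteq> carrier R" "finite A" "?Q = genideal R A" using ideal_finite[OF Q.is_ideal] by blast
  have AQ: "A \<subseteq> ?Q" using genideal_self[OF A(1)] A(3) by simp
  have z0: "qsub R 1 {\<zero>}" by (rule qsubI) auto
  have zc: "{\<zero>} \<subseteq> carrier R" by simp
  define U0 where "U0 = qsat R 1 P {\<zero>}"
  have U0: "qsub R 1 U0" "qsat R 1 P U0 = U0"
    unfolding U0_def using qsub_qsat[OF z0] qsat_qsat[OF zc] by auto
  \<comment> \<open>Nakayama's lemma with \<open>e = 0\<close>, that is for ordinary ideals:
    \<open>?Q\<close> is locally contained in \<open>P\<close> times \<open>?Q\<close>, since the
    expansion of an element of \<open>?Q\<close> by \<open>G\<close> has all its coefficients in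
    \<open>?Q\<close>.\<close>
  have "?Q \<subseteq> U0"
  proof (rule nakayama[of A ?Q 0 U0, unfolded power_0])
    show "finite A" "A \<subseteq> ?Q" "?Q \<subseteq> carrier R" "qsub R 1 U0" "qsat R 1 P U0 = U0"
      using A AQ U0 Q.Icarr by auto
    show "?Q \<subseteq> W" if W: "qsub R 1 W" "A \<subseteq> W" for W
    proof -
      have Wc: "W \<subseteq> carrier R" using qsubD(1)[OF W(1)] .
      have Wm: "x \<otimes> a \<in> W" if "a \<in> W" "x \<in> carrier R" for a x using qsubD(4)[OF W(1) that(2,1)] that(2) by simp
      have "ideal W R"
      proof (rule idealI[OF ring_axioms])
        show "subgroup W (add_monoid R)"
        proof (rule add.subgroupI[OF Wc])
          show "W \<noteq> {}" using qsubD(2)[OF W(1)] by blast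
          show "a \<oplus> b \<in> W" if "a \<in> W" "b \<in> W" for a b using qsubD(3)[OF W(1) that] .
          show "\<ominus> a \<in> W" if "a \<in> W" for a using Wm[OF that, of "\<ominus> \<one>"] Wc that by (auto simp: l_minus subset_iff)
        qed
        show "x \<otimes> a \<in> W" "a \<otimes> x \<in> W" if "a \<in> W" "x \<in> carrier R" for a x
          using Wm[OF that] Wc that m_comm[of a x] by auto
      qed
      then show ?thesis using genideal_minimal[OF _ W(2)] A(3) by simp
    qed
    fix W assume W: "qsub R 1 W" "qsat R 1 P W = W" "U0 \<subseteq> W"
      "\<And>b z. b \<in> P \<Longrightarrow> z \<in> ?Q \<Longrightarrow> b [^] (1::nat) \<otimes> z \<in> W"
    show "?Q \<subseteq> W"
    proof
      fix z assume z: "z \<in> ?Q"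
      have zc: "z \<in> carrier R" using z Q.Icarr by blast
      obtain s where s: "s \<in> carrier R - P" "s [^] p \<otimes> z \<in> tspan R (carrier R) (p ^ 1) {\<zero>} G"
        using span[OF zc] by auto
      obtain c w where cw: "c \<in> G \<rightarrow> carrier R" "w \<in> {\<zero>}" "s [^] p \<otimes> z = w \<oplus> (\<Oplus>g\<in>G. c g [^] (p ^ 1) \<otimes> g)"
        by (rule Z.tspan_finite[OF s(2) G(1,2)])
      have cc: "c g \<in> carrier R" if "g \<in> G" for g using cw(1) that by auto
      have "(\<Oplus>g\<in>G. c g [^] p \<otimes> g) \<in> carrier R" using G cc by (intro finsum_closed) auto
      then have e: "s [^] p \<otimes> z = (\<Oplus>g\<in>G. c g [^] p \<otimes> g)" using cw by simp
      have "s [^] p \<otimes> z \<in> ?Q" using z s by (intro Q.I_l_closed) auto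
      then have cQ: "c g \<in> ?Q" if "g \<in> G" for g using indep[OF cw(1) _ that] e by simp
      \<comment> \<open>Since \<open>p\<close> is at least two, one factor \<open>c g\<close> can
        count as an element of \<open>P\<close> while another keeps the rest of the product in
        \<open>?Q\<close>.\<close>
      obtain r where r: "p = Suc (Suc r)" using p_ge2 by (intro that[of "p - 2"]) simp
      have tW: "c g [^] p \<otimes> g \<in> W" if g: "g \<in> G" for g
      proof -
        have gc: "g \<in> carrier R" "c g \<in> carrier R" using g G cc by auto
        have "c g [^] Suc r \<otimes> g = c g \<otimes> (c g [^] r \<otimes> g)" using gc by (simp add: m_ac)
        then have "c g [^] Suc r \<otimes> g \<in> ?Q" using gc Q.I_r_closed[OF cQ[OF g]] by simp
        then have "c g [^] (1::nat) \<otimes> (c g [^] Suc r \<otimes> g) \<in> W" using W(4) cQ[OF g] QP by blast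
        moreover have "c g [^] (1::nat) \<otimes> (c g [^] Suc r \<otimes> g) = c g [^] p \<otimes> g"
          using gc by (simp add: r m_ac)
        ultimately show ?thesis by simp
      qed
      have "(\<Oplus>g\<in>F. c g [^] p \<otimes> g) \<in> W" if "finite F" "F \<subseteq> G" for F
        using that
      proof (induction F rule: finite_induct)
        case empty then show ?case using qsubD(2)[OF W(1)] by simp
      next
        case (insert g F)
        have "(\<Oplus>g\<in>insert g F. c g [^] p \<otimes> g) = c g [^] p \<otimes> g \<oplus> (\<Oplus>g\<in>F. c g [^] p \<otimes> g)"
          using insert G(2) cc by (intro finsum_insert) (auto simp: subset_iff)
        then show ?case using qsubD(3)[OF W(1) tW] insert by auto
      qed
      then have "(s [^] p) [^] (1::nat) \<otimes> z \<in> W" using e G(1) s by (simp add: nat_pow_Suc)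
      then show "z \<in> W" using qsatI[OF zc pow_notin_P[OF s(1), of p]] W(2) by blast
    qed
  qed
  then have ann: "\<exists>s\<in>carrier R - P. s \<otimes> z = \<zero>" if "z \<in> ?Q" for z
    using that unfolding U0_def qsat_def by auto
  \<comment> \<open>Each element of \<open>?Q\<close> has an annihilator outside \<open>P\<close>;
    finite generation yields a common one.\<close>
  have "\<exists>t\<in>carrier R - P. \<forall>a\<in>A. t \<otimes> a = \<zero>"
  proof (rule Z.common_multiple[OF A(2)])
    show "carrier R - P \<subseteq> carrier R" "\<one> \<in> carrier R - P" using one_notin_P by auto
    show "s \<otimes> t \<in> carrier R - P" if "s \<in> carrier R - P" "t \<in> carrier R - P" for s t using mult_notin_P[OF that] .
    show "\<exists>s\<in>carrier R - P. s \<otimes> a = \<zero>" if "a \<in> A" for a using ann AQ that by blast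
    show "(t \<otimes> s) \<otimes> a = \<zero>" if "a \<in> A" "s \<in> carrier R - P" "t \<in> carrier R - P" "s \<otimes> a = \<zero>" for a s t
    proof -
      have "a \<in> carrier R" using that(1) A(1) by blast
      then show ?thesis using that by (simp add: m_assoc)
    qed
  qed
  then obtain t where t: "t \<in> carrier R - P" "\<forall>a\<in>A. t \<otimes> a = \<zero>" by blast
  have tQ: "t \<otimes> z = \<zero>" if "z \<in> ?Q" for z
  proof -
    have "ideal {z \<in> carrier R. t \<otimes> z = \<zero>} R"
    proof (rule idealI[OF ring_axioms])
      show "subgroup {z \<in> carrier R. t \<otimes> z = \<zero>} (add_monoid R)"
        using t by (intro add.subgroupI) (auto simp: r_distr r_minus)
      fix a x assume "a \<in> {z \<in> carrier R. t \<otimes> z = \<zero>}" "x \<in> carrier R"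
      then show "x \<otimes> a \<in> {z \<in> carrier R. t \<otimes> z = \<zero>}" "a \<otimes> x \<in> {z \<in> carrier R. t \<otimes> z = \<zero>}"
        using t m_lcomm[of t x a] by (auto simp: m_assoc[symmetric])
    qed
    then have "genideal R A \<subseteq> {z \<in> carrier R. t \<otimes> z = \<zero>}" using A(1) t(2) by (intro genideal_minimal) auto
    then show ?thesis using that A(3) by auto
  qed
  have "\<exists>s\<in>carrier R - P. \<forall>h\<in>H. s [^] p \<otimes> h \<in> tspan R (carrier R) p {\<zero>} G"
  proof (rule Z.common_multiple[OF H(1)])
    show "carrier R - P \<subseteq> carrier R" "\<one> \<in> carrier R - P" using one_notin_P by auto
    show "s \<otimes> t \<in> carrier R - P" if "s \<in> carrier R - P" "t \<in> carrier R - P" for s t using mult_notin_P[OF that] .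
    show "\<exists>s\<in>carrier R - P. s [^] p \<otimes> a \<in> tspan R (carrier R) p {\<zero>} G" if "a \<in> H" for a
      using span H(2) that by blast
    show "(t \<otimes> s) [^] p \<otimes> a \<in> tspan R (carrier R) p {\<zero>} G"
      if *: "a \<in> H" "s \<in> carrier R - P" "t \<in> carrier R - P" "s [^] p \<otimes> a \<in> tspan R (carrier R) p {\<zero>} G" for a s t
    proof -
      have "a \<in> carrier R" using *(1) H(2) by blast
      then have "(t \<otimes> s) [^] p \<otimes> a = t [^] p \<otimes> (s [^] p \<otimes> a)" using * by (simp add: nat_pow_distrib m_assoc)
      then show ?thesis using Z.tspan_scale[OF *(4) _ G(2)] *(3) by auto
    qed
  qed
  then obtain s where s: "s \<in> carrier R - P" "\<forall>h\<in>H. s [^] p \<otimes> h \<in> tspan R (carrier R) p {\<zero>} G" by blast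
  have sall: "s [^] p \<otimes> z \<in> tspan R (carrier R) p {\<zero>} G" if z: "z \<in> carrier R" for z
  proof -
    have "qsub R p {z \<in> carrier R. s [^] p \<otimes> z \<in> tspan R (carrier R) p {\<zero>} G}"
      using s(1) Z.tspan_zero Z.tspan_add[OF _ _ G(2)] Z.tspan_scale[OF _ _ G(2)]
      by (intro qsubI) (auto simp: r_distr m_lcomm[of "s [^] p"])
    then have "carrier R \<subseteq> {z \<in> carrier R. s [^] p \<otimes> z \<in> tspan R (carrier R) p {\<zero>} G}"
      using s(2) H(2) by (intro carrier_from_H) auto
    then show ?thesis using z by blast
  qed
  show thesis
  proof (rule that[OF G(1,2) s(1) t(1) sall])
    fix c g assume c: "c \<in> G \<rightarrow> carrier R" "(\<Oplus>g\<in>G. c g [^] p \<otimes> g) = \<zero>" "g \<in> G"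
    then show "t \<otimes> c g = \<zero>" using tQ indep[OF c(1) _ c(3)] Q.zero_closed by simp
  qed
qed

end

section \<open>A global dual basis for the Frobenius pushforward\<close>

text \<open>The \<open>R\<close>-linear maps from the Frobenius pushforward of \<open>R\<close> to
  \<open>R\<close>.\<close>

definition plin :: "('a, 'm) ring_scheme \<Rightarrow> nat \<Rightarrow> ('a \<Rightarrow> 'a) \<Rightarrow> bool" where
  "plin R p f \<longleftrightarrow> (\<forall>x\<in>carrier R. f x \<in> carrier R) \<and>
     (\<forall>x\<in>carrier R. \<forall>y\<in>carrier R. f (x \<oplus>\<^bsub>R\<^esub> y) = f x \<oplus>\<^bsub>R\<^esub> f y) \<and>
     (\<forall>r\<in>carrier R. \<forall>x\<in>carrier R. f ((r [^]\<^bsub>R\<^esub> p) \<otimes>\<^bsub>R\<^esub> x) = r \<otimes>\<^bsub>R\<^esub> f x)"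

text \<open>Lists rather than finite sets, because the global dual basis is assembled by
  concatenating local ones, in which pairs may recur.\<close>

primrec dsum :: "('a, 'm) ring_scheme \<Rightarrow> nat \<Rightarrow> (('a \<Rightarrow> 'a) \<times> 'a) list \<Rightarrow> 'a \<Rightarrow> 'a" where
  "dsum R p [] x = \<zero>\<^bsub>R\<^esub>"
| "dsum R p (fg # L) x = (fst fg x [^]\<^bsub>R\<^esub> p) \<otimes>\<^bsub>R\<^esub> snd fg \<oplus>\<^bsub>R\<^esub> dsum R p L x"

definition plin_list :: "('a, 'm) ring_scheme \<Rightarrow> nat \<Rightarrow> (('a \<Rightarrow> 'a) \<times> 'a) list \<Rightarrow> bool" where
  "plin_list R p L \<longleftrightarrow> (\<forall>(f, g) \<in> set L. plin R p f \<and> g \<in> carrier R)"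

context char_p_ring
begin

lemma plinD:
  assumes "plin R p f"
  shows "x \<in> carrier R \<Longrightarrow> f x \<in> carrier R"
    "x \<in> carrier R \<Longrightarrow> y \<in> carrier R \<Longrightarrow> f (x \<oplus> y) = f x \<oplus> f y"
    "r \<in> carrier R \<Longrightarrow> x \<in> carrier R \<Longrightarrow> f (r [^] p \<otimes> x) = r \<otimes> f x"
  using assms unfolding plin_def by auto

lemma plin_zero: "plin R p f \<Longrightarrow> f \<zero> = \<zero>"
  using plinD(3)[of f \<zero> \<zero>] plinD(1)[of f \<zero>] by simp

lemma dsum_carr: "plin_list R p L \<Longrightarrow> x \<in> carrier R \<Longrightarrow> dsum R p L x \<in> carrier R"
  by (induction L) (auto simp: plin_list_def plinD)

lemma dsum_append:
  "plin_list R p L \<Longrightarrow> plin_list R p L' \<Longrightarrow> x \<in> carrier R \<Longrightarrow> dsum R p (L @ L') x = dsum R p L x \<oplus> dsum R p L' x"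
proof (induction L)
  case Nil
  then show ?case using dsum_carr by simp
next
  case (Cons fg L)
  have L: "plin_list R p L" "fst fg x \<in> carrier R" "snd fg \<in> carrier R"
    using Cons.prems by (auto simp: plin_list_def plinD)
  then show ?case using Cons dsum_carr by (simp add: a_assoc)
qed

lemma dsum_scale:
  assumes "plin_list R p L" "x \<in> carrier R" "a \<in> carrier R"
  shows "dsum R p (map (\<lambda>(f, g). (\<lambda>y. a \<otimes> f y, g)) L) x = a [^] p \<otimes> dsum R p L x"
  using assms
proof (induction L)
  case (Cons fg L)
  have L: "plin_list R p L" "fst fg x \<in> carrier R" "snd fg \<in> carrier R"
    using Cons.prems by (auto simp: plin_list_def plinD)
  then show ?case using Cons dsum_carr[OF L(1)]
    by (simp add: case_prod_beta nat_pow_distrib r_distr m_assoc)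
qed simp

lemma plin_list_scale:
  assumes "plin_list R p L" "a \<in> carrier R"
  shows "plin_list R p (map (\<lambda>(f, g). (\<lambda>y. a \<otimes> f y, g)) L)"
  using assms unfolding plin_list_def plin_def by (auto simp: r_distr m_lcomm)

lemma dsum_finsum:
  assumes "distinct gs" "set gs \<subseteq> carrier R" "\<And>g. g \<in> set gs \<Longrightarrow> f g x \<in> carrier R"
  shows "dsum R p (map (\<lambda>g. (f g, g)) gs) x = (\<Oplus>g\<in>set gs. f g x [^] p \<otimes> g)"
  using assms
proof (induction gs)
  case (Cons g gs)
  have "(\<Oplus>g\<in>insert g (set gs). f g x [^] p \<otimes> g) = f g x [^] p \<otimes> g \<oplus> (\<Oplus>g\<in>set gs. f g x [^] p \<otimes> g)"
    using Cons.prems by (intro finsum_insert) auto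
  then show ?case using Cons by simp
qed simp

end

context reg_ess_alg
begin

text \<open>A partition of unity: the \<open>r\<close> for which \<open>r [^] p\<close> times the
  identity has such an expansion form an ideal, by concatenating and rescaling lists. A maximal
  ideal containing it would contradict the local basis there, so it contains one.\<close>

theorem dual_basis:
  obtains L where "plin_list R p L" "\<And>x. x \<in> carrier R \<Longrightarrow> x = dsum R p L x"
proof -
  define T where "T = {r \<in> carrier R. \<exists>L. plin_list R p L \<and> (\<forall>x\<in>carrier R. r [^] p \<otimes> x = dsum R p L x)}"
  have Tmult: "a \<otimes> r \<in> T" if "r \<in> T" "a \<in> carrier R" for r a
  proof -
    obtain L where L: "r \<in> carrier R" "plin_list R p L" "\<forall>x\<in>carrier R. r [^] p \<otimes> x = dsum R p L x"
      using \<open>r \<in> T\<close> unfolding T_def by blast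
    have "(a \<otimes> r) [^] p \<otimes> x = dsum R p (map (\<lambda>(f, g). (\<lambda>y. a \<otimes> f y, g)) L) x" if x: "x \<in> carrier R" for x
      using L(1) x \<open>a \<in> carrier R\<close> dsum_scale[OF L(2) x \<open>a \<in> carrier R\<close>] L(3)[rule_format, OF x, symmetric]
      by (simp add: nat_pow_distrib m_assoc)
    then show ?thesis unfolding T_def using L(1) plin_list_scale[OF L(2)] \<open>a \<in> carrier R\<close> by blast
  qed
  have T: "ideal T R"
  proof (rule idealI[OF ring_axioms])
    show "subgroup T (add_monoid R)"
    proof (rule add.subgroupI)
      show Tc: "T \<subseteq> carrier R" unfolding T_def by auto
      have "\<zero> [^] p \<otimes> x = dsum R p [] x" if "x \<in> carrier R" for x using that by (simp add: frob_zero1)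
      moreover have "plin_list R p []" by (simp add: plin_list_def)
      ultimately have "\<zero> \<in> T" unfolding T_def by blast
      then show "T \<noteq> {}" by blast
      fix r r' assume r: "r \<in> T" "r' \<in> T"
      show "\<ominus> r \<in> T" using Tmult[OF r(1), of "\<ominus> \<one>"] Tc r(1) by (auto simp: l_minus subset_iff)
      obtain L where L: "r \<in> carrier R" "plin_list R p L" "\<forall>x\<in>carrier R. r [^] p \<otimes> x = dsum R p L x"
        using r(1) unfolding T_def by blast
      obtain L' where L': "r' \<in> carrier R" "plin_list R p L'" "\<forall>x\<in>carrier R. r' [^] p \<otimes> x = dsum R p L' x"
        using r(2) unfolding T_def by blast
      have "(r \<oplus> r') [^] p \<otimes> x = dsum R p (L @ L') x" if x: "x \<in> carrier R" for x
        using L(1) L'(1) x dsum_append[OF L(2) L'(2) x] L(3)[rule_format, OF x, symmetric]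
          L'(3)[rule_format, OF x, symmetric] by (simp add: frob_add1 l_distr)
      moreover have "plin_list R p (L @ L')" using L(2) L'(2) by (auto simp: plin_list_def)
      ultimately show "r \<oplus> r' \<in> T" unfolding T_def using L(1) L'(1) by blast
    qed
    fix r a assume "r \<in> T" "a \<in> carrier R"
    then show "a \<otimes> r \<in> T" "r \<otimes> a \<in> T" using Tmult[of r a] m_comm[of r a] by (auto simp: T_def)
  qed
  have "T = carrier R"
  proof (rule ccontr)
    assume "T \<noteq> carrier R"
    then obtain P where P: "maximalideal P R" "T \<subseteq> P" using maximal_above[OF T] by blast
    have prime: "primeideal P R" by (rule maximalideal_prime[OF P(1)])
    interpret prime_of R p P by (intro prime_of.intro char_p_ring_axioms prime_of_axioms.intro prime)
    interpret Z: twisted R p "carrier R" "{\<zero>}" by (rule twistedI[OF zeroideal carrier_is_subring])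
    obtain G s t where G: "finite G" "G \<subseteq> carrier R" "s \<in> carrier R - P" "t \<in> carrier R - P"
      "\<And>z. z \<in> carrier R \<Longrightarrow> s [^] p \<otimes> z \<in> tspan R (carrier R) p {\<zero>} G"
      "\<And>c g. c \<in> G \<rightarrow> carrier R \<Longrightarrow> (\<Oplus>g\<in>G. c g [^] p \<otimes> g) = \<zero> \<Longrightarrow> g \<in> G \<Longrightarrow> t \<otimes> c g = \<zero>"
      by (rule local_basis[OF prime]) blast
    have stc: "s \<in> carrier R" "t \<in> carrier R" using G(3,4) by auto
    define rep where "rep = (\<lambda>z c. c \<in> G \<rightarrow> carrier R \<and> s [^] p \<otimes> z = (\<Oplus>g\<in>G. c g [^] p \<otimes> g))"
    have repc: "c g \<in> carrier R" if "rep z c" "g \<in> G" for z c g using that unfolding rep_def by auto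
    have "\<exists>c. rep z c" if z: "z \<in> carrier R" for z
    proof -
      have "s [^] p \<otimes> z \<in> tspan R (carrier R) (p ^ 1) {\<zero>} G" using G(5)[OF z] by simp
      then obtain c w where cw: "c \<in> G \<rightarrow> carrier R" "w \<in> {\<zero>}" "s [^] p \<otimes> z = w \<oplus> (\<Oplus>g\<in>G. c g [^] (p ^ 1) \<otimes> g)"
        by (rule Z.tspan_finite[OF _ G(1,2)])
      have "(\<Oplus>g\<in>G. c g [^] p \<otimes> g) \<in> carrier R" using cw(1) G(2) by (intro finsum_closed) auto
      then show ?thesis unfolding rep_def using cw by auto
    qed
    define C where "C = (\<lambda>z. SOME c. rep z c)"
    have C: "rep z (C z)" if "z \<in> carrier R" for z
      unfolding C_def using \<open>\<And>z. z \<in> carrier R \<Longrightarrow> \<exists>c. rep z c\<close>[OF that] by (rule someI_ex)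
    \<comment> \<open>Coordinates are determined only up to elements killed by \<open>t\<close>.
      After multiplication by \<open>t\<close> they no longer depend on the choice \<open>C\<close>,
      and this makes the coordinate functions \<open>f g\<close> linear.\<close>
    have uniq: "t \<otimes> c g = t \<otimes> c' g" if cr: "rep z c" "rep z c'" "g \<in> G" for z c c' g
    proof -
      have cc: "c h \<in> carrier R" "c' h \<in> carrier R" if "h \<in> G" for h using repc cr that by auto
      have fc: "(\<lambda>g. c g [^] p \<otimes> g) \<in> G \<rightarrow> carrier R" "(\<lambda>g. c' g [^] p \<otimes> g) \<in> G \<rightarrow> carrier R"
        using cc G(2) by auto
      have "(\<Oplus>g\<in>G. (c g \<ominus> c' g) [^] p \<otimes> g) = (\<Oplus>g\<in>G. c g [^] p \<otimes> g \<oplus> \<ominus> (c' g [^] p \<otimes> g))"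
        using cc G(2) by (intro finsum_cong') (auto simp: minus_eq frob_add1 frob_neg1 l_distr l_minus subset_iff)
      also have "\<dots> = (\<Oplus>g\<in>G. c g [^] p \<otimes> g) \<oplus> (\<Oplus>g\<in>G. \<ominus> (c' g [^] p \<otimes> g))"
        using fc by (intro finsum_addf) auto
      also have "(\<Oplus>g\<in>G. \<ominus> (c' g [^] p \<otimes> g)) = \<ominus> (\<Oplus>g\<in>G. c' g [^] p \<otimes> g)"
        by (rule finsum_uminus[OF G(1) fc(2), symmetric])
      also have "(\<Oplus>g\<in>G. c' g [^] p \<otimes> g) = (\<Oplus>g\<in>G. c g [^] p \<otimes> g)" using cr unfolding rep_def by metis
      also have "(\<Oplus>g\<in>G. c g [^] p \<otimes> g) \<oplus> \<ominus> (\<Oplus>g\<in>G. c g [^] p \<otimes> g) = \<zero>"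
        using fc(1) by (intro r_neg finsum_closed)
      finally have "t \<otimes> (c g \<ominus> c' g) = \<zero>"
        using G(6)[of "\<lambda>g. c g \<ominus> c' g" g] cc cr(3) by auto
      then show ?thesis using cc[OF cr(3)] stc
        by (simp add: minus_eq r_distr r_minus) (metis minus_eq m_closed r_right_minus_eq)
    qed
    define f where "f = (\<lambda>g z. t \<otimes> C z g)"
    have fv: "f g z = t \<otimes> c g" if "z \<in> carrier R" "g \<in> G" "rep z c" for g z c
      unfolding f_def using uniq[OF C[OF that(1)] that(3,2)] .
    have fplin: "plin R p (f g)" if g: "g \<in> G" for g
      unfolding plin_def
    proof (intro conjI ballI)
      fix x assume x: "x \<in> carrier R"
      show "f g x \<in> carrier R" unfolding f_def using repc[OF C[OF x] g] stc by simp
    next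
      fix x y assume x: "x \<in> carrier R" and y: "y \<in> carrier R"
      have cc: "C x h \<in> carrier R" "C y h \<in> carrier R" if "h \<in> G" for h using repc C x y that by auto
      have "s [^] p \<otimes> (x \<oplus> y) = (\<Oplus>g\<in>G. C x g [^] p \<otimes> g) \<oplus> (\<Oplus>g\<in>G. C y g [^] p \<otimes> g)"
        using C[OF x] C[OF y] x y stc unfolding rep_def by (simp add: r_distr)
      also have "\<dots> = (\<Oplus>g\<in>G. C x g [^] p \<otimes> g \<oplus> C y g [^] p \<otimes> g)"
        using cc G(2) by (intro finsum_addf[symmetric]) auto
      also have "\<dots> = (\<Oplus>g\<in>G. (C x g \<oplus> C y g) [^] p \<otimes> g)"
        using cc G(2) by (intro finsum_cong') (auto simp: frob_add1 l_distr subset_iff)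
      finally have "rep (x \<oplus> y) (\<lambda>g. C x g \<oplus> C y g)" unfolding rep_def using cc by auto
      then have "f g (x \<oplus> y) = t \<otimes> (C x g \<oplus> C y g)" using fv[of "x \<oplus> y" g] x y g by simp
      then show "f g (x \<oplus> y) = f g x \<oplus> f g y" unfolding f_def using cc[OF g] stc by (simp add: r_distr)
    next
      fix r x assume r: "r \<in> carrier R" and x: "x \<in> carrier R"
      have cc: "C x h \<in> carrier R" if "h \<in> G" for h using repc C x that by auto
      have "s [^] p \<otimes> (r [^] p \<otimes> x) = r [^] p \<otimes> (\<Oplus>g\<in>G. C x g [^] p \<otimes> g)"
        using C[OF x] x r stc unfolding rep_def by (simp add: m_lcomm)
      also have "\<dots> = (\<Oplus>g\<in>G. r [^] p \<otimes> (C x g [^] p \<otimes> g))"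
        using cc G(1,2) r by (intro finsum_rdistr) auto
      also have "\<dots> = (\<Oplus>g\<in>G. (r \<otimes> C x g) [^] p \<otimes> g)"
        using cc G(2) r by (intro finsum_cong') (auto simp: nat_pow_distrib m_assoc subset_iff)
      finally have "rep (r [^] p \<otimes> x) (\<lambda>g. r \<otimes> C x g)" unfolding rep_def using cc r by auto
      then have "f g (r [^] p \<otimes> x) = t \<otimes> (r \<otimes> C x g)" using fv[of "r [^] p \<otimes> x" g] x r g by simp
      then show "f g (r [^] p \<otimes> x) = r \<otimes> f g x" unfolding f_def using cc[OF g] stc r by (simp add: m_lcomm)
    qed
    obtain gs where gs: "set gs = G" "distinct gs" using finite_distinct_list[OF G(1)] by blast
    let ?L = "map (\<lambda>g. (f g, g)) gs"
    have pl: "plin_list R p ?L" unfolding plin_list_def using gs fplin G(2) by auto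
    have "(t \<otimes> s) [^] p \<otimes> x = dsum R p ?L x" if x: "x \<in> carrier R" for x
    proof -
      have cc: "C x h \<in> carrier R" if "h \<in> G" for h using repc C x that by auto
      have "(t \<otimes> s) [^] p \<otimes> x = t [^] p \<otimes> (\<Oplus>g\<in>G. C x g [^] p \<otimes> g)"
        using C[OF x] x stc unfolding rep_def by (simp add: nat_pow_distrib m_assoc)
      also have "\<dots> = (\<Oplus>g\<in>G. t [^] p \<otimes> (C x g [^] p \<otimes> g))"
        using cc G(1,2) stc by (intro finsum_rdistr) auto
      also have "\<dots> = (\<Oplus>g\<in>G. f g x [^] p \<otimes> g)"
        unfolding f_def using cc G(2) stc
        by (intro finsum_cong') (auto simp: nat_pow_distrib m_assoc subset_iff)
      also have "\<dots> = dsum R p ?L x"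
        using dsum_finsum[OF gs(2), of f x] gs(1) G(2) plinD(1)[OF fplin _] x by simp
      finally show ?thesis .
    qed
    then have "t \<otimes> s \<in> T" unfolding T_def using pl stc by blast
    then show False using P(2) mult_notin_P[OF G(4,3)] by blast
  qed
  then have "\<one> \<in> T" by simp
  then obtain L where L: "plin_list R p L" "\<forall>x\<in>carrier R. \<one> [^] p \<otimes> x = dsum R p L x" unfolding T_def by blast
  then show thesis using that[OF L(1)] by simp
qed

end

section \<open>Algebras essentially of finite type\<close>

text \<open>At a maximal ideal \<open>Q\<close> the rank of \<open>R\<close> is finite. It bounds
  the rank of the subalgebra \<open>B\<close>, because coefficients from \<open>R\<close> are moved
  into \<open>B\<close> by units, and \<open>pbounded_adjoin\<close> removes the generators
  \<open>xs\<close> one by one. Finally \<open>K\<close> meets \<open>Q\<close> in zero, so spanning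
  modulo \<open>Q\<close> is genuine spanning.\<close>

lemma (in filtered) ground_field_F_finite:
  assumes K_inv: "\<And>c. c \<in> K \<Longrightarrow> c \<noteq> \<zero> \<Longrightarrow> \<exists>d\<in>K. c \<otimes> d = \<one>" and "\<one> \<noteq> \<zero>"
    and unit: "\<And>A. finite A \<Longrightarrow> A \<subseteq> carrier R \<Longrightarrow>
      \<exists>u\<in>Units R. u \<in> generate_ring R (K \<union> set xs) \<and> (\<forall>a\<in>A. u \<otimes> a \<in> generate_ring R (K \<union> set xs))"
    and H: "finite H" "H \<subseteq> carrier R" "\<And>x. x \<in> carrier R \<Longrightarrow> x \<in> tspan R (carrier R) p {\<zero>} H"
  shows "\<exists>E. finite E \<and> E \<subseteq> K \<and> (\<forall>c\<in>K. c \<in> tspan R K p {\<zero>} E)"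
proof -
  have "{\<zero>} \<noteq> carrier R" using assms(2) one_closed by blast
  then obtain Q where Q0: "maximalideal Q R" using maximal_above[OF zeroideal] by blast
  have prime: "primeideal Q R" by (rule maximalideal_prime[OF Q0])
  interpret Q: primeideal Q R by (rule prime)
  interpret T: twisted_prime R p "carrier R" Q by (rule twisted_primeI[OF prime carrier_is_subring])
  have unitQ: "u \<notin> Q" if "u \<in> Units R" for u
  proof
    assume "u \<in> Q"
    then have "inv u \<otimes> u \<in> Q" using that by (intro Q.I_l_closed) auto
    then show False using that T.one_notin by simp
  qed
  have KQ: "c = \<zero>" if c: "c \<in> K" "c \<in> Q" for c
  proof (rule ccontr)
    assume "c \<noteq> \<zero>"
    then obtain d where "d \<in> K" "c \<otimes> d = \<one>" using K_inv c by blast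
    then show False using Q.I_r_closed[OF c(2), of d] T.one_notin K_carr by auto
  qed
  define B where "B = foldr (\<lambda>y S. adjoin R S y) xs K"
  have sub: "subring (foldr (\<lambda>y S. adjoin R S y) ys K) R" if "set ys \<subseteq> carrier R" for ys
    using that
  proof (induction ys)
    case Nil then show ?case using sub_K by simp
  next
    case (Cons y ys)
    then show ?case using adjunction.subring_adjoin[OF adjunction.intro[OF cring_axioms adjunction_axioms.intro]] by simp
  qed
  have incl: "K \<union> set ys \<subseteq> foldr (\<lambda>y S. adjoin R S y) ys K" if "set ys \<subseteq> carrier R" for ys
    using that
  proof (induction ys)
    case (Cons y ys)
    interpret adjunction R "foldr (\<lambda>y S. adjoin R S y) ys K" y
      using Cons.prems sub[of ys] by (intro adjunction.intro cring_axioms adjunction_axioms.intro) auto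
    show ?case using Cons adjoin_incl by auto
  qed simp
  have subB: "subring B R" unfolding B_def by (rule sub[OF xs_carr])
  have inclB: "generate_ring R (K \<union> set xs) \<subseteq> B"
    using incl[OF xs_carr] subB K_carr xs_carr unfolding B_def[symmetric]
    by (intro generate_ring_min_subring1) auto
  interpret TB: twisted_prime R p B Q by (rule twisted_primeI[OF prime subB])
  have bR: "pbounded R p (carrier R) Q" by (rule pbounded_carrier[OF prime H])
  have "pind R p (carrier R) Q n" if n: "pind R p B Q n" for n
  proof -
    obtain v where v: "v \<in> {..<n} \<rightarrow> B" "tindep R B p Q {..<n} v" using n unfolding pind_def by blast
    have vc: "v \<in> {..<n} \<rightarrow> carrier R" using v(1) TB.S_carr by auto
    have "tindep R (carrier R) p Q {..<n} v"
      unfolding tindep_def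
    proof (intro ballI impI)
      fix c i assume c: "c \<in> {..<n} \<rightarrow> carrier R" "(\<Oplus>i\<in>{..<n}. c i [^] p \<otimes> v i) \<in> Q" "i \<in> {..<n}"
      obtain u where u: "u \<in> Units R" "\<forall>a\<in>c ` {..<n}. u \<otimes> a \<in> generate_ring R (K \<union> set xs)"
        using unit[of "c ` {..<n}"] c(1) by auto
      have uc: "u \<in> carrier R" using u by auto
      have uB: "(\<lambda>i. u \<otimes> c i) \<in> {..<n} \<rightarrow> B" using u(2) inclB by auto
      have "(\<Oplus>i\<in>{..<n}. (u \<otimes> c i) [^] p \<otimes> v i) = (\<Oplus>i\<in>{..<n}. u [^] p \<otimes> (c i [^] p \<otimes> v i))"
        using c(1) vc uc by (intro finsum_cong') (auto simp: nat_pow_distrib m_assoc Pi_def)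
      also have "\<dots> = u [^] p \<otimes> (\<Oplus>i\<in>{..<n}. c i [^] p \<otimes> v i)"
        using c(1) vc uc by (intro finsum_rdistr[symmetric]) auto
      also have "\<dots> \<in> Q" using c(2) uc by (intro Q.I_l_closed) auto
      finally have "\<forall>i\<in>{..<n}. u \<otimes> c i \<in> Q"
        using v(2)[unfolded tindep_def, rule_format, OF uB] by blast
      then have "u \<otimes> c i \<in> Q" using c(3) by blast
      then show "c i \<in> Q" using Q.I_prime[of u "c i"] unitQ[OF u(1)] uc c by auto
    qed
    then show ?thesis unfolding pind_def using vc by blast
  qed
  then have bB: "pbounded R p B Q" using bR unfolding pbounded_def by blast
  have "pbounded R p (foldr (\<lambda>y S. adjoin R S y) ys K) Q \<Longrightarrow> pbounded R p K Q" if "set ys \<subseteq> carrier R" for ys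
    using that
  proof (induction ys)
    case (Cons y ys)
    have "twisted_adjunction R p (foldr (\<lambda>y S. adjoin R S y) ys K) Q y"
      using Cons.prems(2) sub[of ys] prime
      by (intro twisted_adjunction.intro twisted_primeI adjunction.intro cring_axioms
          adjunction_axioms.intro twisted_adjunction_axioms.intro) auto
    from twisted_adjunction.pbounded_adjoin[OF this] show ?case using Cons by simp
  qed simp
  then have bK: "pbounded R p K Q" using bB xs_carr unfolding B_def by blast
  interpret TK: twisted_prime R p K Q by (rule twisted_primeI[OF prime sub_K])
  interpret Z: twisted R p K "{\<zero>}" by (rule twistedI[OF zeroideal sub_K])
  obtain n v where v: "v \<in> {..<n} \<rightarrow> K" "pspans R p K Q (v ` {..<n::nat})"
    by (rule TK.pbounded_basis[OF bK]) blast
  let ?E = "v ` {..<n}"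
  have E: "finite ?E" "?E \<subseteq> K" "?E \<subseteq> carrier R" using v(1) K_carr by auto
  have "c \<in> tspan R K p {\<zero>} ?E" if c: "c \<in> K" for c
  proof -
    have cc: "c \<in> carrier R" using c K_carr by auto
    obtain s where s: "s \<in> K" "s \<notin> Q" "s [^] p \<otimes> c \<in> tspan R K (p ^ 1) Q ?E"
      using v(2) c unfolding pspans_def by auto
    obtain b w where b: "b \<in> ?E \<rightarrow> K" "w \<in> Q" "s [^] p \<otimes> c = w \<oplus> (\<Oplus>u\<in>?E. b u [^] (p ^ 1) \<otimes> u)"
      by (rule TK.tspan_finite[OF s(3) E(1,3)])
    have sumK: "(\<Oplus>u\<in>?E. b u [^] p \<otimes> u) \<in> K"
      using b(1) E by (intro TK.S_finsum) (auto intro!: TK.S_mult TK.S_pow)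
    have wc: "w \<in> carrier R" "(\<Oplus>u\<in>?E. b u [^] p \<otimes> u) \<in> carrier R" using b Q.Icarr sumK K_carr by auto
    have "w = (w \<oplus> (\<Oplus>u\<in>?E. b u [^] p \<otimes> u)) \<oplus> \<ominus> (\<Oplus>u\<in>?E. b u [^] p \<otimes> u)"
      using wc by (simp add: a_assoc r_neg)
    also have "\<dots> = s [^] p \<otimes> c \<oplus> \<ominus> (\<Oplus>u\<in>?E. b u [^] p \<otimes> u)" using b(3) by simp
    also have "\<dots> \<in> K" using s c sumK by (intro TK.S_add TK.S_neg TK.S_mult TK.S_pow)
    \<comment> \<open>The error term is a difference of elements of \<open>K\<close>, so it lies in
      \<open>K\<close> as well as in \<open>Q\<close>.\<close>
    finally have "w = \<zero>" using KQ b(2) by blast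
    then have e: "s [^] p \<otimes> c = (\<Oplus>u\<in>?E. b u [^] p \<otimes> u)" using b(3) wc by simp
    have "(\<Oplus>u\<in>?E. b u [^] p \<otimes> u) \<in> tspan R K p {\<zero>} ?E"
      using b(1) E by (intro Z.tspan_finsum Z.tspan_term) auto
    then have 1: "s [^] p \<otimes> c \<in> tspan R K p {\<zero>} ?E" using e by simp
    obtain d where d: "d \<in> K" "s \<otimes> d = \<one>" using K_inv s(1,2) TK.Q_zero by blast
    have sd: "s \<in> carrier R" "d \<in> carrier R" using s(1) d(1) K_carr by auto
    have "d [^] p \<otimes> (s [^] p \<otimes> c) = (d \<otimes> s) [^] p \<otimes> c"
      using sd cc by (simp add: nat_pow_distrib m_assoc)
    moreover have "d \<otimes> s = \<one>" using d(2) sd by (simp add: m_comm)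
    ultimately show ?thesis using Z.tspan_scale[OF 1 d(1) E(3)] cc by simp
  qed
  then show ?thesis using E by blast
qed

lemma ring_hom_inv_carr:
  assumes "h \<in> ring_iso A B"
  shows "h \<in> ring_hom A B" "h ` carrier A = carrier B"
  using assms unfolding ring_iso_def bij_betw_def by auto

text \<open>\<open>u\<close> is the image of a denominator of \<open>r\<close>. Clearing it leaves
  the image of an element of \<open>A\<close>, and such images are generated by those of the scalars
  and of the algebra generators.\<close>

lemma ess_finite_type_units:
  fixes R (structure)
  assumes "ess_finite_type_algebra TYPE('b) K R \<phi>" "cring R" "field K"
  obtains E where "finite E" "E \<subseteq> carrier R"
    "\<And>r. r \<in> carrier R \<Longrightarrow> \<exists>u\<in>Units R. u \<in> generate_ring R (\<phi> ` carrier K \<union> E)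
        \<and> u \<otimes> r \<in> generate_ring R (\<phi> ` carrier K \<union> E)"
proof -
  interpret R: cring R by fact
  obtain A :: "'b ring" and \<psi> W h where *: "finite_type_algebra K A \<psi>" "submonoid W A"
    "h \<in> ring_iso (localization A W) R" "\<forall>x\<in>carrier K. h (fraction A W (\<psi> x) \<one>\<^bsub>A\<^esub>) = \<phi> x"
    using assms(1) unfolding ess_finite_type_algebra_def by blast
  interpret A: cring A using *(1) by (simp add: finite_type_algebra_def)
  interpret L: localize A W by (intro localize.intro A.cring_axioms localize_axioms.intro *(2))
  let ?L = "localization A W"
  obtain G where G: "G \<subseteq> carrier A" "finite G" "generate_ring A (\<psi> ` carrier K \<union> G) = carrier A"
    using *(1) unfolding finite_type_algebra_def by blast
  have \<psi>: "\<psi> \<in> ring_hom K A" using *(1) by (simp add: finite_type_algebra_def)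
  have h: "h \<in> ring_hom ?L R" "h ` carrier ?L = carrier R" using ring_hom_inv_carr[OF *(3)] by auto
  define j where "j = (\<lambda>a. h (fraction A W a \<one>\<^bsub>A\<^esub>))"
  have jc: "j a \<in> carrier R" if "a \<in> carrier A" for a
    unfolding j_def using that L.W_one by (intro ring_hom_closed[OF h(1)] L.fraction_closed)
  have frc: "fraction A W a \<one>\<^bsub>A\<^esub> \<in> carrier ?L" if "a \<in> carrier A" for a using that L.W_one L.fraction_closed by blast
  have jadd: "j (a \<oplus>\<^bsub>A\<^esub> b) = j a \<oplus> j b" if "a \<in> carrier A" "b \<in> carrier A" for a b
    unfolding j_def using ring_hom_add[OF L.fraction_hom that] ring_hom_add[OF h(1) frc[OF that(1)] frc[OF that(2)]] by simp
  have jmult: "j (a \<otimes>\<^bsub>A\<^esub> b) = j a \<otimes> j b" if "a \<in> carrier A" "b \<in> carrier A" for a b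
    unfolding j_def using ring_hom_mult[OF L.fraction_hom that] ring_hom_mult[OF h(1) frc[OF that(1)] frc[OF that(2)]] by simp
  have jone: "j \<one>\<^bsub>A\<^esub> = \<one>"
    unfolding j_def using ring_hom_one[OF h(1)] L.one_localization by simp
  have jhom: "j \<in> ring_hom A R" by (rule ring_hom_memI) (use jc jadd jmult jone in auto)
  have jneg: "j (\<ominus>\<^bsub>A\<^esub> a) = \<ominus> j a" if "a \<in> carrier A" for a
  proof -
    interpret J: ring_hom_cring A R j
      by (intro ring_hom_cring.intro A.cring_axioms assms(2) ring_hom_cring_axioms.intro jhom)
    show ?thesis using J.hom_a_inv that by simp
  qed
  define E where "E = j ` G"
  have j\<phi>: "j (\<psi> x) = \<phi> x" if "x \<in> carrier K" for x using *(4) that by (simp add: j_def)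
  have \<psi>c: "\<psi> ` carrier K \<union> G \<subseteq> carrier A" using G(1) ring_hom_closed[OF \<psi>] by auto
  have jgen: "j a \<in> generate_ring R (\<phi> ` carrier K \<union> E)" if "a \<in> carrier A" for a
  proof -
    have "a \<in> generate_ring A (\<psi> ` carrier K \<union> G)" using G(3) that by simp
    then show ?thesis
    proof induction
      case one then show ?case using jone generate_ring.one by metis
    next
      case (incl x)
      then show ?case using j\<phi> by (auto simp: E_def intro!: generate_ring.incl)
    next
      case (a_inv x)
      then show ?case using jneg[of x] A.generate_ring_in_carrier[OF \<psi>c a_inv(1)]
        by (simp add: generate_ring.a_inv)
    next
      case (eng_add x y)
      then show ?case using jadd[of x y] A.generate_ring_in_carrier[OF \<psi>c eng_add(1)]
          A.generate_ring_in_carrier[OF \<psi>c eng_add(2)] by (simp add: generate_ring.eng_add)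
    next
      case (eng_mult x y)
      then show ?case using jmult[of x y] A.generate_ring_in_carrier[OF \<psi>c eng_mult(1)]
          A.generate_ring_in_carrier[OF \<psi>c eng_mult(2)] by (simp add: generate_ring.eng_mult)
    qed
  qed
  have "\<exists>u\<in>Units R. u \<in> generate_ring R (\<phi> ` carrier K \<union> E)
        \<and> u \<otimes> r \<in> generate_ring R (\<phi> ` carrier K \<union> E)" if r: "r \<in> carrier R" for r
  proof -
    obtain z where z: "z \<in> carrier ?L" "r = h z" using r h(2) by blast
    then obtain a w where aw: "a \<in> carrier A" "w \<in> W" "z = fraction A W a w" using L.carrier_localization by blast
    have wc: "w \<in> carrier A" using L.W_carr aw by blast
    have "j w \<otimes> r = h (fraction A W w \<one>\<^bsub>A\<^esub> \<otimes>\<^bsub>?L\<^esub> z)"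
      unfolding j_def z(2) using ring_hom_mult[OF h(1) frc[OF wc] z(1)] by simp
    also have "\<dots> = j a" unfolding j_def aw(3) using L.fraction_split[OF aw(1,2)] by simp
    finally have jr: "j w \<otimes> r = j a" .
    define v where "v = h (fraction A W \<one>\<^bsub>A\<^esub> w)"
    have vc: "v \<in> carrier R" unfolding v_def using aw by (intro ring_hom_closed[OF h(1)] L.fraction_closed) auto
    have "j w \<otimes> v = h (fraction A W w \<one>\<^bsub>A\<^esub> \<otimes>\<^bsub>?L\<^esub> fraction A W \<one>\<^bsub>A\<^esub> w)"
      unfolding j_def v_def using ring_hom_mult[OF h(1) frc[OF wc] L.fraction_closed[OF A.one_closed aw(2)]] by simp
    also have "\<dots> = \<one>" using L.fraction_split[OF A.one_closed aw(2)] jone by (simp add: j_def)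
    finally have "j w \<in> Units R" using vc jc[OF wc] R.m_comm[of "j w" v] unfolding Units_def by auto
    then show ?thesis using jr jgen[OF wc] jgen[OF aw(1)] by auto
  qed
  moreover have "finite E" "E \<subseteq> carrier R" using G jc by (auto simp: E_def)
  ultimately show thesis using that by blast
qed

text \<open>From here on the presentation as a localization survives only in one property: every
  finite subset of \<open>R\<close> can be multiplied by a unit into a degree part.\<close>

lemma reg_ess_algI:
  fixes R (structure)
  assumes "Factorial_Ring.prime p" and "field K" and "regular_ring R" and "F_finite p R"
    and "ess_finite_type_algebra TYPE('b) K R \<phi>"
  obtains xs E H where "reg_ess_alg R p (\<phi> ` carrier K) xs E H" "\<one> \<noteq> \<zero>"
proof -
  interpret cring R using assms by (simp add: regular_ring_def)
  have hc: "has_characteristic R p" using assms by (simp add: F_finite_def)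
  have char0: "[p] \<cdot>\<^bsub>R\<^esub> \<one> = \<zero>" using hc[unfolded has_characteristic_def, rule_format, of p] by simp
  have "\<not> p dvd 1" using prime_gt_1_nat[OF assms(1)] by simp
  then have "[(1::nat)] \<cdot>\<^bsub>R\<^esub> \<one> \<noteq> \<zero>"
    using hc[unfolded has_characteristic_def, rule_format, of 1] by simp
  then have ne: "\<one> \<noteq> \<zero>" by simp
  interpret char_p_ring R p by (intro char_p_ring.intro cring_axioms char_p_ring_axioms.intro assms(1) char0)
  interpret K: field K by fact
  have \<phi>: "\<phi> \<in> ring_hom K R" using assms(5) unfolding ess_finite_type_algebra_def by blast
  interpret PH: ring_hom_ring K R \<phi>
    by (rule ring_hom_ringI2[OF K.ring_axioms ring_axioms \<phi>])
  let ?K = "\<phi> ` carrier K"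
  have subK: "subring ?K R" using PH.img_is_subring[OF K.carrier_is_subring] .
  have Kinv: "\<exists>d\<in>?K. c \<otimes> d = \<one>" if c: "c \<in> ?K" "c \<noteq> \<zero>" for c
  proof -
    obtain x where x: "x \<in> carrier K" "c = \<phi> x" using c by blast
    have "x \<noteq> \<zero>\<^bsub>K\<^esub>" using x c PH.hom_zero by metis
    then have "x \<in> Units K" using x K.field_Units by simp
    then have "x \<otimes>\<^bsub>K\<^esub> inv\<^bsub>K\<^esub> x = \<one>\<^bsub>K\<^esub>" "inv\<^bsub>K\<^esub> x \<in> carrier K" by auto
    then have "\<phi> x \<otimes> \<phi> (inv\<^bsub>K\<^esub> x) = \<one>" using x(1) ring_hom_mult[OF \<phi>, of x "inv\<^bsub>K\<^esub> x"] ring_hom_one[OF \<phi>] by simp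
    then show ?thesis using x \<open>inv\<^bsub>K\<^esub> x \<in> carrier K\<close> by blast
  qed
  obtain G where G: "finite G" "G \<subseteq> carrier R"
    "\<And>r. r \<in> carrier R \<Longrightarrow> \<exists>u\<in>Units R. u \<in> generate_ring R (?K \<union> G) \<and> u \<otimes> r \<in> generate_ring R (?K \<union> G)"
    by (rule ess_finite_type_units[OF assms(5) cring_axioms assms(2)]) blast
  obtain xs where xs: "set xs = G" using finite_list[OF G(1)] by blast
  let ?A = "generate_ring R (?K \<union> set xs)"
  have Kc: "?K \<subseteq> carrier R" using subringE(1)[OF subK] .
  have subA: "subring ?A R" using Kc G(2) xs by (intro generate_ring_is_subring) auto
  interpret Z: twisted R p "carrier R" "{\<zero>}" by (rule twistedI[OF zeroideal carrier_is_subring])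
  have unit: "\<exists>u\<in>Units R. u \<in> ?A \<and> (\<forall>a\<in>F. u \<otimes> a \<in> ?A)" if F: "finite F" "F \<subseteq> carrier R" for F
  proof -
    have "\<exists>u\<in>Units R \<inter> ?A. \<forall>a\<in>F. u \<otimes> a \<in> ?A"
    proof (rule Z.common_multiple[OF F(1)])
      show "Units R \<inter> ?A \<subseteq> carrier R" by auto
      show "\<one> \<in> Units R \<inter> ?A" using generate_ring.one by auto
      show "s \<otimes> t \<in> Units R \<inter> ?A" if "s \<in> Units R \<inter> ?A" "t \<in> Units R \<inter> ?A" for s t
        using that subringE(6)[OF subA] by auto
      show "\<exists>s\<in>Units R \<inter> ?A. s \<otimes> a \<in> ?A" if "a \<in> F" for a using G(3)[of a] F(2) that xs by blast
      show "(t \<otimes> s) \<otimes> a \<in> ?A" if "a \<in> F" "s \<in> Units R \<inter> ?A" "t \<in> Units R \<inter> ?A" "s \<otimes> a \<in> ?A" for a s t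
      proof -
        have "a \<in> carrier R" using F(2) that(1) by blast
        then have "(t \<otimes> s) \<otimes> a = t \<otimes> (s \<otimes> a)" using that by (intro m_assoc) auto
        then show ?thesis using subringE(6)[OF subA, of t "s \<otimes> a"] that by auto
      qed
    qed
    then show ?thesis by blast
  qed
  obtain H where H: "H \<subseteq> carrier R" "finite H"
    "\<forall>x\<in>carrier R. \<exists>c \<in> H \<rightarrow> carrier R. x = (\<Oplus>g\<in>H. (c g [^] p) \<otimes> g)"
    using assms(4) unfolding F_finite_def by blast
  have Hspan: "x \<in> tspan R (carrier R) p {\<zero>} H" if x: "x \<in> carrier R" for x
  proof -
    obtain c where c: "c \<in> H \<rightarrow> carrier R" "x = (\<Oplus>g\<in>H. (c g [^] p) \<otimes> g)" using H(3) x by blast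
    have "(\<Oplus>g\<in>H. (c g [^] p) \<otimes> g) \<in> tspan R (carrier R) p {\<zero>} H"
      using c(1) H by (intro Z.tspan_finsum Z.tspan_term) auto
    then show ?thesis using c(2) by simp
  qed
  interpret F: filtered R p ?K xs
    using subK G(2) xs by (intro filtered.intro char_p_ring_axioms filtered_axioms.intro) auto
  obtain E where E: "finite E" "E \<subseteq> ?K" "\<forall>c\<in>?K. c \<in> tspan R ?K p {\<zero>} E"
    using F.ground_field_F_finite[OF Kinv ne unit H(2,1) Hspan] by blast
  have unitV: "\<exists>u\<in>Units R. \<exists>d. u \<in> F.V d \<and> (\<forall>a\<in>A. u \<otimes> a \<in> F.V d)" if A: "finite A" "A \<subseteq> carrier R" for A
  proof -
    obtain u where u: "u \<in> Units R" "u \<in> ?A" "\<forall>a\<in>A. u \<otimes> a \<in> ?A" using unit[OF A] by blast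
    have "\<forall>x\<in>insert u ((\<lambda>a. u \<otimes> a) ` A). \<exists>d. x \<in> F.V d" using u F.generated_in_V by auto
    then obtain d where d: "\<forall>x\<in>insert u ((\<lambda>a. u \<otimes> a) ` A). x \<in> F.V (d x)" by (rule bchoice[THEN exE])
    define D where "D = Max (d ` insert u ((\<lambda>a. u \<otimes> a) ` A))"
    have "x \<in> F.V D" if "x \<in> insert u ((\<lambda>a. u \<otimes> a) ` A)" for x
    proof -
      have "d x \<le> D" unfolding D_def using that A(1) by (intro Max_ge) auto
      then show ?thesis using d that F.V_mono by blast
    qed
    then show ?thesis using u(1) by auto
  qed
  have "F_finite_filtered R p ?K xs E"
    using E Kc by (intro F_finite_filtered.intro F.filtered_axioms F_finite_filtered_axioms.intro) auto
  then have "ess_finite_alg R p ?K xs E H"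
    using Kinv unitV H Hspan by (intro ess_finite_alg.intro ess_finite_alg_axioms.intro) auto
  then have "reg_ess_alg R p ?K xs E H"
    using assms(3) by (intro reg_ess_alg.intro reg_ess_alg_axioms.intro)
  then show thesis using that ne by blast
qed

section \<open>Frobenius roots and ideal powers\<close>

context cring
begin

lemma colon_ideal:
  assumes "ideal J R" "B \<subseteq> carrier R"
  shows "ideal {x \<in> carrier R. \<forall>b\<in>B. b \<otimes> x \<in> J} R"
proof -
  interpret J: ideal J R by fact
  show ?thesis
  proof (rule idealI[OF ring_axioms])
    have neg: "b \<otimes> (\<ominus> x) \<in> J" if "b \<in> B" "x \<in> carrier R" "b \<otimes> x \<in> J" for b x
    proof -
      have "b \<otimes> (\<ominus> x) = \<ominus> (b \<otimes> x)" using that assms(2) by (intro r_minus) auto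
      then show ?thesis using that by simp
    qed
    show "subgroup {x \<in> carrier R. \<forall>b\<in>B. b \<otimes> x \<in> J} (add_monoid R)"
    proof (rule add.subgroupI)
      have "\<zero> \<in> {x \<in> carrier R. \<forall>b\<in>B. b \<otimes> x \<in> J}" using assms(2) by auto
      then show "{x \<in> carrier R. \<forall>b\<in>B. b \<otimes> x \<in> J} \<noteq> {}" by blast
      fix x y assume "x \<in> {x \<in> carrier R. \<forall>b\<in>B. b \<otimes> x \<in> J}" "y \<in> {x \<in> carrier R. \<forall>b\<in>B. b \<otimes> x \<in> J}"
      then show "x \<oplus> y \<in> {x \<in> carrier R. \<forall>b\<in>B. b \<otimes> x \<in> J}"
        using assms(2) by (auto simp: r_distr subset_iff)
    qed (use neg in auto)
    fix x a assume x: "x \<in> {x \<in> carrier R. \<forall>b\<in>B. b \<otimes> x \<in> J}" and a: "a \<in> carrier R"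
    have "b \<otimes> (a \<otimes> x) \<in> J" if b: "b \<in> B" for b
    proof -
      have "b \<otimes> (a \<otimes> x) = a \<otimes> (b \<otimes> x)" using b x a assms(2) by (intro m_lcomm) auto
      then show ?thesis using J.I_l_closed[OF _ a, of "b \<otimes> x"] b x by simp
    qed
    then show "a \<otimes> x \<in> {x \<in> carrier R. \<forall>b\<in>B. b \<otimes> x \<in> J}" using x a by simp
    then show "x \<otimes> a \<in> {x \<in> carrier R. \<forall>b\<in>B. b \<otimes> x \<in> J}" using x a by (simp add: m_comm)
  qed
qed

text \<open>Membership is tested on one factor at a time: the elements that multiply a given set
  into \<open>J\<close> form an ideal, so generators suffice first in \<open>B\<close> and then in
  \<open>A\<close>.\<close>

lemma ideal_prod_subset:
  assumes "ideal J R" "A \<subseteq> carrier R" "B \<subseteq> carrier R" "\<And>a b. a \<in> A \<Longrightarrow> b \<in> B \<Longrightarrow> a \<otimes> b \<in> J"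
  shows "ideal_prod R (genideal R A) (genideal R B) \<subseteq> J"
proof
  have IA: "ideal (genideal R A) R" using assms by (intro genideal_ideal)
  have Ac: "x \<in> carrier R" if "x \<in> genideal R A" for x using ideal.Icarr[OF IA that] .
  have 1: "a \<otimes> y \<in> J" if "a \<in> A" "y \<in> genideal R B" for a y
  proof -
    have "genideal R B \<subseteq> {x \<in> carrier R. \<forall>b\<in>{a}. b \<otimes> x \<in> J}"
      using assms that by (intro genideal_minimal colon_ideal) auto
    then show ?thesis using that by auto
  qed
  have Bc: "genideal R B \<subseteq> carrier R" using ideal.Icarr[OF genideal_ideal[OF assms(3)]] by auto
  have 2: "x \<otimes> y \<in> J" if "x \<in> genideal R A" "y \<in> genideal R B" for x y
  proof -
    have "a \<in> {x \<in> carrier R. \<forall>b\<in>genideal R B. b \<otimes> x \<in> J}" if a: "a \<in> A" for a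
    proof -
      have "b \<otimes> a \<in> J" if b: "b \<in> genideal R B" for b
      proof -
        have "a \<in> carrier R" "b \<in> carrier R" using a b assms(2) Bc by blast+
        then show ?thesis using 1[OF a b] by (simp add: m_comm)
      qed
      then show ?thesis using a assms(2) by auto
    qed
    then have "genideal R A \<subseteq> {x \<in> carrier R. \<forall>b\<in>genideal R B. b \<otimes> x \<in> J}"
      using colon_ideal[OF assms(1) Bc] by (intro genideal_minimal) auto
    then have "y \<otimes> x \<in> J" using that by auto
    then show ?thesis using m_comm[of x y] that Ac Bc by auto
  qed
  fix x assume "x \<in> ideal_prod R (genideal R A) (genideal R B)"
  then show "x \<in> J"
    by induction (use 2 additive_subgroup.a_closed[OF ideal.axioms(1)[OF assms(1)]] in auto)
qed

lemma ideal_power_0: "ideal_power R I 0 = carrier R"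
  unfolding ideal_power_def ideals_set_def by simp

lemma ideal_power_Suc: "ideal_power R I (Suc n) = ideal_prod R (ideal_power R I n) I"
  unfolding ideal_power_def ideals_set_def by simp

lemma ideal_power_ideal: "ideal I R \<Longrightarrow> ideal (ideal_power R I n) R"
  by (induction n) (auto simp: ideal_power_0 ideal_power_Suc oneideal ideal_prod_is_ideal)

lemma ideal_power_add:
  assumes "ideal I R"
  shows "ideal_power R I (m + n) = ideal_prod R (ideal_power R I m) (ideal_power R I n)"
proof (induction n)
  case 0
  then show ?case using ideal_prod_one[OF ideal_power_ideal[OF assms]] by (simp add: ideal_power_0)
next
  case (Suc n)
  then show ?case
    using ideal_prod_assoc[OF ideal_power_ideal[OF assms] ideal_power_ideal[OF assms] assms]
    by (simp add: ideal_power_Suc)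
qed

lemma ideal_power_antimono:
  assumes "ideal I R" "m \<le> n"
  shows "ideal_power R I n \<subseteq> ideal_power R I m"
proof -
  obtain k where n: "n = m + k" using assms(2) le_Suc_ex by blast
  show ?thesis unfolding n ideal_power_add[OF assms(1)]
    using ideal_prod_inter[OF ideal_power_ideal[OF assms(1)] ideal_power_ideal[OF assms(1)]] by blast
qed

lemma pow_mem_ideal_power:
  assumes "ideal I R" "u \<in> ideal_power R I m"
  shows "u [^] n \<in> ideal_power R I (n * m)"
proof (induction n)
  case 0
  then show ?case by (simp add: ideal_power_0)
next
  case (Suc n)
  have "u [^] n \<otimes> u \<in> ideal_power R I (n * m + m)"
    unfolding ideal_power_add[OF assms(1)] using Suc assms(2) by (rule ideal_prod.prod)
  then show ?case by (simp add: add.commute)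
qed

section \<open>Monomials in the generators of an ideal\<close>

definition mprod :: "'a list \<Rightarrow> 'a" where "mprod xs = foldr (\<otimes>) xs \<one>"

lemma mprod_simps [simp]: "mprod [] = \<one>" "mprod (x # xs) = x \<otimes> mprod xs"
  by (auto simp: mprod_def)

lemma mprod_carr: "set xs \<subseteq> carrier R \<Longrightarrow> mprod xs \<in> carrier R"
  by (induction xs) auto

lemma mprod_middle: "set (as @ s # bs) \<subseteq> carrier R \<Longrightarrow> mprod (as @ s # bs) = s \<otimes> mprod (as @ bs)"
  by (induction as) (auto simp: m_lcomm mprod_carr)

lemma mprod_extract:
  "set xs \<subseteq> carrier R \<Longrightarrow> q \<le> count_list xs s \<Longrightarrow>
    \<exists>ys. set ys \<subseteq> set xs \<and> length ys = length xs - q \<and> mprod xs = s [^] q \<otimes> mprod ys"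
proof (induction q arbitrary: xs)
  case 0
  then show ?case using mprod_carr by (intro exI[of _ xs]) auto
next
  case (Suc q)
  then have "s \<in> set xs" by (metis count_list_0_iff not_less_eq_eq zero_le)
  then obtain as bs where xs: "xs = as @ s # bs" using split_list by fast
  have "set (as @ bs) \<subseteq> carrier R" "q \<le> count_list (as @ bs) s" using Suc.prems by (auto simp: xs)
  from Suc.IH[OF this] obtain ys where ys: "set ys \<subseteq> set (as @ bs)" "length ys = length (as @ bs) - q"
    "mprod (as @ bs) = s [^] q \<otimes> mprod ys" by blast
  have c: "s \<in> carrier R" "mprod ys \<in> carrier R" using Suc.prems(1) ys(1) by (auto simp: xs intro!: mprod_carr)
  have "mprod xs = s [^] Suc q \<otimes> mprod ys"
    unfolding xs using mprod_middle[of as s bs] Suc.prems(1) c ys(3) by (simp add: xs m_ac)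
  moreover have "set ys \<subseteq> set xs" "length ys = length xs - Suc q" using ys by (auto simp: xs)
  ultimately show ?case by blast
qed

lemma mprod_mem_ideal_power:
  assumes "ideal I R" "set xs \<subseteq> I"
  shows "mprod xs \<in> ideal_power R I (length xs)"
  using assms(2)
proof (induction xs)
  case (Cons x xs)
  have "mprod xs \<otimes> x \<in> ideal_power R I (length (x # xs))"
    unfolding list.size add_Suc_right add_0_right ideal_power_Suc using Cons by (intro ideal_prod.prod) auto
  moreover have "set (x # xs) \<subseteq> carrier R" using Cons.prems ideal.Icarr[OF assms(1)] by blast
  ultimately show ?case using mprod_carr[of xs] by (simp add: m_comm)
qed (simp add: ideal_power_0)

lemma ideal_power_generated:
  assumes "G \<subseteq> carrier R"
  shows "ideal_power R (genideal R G) n \<subseteq> genideal R {mprod xs | xs. set xs \<subseteq> G \<and> length xs = n}"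
proof (induction n)
  case 0
  have "mprod [] \<in> {mprod xs | xs. set xs \<subseteq> G \<and> length xs = 0}" by (intro CollectI exI[of _ "[]"]) auto
  moreover have sub: "{mprod xs | xs. set xs \<subseteq> G \<and> length xs = 0} \<subseteq> carrier R" using assms mprod_carr by auto
  ultimately have "\<one> \<in> genideal R {mprod xs | xs. set xs \<subseteq> G \<and> length xs = 0}"
    using genideal_self[OF sub] by auto
  then show ?case using ideal.one_imp_carrier[OF genideal_ideal[OF sub]] by (simp add: ideal_power_0)
next
  case (Suc n)
  have sub: "{mprod xs | xs. set xs \<subseteq> G \<and> length xs = n} \<subseteq> carrier R" for n using assms mprod_carr by auto
  have "ideal_power R (genideal R G) (Suc n)
    \<subseteq> ideal_prod R (genideal R {mprod xs | xs. set xs \<subseteq> G \<and> length xs = n}) (genideal R G)"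
  proof
    fix x assume "x \<in> ideal_power R (genideal R G) (Suc n)"
    then have "x \<in> ideal_prod R (ideal_power R (genideal R G) n) (genideal R G)" by (simp add: ideal_power_Suc)
    then show "x \<in> ideal_prod R (genideal R {mprod xs | xs. set xs \<subseteq> G \<and> length xs = n}) (genideal R G)"
      by induction (use Suc in \<open>auto intro: ideal_prod.intros\<close>)
  qed
  also have "\<dots> \<subseteq> genideal R {mprod xs | xs. set xs \<subseteq> G \<and> length xs = Suc n}"
  proof (rule ideal_prod_subset[OF genideal_ideal[OF sub] sub assms])
    fix a b assume "a \<in> {mprod xs | xs. set xs \<subseteq> G \<and> length xs = n}" and b: "b \<in> G"
    then obtain xs where xs: "a = mprod xs" "set xs \<subseteq> G" "length xs = n" by blast
    have "a \<otimes> b = mprod (b # xs)" using xs b assms mprod_carr[of xs] by (auto simp: m_comm subset_iff)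
    moreover have "set (b # xs) \<subseteq> G" "length (b # xs) = Suc n" using xs b by auto
    ultimately have "a \<otimes> b \<in> {mprod xs | xs. set xs \<subseteq> G \<and> length xs = Suc n}" by blast
    then show "a \<otimes> b \<in> genideal R {mprod xs | xs. set xs \<subseteq> G \<and> length xs = Suc n}"
      using genideal_self[OF sub] by blast
  qed
  finally show ?case .
qed

lemma frob_power_ideal: "J \<subseteq> carrier R \<Longrightarrow> ideal (frob_power R q J) R"
  unfolding frob_power_def by (intro genideal_ideal) auto

lemma frob_power_incl: "J \<subseteq> carrier R \<Longrightarrow> u \<in> J \<Longrightarrow> u [^] q \<in> frob_power R q J"
proof -
  assume J: "J \<subseteq> carrier R" and u: "u \<in> J"
  have "{u [^] q | u. u \<in> J} \<subseteq> carrier R" using J by auto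
  from genideal_self[OF this] show ?thesis unfolding frob_power_def using u by blast
qed

text \<open>Pigeonhole: a monomial of degree more than \<open>r (q - 1)\<close> in \<open>r\<close> generators contains a \<open>q\<close>-th power.\<close>

lemma ideal_power_frob_split:
  assumes "finite G" "G \<subseteq> carrier R" "I = genideal R G" "card G * (q - 1) < n" "q > 0" "q \<le> n"
  shows "ideal_power R I n = ideal_prod R (frob_power R q I) (ideal_power R I (n - q))"
proof
  have I: "ideal I R" using assms by (auto intro: genideal_ideal)
  have Ic: "I \<subseteq> carrier R" using ideal.Icarr[OF I] by auto
  have GI: "G \<subseteq> I" using genideal_self[OF assms(2)] assms(3) by simp
  have prodI: "ideal (ideal_prod R (frob_power R q I) (ideal_power R I (n - q))) R"
    by (intro ideal_prod_is_ideal frob_power_ideal Ic ideal_power_ideal I)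
  show "ideal_power R I n \<subseteq> ideal_prod R (frob_power R q I) (ideal_power R I (n - q))"
  proof -
    have "mprod xs \<in> ideal_prod R (frob_power R q I) (ideal_power R I (n - q))"
      if xs: "set xs \<subseteq> G" "length xs = n" for xs
    proof -
      have "\<exists>s\<in>G. q \<le> count_list xs s"
      proof (rule ccontr)
        assume "\<not> (\<exists>s\<in>G. q \<le> count_list xs s)"
        then have "count_list xs s \<le> q - 1" if "s \<in> G" for s using that by (auto simp: not_le)
        then have "sum (count_list xs) G \<le> card G * (q - 1)" using sum_bounded_above[of G "count_list xs" "q - 1"] by simp
        moreover have "sum (count_list xs) G = n" using sum_count_set[OF xs(1) assms(1)] xs(2) by simp
        ultimately show False using assms(4) by simp
      qed
      then obtain s where s: "s \<in> G" "q \<le> count_list xs s" by blast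
      have "set xs \<subseteq> carrier R" using xs assms(2) by blast
      from mprod_extract[OF this s(2)] obtain ys where
        ys: "set ys \<subseteq> set xs" "length ys = n - q" "mprod xs = s [^] q \<otimes> mprod ys" using xs(2) by blast
      have "mprod ys \<in> ideal_power R I (n - q)"
        using mprod_mem_ideal_power[OF I, of ys] ys xs GI by auto
      moreover have "s [^] q \<in> frob_power R q I" using s GI frob_power_incl[OF Ic] by blast
      ultimately show ?thesis unfolding ys(3) by (intro ideal_prod.prod)
    qed
    then have "genideal R {mprod xs | xs. set xs \<subseteq> G \<and> length xs = n}
        \<subseteq> ideal_prod R (frob_power R q I) (ideal_power R I (n - q))"
      by (intro genideal_minimal prodI) blast
    then show ?thesis using ideal_power_generated[OF assms(2)] unfolding assms(3) by blast
  qed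
  have "frob_power R q I \<subseteq> ideal_power R I q"
    unfolding frob_power_def
  proof (intro genideal_minimal ideal_power_ideal I subsetI)
    fix x assume "x \<in> {u [^] q | u. u \<in> I}"
    then obtain u where u: "u \<in> I" "x = u [^] q" by blast
    have "ideal_power R I 1 = I"
      using ideal_prod_commute[OF oneideal I] ideal_prod_one[OF I]
      by (simp add: ideal_power_Suc ideal_power_0)
    then show "x \<in> ideal_power R I q" using pow_mem_ideal_power[OF I, of u 1 q] u by simp
  qed
  note le = this
  have sub: "x \<in> ideal_prod R (ideal_power R I q) (ideal_power R I (n - q))"
    if "x \<in> ideal_prod R (frob_power R q I) (ideal_power R I (n - q))" for x
    using that by induction (use le in \<open>auto intro: ideal_prod.intros\<close>)
  have "ideal_prod R (ideal_power R I q) (ideal_power R I (n - q)) = ideal_power R I n"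
    using ideal_power_add[OF I, of q "n - q"] assms(6) by simp
  then show "ideal_prod R (frob_power R q I) (ideal_power R I (n - q)) \<subseteq> ideal_power R I n" using sub by blast
qed

end

section \<open>Frobenius roots computed from a dual basis\<close>

locale frob_dual = char_p_ring R p for R (structure) and p +
  fixes L :: "(('a \<Rightarrow> 'a) \<times> 'a) list"
  assumes plin_L: "plin_list R p L" and dual: "\<And>x. x \<in> carrier R \<Longrightarrow> x = dsum R p L x"
begin

lemma L_plin: "(f, g) \<in> set L \<Longrightarrow> plin R p f" and L_carr: "(f, g) \<in> set L \<Longrightarrow> g \<in> carrier R"
  using plin_L unfolding plin_list_def by auto

definition root1 :: "'a set \<Rightarrow> 'a set" where
  "root1 b = genideal R {f x | f g x. (f, g) \<in> set L \<and> x \<in> b}"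

lemma root1_gens: "b \<subseteq> carrier R \<Longrightarrow> {f x | f g x. (f, g) \<in> set L \<and> x \<in> b} \<subseteq> carrier R"
  using plinD(1)[OF L_plin] by auto

lemma root1_ideal: "b \<subseteq> carrier R \<Longrightarrow> ideal (root1 b) R"
  unfolding root1_def by (intro genideal_ideal root1_gens)

lemma root1_mem: "b \<subseteq> carrier R \<Longrightarrow> (f, g) \<in> set L \<Longrightarrow> x \<in> b \<Longrightarrow> f x \<in> root1 b"
  using genideal_self[OF root1_gens] unfolding root1_def by blast

lemma root1_minimal:
  "ideal J R \<Longrightarrow> (\<And>f g x. (f, g) \<in> set L \<Longrightarrow> x \<in> b \<Longrightarrow> f x \<in> J) \<Longrightarrow> root1 b \<subseteq> J"
  unfolding root1_def by (intro genideal_minimal) auto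

text \<open>\<open>f\<close> maps an ideal into \<open>J\<close> as soon as it maps all multiples of generators into \<open>J\<close>.\<close>

lemma plin_preimage_ideal:
  assumes "plin R p f" "ideal J R"
  shows "ideal {x \<in> carrier R. \<forall>r\<in>carrier R. f (r \<otimes> x) \<in> J} R"
proof -
  interpret J: ideal J R by fact
  note f = plinD[OF assms(1)]
  let ?S = "{x \<in> carrier R. \<forall>r\<in>carrier R. f (r \<otimes> x) \<in> J}"
  have mult: "a \<otimes> x \<in> ?S" if "x \<in> ?S" "a \<in> carrier R" for a x
    using that by (auto simp: m_assoc[symmetric])
  show ?thesis
  proof (rule idealI[OF ring_axioms])
    show "subgroup ?S (add_monoid R)"
    proof (rule add.subgroupI)
      have "\<zero> \<in> ?S" using plin_zero[OF assms(1)] by simp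
      then show "?S \<noteq> {}" by blast
      fix x y assume "x \<in> ?S" "y \<in> ?S"
      then show "x \<oplus> y \<in> ?S" by (auto simp: r_distr f(2))
      have "\<ominus> \<one> \<otimes> x \<in> ?S" using mult \<open>x \<in> ?S\<close> by blast
      then show "\<ominus> x \<in> ?S" using \<open>x \<in> ?S\<close> by (simp add: l_minus)
    qed auto
    fix x a assume "x \<in> ?S" "a \<in> carrier R"
    then show "a \<otimes> x \<in> ?S" by (rule mult)
    then show "x \<otimes> a \<in> ?S" using \<open>x \<in> ?S\<close> \<open>a \<in> carrier R\<close> by (simp add: m_comm)
  qed
qed

lemma dsum_in_ideal:
  assumes "ideal J R" "\<And>f g. (f, g) \<in> set L' \<Longrightarrow> f x [^] p \<in> J" "plin_list R p L'" "x \<in> carrier R"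
  shows "dsum R p L' x \<in> J"
proof -
  interpret J: ideal J R by fact
  show ?thesis using assms(2,3)
  proof (induction L')
    case (Cons fg L')
    obtain f g where fg: "fg = (f, g)" by (cases fg)
    have "f x [^] p \<otimes> g \<in> J" using Cons.prems by (intro J.I_r_closed) (auto simp: fg plin_list_def)
    moreover have "dsum R p L' x \<in> J" using Cons by (auto simp: plin_list_def)
    ultimately show ?case by (simp add: fg)
  qed simp
qed

text \<open>From left to right, \<open>x\<close> is expanded by the dual basis with coefficients
  \<open>f x [^] p\<close>. From right to left, \<open>f (r \<otimes> u [^] p)\<close> equals
  \<open>u \<otimes> f r\<close>, which lies in \<open>I\<close> together with
  \<open>u\<close>.\<close>

lemma root1_adjoint:
  assumes "b \<subseteq> carrier R" "ideal I R"
  shows "root1 b \<subseteq> I \<longleftrightarrow> b \<subseteq> frob_power R p I"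
proof
  have Ic: "I \<subseteq> carrier R" using ideal.Icarr[OF assms(2)] by auto
  {
    assume sub: "root1 b \<subseteq> I"
    show "b \<subseteq> frob_power R p I"
    proof
      fix x assume x: "x \<in> b"
      have "dsum R p L x \<in> frob_power R p I"
      proof (rule dsum_in_ideal[OF frob_power_ideal[OF Ic] _ plin_L])
        fix f g assume "(f, g) \<in> set L"
        then have "f x \<in> I" using root1_mem[OF assms(1) _ x] sub by blast
        then show "f x [^] p \<in> frob_power R p I" by (rule frob_power_incl[OF Ic])
      qed (use x assms in auto)
      then show "x \<in> frob_power R p I" using dual[of x] x assms(1) by auto
    qed
  next
    assume sub: "b \<subseteq> frob_power R p I"
    show "root1 b \<subseteq> I"
    proof (rule root1_minimal[OF assms(2)])
      fix f g x assume fg: "(f, g) \<in> set L" and x: "x \<in> b"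
      note pl = L_plin[OF fg]
      have "frob_power R p I \<subseteq> {x \<in> carrier R. \<forall>r\<in>carrier R. f (r \<otimes> x) \<in> I}"
        unfolding frob_power_def
      proof (intro genideal_minimal plin_preimage_ideal pl assms(2) subsetI)
        fix y assume "y \<in> {u [^] p | u. u \<in> I}"
        then obtain u where u: "u \<in> I" "y = u [^] p" by blast
        have uc: "u \<in> carrier R" using u Ic by auto
        have "f (r \<otimes> y) \<in> I" if r: "r \<in> carrier R" for r
        proof -
          have "f (r \<otimes> y) = u \<otimes> f r" using plinD(3)[OF pl uc r] u uc r by (simp add: m_comm)
          then show ?thesis using ideal.I_r_closed[OF assms(2) u(1)] plinD(1)[OF pl r] by simp
        qed
        then show "y \<in> {x \<in> carrier R. \<forall>r\<in>carrier R. f (r \<otimes> x) \<in> I}" using u uc by simp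
      qed
      then have "f (\<one> \<otimes> x) \<in> I" using sub x by blast
      then show "f x \<in> I" using x assms(1) by auto
    qed
  }
qed

lemma frob_power_Suc:
  assumes "ideal J R"
  shows "frob_power R (p ^ Suc e) J = frob_power R p (frob_power R (p ^ e) J)"
proof
  have Jc: "J \<subseteq> carrier R" using ideal.Icarr[OF assms] by auto
  have idJ: "ideal (frob_power R (p ^ e) J) R" by (rule frob_power_ideal[OF Jc])
  have Jec: "frob_power R (p ^ e) J \<subseteq> carrier R" using ideal.Icarr[OF idJ] by auto
  have pw: "u [^] (p ^ Suc e) = (u [^] (p ^ e)) [^] p" if "u \<in> carrier R" for u
    using that by (simp add: nat_pow_pow mult.commute)
  show "frob_power R (p ^ Suc e) J \<subseteq> frob_power R p (frob_power R (p ^ e) J)"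
  proof -
    have "{u [^] (p ^ Suc e) | u. u \<in> J} \<subseteq> frob_power R p (frob_power R (p ^ e) J)"
      using pw Jc frob_power_incl[OF Jec frob_power_incl[OF Jc]] by (auto simp del: power_Suc)
    then show ?thesis unfolding frob_power_def[of R "p ^ Suc e"]
      by (intro genideal_minimal frob_power_ideal Jec)
  qed
  define F where "F = frob_power R (p ^ Suc e) J"
  interpret F: ideal F R unfolding F_def by (rule frob_power_ideal[OF Jc])
  let ?S = "{w \<in> carrier R. w [^] p \<in> F}"
  \<comment> \<open>Frobenius is a ring homomorphism, so the preimage of the ideal \<open>F\<close>
    is an ideal.\<close>
  have "ideal ?S R"
  proof (rule idealI[OF ring_axioms])
    have "\<zero> \<in> ?S" by (simp add: frob_zero1)
    then have "?S \<noteq> {}" by blast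
    then show "subgroup ?S (add_monoid R)"
      by (intro add.subgroupI) (auto simp: frob_add1 frob_neg1)
    fix w x assume w: "w \<in> ?S" and x: "x \<in> carrier R"
    then show "x \<otimes> w \<in> ?S" by (auto simp: nat_pow_distrib intro!: F.I_l_closed)
    show "w \<otimes> x \<in> ?S" using w x by (auto simp: nat_pow_distrib intro!: F.I_r_closed)
  qed
  moreover have "{u [^] (p ^ e) | u. u \<in> J} \<subseteq> ?S"
    using pw[symmetric] frob_power_incl[OF Jc, of _ "p ^ Suc e"] Jc by (auto simp del: power_Suc simp: F_def)
  ultimately have "frob_power R (p ^ e) J \<subseteq> ?S"
    unfolding frob_power_def[of R "p ^ e"] by (rule genideal_minimal)
  then show "frob_power R p (frob_power R (p ^ e) J) \<subseteq> frob_power R (p ^ Suc e) J"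
    unfolding frob_power_def[of R p] F_def[symmetric] by (intro genideal_minimal F.is_ideal) auto
qed

definition rootn :: "nat \<Rightarrow> 'a set \<Rightarrow> 'a set" where "rootn e = root1 ^^ e"

lemma rootn_0: "rootn 0 b = b" and rootn_Suc: "rootn (Suc e) b = root1 (rootn e b)"
  and rootn_Suc_right: "rootn (Suc e) b = rootn e (root1 b)"
  by (simp_all add: rootn_def funpow_swap1)

lemma rootn_ideal: "ideal b R \<Longrightarrow> ideal (rootn e b) R"
proof (induction e)
  case (Suc e)
  then have "rootn e b \<subseteq> carrier R" using ideal.Icarr[of "rootn e b"] by auto
  then show ?case unfolding rootn_Suc by (rule root1_ideal)
qed (simp add: rootn_0)

lemma root1_mono:
  assumes "b \<subseteq> b'" "b' \<subseteq> carrier R"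
  shows "root1 b \<subseteq> root1 b'"
proof (rule root1_minimal[OF root1_ideal[OF assms(2)]])
  fix f g x assume "(f, g) \<in> set L" "x \<in> b"
  then show "f x \<in> root1 b'" using root1_mem[OF assms(2)] assms(1) by blast
qed

lemma rootn_mono: "ideal b R \<Longrightarrow> ideal b' R \<Longrightarrow> b \<subseteq> b' \<Longrightarrow> rootn e b \<subseteq> rootn e b'"
proof (induction e)
  case (Suc e)
  then show ?case unfolding rootn_Suc using ideal.Icarr[OF rootn_ideal[of b' e]] by (intro root1_mono) auto
qed (simp add: rootn_0)

lemma rootn_adjoint:
  assumes "ideal J R"
  shows "ideal b R \<Longrightarrow> rootn e b \<subseteq> J \<longleftrightarrow> b \<subseteq> frob_power R (p ^ e) J"
proof (induction e arbitrary: b)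
  case 0
  have Jc: "J \<subseteq> carrier R" using ideal.Icarr[OF assms] by auto
  have "{u [^] (1::nat) | u. u \<in> J} = J" using Jc by force
  then have "frob_power R 1 J = genideal R J" unfolding frob_power_def by simp
  also have "\<dots> = J" using genideal_minimal[OF assms subset_refl] genideal_self[OF Jc] by blast
  finally show ?case by (simp add: rootn_0)
next
  case (Suc e)
  have Jc: "J \<subseteq> carrier R" "b \<subseteq> carrier R" using ideal.Icarr[OF assms] ideal.Icarr[OF Suc.prems] by auto
  have "rootn (Suc e) b \<subseteq> J \<longleftrightarrow> root1 b \<subseteq> frob_power R (p ^ e) J"
    unfolding rootn_Suc_right by (rule Suc.IH[OF root1_ideal[OF Jc(2)]])
  also have "\<dots> \<longleftrightarrow> b \<subseteq> frob_power R p (frob_power R (p ^ e) J)"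
    by (rule root1_adjoint[OF Jc(2) frob_power_ideal[OF Jc(1)]])
  finally show ?case unfolding frob_power_Suc[OF assms] .
qed

text \<open>Adjointness exhibits \<open>rootn e b\<close> as an admissible ideal contained in all
  others, so the least element in the definition of \<open>frob_root\<close> exists.\<close>

lemma frob_root_eq:
  assumes "ideal b R"
  shows "frob_root R (p ^ e) b = rootn e b"
  unfolding frob_root_def
proof (rule Least_equality)
  show "ideal (rootn e b) R \<and> b \<subseteq> frob_power R (p ^ e) (rootn e b)"
    using rootn_ideal[OF assms] rootn_adjoint[OF rootn_ideal[OF assms] assms] by blast
  fix J assume "ideal J R \<and> b \<subseteq> frob_power R (p ^ e) J"
  then show "rootn e b \<subseteq> J" using rootn_adjoint[OF _ assms] by blast
qed

text \<open>A factor \<open>u [^] p\<close> leaves each map \<open>f\<close> as \<open>u\<close>.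
  This projection formula is the source of Skoda's theorem.\<close>

lemma root1_frob_prod:
  assumes "ideal a R" "ideal b R"
  shows "root1 (ideal_prod R (frob_power R p a) b) = ideal_prod R a (root1 b)"
proof
  have ac: "a \<subseteq> carrier R" and bc: "b \<subseteq> carrier R" using ideal.Icarr[OF assms(1)] ideal.Icarr[OF assms(2)] by auto
  have fa: "ideal (frob_power R p a) R" by (rule frob_power_ideal[OF ac])
  have pc: "ideal_prod R (frob_power R p a) b \<subseteq> carrier R" by (rule ideal_prod_in_carrier[OF fa assms(2)])
  have rb: "ideal (root1 b) R" by (rule root1_ideal[OF bc])
  have ab: "ideal (ideal_prod R a (root1 b)) R" by (rule ideal_prod_is_ideal[OF assms(1) rb])
  show "root1 (ideal_prod R (frob_power R p a) b) \<subseteq> ideal_prod R a (root1 b)"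
  proof (rule root1_minimal[OF ab])
    fix f g x assume fg: "(f, g) \<in> set L" and x: "x \<in> ideal_prod R (frob_power R p a) b"
    note pl = L_plin[OF fg]
    let ?S = "{x \<in> carrier R. \<forall>r\<in>carrier R. f (r \<otimes> x) \<in> ideal_prod R a (root1 b)}"
    have S: "ideal ?S R" by (rule plin_preimage_ideal[OF pl ab])
    have gen: "u [^] p \<otimes> j \<in> ?S" if u: "u \<in> a" and j: "j \<in> b" for u j
    proof -
      have c: "u \<in> carrier R" "j \<in> carrier R" using u j ac bc by auto
      have "f (r \<otimes> (u [^] p \<otimes> j)) \<in> ideal_prod R a (root1 b)" if r: "r \<in> carrier R" for r
      proof -
        have "f (r \<otimes> (u [^] p \<otimes> j)) = f (u [^] p \<otimes> (r \<otimes> j))" using c r by (simp add: m_lcomm)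
        also have "\<dots> = u \<otimes> f (r \<otimes> j)" using plinD(3)[OF pl c(1)] c r by simp
        also have "\<dots> \<in> ideal_prod R a (root1 b)"
          using u root1_mem[OF bc fg ideal.I_l_closed[OF assms(2) j r]] by (rule ideal_prod.prod)
        finally show ?thesis .
      qed
      then show ?thesis using c by simp
    qed
    have gb: "genideal R b = b" using genideal_minimal[OF assms(2) subset_refl] genideal_self[OF bc] by blast
    have "ideal_prod R (genideal R {u [^] p | u. u \<in> a}) (genideal R b) \<subseteq> ?S"
      by (rule ideal_prod_subset[OF S _ bc]) (use ac gen in auto)
    then have "x \<in> ?S" using x unfolding gb frob_power_def by blast
    then have "f (\<one> \<otimes> x) \<in> ideal_prod R a (root1 b)" by blast
    then show "f x \<in> ideal_prod R a (root1 b)" using x pc by auto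
  qed
  have rp: "ideal (root1 (ideal_prod R (frob_power R p a) b)) R" by (rule root1_ideal[OF pc])
  have ga: "genideal R a = a" using genideal_minimal[OF assms(1) subset_refl] genideal_self[OF ac] by blast
  have "ideal_prod R (genideal R a) (genideal R {f x | f g x. (f, g) \<in> set L \<and> x \<in> b})
      \<subseteq> root1 (ideal_prod R (frob_power R p a) b)"
  proof (rule ideal_prod_subset[OF rp ac root1_gens[OF bc]])
    fix u y assume u: "u \<in> a" and "y \<in> {f x | f g x. (f, g) \<in> set L \<and> x \<in> b}"
    then obtain f g x where y: "y = f x" "(f, g) \<in> set L" "x \<in> b" by blast
    have "u \<in> carrier R" "x \<in> carrier R" using u y ac bc by auto
    then have "u \<otimes> y = f (u [^] p \<otimes> x)" using plinD(3)[OF L_plin[OF y(2)], of u x] y(1) by simp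
    moreover have "u [^] p \<otimes> x \<in> ideal_prod R (frob_power R p a) b"
      using frob_power_incl[OF ac u] y(3) by (rule ideal_prod.prod)
    ultimately show "u \<otimes> y \<in> root1 (ideal_prod R (frob_power R p a) b)" using root1_mem[OF pc y(2)] by simp
  qed
  then show "ideal_prod R a (root1 b) \<subseteq> root1 (ideal_prod R (frob_power R p a) b)" unfolding ga root1_def .
qed

lemma rootn_frob_prod:
  "ideal a R \<Longrightarrow> ideal b R \<Longrightarrow> rootn e (ideal_prod R (frob_power R (p ^ e) a) b) = ideal_prod R a (rootn e b)"
proof (induction e arbitrary: b)
  case 0
  have ac: "a \<subseteq> carrier R" using ideal.Icarr[OF 0(1)] by auto
  have "{u [^] (1::nat) | u. u \<in> a} = a" using ac by force
  then have "frob_power R 1 a = genideal R a" unfolding frob_power_def by simp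
  also have "\<dots> = a" using genideal_minimal[OF 0(1) subset_refl] genideal_self[OF ac] by blast
  finally show ?case by (simp add: rootn_0)
next
  case (Suc e)
  have ac: "a \<subseteq> carrier R" "b \<subseteq> carrier R" using ideal.Icarr[OF Suc.prems(1)] ideal.Icarr[OF Suc.prems(2)] by auto
  show ?case
    unfolding rootn_Suc_right frob_power_Suc[OF Suc.prems(1)]
      root1_frob_prod[OF frob_power_ideal[OF ac(1)] Suc.prems(2)]
    by (rule Suc.IH[OF Suc.prems(1) root1_ideal[OF ac(2)]])
qed

text \<open>Expanding one by the dual basis puts it into the ideal of the values
  \<open>f \<one>\<close>. With the projection formula this makes \<open>root1\<close> a left
  inverse of the Frobenius power.\<close>

lemma root1_carrier: "root1 (carrier R) = carrier R"
proof -
  interpret J: ideal "root1 (carrier R)" R by (rule root1_ideal) simp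
  obtain r where r: "p = Suc r" using p_pos gr0_implies_Suc by blast
  have "dsum R p L \<one> \<in> root1 (carrier R)"
  proof (rule dsum_in_ideal[OF J.is_ideal _ plin_L])
    fix f g assume fg: "(f, g) \<in> set L"
    have "f \<one> \<in> root1 (carrier R)" by (rule root1_mem[OF _ fg]) auto
    then show "f \<one> [^] p \<in> root1 (carrier R)"
      using J.I_l_closed[of "f \<one>" "f \<one> [^] r"] plinD(1)[OF L_plin[OF fg]] by (simp add: r)
  qed simp
  then have "\<one> \<in> root1 (carrier R)" using dual[of \<one>] by simp
  then show ?thesis by (rule J.one_imp_carrier)
qed

lemma root1_frob_power:
  assumes "ideal a R"
  shows "root1 (frob_power R p a) = a"
proof -
  have ac: "a \<subseteq> carrier R" using ideal.Icarr[OF assms] by auto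
  show ?thesis
    using root1_frob_prod[OF assms oneideal] ideal_prod_one[OF frob_power_ideal[OF ac]]
      ideal_prod_one[OF assms] root1_carrier by simp
qed

end

section \<open>Bounded degrees\<close>

locale dual_alg = reg_ess_alg R p K xs E H + frob_dual R p L
  for R (structure) and p K xs E H L +
  assumes one_neq_zero: "\<one> \<noteq> \<zero>"
begin

text \<open>Generation is over \<open>R\<close>, so generators may be multiplied by units. An ideal
  with this property is determined by \<open>b \<inter> V d\<close>, a subspace of a fixed
  finite-dimensional space.\<close>

definition deg_le :: "nat \<Rightarrow> 'a set \<Rightarrow> bool" where
  "deg_le d b \<longleftrightarrow> b \<subseteq> genideal R (b \<inter> V d)"

lemma inter_V_sub: "b \<inter> V d \<subseteq> carrier R" using V_carr by auto

lemma deg_le_mono: "deg_le d b \<Longrightarrow> d \<le> e \<Longrightarrow> deg_le e b"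
proof -
  assume a: "deg_le d b" "d \<le> e"
  have "genideal R (b \<inter> V d) \<subseteq> genideal R (b \<inter> V e)"
    using genideal_self[OF inter_V_sub[of b e]] V_mono[OF a(2)] inter_V_sub
    by (intro genideal_minimal genideal_ideal) blast+
  then show ?thesis using a unfolding deg_le_def by blast
qed

lemma deg_le_prod:
  assumes "ideal a R" "ideal b R" "deg_le d a" "deg_le e b"
  shows "deg_le (d + e) (ideal_prod R a b)"
proof -
  let ?J = "genideal R (ideal_prod R a b \<inter> V (d + e))"
  have "ideal_prod R (genideal R (a \<inter> V d)) (genideal R (b \<inter> V e)) \<subseteq> ?J"
  proof (rule ideal_prod_subset[OF genideal_ideal[OF inter_V_sub] inter_V_sub inter_V_sub])
    fix x y assume "x \<in> a \<inter> V d" "y \<in> b \<inter> V e"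
    then have "x \<otimes> y \<in> ideal_prod R a b \<inter> V (d + e)" using V_mult by (auto intro: ideal_prod.prod)
    then show "x \<otimes> y \<in> ?J" using genideal_self[OF inter_V_sub] by blast
  qed
  moreover have "x \<in> ideal_prod R (genideal R (a \<inter> V d)) (genideal R (b \<inter> V e))" if "x \<in> ideal_prod R a b" for x
    using that by induction (use assms(3,4) in \<open>auto simp: deg_le_def intro: ideal_prod.intros\<close>)
  ultimately show ?thesis unfolding deg_le_def by blast
qed

lemma deg_le_exists:
  assumes "ideal I R"
  obtains d where "deg_le d I"
proof -
  obtain A where A: "A \<subseteq> carrier R" "finite A" "I = genideal R A" using ideal_finite[OF assms] by blast
  obtain u d where u: "u \<in> Units R" "\<forall>a\<in>A. u \<otimes> a \<in> V d" using unit_multiple[OF A(2,1)] by blast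
  interpret I: ideal I R by fact
  interpret J: ideal "genideal R (I \<inter> V d)" R by (rule genideal_ideal[OF inter_V_sub])
  have AI: "A \<subseteq> I" using genideal_self[OF A(1)] A(3) by simp
  have "A \<subseteq> genideal R (I \<inter> V d)"
  proof
    fix a assume a: "a \<in> A"
    have uc: "u \<in> carrier R" "inv u \<in> carrier R" "a \<in> carrier R" using u A a by auto
    have "u \<otimes> a \<in> I \<inter> V d" using u a AI I.I_l_closed[of a u] uc by auto
    then have "u \<otimes> a \<in> genideal R (I \<inter> V d)" using genideal_self[OF inter_V_sub] by blast
    from J.I_l_closed[OF this uc(2)] show "a \<in> genideal R (I \<inter> V d)"
      using uc u(1) by (simp add: m_assoc[symmetric])
  qed
  then have "genideal R A \<subseteq> genideal R (I \<inter> V d)" by (intro genideal_minimal J.is_ideal)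
  then show thesis using that[of d] A(3) unfolding deg_le_def by simp
qed

lemma deg_le_power:
  assumes "ideal I R" "deg_le d I"
  shows "deg_le (n * d) (ideal_power R I n)"
proof (induction n)
  case 0
  have "\<one> \<in> genideal R (carrier R \<inter> V 0)" using genideal_self[OF inter_V_sub] V_one by blast
  then have "genideal R (carrier R \<inter> V 0) = carrier R"
    by (intro ideal.one_imp_carrier genideal_ideal inter_V_sub)
  then show ?case by (simp add: ideal_power_0 deg_le_def)
next
  case (Suc n)
  then show ?case unfolding ideal_power_Suc
    using deg_le_prod[OF ideal_power_ideal[OF assms(1)] assms(1) Suc assms(2)] by (simp add: add.commute)
qed

text \<open>\<open>f\<close> turns a factor \<open>h [^] p\<close> into \<open>h\<close>, so only
  the degree of \<open>h\<close> counts; the values of \<open>f\<close> at the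
  \<open>g \<otimes> \<beta>\<close> add a constant \<open>D\<close> once the unit \<open>u\<close>
  has brought them into \<open>V D\<close>.\<close>

lemma plin_add_closure_V:
  assumes "plin R p f" "g \<in> carrier R" "u \<in> carrier R" "B \<subseteq> carrier R"
    "\<And>\<beta>. \<beta> \<in> B \<Longrightarrow> u \<otimes> f (g \<otimes> \<beta>) \<in> V D"
    "x \<in> add_closure R {h [^] p \<otimes> \<beta> | h \<beta>. h \<in> V c \<and> \<beta> \<in> B}"
  shows "u \<otimes> f (g \<otimes> x) \<in> V (c + D)"
proof -
  note f = plinD[OF assms(1)]
  have sub: "{h [^] p \<otimes> \<beta> | h \<beta>. h \<in> V c \<and> \<beta> \<in> B} \<subseteq> carrier R" using V_carr assms(4) by auto
  show ?thesis using assms(6)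
  proof induction
    case zero
    then show ?case using assms plin_zero[OF assms(1)] V_zero by simp
  next
    case (add x m)
    obtain h \<beta> where h: "h \<in> V c" "\<beta> \<in> B" "m = h [^] p \<otimes> \<beta>" using add(2) by blast
    have c: "h \<in> carrier R" "\<beta> \<in> carrier R" "x \<in> carrier R"
      using h V_carr assms(4) add_closure_carr[OF add(1) sub] by auto
    have "g \<otimes> m = h [^] p \<otimes> (g \<otimes> \<beta>)" using c assms(2) by (simp add: h(3) m_lcomm)
    then have "f (g \<otimes> m) = h \<otimes> f (g \<otimes> \<beta>)" using f(3)[OF c(1)] c assms(2) by simp
    then have "u \<otimes> f (g \<otimes> m) = h \<otimes> (u \<otimes> f (g \<otimes> \<beta>))" using c assms(2,3) f(1) by (simp add: m_lcomm)
    then have m: "u \<otimes> f (g \<otimes> m) \<in> V (c + D)" using V_mult[OF h(1) assms(5)[OF h(2)]] by simp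
    have mc: "m \<in> carrier R" using c h by simp
    have "u \<otimes> f (g \<otimes> (x \<oplus> m)) = u \<otimes> f (g \<otimes> x) \<oplus> u \<otimes> f (g \<otimes> m)"
      using c mc assms(2,3) f(1,2) by (simp add: r_distr)
    then show ?case using V_add[OF add.IH m] by simp
  qed
qed

text \<open>The map \<open>f\<close> commutes with \<open>p\<close>-th powers only, so all multiples
  \<open>r \<otimes> x\<close> of a generator must be checked. Expanding \<open>r\<close> by the
  dual basis leaves the finitely many multipliers \<open>g\<close>.\<close>

lemma plin_dsum_in_ideal:
  assumes "plin R p f" "ideal J R" "x \<in> carrier R" "r \<in> carrier R" "plin_list R p L'"
    "\<And>f' g. (f', g) \<in> set L' \<Longrightarrow> f (g \<otimes> x) \<in> J"
  shows "f (dsum R p L' r \<otimes> x) \<in> J"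
proof -
  interpret J: ideal J R by fact
  note f = plinD[OF assms(1)]
  show ?thesis using assms(5,6)
  proof (induction L')
    case Nil
    then show ?case using assms plin_zero[OF assms(1)] by simp
  next
    case (Cons fg L')
    obtain f' g where fg: "fg = (f', g)" by (cases fg)
    have L': "plin_list R p L'" "f' r \<in> carrier R" "g \<in> carrier R"
      using Cons.prems assms(4) by (auto simp: fg plin_list_def plinD)
    have dc: "dsum R p L' r \<in> carrier R" by (rule dsum_carr[OF L'(1) assms(4)])
    have "(f' r [^] p \<otimes> g \<oplus> dsum R p L' r) \<otimes> x = f' r [^] p \<otimes> (g \<otimes> x) \<oplus> dsum R p L' r \<otimes> x"
      using L' dc assms(3) by (simp add: l_distr m_assoc)
    then have "f (dsum R p (fg # L') r \<otimes> x) = f' r \<otimes> f (g \<otimes> x) \<oplus> f (dsum R p L' r \<otimes> x)"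
      using L' dc assms(3) f by (simp add: fg)
    moreover have "f (dsum R p L' r \<otimes> x) \<in> J" using Cons.IH[OF L'(1)] Cons.prems(2) by auto
    moreover have "f' r \<otimes> f (g \<otimes> x) \<in> J"
      using Cons.prems(2)[of f' g] L' by (intro J.I_l_closed) (auto simp: fg)
    ultimately show ?case by simp
  qed
qed

lemma deg_le_root1:
  obtains D where "\<And>d b. ideal b R \<Longrightarrow> deg_le d b \<Longrightarrow> deg_le (d div p + D) (root1 b)"
proof -
  obtain B where B: "finite B" "B \<subseteq> carrier R"
    "\<And>d v. v \<in> V d \<Longrightarrow> v \<in> add_closure R {f [^] p \<otimes> b | f b. f \<in> V (d div p) \<and> b \<in> B}"
    by (rule V_frob_decomp) blast
  \<comment> \<open>All values that can arise beyond the factors \<open>h\<close>. There are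
    finitely many, so a single unit and a single degree serve for all \<open>d\<close> and
    \<open>b\<close>.\<close>
  define F where "F = (\<lambda>(((f, _), (_, g)), \<beta>). f (g \<otimes> \<beta>)) ` ((set L \<times> set L) \<times> B)"
  have "F \<subseteq> carrier R"
  proof
    fix z assume "z \<in> F"
    then obtain f g0 f0 g \<beta> where z: "(f, g0) \<in> set L" "(f0, g) \<in> set L" "\<beta> \<in> B" "z = f (g \<otimes> \<beta>)"
      unfolding F_def by auto
    then show "z \<in> carrier R" using plinD(1)[OF L_plin[OF z(1)], of "g \<otimes> \<beta>"] L_carr[OF z(2)] B(2) by auto
  qed
  moreover have "finite F" unfolding F_def using B(1) by auto
  ultimately obtain u D where u: "u \<in> Units R" "\<forall>a\<in>F. u \<otimes> a \<in> V D" using unit_multiple by blast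
  have uc: "u \<in> carrier R" "inv u \<in> carrier R" using u by auto
  have "deg_le (d div p + D) (root1 b)" if b: "ideal b R" "deg_le d b" for d b
  proof -
    interpret b: ideal b R by (rule b(1))
    have bc: "b \<subseteq> carrier R" using b.Icarr by auto
    let ?J = "genideal R (root1 b \<inter> V (d div p + D))"
    interpret J: ideal ?J R by (rule genideal_ideal[OF inter_V_sub])
    interpret rb: ideal "root1 b" R by (rule root1_ideal[OF bc])
    have "root1 b \<subseteq> ?J"
    proof (rule root1_minimal[OF J.is_ideal])
      fix f g0 y assume fg: "(f, g0) \<in> set L" and y: "y \<in> b"
      note pl = L_plin[OF fg]
      have "b \<inter> V d \<subseteq> {x \<in> carrier R. \<forall>r\<in>carrier R. f (r \<otimes> x) \<in> ?J}"
      proof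
        fix x assume x: "x \<in> b \<inter> V d"
        have xc: "x \<in> carrier R" using x bc by auto
        have gx: "f (g \<otimes> x) \<in> ?J" if g: "(f', g) \<in> set L" for f' g
        proof -
          have gc: "g \<in> carrier R" by (rule L_carr[OF g])
          have "u \<otimes> f (g \<otimes> x) \<in> V (d div p + D)"
          proof (rule plin_add_closure_V[OF pl gc uc(1) B(2)])
            fix \<beta> assume "\<beta> \<in> B"
            then have "f (g \<otimes> \<beta>) \<in> F"
              unfolding F_def using fg g by (intro image_eqI[of _ _ "(((f, g0), (f', g)), \<beta>)"]) auto
            then show "u \<otimes> f (g \<otimes> \<beta>) \<in> V D" using u(2) by blast
          qed (use B(3) x in blast)
          moreover have "u \<otimes> f (g \<otimes> x) \<in> root1 b"
            using x gc uc by (intro rb.I_l_closed root1_mem[OF bc fg] b.I_l_closed) auto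
          ultimately have "u \<otimes> f (g \<otimes> x) \<in> ?J" using genideal_self[OF inter_V_sub] by blast
          from J.I_l_closed[OF this uc(2)] show ?thesis
            using plinD(1)[OF pl, of "g \<otimes> x"] gc xc uc u(1) by (simp add: m_assoc[symmetric])
        qed
        have "f (r \<otimes> x) \<in> ?J" if r: "r \<in> carrier R" for r
          using plin_dsum_in_ideal[OF pl J.is_ideal xc r plin_L gx] dual[OF r] by simp
        then show "x \<in> {x \<in> carrier R. \<forall>r\<in>carrier R. f (r \<otimes> x) \<in> ?J}" using xc by simp
      qed
      then have "genideal R (b \<inter> V d) \<subseteq> {x \<in> carrier R. \<forall>r\<in>carrier R. f (r \<otimes> x) \<in> ?J}"
        by (intro genideal_minimal plin_preimage_ideal pl J.is_ideal)
      then have "f (\<one> \<otimes> y) \<in> ?J" using y b(2) unfolding deg_le_def by blast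
      then show "f y \<in> ?J" using y bc by auto
    qed
    then show ?thesis unfolding deg_le_def .
  qed
  then show thesis using that by blast
qed

text \<open>Every root divides the degree by \<open>p\<close> and adds \<open>D\<close>. As
  \<open>p\<close> is at least two, the surplus \<open>2 * D\<close> absorbs these additions however
  many roots are taken.\<close>

lemma deg_le_rootn:
  obtains D where "\<And>d b e. ideal b R \<Longrightarrow> deg_le d b \<Longrightarrow> deg_le (d div p ^ e + 2 * D) (rootn e b)"
proof -
  obtain D where D: "\<And>d b. ideal b R \<Longrightarrow> deg_le d b \<Longrightarrow> deg_le (d div p + D) (root1 b)"
    by (rule deg_le_root1) blast
  have "deg_le (d div p ^ e + 2 * D) (rootn e b)" if b: "ideal b R" "deg_le d b" for d b e
  proof (induction e)
    case 0
    then show ?case using deg_le_mono[OF b(2)] by (simp add: rootn_0)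
  next
    case (Suc e)
    have "(d div p ^ e + 2 * D) div p \<le> (d div p ^ e + p * D) div p"
      using p_ge2 by (intro div_le_mono add_le_mono mult_le_mono) auto
    also have "\<dots> = d div p ^ e div p + D" using p_pos by simp
    also have "d div p ^ e div p = d div p ^ Suc e" by (metis div_mult2_eq power_Suc2)
    finally have "(d div p ^ e + 2 * D) div p + D \<le> d div p ^ Suc e + 2 * D" by simp
    then show ?case unfolding rootn_Suc using D[OF rootn_ideal[OF b(1)] Suc] deg_le_mono by blast
  qed
  then show thesis using that by blast
qed

text \<open>Every strict step yields some \<open>v i\<close> in \<open>W i \<inter> V M\<close>
  outside \<open>W (Suc i)\<close>, for otherwise the generators of \<open>W i\<close> would lie in
  the next ideal. These elements are linearly independent over \<open>K\<close>, so the length is at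
  most the number of elements spanning \<open>V M\<close>.\<close>

lemma ideal_chain_bounded:
  obtains N where "\<And>n W. (\<And>i. i \<le> n \<Longrightarrow> ideal (W i) R \<and> deg_le M (W i)) \<Longrightarrow>
    (\<And>i. i < n \<Longrightarrow> W (Suc i) \<subset> W i) \<Longrightarrow> n \<le> N"
proof -
  interpret Z: twisted R p K "{\<zero>}" by (rule twistedI[OF zeroideal sub_K])
  have domK: "a = \<zero> \<or> b = \<zero>" if ab: "a \<in> K" "b \<in> K" "a \<otimes> b = \<zero>" for a b
  proof (rule ccontr)
    assume n: "\<not> (a = \<zero> \<or> b = \<zero>)"
    then obtain d where d: "d \<in> K" "a \<otimes> d = \<one>" using K_inv ab by blast
    have c: "a \<in> carrier R" "b \<in> carrier R" "d \<in> carrier R" using ab d K_carr by auto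
    have "b = (a \<otimes> d) \<otimes> b" using d c by simp
    also have "\<dots> = d \<otimes> (a \<otimes> b)" using c by (simp add: m_ac)
    finally show False using ab n c by simp
  qed
  interpret Z: twisted_prime R p K "{\<zero>}"
    using one_neq_zero domK by (intro twisted_prime.intro Z.twisted_axioms twisted_prime_axioms.intro) auto
  obtain T where T: "finite T" "T \<subseteq> carrier R" "V M \<subseteq> tspan R K 1 {\<zero>} T"
    by (rule V_span[OF zeroideal])
  have "n \<le> card T" if W: "\<And>i. i \<le> n \<Longrightarrow> ideal (W i) R \<and> deg_le M (W i)" "\<And>i. i < n \<Longrightarrow> W (Suc i) \<subset> W i" for n W
  proof (rule ccontr)
    assume gt: "\<not> n \<le> card T"
    have "\<exists>v. v \<in> W i \<inter> V M \<and> v \<notin> W (Suc i)" if i: "i < n" for i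
    proof (rule ccontr)
      assume "\<not> ?thesis"
      then have "W i \<inter> V M \<subseteq> W (Suc i)" by blast
      then have "genideal R (W i \<inter> V M) \<subseteq> W (Suc i)" using W(1)[of "Suc i"] i by (intro genideal_minimal) auto
      then have "W i \<subseteq> W (Suc i)" using W(1)[of i] i unfolding deg_le_def by auto
      then show False using W(2)[OF i] by blast
    qed
    then have "\<forall>i\<in>{..<n}. \<exists>v. v \<in> W i \<inter> V M \<and> v \<notin> W (Suc i)" by blast
    then obtain v where v: "\<forall>i\<in>{..<n}. v i \<in> W i \<inter> V M \<and> v i \<notin> W (Suc i)" by (rule bchoice[THEN exE])
    have vc: "v i \<in> carrier R" if "i < n" for i using v that V_carr by auto
    have "\<not> tindep R K (p ^ 0) {\<zero>} {..<n} v"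
    proof (rule Z.tspan_exchange[OF T(1,2)])
      show "v \<in> {..<n} \<rightarrow> carrier R" using vc by auto
      show "card T < card {..<n}" using gt by simp
      fix i assume i: "i \<in> {..<n}"
      have "\<one> [^] (p ^ 0) \<otimes> v i \<in> tspan R K (p ^ 0) {\<zero>} T" using T(3) v i vc[of i] by auto
      then show "\<exists>s\<in>K - {\<zero>}. s [^] (p ^ 0) \<otimes> v i \<in> tspan R K (p ^ 0) {\<zero>} T"
        using Z.S_one one_neq_zero by blast
    qed simp
    then obtain c where c: "c \<in> {..<n} \<rightarrow> K" "(\<Oplus>i\<in>{..<n}. c i [^] (1::nat) \<otimes> v i) = \<zero>"
      "\<exists>i\<in>{..<n}. c i \<noteq> \<zero>" unfolding tindep_def by auto
    have cc: "c i \<in> carrier R" if "i < n" for i using c(1) that K_carr by auto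
    \<comment> \<open>At the first nonvanishing coefficient of a linear relation, all later terms
      lie in \<open>W (Suc k)\<close>, so \<open>v k\<close> is forced into it after dividing by
      \<open>c k\<close>.\<close>
    define k where "k = (LEAST i. i < n \<and> c i \<noteq> \<zero>)"
    have k: "k < n \<and> c k \<noteq> \<zero>" unfolding k_def by (rule LeastI_ex) (use c(3) in auto)
    have kl: "c i = \<zero>" if "i < k" "i < n" for i using not_less_Least[of i] that unfolding k_def by auto
    interpret Wk: ideal "W (Suc k)" R using W(1)[of "Suc k"] k by auto
    have decr: "W j \<subseteq> W (Suc k)" if "Suc k \<le> j" "j \<le> n" for j
      using that
    proof (induction j rule: dec_induct)
      case (step j)
      then show ?case using W(2)[of j] by auto
    qed simp
    let ?f = "\<lambda>i. c i [^] (1::nat) \<otimes> v i"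
    have "{..<n} = insert k ({..<n} - {k})" using k by auto
    then have "(\<Oplus>i\<in>{..<n}. ?f i) = (\<Oplus>i\<in>insert k ({..<n} - {k}). ?f i)" by simp
    also have "\<dots> = ?f k \<oplus> (\<Oplus>i\<in>{..<n} - {k}. ?f i)"
      using cc vc k by (intro finsum_insert) auto
    finally have e: "?f k \<oplus> (\<Oplus>i\<in>{..<n} - {k}. ?f i) = \<zero>" using c(2) by simp
    interpret TW: twisted R p K "W (Suc k)" by (rule twistedI[OF Wk.is_ideal sub_K])
    have rest: "(\<Oplus>i\<in>{..<n} - {k}. ?f i) \<in> W (Suc k)"
    proof (rule TW.Q_finsum)
      show "?f \<in> {..<n} - {k} \<rightarrow> W (Suc k)"
      proof
        fix i assume i: "i \<in> {..<n} - {k}"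
        show "?f i \<in> W (Suc k)"
        proof (cases "i < k")
          case True then show ?thesis using kl i vc by auto
        next
          case False
          then have "v i \<in> W (Suc k)" using v i decr[of i] by auto
          then show ?thesis using cc i by (intro Wk.I_l_closed) auto
        qed
      qed
    qed simp
    have "?f k \<in> W (Suc k)"
      by (rule TW.Q_cancel[OF _ rest]) (use e cc vc k in auto)
    then have ck: "c k \<otimes> v k \<in> W (Suc k)" using cc k by simp
    have "c k \<in> K" using c(1) k by auto
    then obtain d where d: "d \<in> K" "c k \<otimes> d = \<one>" using K_inv k by blast
    have dc: "d \<in> carrier R" "c k \<in> carrier R" "v k \<in> carrier R" using d K_carr cc vc k by auto
    have "d \<otimes> (c k \<otimes> v k) = v k" using d(2) dc by (simp add: m_assoc[symmetric] m_comm[of d])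
    then have "v k \<in> W (Suc k)" using Wk.I_l_closed[OF ck dc(1)] by simp
    then show False using v k by auto
  qed
  then show thesis using that by blast
qed

end

section \<open>Test ideals\<close>

locale test_ideals = dual_alg R p K xs E H L
  for R (structure) and p K xs E H L +
  fixes I assumes ideal_I: "ideal I R"
begin

definition lev :: "real \<Rightarrow> nat \<Rightarrow> 'a set" where
  "lev c e = rootn e (ideal_power R I (nat \<lceil>c * real p ^ e\<rceil>))"

definition tau :: "real \<Rightarrow> 'a set" where "tau c = test_ideal p R I c"

lemma lev_ideal: "ideal (lev c e) R"
  unfolding lev_def by (intro rootn_ideal ideal_power_ideal ideal_I)

lemma tau_eq: "c > 0 \<Longrightarrow> tau c = (\<Union>e\<in>{e. e > 0}. lev c e)"
  unfolding tau_def test_ideal_def lev_def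
  by (simp add: frob_root_eq[OF ideal_power_ideal[OF ideal_I]])

text \<open>Rounding up gives an exponent at level \<open>Suc e\<close> of at most \<open>p\<close>
  times that at level \<open>e\<close>. So the power at level \<open>Suc e\<close> contains the
  Frobenius power of the one at level \<open>e\<close>, and \<open>root1\<close> undoes that
  Frobenius power.\<close>

lemma lev_Suc:
  assumes "c > 0"
  shows "lev c e \<subseteq> lev c (Suc e)"
proof -
  let ?N = "nat \<lceil>c * real p ^ e\<rceil>" and ?N' = "nat \<lceil>c * real p ^ Suc e\<rceil>"
  have "?N' \<le> p * ?N"
  proof -
    have "c * real p ^ Suc e = real p * (c * real p ^ e)" by simp
    also have "\<dots> \<le> real p * real ?N" by (intro mult_left_mono) (auto simp: real_nat_ceiling_ge)
    also have "\<dots> = real_of_int (int (p * ?N))" by simp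
    finally have "\<lceil>c * real p ^ Suc e\<rceil> \<le> int (p * ?N)" by (rule ceiling_le)
    then show ?thesis by linarith
  qed
  then have sub: "ideal_power R I (p * ?N) \<subseteq> ideal_power R I ?N'" by (rule ideal_power_antimono[OF ideal_I])
  let ?J = "ideal_power R I ?N"
  have J: "ideal ?J R" by (rule ideal_power_ideal[OF ideal_I])
  have Jc: "?J \<subseteq> carrier R" using ideal.Icarr[OF J] by auto
  have "frob_power R p ?J \<subseteq> ideal_power R I (p * ?N)"
    unfolding frob_power_def
    using pow_mem_ideal_power[OF ideal_I] by (intro genideal_minimal ideal_power_ideal ideal_I) auto
  then have "frob_power R p ?J \<subseteq> ideal_power R I ?N'" using sub by blast
  then have "root1 (frob_power R p ?J) \<subseteq> root1 (ideal_power R I ?N')"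
    using ideal.Icarr[OF ideal_power_ideal[OF ideal_I]] by (intro root1_mono) auto
  then have "?J \<subseteq> root1 (ideal_power R I ?N')" using root1_frob_power[OF J] by simp
  then show ?thesis unfolding lev_def rootn_Suc_right
    using ideal.Icarr[OF ideal_power_ideal[OF ideal_I]]
    by (intro rootn_mono J root1_ideal) auto
qed

lemma lev_mono_e: "e \<le> e' \<Longrightarrow> c > 0 \<Longrightarrow> lev c e \<subseteq> lev c e'"
  by (induction e' rule: dec_induct) (use lev_Suc in blast)+

lemma tau_stable:
  assumes "c > 0"
  obtains e0 where "e0 > 0" "\<And>e. e \<ge> e0 \<Longrightarrow> tau c = lev c e"
proof -
  interpret N: noetherian_ring R by (rule noeth)
  let ?C = "lev c ` {e. e > 0}"
  have "subset.chain {J. ideal J R} ?C"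
    unfolding subset_chain_def
  proof (intro conjI ballI subsetI)
    fix A B assume "A \<in> ?C" "B \<in> ?C"
    then obtain i j where "A = lev c i" "B = lev c j" by blast
    then show "A \<subseteq> B \<or> B \<subseteq> A"
      using lev_mono_e[OF _ assms, of i j] lev_mono_e[OF _ assms, of j i] nat_le_linear[of i j] by blast
  qed (use lev_ideal in auto)
  then have "\<Union>?C \<in> ?C" by (intro N.ideal_chain_is_trivial) auto
  then obtain e0 where e0: "e0 > 0" "tau c = lev c e0" using tau_eq[OF assms] by auto
  have "tau c = lev c e" if "e \<ge> e0" for e
  proof
    show "tau c \<subseteq> lev c e" using lev_mono_e[OF that assms] e0 by simp
    have "e \<in> {e. e > 0}" using that e0(1) by simp
    then show "lev c e \<subseteq> tau c" unfolding tau_eq[OF assms] by blast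
  qed
  then show thesis using that e0 by blast
qed

text \<open>Both test ideals can be read off at finite levels; the shift \<open>k\<close> allows for
  exponents that differ by a power of \<open>p\<close>.\<close>

lemma tau_common:
  assumes "c > 0" "c' > 0"
  obtains e where "tau c = lev c e" "tau c' = lev c' (e + k)"
proof -
  obtain e0 where e0: "\<And>e. e \<ge> e0 \<Longrightarrow> tau c = lev c e" by (rule tau_stable[OF assms(1)]) blast
  obtain e1 where e1: "\<And>e. e \<ge> e1 \<Longrightarrow> tau c' = lev c' e" by (rule tau_stable[OF assms(2)]) blast
  show thesis by (rule that[of "max e0 e1"]) (use e0 e1 in auto)
qed

lemma tau_ideal: "c > 0 \<Longrightarrow> ideal (tau c) R"
  by (erule tau_stable) (metis lev_ideal order_refl)

lemma tau_antimono:
  assumes "0 < c" "c \<le> c'"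
  shows "tau c' \<subseteq> tau c"
proof -
  obtain e where e: "tau c = lev c e" "tau c' = lev c' (e + 0)"
    by (rule tau_common[of c c' 0]) (use assms in auto)
  have "c * real p ^ e \<le> c' * real p ^ e" using assms by (intro mult_right_mono) auto
  then have "nat \<lceil>c * real p ^ e\<rceil> \<le> nat \<lceil>c' * real p ^ e\<rceil>" by (intro nat_mono ceiling_mono)
  then show ?thesis unfolding e lev_def add_0_right
    by (intro rootn_mono ideal_power_ideal ideal_I ideal_power_antimono)
qed

text \<open>The exponent \<open>real p * c\<close> at level \<open>e\<close> and \<open>c\<close> at
  level \<open>Suc e\<close> lead to the same power of \<open>I\<close>, and the latter takes one
  more root.\<close>

lemma root1_tau:
  assumes "c > 0"
  shows "root1 (tau (real p * c)) = tau c"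
proof -
  have "real p * c > 0" using assms p_pos by simp
  then obtain e where e: "tau (real p * c) = lev (real p * c) e" "tau c = lev c (e + 1)"
    by (rule tau_common[OF _ assms])
  have "real p * c * real p ^ e = c * real p ^ Suc e" by simp
  then show ?thesis unfolding e lev_def rootn_Suc[symmetric] Suc_eq_plus1[symmetric] by (simp only:)
qed

text \<open>For \<open>c\<close> above the number of generators, the power of \<open>I\<close> at
  every level is large enough to split off the Frobenius power of \<open>I\<close>, which leaves the
  root as a factor \<open>I\<close>.\<close>

lemma tau_skoda:
  assumes "finite G" "G \<subseteq> carrier R" "I = genideal R G" "c > real (card G)" "c > 1"
  shows "tau c = ideal_prod R I (tau (c - 1))"
proof -
  have "c > 0" "c - 1 > 0" using assms(5) by auto
  then obtain e where e: "tau c = lev c e" "tau (c - 1) = lev (c - 1) (e + 0)" by (rule tau_common)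
  let ?q = "p ^ e" and ?n = "nat \<lceil>c * real p ^ e\<rceil>"
  have q: "?q > 0" using p_pos by simp
  have qr: "real p ^ e \<ge> 1" using p_pos by simp
  have "real (card G * (?q - 1)) \<le> real (card G) * real p ^ e" by (simp add: mult_left_mono)
  also have "\<dots> < c * real p ^ e" using assms(4) p_pos by (intro mult_strict_right_mono) auto
  also have "\<dots> \<le> real ?n" by (rule real_nat_ceiling_ge)
  finally have 1: "card G * (?q - 1) < ?n" by (simp only: of_nat_less_iff)
  have "1 * real p ^ e \<le> c * real p ^ e" using assms(5) by (intro mult_right_mono) auto
  then have "real ?q \<le> c * real p ^ e" by simp
  also have "\<dots> \<le> real ?n" by (rule real_nat_ceiling_ge)
  finally have 2: "?q \<le> ?n" by simp
  \<comment> \<open>Lowering \<open>c\<close> by one lowers the exponent by the integer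
    \<open>p ^ e\<close>, so rounding commutes with it.\<close>
  have "(c - 1) * real p ^ e = c * real p ^ e - real_of_int (int ?q)" by (simp add: algebra_simps)
  then have "\<lceil>(c - 1) * real p ^ e\<rceil> = \<lceil>c * real p ^ e\<rceil> - int ?q" by (simp only: ceiling_diff_of_int)
  moreover have "nat (z - int m) = nat z - m" for z m by linarith
  ultimately have 3: "nat \<lceil>(c - 1) * real p ^ e\<rceil> = ?n - ?q" by (simp only:)
  have "ideal_power R I ?n = ideal_prod R (frob_power R ?q I) (ideal_power R I (?n - ?q))"
    by (rule ideal_power_frob_split[OF assms(1-3) 1 q 2])
  then have "lev c e = ideal_prod R I (rootn e (ideal_power R I (?n - ?q)))"
    unfolding lev_def using rootn_frob_prod[OF ideal_I ideal_power_ideal[OF ideal_I]] by simp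
  then show ?thesis unfolding e lev_def 3[symmetric] by simp
qed

text \<open>The power of \<open>I\<close> at level \<open>e\<close> has degree proportional to
  \<open>p ^ e\<close>, and the \<open>e\<close> roots divide by \<open>p ^ e\<close> again; the
  bound depends neither on \<open>e\<close> nor on \<open>c\<close> below \<open>C\<close>.\<close>

lemma tau_deg_bounded:
  obtains M where "\<And>c. 0 < c \<Longrightarrow> c \<le> real C \<Longrightarrow> deg_le M (tau c)"
proof -
  obtain d where d: "deg_le d I" by (rule deg_le_exists[OF ideal_I])
  obtain D where D: "\<And>d b e. ideal b R \<Longrightarrow> deg_le d b \<Longrightarrow> deg_le (d div p ^ e + 2 * D) (rootn e b)"
    by (rule deg_le_rootn) blast
  have "deg_le ((C + 1) * d + 2 * D) (tau c)" if c: "0 < c" "c \<le> real C" for c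
  proof -
    obtain e where e: "tau c = lev c e" by (rule tau_stable[OF c(1)]) blast
    let ?n = "nat \<lceil>c * real p ^ e\<rceil>"
    have "c * real p ^ e \<le> real C * real p ^ e" using c by (intro mult_right_mono) auto
    then have "c * real p ^ e \<le> real_of_int (int (C * p ^ e))" by simp
    then have "\<lceil>c * real p ^ e\<rceil> \<le> int (C * p ^ e)" by (rule ceiling_le)
    then have "?n \<le> C * p ^ e" by linarith
    then have "?n * d \<le> C * p ^ e * d" by (rule mult_le_mono1)
    also have "\<dots> \<le> (C + 1) * d * p ^ e" by (simp add: algebra_simps)
    finally have "?n * d \<le> (C + 1) * d * p ^ e" .
    then have "?n * d div p ^ e \<le> (C + 1) * d * p ^ e div p ^ e" by (rule div_le_mono)
    also have "\<dots> = (C + 1) * d" using p_pos by simp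
    finally have le: "?n * d div p ^ e + 2 * D \<le> (C + 1) * d + 2 * D" by simp
    have "deg_le (?n * d div p ^ e + 2 * D) (lev c e)"
      unfolding lev_def by (intro D ideal_power_ideal ideal_I deg_le_power d)
    then show ?thesis unfolding e using deg_le_mono le by blast
  qed
  then show thesis using that by blast
qed

text \<open>The comparison with exponent \<open>0\<close> only removes candidates, so \<open>\<tau>(a\<^sup>0)\<close> plays no role.\<close>

definition jumps :: "real set" where
  "jumps = {c. c > 0 \<and> (\<forall>\<epsilon>. 0 < \<epsilon> \<and> \<epsilon> < c \<longrightarrow> tau c \<noteq> tau (c - \<epsilon>))}"

lemma jumping_subset: "F_jumping_exponents p R I \<subseteq> insert 0 jumps"
  unfolding F_jumping_exponents_def jumps_def tau_def by auto

lemma jumps_less: "c \<in> jumps \<Longrightarrow> 0 < b \<Longrightarrow> b < c \<Longrightarrow> tau c \<subset> tau b"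
proof -
  assume c: "c \<in> jumps" "0 < b" "b < c"
  then have "0 < c - b \<and> c - b < c" by auto
  then have "tau c \<noteq> tau (c - (c - b))" using c(1) unfolding jumps_def by blast
  then show ?thesis using tau_antimono[of b c] c by auto
qed

text \<open>In increasing order, the test ideals at jumps decrease strictly and are generated in a
  common degree, so \<open>ideal_chain_bounded\<close> limits their number.\<close>

lemma finite_jumps: "finite (jumps \<inter> {..real C})"
proof -
  obtain M where M: "\<And>c. 0 < c \<Longrightarrow> c \<le> real C \<Longrightarrow> deg_le M (tau c)" by (rule tau_deg_bounded) blast
  obtain N where N: "\<And>n W. (\<And>i. i \<le> n \<Longrightarrow> ideal (W i) R \<and> deg_le M (W i)) \<Longrightarrow>
    (\<And>i. i < n \<Longrightarrow> W (Suc i) \<subset> W i) \<Longrightarrow> n \<le> N" by (rule ideal_chain_bounded) blast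
  have "card F \<le> Suc N" if F: "finite F" "F \<subseteq> jumps \<inter> {..real C}" for F
  proof (cases "F = {}")
    case False
    define cs where "cs = sorted_list_of_set F"
    have cs: "set cs = F" "length cs = card F" "sorted_wrt (<) cs"
      unfolding cs_def using F(1) by auto
    obtain n where n: "card F = Suc n" using False F(1) by (metis card_0_eq not0_implies_Suc)
    have mem: "cs ! i \<in> jumps" "0 < cs ! i" "cs ! i \<le> real C" if "i \<le> n" for i
    proof -
      have "cs ! i \<in> F" using that n cs by (metis le_imp_less_Suc nth_mem)
      then show "cs ! i \<in> jumps" "cs ! i \<le> real C" using F(2) by auto
      then show "0 < cs ! i" by (simp add: jumps_def)
    qed
    have "n \<le> N"
    proof (rule N[of n "\<lambda>i. tau (cs ! i)"])
      show "ideal (tau (cs ! i)) R \<and> deg_le M (tau (cs ! i))" if "i \<le> n" for i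
        using mem[OF that] tau_ideal M by blast
      show "tau (cs ! Suc i) \<subset> tau (cs ! i)" if i: "i < n" for i
      proof (rule jumps_less)
        show "cs ! i < cs ! Suc i" using sorted_wrt_nth_less[OF cs(3), of i "Suc i"] i n cs(2) by simp
      qed (use mem[of i] mem[of "Suc i"] i in auto)
    qed
    then show ?thesis using n by simp
  qed simp
  then show ?thesis 
    by (intro conjunct1[OF finite_if_finite_subsets_card_bdd[of "jumps \<inter> {..real C}" "Suc N"]])
qed

text \<open>If the test ideal were constant just below \<open>real p * c\<close>, then
  \<open>root1\<close> would carry the equality over to \<open>c\<close>, with
  \<open>\<epsilon>\<close> divided by \<open>p\<close>.\<close>

lemma jumps_times_p: "c \<in> jumps \<Longrightarrow> real p * c \<in> jumps"
proof -
  assume c: "c \<in> jumps"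
  have c0: "c > 0" using c by (simp add: jumps_def)
  have pr: "real p > 0" using p_pos by simp
  have "tau (real p * c) \<noteq> tau (real p * c - \<epsilon>)" if \<epsilon>: "0 < \<epsilon>" "\<epsilon> < real p * c" for \<epsilon>
  proof
    assume eq: "tau (real p * c) = tau (real p * c - \<epsilon>)"
    have "real p * c - \<epsilon> = real p * (c - \<epsilon> / real p)" using pr by (simp add: field_simps)
    moreover have d: "c - \<epsilon> / real p > 0" using \<epsilon> pr by (simp add: field_simps)
    ultimately have "tau c = tau (c - \<epsilon> / real p)" using root1_tau[OF c0] root1_tau[OF d] eq by metis
    moreover have "0 < \<epsilon> / real p" "\<epsilon> / real p < c" using \<epsilon> pr d by auto
    ultimately show False using c unfolding jumps_def by blast
  qed
  then show ?thesis using c0 pr by (simp add: jumps_def)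
qed

text \<open>By Skoda's theorem the test ideals just below \<open>c\<close> are \<open>I\<close>
  times those just below \<open>c - 1\<close>, so constancy there would imply constancy
  here.\<close>

lemma jumps_minus_one:
  assumes "finite G" "G \<subseteq> carrier R" "I = genideal R G" "c \<in> jumps" "c > real (card G)" "c > 1"
  shows "c - 1 \<in> jumps"
proof -
  have "tau (c - 1) \<noteq> tau (c - 1 - \<epsilon>)" if \<epsilon>: "0 < \<epsilon>" "\<epsilon> < c - 1" for \<epsilon>
  proof
    assume eq: "tau (c - 1) = tau (c - 1 - \<epsilon>)"
    \<comment> \<open>Small enough to stay within the interval of constancy and to keep
      \<open>c - \<delta>\<close> above both \<open>card G\<close> and one, where Skoda's theorem
      still applies.\<close>
    define \<delta> where "\<delta> = min \<epsilon> (min ((c - real (card G)) / 2) ((c - 1) / 2))"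
    have \<delta>: "0 < \<delta>" "\<delta> \<le> \<epsilon>" "c - \<delta> > real (card G)" "c - \<delta> > 1" "\<delta> < c"
      using \<epsilon> assms(5,6) unfolding \<delta>_def by (auto simp: min_def field_simps)
    have "tau (c - \<delta> - 1) \<subseteq> tau (c - 1 - \<epsilon>)" using \<epsilon> \<delta> by (intro tau_antimono) auto
    moreover have "tau (c - 1) \<subseteq> tau (c - \<delta> - 1)" using \<delta> by (intro tau_antimono) auto
    ultimately have "tau (c - \<delta> - 1) = tau (c - 1)" using eq by blast
    then have "tau c = tau (c - \<delta>)"
      using tau_skoda[OF assms(1-3,5,6)] tau_skoda[OF assms(1-3) \<delta>(3,4)] by simp
    then show False using assms(4) \<delta> unfolding jumps_def by blast
  qed
  then show ?thesis using assms(6) by (simp add: jumps_def)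
qed

lemma jumps_rational: "jumps \<subseteq> \<rat>"
proof
  fix c assume c: "c \<in> jumps"
  obtain G where G: "G \<subseteq> carrier R" "finite G" "I = genideal R G" using ideal_finite[OF ideal_I] by blast
  \<comment> \<open>Exceeding \<open>r\<close> guarantees both \<open>x > card G\<close> and
    \<open>x > 1\<close>, even if \<open>G\<close> is empty.\<close>
  define r where "r = card G + 1"
  have reduce: "\<exists>n::nat. x - real n \<in> jumps \<inter> {..real r}" if "x \<in> jumps" "x \<le> real r + real k" for x k
    using that
  proof (induction k arbitrary: x)
    case 0
    then show ?case by (intro exI[of _ 0]) auto
  next
    case (Suc k)
    show ?case
    proof (cases "x \<le> real r")
      case True then show ?thesis using Suc by (intro exI[of _ 0]) auto
    next
      case False
      then have "x - 1 \<in> jumps" using Suc.prems G by (intro jumps_minus_one[of G]) (auto simp: r_def)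
      then obtain n :: nat where "x - 1 - real n \<in> jumps \<inter> {..real r}" using Suc.IH[of "x - 1"] Suc.prems by auto
      then show ?thesis by (intro exI[of _ "Suc n"]) (simp add: algebra_simps)
    qed
  qed
  have pw: "real p ^ e * c \<in> jumps" for e
    by (induction e) (use c jumps_times_p in \<open>auto simp: mult.assoc\<close>)
  have "\<exists>n::nat. real p ^ e * c - real n \<in> jumps \<inter> {..real r}" for e
  proof -
    obtain k :: nat where "real p ^ e * c \<le> real k" using real_arch_simple by blast
    then show ?thesis using reduce[OF pw, of e k] by simp
  qed
  then obtain n :: "nat \<Rightarrow> nat" where n: "\<And>e. real p ^ e * c - real (n e) \<in> jumps \<inter> {..real r}" by metis
  define f where "f = (\<lambda>e. real p ^ e * c - real (n e))"
  have "range f \<subseteq> jumps \<inter> {..real r}" using n by (auto simp: f_def)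
  then have "finite (range f)" using finite_jumps finite_subset by blast
  \<comment> \<open>Infinitely many \<open>e\<close> but finitely many values: two of them coincide,
    and the resulting linear equation determines \<open>c\<close>.\<close>
  then have "\<not> inj f" using finite_imageD[of f UNIV] by auto
  then obtain e e' where e: "f e = f e'" "e \<noteq> e'" unfolding inj_def by blast
  have ne: "real p ^ e - real p ^ e' \<noteq> 0" using e(2) p_ge2 by (simp add: power_inject_exp)
  have "(real p ^ e - real p ^ e') * c = real (n e) - real (n e')" using e(1) by (simp add: f_def algebra_simps)
  then have "c = (real (n e) - real (n e')) / (real p ^ e - real p ^ e')" using ne by (simp add: field_simps)
  then show "c \<in> \<rat>" by simp
qed

end

theorem theorem3p1:
  fixes K :: "('k, 'n) ring_scheme" and R :: "('a, 'm) ring_scheme"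
    and \<phi> :: "'k \<Rightarrow> 'a" and I :: "'a set" and p :: nat
  assumes "Factorial_Ring.prime p" and "field K" and "has_characteristic K p"
    and "regular_ring R" and "F_finite p R"
    and "ess_finite_type_algebra TYPE('b) K R \<phi>"
    and "ideal I R"
  shows "(\<forall>a b. finite (F_jumping_exponents p R I \<inter> {a..b})) \<and>
         F_jumping_exponents p R I \<subseteq> \<rat>"
proof -
  obtain xs E H where alg: "reg_ess_alg R p (\<phi> ` carrier K) xs E H" and ne: "\<one>\<^bsub>R\<^esub> \<noteq> \<zero>\<^bsub>R\<^esub>"
    by (rule reg_ess_algI[OF assms(1,2,4,5,6)])
  interpret A: reg_ess_alg R p "\<phi> ` carrier K" xs E H by (rule alg)
  obtain L where L: "plin_list R p L" "\<And>x. x \<in> carrier R \<Longrightarrow> x = dsum R p L x" by (rule A.dual_basis) blast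
  interpret test_ideals R p "\<phi> ` carrier K" xs E H L I
    by (intro test_ideals.intro dual_alg.intro alg frob_dual.intro A.char_p_ring_axioms frob_dual_axioms.intro
        dual_alg_axioms.intro test_ideals_axioms.intro L ne assms(7))
  have "finite (F_jumping_exponents p R I \<inter> {a..b})" for a b
  proof -
    obtain C :: nat where "b \<le> real C" using real_arch_simple by blast
    then have "F_jumping_exponents p R I \<inter> {a..b} \<subseteq> insert 0 (jumps \<inter> {..real C})"
      using jumping_subset by auto
    then show ?thesis using finite_jumps finite_subset by blast
  qed
  moreover have "F_jumping_exponents p R I \<subseteq> \<rat>" using jumping_subset jumps_rational by auto
  ultimately show ?thesis by blast
qed

end
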